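(* Let $\alpha\in(0,\frac13)$, let $S(K_\alpha)=(C(K_\alpha),\mathscr H_\alpha,D_\alpha)$ with representation $\pi_\alpha$ be the direct sum spectral triple of the stretched Sierpinski gasket $K_\alpha$ described in the context, let $\mathfrak d=\mathfrak d(K_\alpha)=\frac{\log3}{\log2-\log(1-\alpha)}$ be its spectral dimension, and let $\mathrm{Tr}_w$ be a Dixmier trace. Then $S(K_\alpha)$ recovers the $\mathfrak d$-dimensional Hausdorff measure $\mathcal H^{\mathfrak d}$ on $K_\alpha$ (normalized to be a probability measure) via the formula $$\mathrm{Tr}_w\big(\pi_\alpha(f)|D_\alpha|^{-\mathfrak d}\big)=c_{\mathfrak d}\int_{K_\alpha}f\,d\mathcal H^{\mathfrak d}$$ for all $f\in C(K_\alpha)$. Moreover, $$c_{\mathfrak d}=\frac{2^{\mathfrak d+1}(2^{\mathfrak d}-1)\,\zeta(\mathfrak d)\,(3+3\alpha^{\mathfrak d})}{\mathfrak d\,\pi^{\mathfrak d}\,\big(2^{\mathfrak d}\log 2-3(1-\alpha)^{\mathfrak d}\log(1-\alpha)\big)},$$ where $\zeta$ is the Riemann zeta function.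
   Context: **Stretched Sierpinski gasket.** Fix $\alpha\in(0,\frac13)$. Let $p_1=(0,0)$, $p_2=(\frac12,\frac{\sqrt3}2)$, $p_3=(1,0)$, $p_4=\frac{p_2+p_3}2$, $p_5=\frac{p_1+p_3}2$, $p_6=\frac{p_1+p_2}2$; $A_1=A_2=A_3=\frac{1-\alpha}2 I_2$, $A_4=\frac\alpha4\begin{pmatrix}1&-\sqrt3\\-\sqrt3&3\end{pmatrix}$, $A_5=\alpha\begin{pmatrix}1&0\\0&0\end{pmatrix}$, $A_6=\frac\alpha4\begin{pmatrix}1&\sqrt3\\\sqrt3&3\end{pmatrix}$; $F_j(x)=A_j(x-p_j)+p_j$ on $\mathbb R^2$, $j=1,\dots,6$. $K_\alpha$ is the unique nonempty compact set with $K_\alpha=\bigcup_{j=1}^6F_j(K_\alpha)$. For $w=w_1\cdots w_n\in\{1,2,3\}^n$ put $F_w=F_{w_n}\circ\cdots\circ F_{w_1}$, $F_\emptyset=\mathrm{id}$. Let $T$ be the triangle with vertices $p_1,p_2,p_3$. **Edges.** For $n\ge0$, $T_n$ is the set of closed segments $[x\to y]$ joining two distinct points $x,y$ of $F_w(\{p_1,p_2,p_3\})$ for some $w\in\{1,2,3\}^n$ (triangle edges). Let $\overline{e_i}=F_{i+3}(T)$, $i=1,2,3$ (closed segments of length $\alpha$), $\mathcal J_0=\emptyset$ and $\mathcal J_n=\bigcup_{m=0}^{n-1}\bigcup_{w\in\{1,2,3\}^m}\{F_w(\overline{e_i}):i=1,2,3\}$ for $n\ge1$ (joining edges). Put $\mathscr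 E_n=T_n\cup\mathcal J_n$ and enumerate $\mathscr E=\bigcup_{n\ge0}\mathscr E_n=\{\epsilon_1,\epsilon_2,\dots\}$. For each $j$ let $l_j=L(\epsilon_j)$ and let $R^s_j:[0,l_j]\to K_\alpha$ be the arclength (affine) parametrization of $\epsilon_j$. **Spectral triple of a curve.** For a compact Hausdorff space $X$, $\ell>0$ and a continuous injective $R:[0,\ell]\to X$: the algebra is $C(X)$, $\mathscr H_\ell=L^2([-\ell,\ell],(2\ell)^{-1}dm)$ ($m$ = Lebesgue measure), $(\pi_\ell(f)h)(x)=f(R(|x|))h(x)$, and $D_\ell=D+\frac{\pi}{2\ell}I$, where $D$ is the closure of $-i\frac{d}{dx}$ on $\mathrm{span}\{e^{i\pi kx/\ell}:k\in\mathbb Z\}$; so $D_\ell$ has orthonormal eigenbasis $e^{i\pi kx/\ell}$ with eigenvalues $\frac{(2k+1)\pi}{2\ell}$, $k\in\mathbb Z$. **Spectral triple of $K_\alpha$.** $S(K_\alpha)=(C(K_\alpha),\mathscr H_\alpha,D_\alpha)$ with representation $\pi_\alpha$ is the direct sum over $j\ge1$ of the spectral triples of the curves $R^s_j$ (with $X=K_\alpha$). Its spectral dimension is $\mathfrak d(K_\alpha)=\inf\{p>0:\mathrm{tr}((I+D_\alpha^2)^{-p/2})<\infty\}$, which equals the Hausdorff dimension $d_\alpha=\frac{\log3}{\log2-\log(1-\alpha)}$ of $K_\alpha$. **Dixmier trace.** For a compact operator $T$, let $\mu_1(T)\ge\mu_2(T)\ge\cdots$ be the eigenvalues of $|T|$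 with multiplicity, and $\mathcal L^{(1,\infty)}=\{T\text{ compact}:\sup_N\frac1{\log(1+N)}\sum_{j=1}^N\mu_j(T)<\infty\}$. Let $w:\ell^\infty\to\mathbb C$ be an extended limit: a positive linear functional with $w(1,1,\dots)=1$, vanishing on $c_0$, with $w(x_1,x_1,x_2,x_2,\dots)=w(x_1,x_2,\dots)$. For $0\le T\in\mathcal L^{(1,\infty)}$, $\mathrm{Tr}_w(T)=w\big(\{\frac1{\log(1+N)}\sum_{n=1}^N\mu_n(T)\}_N\big)$, extended to $\mathcal L^{(1,\infty)}$ by linearity. *)

theory Defs
  imports "HOL-Analysis.Analysis" "HOL-Library.Function_Algebras"
begin

section \<open>Complex vector spaces as a type class\<close>

class scaleC =
  fixes scaleC :: "complex \<Rightarrow> 'a \<Rightarrow> 'a"  (infixr "*\<^sub>C" 75)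

class complex_vector = scaleC + ab_group_add +
  assumes scaleC_add_right: "a *\<^sub>C (x + y) = a *\<^sub>C x + a *\<^sub>C y"
    and scaleC_add_left: "(a + b) *\<^sub>C x = a *\<^sub>C x + b *\<^sub>C x"
    and scaleC_scaleC: "a *\<^sub>C (b *\<^sub>C x) = (a * b) *\<^sub>C x"
    and scaleC_one: "1 *\<^sub>C x = x"

interpretation cvec: vector_space "scaleC :: complex \<Rightarrow> 'a \<Rightarrow> 'a::complex_vector"
  by unfold_locales (fact scaleC_add_right scaleC_add_left scaleC_scaleC scaleC_one)+

instantiation "fun" :: (type, complex_vector) complex_vector
begin
definition scaleC_fun :: "complex \<Rightarrow> ('a \<Rightarrow> 'b) \<Rightarrow> 'a \<Rightarrow> 'b"
  where "scaleC_fun a f = (\<lambda>x. a *\<^sub>C f x)"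
instance
  by standard (simp_all add: scaleC_fun_def fun_eq_iff scaleC_add_right scaleC_add_left
      scaleC_scaleC scaleC_one)
end

section \<open>Hilbert spaces and their operators\<close>

text \<open>A Hilbert space is a linear subspace of an ambient complex vector space together with an
  inner product, linear in the first argument.  Bounded operators are functions on the ambient type
  which vanish off the carrier, so that equality of operators is equality of functions.\<close>

record 'v hilbert =
  carr :: "'v set"
  inn :: "'v \<Rightarrow> 'v \<Rightarrow> complex"

definition hnorm :: "'v hilbert \<Rightarrow> 'v \<Rightarrow> real"
  where "hnorm H x = sqrt (Re (inn H x x))"

definition hlim :: "'v::complex_vector hilbert \<Rightarrow> (nat \<Rightarrow> 'v) \<Rightarrow> 'v \<Rightarrow> bool"
  where "hlim H X x \<longleftrightarrow> (\<lambda>n. hnorm H (X n - x)) \<longlonglongrightarrow> 0"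

definition is_onb :: "'v::complex_vector hilbert \<Rightarrow> 'v set \<Rightarrow> bool"
  where "is_onb H E \<longleftrightarrow> E \<subseteq> carr H \<and> (\<forall>e\<in>E. \<forall>e'\<in>E. inn H e e' = (if e = e' then 1 else 0)) \<and>
    (\<forall>x\<in>carr H. (\<forall>e\<in>E. inn H x e = 0) \<longrightarrow> x = 0)"

definition bounded_ops :: "'v::complex_vector hilbert \<Rightarrow> ('v \<Rightarrow> 'v) set"
  where "bounded_ops H = {B. (\<forall>x\<in>carr H. B x \<in> carr H) \<and>
    (\<forall>x\<in>carr H. \<forall>y\<in>carr H. B (x + y) = B x + B y) \<and>
    (\<forall>a. \<forall>x\<in>carr H. B (a *\<^sub>C x) = a *\<^sub>C B x) \<and>
    (\<exists>C. \<forall>x\<in>carr H. hnorm H (B x) \<le> C * hnorm H x) \<and>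
    (\<forall>x. x \<notin> carr H \<longrightarrow> B x = 0)}"

definition hadjoint :: "'v::complex_vector hilbert \<Rightarrow> ('v \<Rightarrow> 'v) \<Rightarrow> 'v \<Rightarrow> 'v"
  where "hadjoint H B = (THE B'. B' \<in> bounded_ops H \<and>
    (\<forall>x\<in>carr H. \<forall>y\<in>carr H. inn H (B x) y = inn H x (B' y)))"

definition positive_op :: "'v::complex_vector hilbert \<Rightarrow> ('v \<Rightarrow> 'v) \<Rightarrow> bool"
  where "positive_op H B \<longleftrightarrow> B \<in> bounded_ops H \<and>
    (\<forall>x\<in>carr H. Im (inn H (B x) x) = 0 \<and> 0 \<le> Re (inn H (B x) x))"

definition abs_op :: "'v::complex_vector hilbert \<Rightarrow> ('v \<Rightarrow> 'v) \<Rightarrow> 'v \<Rightarrow> 'v"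
  where "abs_op H B = (THE P. positive_op H P \<and> P \<circ> P = hadjoint H B \<circ> B)"

definition compact_op :: "'v::complex_vector hilbert \<Rightarrow> ('v \<Rightarrow> 'v) \<Rightarrow> bool"
  where "compact_op H B \<longleftrightarrow> B \<in> bounded_ops H \<and>
    (\<forall>X :: nat \<Rightarrow> 'v. (\<forall>n. X n \<in> carr H \<and> hnorm H (X n) \<le> 1) \<longrightarrow>
      (\<exists>r y. strict_mono r \<and> y \<in> carr H \<and> hlim H (\<lambda>n. B (X (r n))) y))"

text \<open>The trace of a positive operator; its value does not depend on the orthonormal basis.\<close>

definition trace_op :: "'v::complex_vector hilbert \<Rightarrow> ('v \<Rightarrow> 'v) \<Rightarrow> ennreal"
  where "trace_op H B = (\<Sum>\<^sub>\<infinity>e\<in>(SOME E. is_onb H E). ennreal (Re (inn H (B e) e)))"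

text \<open>Unbounded operators are given by their graphs.\<close>

definition closure_graph :: "'v::complex_vector hilbert \<Rightarrow> ('v \<times> 'v) set \<Rightarrow> ('v \<times> 'v) set"
  where "closure_graph H G = {(u, v). u \<in> carr H \<and> v \<in> carr H \<and>
    (\<exists>U V. (\<forall>n. (U n, V n) \<in> G) \<and> hlim H U u \<and> hlim H V v)}"

text \<open>Functional calculus \<open>g(D)\<close> for a self-adjoint operator \<open>D\<close> possessing an orthonormal basis of
  eigenvectors and \<open>g\<close> bounded on the spectrum: \<open>g(D)\<close> is the unique bounded operator that acts as
  \<open>g(t)\<close> on the eigenspace of each eigenvalue \<open>t\<close>.\<close>

definition fun_calc ::
    "'v::complex_vector hilbert \<Rightarrow> ('v \<times> 'v) set \<Rightarrow> (real \<Rightarrow> real) \<Rightarrow> 'v \<Rightarrow> 'v"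
  where "fun_calc H D g = (THE B. B \<in> bounded_ops H \<and>
    (\<forall>u t. (u, of_real t *\<^sub>C u) \<in> D \<longrightarrow> B u = of_real (g t) *\<^sub>C u))"

section \<open>Dixmier traces\<close>

text \<open>All sequences are indexed from 0, so the term with index \<open>n\<close> is the \<open>(n+1)\<close>-st one.  For a
  compact operator with only finitely many nonzero eigenvalues of \<open>|T|\<close> the sequence is filled up
  with zeros.\<close>

definition eigval_seq :: "'v::complex_vector hilbert \<Rightarrow> ('v \<Rightarrow> 'v) \<Rightarrow> nat \<Rightarrow> real"
  where "eigval_seq H T = (THE \<mu>. decseq \<mu> \<and> (\<forall>n. 0 \<le> \<mu> n) \<and> \<mu> \<longlonglongrightarrow> 0 \<and>
    (\<forall>t>0. card {n. \<mu> n = t} = cvec.dim {x \<in> carr H. abs_op H T x = of_real t *\<^sub>C x}))"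

definition log_means :: "'v::complex_vector hilbert \<Rightarrow> ('v \<Rightarrow> 'v) \<Rightarrow> nat \<Rightarrow> real"
  where "log_means H T = (\<lambda>n. (\<Sum>j\<le>n. eigval_seq H T j) / ln (1 + real (Suc n)))"

definition dixmier_ideal :: "'v::complex_vector hilbert \<Rightarrow> ('v \<Rightarrow> 'v) set"
  where "dixmier_ideal H = {T. compact_op H T \<and> bdd_above (range (log_means H T))}"

definition extended_limit :: "((nat \<Rightarrow> complex) \<Rightarrow> complex) \<Rightarrow> bool"
  where "extended_limit w \<longleftrightarrow>
    (\<forall>x y. Bseq x \<longrightarrow> Bseq y \<longrightarrow> w (\<lambda>n. x n + y n) = w x + w y) \<and>
    (\<forall>a x. Bseq x \<longrightarrow> w (\<lambda>n. a * x n) = a * w x) \<and>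
    (\<forall>x. Bseq x \<longrightarrow> (\<forall>n. Im (x n) = 0 \<and> 0 \<le> Re (x n)) \<longrightarrow> Im (w x) = 0 \<and> 0 \<le> Re (w x)) \<and>
    w (\<lambda>_. 1) = 1 \<and>
    (\<forall>x. x \<longlonglongrightarrow> 0 \<longrightarrow> w x = 0) \<and>
    (\<forall>x. Bseq x \<longrightarrow> w (\<lambda>n. x (n div 2)) = w x)"

definition dixmier_trace_pos ::
    "'v::complex_vector hilbert \<Rightarrow> ((nat \<Rightarrow> complex) \<Rightarrow> complex) \<Rightarrow> ('v \<Rightarrow> 'v) \<Rightarrow> complex"
  where "dixmier_trace_pos H w T = w (\<lambda>n. of_real (log_means H T n))"

text \<open>The extension by linearity: every element of the ideal is a combination
  \<open>A - B + \<i>(C - E)\<close> of positive elements of the ideal, and the value does not depend on it.\<close>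

definition dixmier_trace ::
    "'v::complex_vector hilbert \<Rightarrow> ((nat \<Rightarrow> complex) \<Rightarrow> complex) \<Rightarrow> ('v \<Rightarrow> 'v) \<Rightarrow> complex"
  where "dixmier_trace H w T = (THE z. \<exists>A B C E.
    {A, B, C, E} \<subseteq> {P \<in> dixmier_ideal H. positive_op H P} \<and>
    T = A - B + \<i> *\<^sub>C (C - E) \<and>
    z = dixmier_trace_pos H w A - dixmier_trace_pos H w B
      + \<i> * (dixmier_trace_pos H w C - dixmier_trace_pos H w E))"

section \<open>The Hilbert spaces of square-integrable functions on \<open>[-l,l]\<close>\<close>

text \<open>Complex Borel functions on the line modulo equality almost everywhere.  The elements of
  \<open>L\<^sup>2([-l,l])\<close> are represented as classes of functions vanishing off \<open>[-l,l]\<close>.\<close>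

quotient_type ae_fun = "real \<Rightarrow> complex" / partial:
  "\<lambda>f g. f \<in> borel_measurable lborel \<and> g \<in> borel_measurable lborel \<and> (AE x in lborel. f x = g x)"
proof (rule part_equivpI)
  show "\<exists>f::real \<Rightarrow> complex. f \<in> borel_measurable lborel \<and> f \<in> borel_measurable lborel \<and>
      (AE x in lborel. f x = f x)"
    by (rule exI[of _ "\<lambda>_. 0"]) simp
  show "symp (\<lambda>f g::real \<Rightarrow> complex. f \<in> borel_measurable lborel \<and> g \<in> borel_measurable lborel \<and>
      (AE x in lborel. f x = g x))"
    by (auto simp: symp_def elim: eventually_mono)
  show "transp (\<lambda>f g::real \<Rightarrow> complex. f \<in> borel_measurable lborel \<and> g \<in> borel_measurable lborel \<and>
      (AE x in lborel. f x = g x))"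
    unfolding transp_def by (auto elim: eventually_elim2)
qed

instantiation ae_fun :: complex_vector
begin
lift_definition zero_ae_fun :: ae_fun is "\<lambda>_. 0" by simp
lift_definition plus_ae_fun :: "ae_fun \<Rightarrow> ae_fun \<Rightarrow> ae_fun" is "\<lambda>f g x. f x + g x"
  by (auto elim: eventually_elim2)
lift_definition uminus_ae_fun :: "ae_fun \<Rightarrow> ae_fun" is "\<lambda>f x. - f x"
  by (auto elim: eventually_mono)
lift_definition minus_ae_fun :: "ae_fun \<Rightarrow> ae_fun \<Rightarrow> ae_fun" is "\<lambda>f g x. f x - g x"
  by (auto elim: eventually_elim2)
lift_definition scaleC_ae_fun :: "complex \<Rightarrow> ae_fun \<Rightarrow> ae_fun" is "\<lambda>a f x. a * f x"
  by (auto elim: eventually_mono)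
instance
  by standard (transfer; simp add: algebra_simps)+
end

lift_definition in_L2 :: "real \<Rightarrow> ae_fun \<Rightarrow> bool" is
  "\<lambda>l f. (AE x in lborel. x \<notin> {-l..l} \<longrightarrow> f x = 0) \<and>
    set_integrable lborel {-l..l} (\<lambda>x. (cmod (f x))\<^sup>2)"
proof -
  fix l :: real and f g :: "real \<Rightarrow> complex"
  assume *: "f \<in> borel_measurable lborel \<and> g \<in> borel_measurable lborel \<and> (AE x in lborel. f x = g x)"
  then have eq: "AE x in lborel. f x = g x" by blast
  have "(AE x in lborel. x \<notin> {-l..l} \<longrightarrow> f x = 0) \<longleftrightarrow> (AE x in lborel. x \<notin> {-l..l} \<longrightarrow> g x = 0)"
    using eq by (auto elim: eventually_elim2)
  moreover have "set_integrable lborel {-l..l} (\<lambda>x. (cmod (f x))\<^sup>2) \<longleftrightarrow>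
      set_integrable lborel {-l..l} (\<lambda>x. (cmod (g x))\<^sup>2)"
    unfolding set_integrable_def
    by (rule integrable_cong_AE) (use * eq in \<open>auto elim: eventually_mono\<close>)
  ultimately show "((AE x in lborel. x \<notin> {-l..l} \<longrightarrow> f x = 0) \<and>
      set_integrable lborel {-l..l} (\<lambda>x. (cmod (f x))\<^sup>2)) =
    ((AE x in lborel. x \<notin> {-l..l} \<longrightarrow> g x = 0) \<and>
      set_integrable lborel {-l..l} (\<lambda>x. (cmod (g x))\<^sup>2))"
    by blast
qed

lift_definition L2_inner :: "real \<Rightarrow> ae_fun \<Rightarrow> ae_fun \<Rightarrow> complex" is
  "\<lambda>l f g. of_real (1 / (2 * l)) * (LINT x:{-l..l}|lborel. f x * cnj (g x))"
proof -
  fix l :: real and f f' g g' :: "real \<Rightarrow> complex"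
  assume *: "f \<in> borel_measurable lborel \<and> f' \<in> borel_measurable lborel \<and> (AE x in lborel. f x = f' x)"
    "g \<in> borel_measurable lborel \<and> g' \<in> borel_measurable lborel \<and> (AE x in lborel. g x = g' x)"
  have [measurable]: "cnj \<in> borel_measurable borel"
    by (intro borel_measurable_continuous_onI continuous_intros)
  have [measurable]: "f \<in> borel_measurable borel" "f' \<in> borel_measurable borel"
    "g \<in> borel_measurable borel" "g' \<in> borel_measurable borel"
    using * by simp_all
  have "(LINT x:{-l..l}|lborel. f x * cnj (g x)) = (LINT x:{-l..l}|lborel. f' x * cnj (g' x))"
    unfolding set_lebesgue_integral_def
  proof (rule integral_cong_AE)
    show "AE x in lborel. indicat_real {-l..l} x *\<^sub>R (f x * cnj (g x)) =
        indicat_real {-l..l} x *\<^sub>R (f' x * cnj (g' x))"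
      using * by (auto elim: eventually_elim2)
  qed measurable
  then show "of_real (1 / (2 * l)) * (LINT x:{-l..l}|lborel. f x * cnj (g x)) =
      of_real (1 / (2 * l)) * (LINT x:{-l..l}|lborel. f' x * cnj (g' x))"
    by simp
qed

definition L2_space :: "real \<Rightarrow> ae_fun hilbert"
  where "L2_space l = \<lparr>carr = {h. in_L2 l h}, inn = L2_inner l\<rparr>"

definition L2_class :: "real \<Rightarrow> (real \<Rightarrow> complex) \<Rightarrow> ae_fun"
  where "L2_class l h = abs_ae_fun (\<lambda>x. if x \<in> {-l..l} then h x else 0)"

section \<open>Spectral triples\<close>

definition cont_algebra :: "'x::topological_space set \<Rightarrow> ('x \<Rightarrow> complex) set"
  where "cont_algebra X = {f. continuous_on X f}"

record ('x, 'v) spectral_triple =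
  st_alg :: "('x \<Rightarrow> complex) set"
  st_space :: "'v hilbert"
  st_rep :: "('x \<Rightarrow> complex) \<Rightarrow> 'v \<Rightarrow> 'v"
  st_dirac :: "('v \<times> 'v) set"

definition curve_rep :: "real \<Rightarrow> (real \<Rightarrow> 'x) \<Rightarrow> ('x \<Rightarrow> complex) \<Rightarrow> ae_fun \<Rightarrow> ae_fun"
  where "curve_rep l R f h = (if h \<in> carr (L2_space l)
    then L2_class l (\<lambda>x. f (R \<bar>x\<bar>) * rep_ae_fun h x) else 0)"

definition trig_polys :: "real \<Rightarrow> (real \<Rightarrow> complex) set"
  where "trig_polys l = {\<lambda>x. \<Sum>k\<in>A. c k * exp (\<i> * of_real (pi * of_int k * x / l)) | A c.
    finite (A :: int set)}"

definition deriv_op :: "real \<Rightarrow> (ae_fun \<times> ae_fun) set"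
  where "deriv_op l = closure_graph (L2_space l)
    {(L2_class l p, L2_class l (\<lambda>x. - \<i> * vector_derivative p (at x))) | p. p \<in> trig_polys l}"

definition curve_dirac :: "real \<Rightarrow> (ae_fun \<times> ae_fun) set"
  where "curve_dirac l = {(u, v + of_real (pi / (2 * l)) *\<^sub>C u) | u v. (u, v) \<in> deriv_op l}"

definition curve_triple ::
    "'x::topological_space set \<Rightarrow> real \<Rightarrow> (real \<Rightarrow> 'x) \<Rightarrow> ('x, ae_fun) spectral_triple"
  where "curve_triple X l R = \<lparr>st_alg = cont_algebra X, st_space = L2_space l,
    st_rep = curve_rep l R, st_dirac = curve_dirac l\<rparr>"

definition direct_sum_space :: "(nat \<Rightarrow> 'v hilbert) \<Rightarrow> (nat \<Rightarrow> 'v) hilbert"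
  where "direct_sum_space H =
    \<lparr>carr = {h. (\<forall>j. h j \<in> carr (H j)) \<and> summable (\<lambda>j. (hnorm (H j) (h j))\<^sup>2)},
     inn = (\<lambda>g h. \<Sum>j. inn (H j) (g j) (h j))\<rparr>"

definition direct_sum_triple ::
    "(nat \<Rightarrow> ('x, 'v::complex_vector) spectral_triple) \<Rightarrow> ('x, nat \<Rightarrow> 'v) spectral_triple"
  where "direct_sum_triple S = (let H = direct_sum_space (\<lambda>j. st_space (S j)) in
    \<lparr>st_alg = (\<Inter>j. st_alg (S j)), st_space = H,
     st_rep = (\<lambda>f h. if h \<in> carr H then (\<lambda>j. st_rep (S j) f (h j)) else 0),
     st_dirac = {(g, h). g \<in> carr H \<and> h \<in> carr H \<and> (\<forall>j. (g j, h j) \<in> st_dirac (S j))}\<rparr>)"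

definition spectral_dim :: "('x, 'v::complex_vector) spectral_triple \<Rightarrow> real"
  where "spectral_dim S = Inf {p. p > 0 \<and>
    trace_op (st_space S) (fun_calc (st_space S) (st_dirac S) (\<lambda>t. (1 + t\<^sup>2) powr (- p / 2))) < \<infinity>}"

section \<open>The stretched Sierpinski gasket\<close>

definition gpt :: "nat \<Rightarrow> real^2"
  where "gpt j = (if j = 1 then vector [0, 0]
    else if j = 2 then vector [1/2, sqrt 3 / 2]
    else if j = 3 then vector [1, 0]
    else if j = 4 then (1/2) *\<^sub>R (vector [1/2, sqrt 3 / 2] + vector [1, 0])
    else if j = 5 then (1/2) *\<^sub>R (vector [0, 0] + vector [1, 0])
    else (1/2) *\<^sub>R (vector [0, 0] + vector [1/2, sqrt 3 / 2]))"

definition gmat :: "real \<Rightarrow> nat \<Rightarrow> real^2^2"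
  where "gmat \<alpha> j = (if j \<in> {1, 2, 3} then ((1 - \<alpha>) / 2) *\<^sub>R mat 1
    else if j = 4 then (\<alpha> / 4) *\<^sub>R vector [vector [1, - sqrt 3], vector [- sqrt 3, 3]]
    else if j = 5 then \<alpha> *\<^sub>R vector [vector [1, 0], vector [0, 0]]
    else (\<alpha> / 4) *\<^sub>R vector [vector [1, sqrt 3], vector [sqrt 3, 3]])"

definition gmap :: "real \<Rightarrow> nat \<Rightarrow> real^2 \<Rightarrow> real^2"
  where "gmap \<alpha> j x = gmat \<alpha> j *v (x - gpt j) + gpt j"

definition gasket :: "real \<Rightarrow> (real^2) set"
  where "gasket \<alpha> = (THE K. compact K \<and> K \<noteq> {} \<and> K = (\<Union>j\<in>{1..6}. gmap \<alpha> j ` K))"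

text \<open>\<open>F\<^sub>w = F\<^bsub>w\<^sub>n\<^esub> \<circ> \<dots> \<circ> F\<^bsub>w\<^sub>1\<^esub>\<close>: the first letter of \<open>w\<close> is applied first.\<close>

definition gmap_word :: "real \<Rightarrow> nat list \<Rightarrow> real^2 \<Rightarrow> real^2"
  where "gmap_word \<alpha> w = fold (gmap \<alpha>) w"

definition words :: "nat \<Rightarrow> nat list set"
  where "words n = {w. length w = n \<and> set w \<subseteq> {1, 2, 3}}"

definition triangle_edges :: "real \<Rightarrow> nat \<Rightarrow> (real^2) set set"
  where "triangle_edges \<alpha> n = {closed_segment x y | x y w. w \<in> words n \<and> x \<noteq> y \<and>
    x \<in> gmap_word \<alpha> w ` gpt ` {1, 2, 3} \<and> y \<in> gmap_word \<alpha> w ` gpt ` {1, 2, 3}}"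

definition base_edge :: "real \<Rightarrow> nat \<Rightarrow> (real^2) set"
  where "base_edge \<alpha> i = gmap \<alpha> (i + 3) ` (convex hull (gpt ` {1, 2, 3}))"

definition joining_edges :: "real \<Rightarrow> nat \<Rightarrow> (real^2) set set"
  where "joining_edges \<alpha> n =
    (\<Union>m\<in>{..<n}. \<Union>w\<in>words m. {gmap_word \<alpha> w ` base_edge \<alpha> i | i. i \<in> {1, 2, 3}})"

definition all_edges :: "real \<Rightarrow> (real^2) set set"
  where "all_edges \<alpha> = (\<Union>n. triangle_edges \<alpha> n \<union> joining_edges \<alpha> n)"

text \<open>\<open>l\<close> is the length of the segment \<open>e\<close>, and \<open>R\<close> restricted to \<open>[0,l]\<close> is one of its two affine
  parametrizations by arclength.\<close>

definition arclength_param :: "(real^2) set \<Rightarrow> real \<Rightarrow> (real \<Rightarrow> real^2) \<Rightarrow> bool"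
  where "arclength_param e l R \<longleftrightarrow> (\<exists>x y. e = closed_segment x y \<and> x \<noteq> y \<and> l = dist x y \<and>
    (\<forall>t\<in>{0..l}. R t = x + (t / l) *\<^sub>R (y - x)))"

definition gasket_triple ::
    "real \<Rightarrow> (nat \<Rightarrow> real) \<Rightarrow> (nat \<Rightarrow> real \<Rightarrow> real^2) \<Rightarrow> (real^2, nat \<Rightarrow> ae_fun) spectral_triple"
  where "gasket_triple \<alpha> l R = direct_sum_triple (\<lambda>j. curve_triple (gasket \<alpha>) (l j) (R j))"

section \<open>Hausdorff measure and the zeta function\<close>

text \<open>Meant for \<open>s > 0\<close>, since \<open>0 powr 0 = 0\<close>.  The constant by which some authors scale the sum of
  the powers of the diameters disappears upon normalization to a probability measure.\<close>

definition hausdorff_pre :: "real \<Rightarrow> real \<Rightarrow> 'a::metric_space set \<Rightarrow> ennreal"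
  where "hausdorff_pre s \<delta> A = Inf {\<Sum>i. ennreal (diameter (U i) powr s) | U :: nat \<Rightarrow> 'a set.
    A \<subseteq> (\<Union>i. U i) \<and> (\<forall>i. bounded (U i) \<and> diameter (U i) \<le> \<delta>)}"

definition hausdorff_outer :: "real \<Rightarrow> 'a::metric_space set \<Rightarrow> ennreal"
  where "hausdorff_outer s A = (SUP \<delta>\<in>{0<..}. hausdorff_pre s \<delta> A)"

definition hausdorff_measure :: "real \<Rightarrow> 'a::metric_space measure"
  where "hausdorff_measure s = measure_of UNIV (sets borel) (hausdorff_outer s)"

text \<open>The Riemann zeta function on the half-line \<open>s > 1\<close>.\<close>

definition zeta_real :: "real \<Rightarrow> real"
  where "zeta_real s = (\<Sum>n. 1 / real (Suc n) powr s)"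

end

theory Submission
 imports Defs
begin

text \<open>In the eigenbasis \<open>e\<^bsub>j,k\<^esub>\<close> of the Dirac operator, the operator \<open>G = |D|\<^bsup>-d\<^esup>\<close> is diagonal with entries
 \<open>l\<^sub>j\<^sup>d (2 / (\<pi> |2 k + 1|))\<^sup>d\<close>. By polarization \<open>\<pi>(f) G\<close> is a combination of four operators
 \<open>\<pi>(g) G \<pi>(g)\<^sup>*\<close>, whose eigenvalue sums are Ky Fan suprema over finite orthonormal families. As \<open>g\<close> is almost
 constant on short edges, these suprema are squeezed between sums over the edges of level at most \<open>m\<close>.
 Each level contributes \<open>(3 + 3 \<alpha>\<^sup>d)\<close> times a Riemann sum of \<open>|g|\<^sup>2\<close> over the \<open>3\<^sup>m\<close> cells, which all have
 measure \<open>3\<^bsup>-m\<^esup>\<close>, so the logarithmic means converge and every extended limit gives the same value.\<close>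

section \<open>Inner product spaces\<close>

text \<open>The operator notions are definite descriptions, so existence and uniqueness of adjoints,
  square roots, eigenvalue sequences and functional calculi must be proved before any value is
  available. The delicate one is the linear extension of the Dixmier trace: it is single valued only
  because the trace is additive on positive operators, and dilation invariance of the extended limit
  is used there and nowhere else. All other passages are honest limits. The condition
  \<open>\<alpha> < 1 / 3\<close> means \<open>r > 1 / 3\<close> and hence dimension above 1. This
  makes the sum over the odd frequencies converge, which is the zeta series without its even terms,
  and it makes segments null sets, so that the cells of each level carry the full measure although
  they do not cover the joining edges. Origin of the constant: the first \<open>N\<close>
  eigenvalues reach down to about level \<open>ln N / ln 3\<close>, and all levels contribute
  equally in the limit because \<open>3 * r powr dm = 1\<close>. The resulting factor
  \<open>1 / ln 3\<close> enters the stated denominator through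
  \<open>ln 3 = dm * (ln 2 - ln (1 - \<alpha>))\<close>.\<close>

lemma mult_cnj_cmod: "z * cnj z = (complex_of_real (cmod z))\<^sup>2" "cnj z * z = (complex_of_real (cmod z))\<^sup>2"
 by (metis complex_norm_square of_real_power) (metis complex_norm_square mult.commute of_real_power)

locale semi_inner =
 fixes V :: "'v::complex_vector set" and s :: "'v => 'v => complex"
 assumes zero_mem [simp]: "0 \<in> V"
  and add_mem [simp]: "x \<in> V ==> y \<in> V ==> x + y \<in> V"
  and scale_mem [simp]: "x \<in> V ==> a *\<^sub>C x \<in> V"
  and s_add: "x \<in> V ==> y \<in> V ==> z \<in> V ==> s (x + y) z = s x z + s y z"
  and s_scale: "x \<in> V ==> y \<in> V ==> s (a *\<^sub>C x) y = a * s x y"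
  and s_cnj: "x \<in> V ==> y \<in> V ==> s y x = cnj (s x y)"
  and s_pos: "x \<in> V ==> 0 <= Re (s x x)"
begin

lemma minus_mem [simp]: "x \<in> V ==> - x \<in> V"
 using scale_mem[of x "-1"] by (simp add: cvec.scale_minus_left)

lemma diff_mem [simp]: "x \<in> V ==> y \<in> V ==> x - y \<in> V"
 using add_mem[of x "- y"] by simp

lemma s_uminus: "x \<in> V ==> y \<in> V ==> s (- x) y = - s x y"
 using s_scale[of x y "-1"] by (simp add: cvec.scale_minus_left)

lemma s_diff: "x \<in> V ==> y \<in> V ==> z \<in> V ==> s (x - y) z = s x z - s y z"
 using s_add[of x "- y" z] by (simp add: s_uminus)

lemma s_add_right: "x \<in> V ==> y \<in> V ==> z \<in> V ==> s z (x + y) = s z x + s z y"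
 using s_add[of x y z] s_cnj[of "x + y" z] s_cnj[of x z] s_cnj[of y z] by simp

lemma s_scale_right: "x \<in> V ==> y \<in> V ==> s x (a *\<^sub>C y) = cnj a * s x y"
 using s_scale[of y x a] s_cnj[of "a *\<^sub>C y" x] s_cnj[of y x] by simp

lemma s_diff_right: "x \<in> V ==> y \<in> V ==> z \<in> V ==> s z (x - y) = s z x - s z y"
 using s_diff[of x y z] s_cnj[of "x - y" z] s_cnj[of x z] s_cnj[of y z] by simp

lemma s_zero_left [simp]: "x \<in> V ==> s 0 x = 0"
 using s_scale[of 0 x 0] by simp

lemma s_zero_right [simp]: "x \<in> V ==> s x 0 = 0"
 using s_cnj[of 0 x] by simp

lemma sum_mem [simp]: "(\<And>i. i \<in> A ==> f i \<in> V) ==> sum f A \<in> V"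
 by (induction A rule: infinite_finite_induct) auto

lemma s_sum: "(\<And>i. i \<in> A ==> f i \<in> V) ==> y \<in> V ==> s (sum f A) y = (\<Sum>i\<in>A. s (f i) y)"
 by (induction A rule: infinite_finite_induct) (auto simp: s_add)

lemma s_sum_right: "(\<And>i. i \<in> A ==> f i \<in> V) ==> y \<in> V ==> s y (sum f A) = (\<Sum>i\<in>A. s y (f i))"
 by (induction A rule: infinite_finite_induct) (auto simp: s_add_right)

lemma s_self_real: "x \<in> V ==> s x x = of_real (Re (s x x))"
 using s_cnj[of x x] by (simp add: complex_eq_iff)

lemma s_expand:
 assumes "x \<in> V" "y \<in> V"
 shows "Re (s (x - c *\<^sub>C y) (x - c *\<^sub>C y)) = Re (s x x) - 2 * Re (cnj c * s x y) + (cmod c)\<^sup>2 * Re (s y y)"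
proof -
 have "s (x - c *\<^sub>C y) (x - c *\<^sub>C y) = s x x - cnj c * s x y - c * cnj (s x y) + c * cnj c * s y y"
  using assms s_cnj[of x y] by (simp add: s_diff s_diff_right s_scale s_scale_right algebra_simps)
 also have "\<dots> = s x x - cnj c * s x y - cnj (cnj c * s x y) + of_real ((cmod c)\<^sup>2) * s y y"
  by (simp add: mult_cnj_cmod)
 finally have "Re (s (x - c *\<^sub>C y) (x - c *\<^sub>C y)) = Re (s x x) - Re (cnj c * s x y)
   - Re (cnj (cnj c * s x y)) + Re (of_real ((cmod c)\<^sup>2) * s y y)"
  by (simp only: minus_complex.sel plus_complex.sel)
 then show ?thesis unfolding complex_cnj Re_complex_of_real
  by (simp del: complex_cnj_mult of_real_power)
qed

lemma s_CS:
 assumes "x \<in> V" "y \<in> V"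
 shows "(cmod (s x y))\<^sup>2 <= Re (s x x) * Re (s y y)"
proof (cases "s x y = 0")
 case True then show ?thesis using s_pos assms by simp
next
 case False
 define a where "a = (cmod (s x y))\<^sup>2"
 have a: "a > 0" using False by (simp add: a_def)
 \<comment> \<open>Subtracting the multiple \<open>t * s x y\<close> of \<open>y\<close> makes the
   cross term real and leaves a quadratic in the real variable \<open>t\<close>. Its leading
   coefficient may be 0, since the form can degenerate at \<open>y\<close>; hence the two cases
   below.\<close>
 have *: "0 <= Re (s x x) - 2 * t * a + t\<^sup>2 * a * Re (s y y)" for t :: real
 proof -
  define c where "c = of_real t * s x y"
  have 1: "cnj c * s x y = of_real (t * a)"
   by (simp add: c_def a_def mult_cnj_cmod)
  have 2: "(cmod c)\<^sup>2 = t\<^sup>2 * a" by (simp add: c_def a_def norm_mult power_mult_distrib)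
  have "0 <= Re (s (x - c *\<^sub>C y) (x - c *\<^sub>C y))" using assms by (intro s_pos) simp
  then show ?thesis unfolding s_expand[OF assms] 1 2 by simp
 qed
 show ?thesis
 proof (cases "Re (s y y) = 0")
  case True
  \<comment> \<open>Without the quadratic term the function of \<open>t\<close> is linear, and at
    this point it would be -1.\<close>
  then show ?thesis using *[of "(Re (s x x) + 1) / (2 * a)"] a by (simp add: field_simps)
 next
  case False
  then have "Re (s y y) > 0" using s_pos[OF assms(2)] by simp
  \<comment> \<open>This \<open>t\<close> minimizes the quadratic.\<close>
  then show ?thesis using *[of "1 / Re (s y y)"] a unfolding a_def[symmetric]
   by (simp add: field_simps power2_eq_square)
 qed
qed

end

section \<open>Norms and limits in pre-Hilbert spaces\<close>

locale pre_hilbert =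
 fixes H :: "'v::complex_vector hilbert"
 assumes semi: "semi_inner (carr H) (inn H)"
  and definite: "x \<in> carr H ==> inn H x x = 0 ==> x = 0"
begin

sublocale semi_inner "carr H" "inn H" by (rule semi)

lemma hnorm_nonneg: "x \<in> carr H ==> 0 <= hnorm H x"
 by (simp add: hnorm_def s_pos)

lemma hnorm_sq: "x \<in> carr H ==> (hnorm H x)\<^sup>2 = Re (inn H x x)"
 by (simp add: hnorm_def s_pos)

lemma inn_self: "x \<in> carr H ==> inn H x x = of_real ((hnorm H x)\<^sup>2)"
 using s_self_real hnorm_sq by simp

lemma hnorm_zero [simp]: "hnorm H 0 = 0"
 by (simp add: hnorm_def)

lemma hnorm_eq_0: "x \<in> carr H ==> hnorm H x = 0 \<longleftrightarrow> x = 0"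
 using definite inn_self by auto

lemma CS: "x \<in> carr H ==> y \<in> carr H ==> cmod (inn H x y) <= hnorm H x * hnorm H y"
 by (rule power2_le_imp_le) (auto simp: power_mult_distrib hnorm_sq s_CS hnorm_nonneg)

lemma hnorm_scale: "x \<in> carr H ==> hnorm H (a *\<^sub>C x) = cmod a * hnorm H x"
proof -
 assume x: "x \<in> carr H"
 have "Re (inn H (a *\<^sub>C x) (a *\<^sub>C x)) = (cmod a)\<^sup>2 * (hnorm H x)\<^sup>2"
 proof -
  have "inn H (a *\<^sub>C x) (a *\<^sub>C x) = (a * cnj a) * inn H x x"
   using x by (simp add: s_scale s_scale_right)
  also have "\<dots> = of_real ((cmod a)\<^sup>2 * (hnorm H x)\<^sup>2)"
   using x by (simp add: inn_self complex_norm_square[symmetric])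
  finally show ?thesis by (simp only: Re_complex_of_real)
 qed
 then show ?thesis using x hnorm_nonneg
  by (simp add: hnorm_def[of H "a *\<^sub>C x"] real_sqrt_mult)
qed

lemma hnorm_minus: "x \<in> carr H ==> hnorm H (- x) = hnorm H x"
 using hnorm_scale[of x "-1"] by (simp add: cvec.scale_minus_left)

lemma hnorm_minus_commute: "x \<in> carr H ==> y \<in> carr H ==> hnorm H (x - y) = hnorm H (y - x)"
 using hnorm_minus[of "x - y"] by simp

lemma hnorm_add_sq:
 assumes "x \<in> carr H" "y \<in> carr H"
 shows "(hnorm H (x + y))\<^sup>2 = (hnorm H x)\<^sup>2 + 2 * Re (inn H x y) + (hnorm H y)\<^sup>2"
 using assms s_expand[of x y "-1"] by (simp add: hnorm_sq cvec.scale_minus_left)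

lemma hnorm_triangle: "x \<in> carr H ==> y \<in> carr H ==> hnorm H (x + y) <= hnorm H x + hnorm H y"
proof (rule power2_le_imp_le)
 assume xy: "x \<in> carr H" "y \<in> carr H"
 have "Re (inn H x y) <= hnorm H x * hnorm H y"
  using CS[OF xy] complex_Re_le_cmod order_trans by blast
 then show "(hnorm H (x + y))\<^sup>2 <= (hnorm H x + hnorm H y)\<^sup>2"
  using xy by (simp add: hnorm_add_sq power2_sum)
qed (simp add: hnorm_nonneg)

lemma hnorm_triangle_diff: "x \<in> carr H ==> y \<in> carr H ==> hnorm H (x - y) <= hnorm H x + hnorm H y"
 using hnorm_triangle[of x "- y"] by (simp add: hnorm_minus)

lemma hnorm_triangle_sub: "x \<in> carr H ==> y \<in> carr H ==> hnorm H x <= hnorm H y + hnorm H (x - y)"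
 using hnorm_triangle[of y "x - y"] by simp

lemma hnorm_triangle_dist: "x \<in> carr H ==> y \<in> carr H ==> z \<in> carr H ==>
  hnorm H (x - z) <= hnorm H (x - y) + hnorm H (y - z)"
 using hnorm_triangle[of "x - y" "y - z"] by simp

lemma hlim_inn:
 assumes "hlim H X x" "\<And>n. X n \<in> carr H" "x \<in> carr H" "y \<in> carr H"
 shows "(%n. inn H (X n) y) \<longlonglongrightarrow> inn H x y"
proof (rule LIM_zero_cancel, rule Lim_null_comparison)
 show "\<forall>\<^sub>F n in sequentially. norm (inn H (X n) y - inn H x y) <= hnorm H (X n - x) * hnorm H y"
  using assms CS by (intro always_eventually allI) (simp add: s_diff[symmetric])
 show "(%n. hnorm H (X n - x) * hnorm H y) \<longlonglongrightarrow> 0"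
  using assms(1) unfolding hlim_def by (rule tendsto_mult_left_zero)
qed

lemma hlim_hnorm:
 assumes "hlim H X x" "\<And>n. X n \<in> carr H" "x \<in> carr H"
 shows "(%n. hnorm H (X n)) \<longlonglongrightarrow> hnorm H x"
proof (rule LIM_zero_cancel, rule Lim_null_comparison)
 show "\<forall>\<^sub>F n in sequentially. norm (hnorm H (X n) - hnorm H x) <= hnorm H (X n - x)"
  using assms hnorm_triangle_sub hnorm_minus_commute
  by (intro always_eventually allI) (smt (verit) real_norm_def)
 show "(%n. hnorm H (X n - x)) \<longlonglongrightarrow> 0"
  using assms(1) unfolding hlim_def .
qed

lemma hlim_unique:
 assumes "hlim H X x" "hlim H X y" "\<And>n. X n \<in> carr H" "x \<in> carr H" "y \<in> carr H"
 shows "x = y"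
proof -
 have "(%n. inn H (X n) (x - y)) \<longlonglongrightarrow> inn H x (x - y)"
   "(%n. inn H (X n) (x - y)) \<longlonglongrightarrow> inn H y (x - y)"
  using assms by (auto intro!: hlim_inn)
 then have "inn H (x - y) (x - y) = 0" using assms LIMSEQ_unique by (simp add: s_diff)
 then show ?thesis using definite[of "x - y"] assms by simp
qed

end

section \<open>Finite orthonormal families and their projections\<close>

definition ons :: "'v::complex_vector hilbert => 'v set => bool"
 where "ons H F \<longleftrightarrow> F \<subseteq> carr H \<and> (\<forall>e\<in>F. \<forall>e'\<in>F. inn H e e' = (if e = e' then 1 else 0))"

text \<open>The orthogonal projection onto the span of a finite orthonormal \<open>F\<close>. For
  infinite \<open>F\<close> the sum has the default value 0.\<close>

definition hproj :: "'v::complex_vector hilbert => 'v set => 'v => 'v"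
 where "hproj H F x = (\<Sum>e\<in>F. inn H x e *\<^sub>C e)"

lemma ons_subset: "ons H F ==> G \<subseteq> F ==> ons H G"
 unfolding ons_def by blast

lemma ons_carr: "ons H F ==> e \<in> F ==> e \<in> carr H"
 unfolding ons_def by blast

lemma ons_empty [simp]: "ons H {}"
 by (simp add: ons_def)

lemma ons_inn: "ons H F ==> e \<in> F ==> e' \<in> F ==> inn H e e' = (if e = e' then 1 else 0)"
 unfolding ons_def by blast

context pre_hilbert
begin

lemma ons_norm: "ons H F ==> e \<in> F ==> hnorm H e = 1"
 unfolding ons_def hnorm_def by simp

lemma ons_insert:
 assumes "ons H F" "x \<in> carr H" "hnorm H x = 1" "\<And>e. e \<in> F ==> inn H x e = 0"
 shows "ons H (insert x F)"
proof -
 have "inn H e x = 0" if "e \<in> F" for e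
  using assms that s_cnj[of x e] ons_carr by (metis complex_cnj_zero)
 then show ?thesis using assms inn_self[of x] unfolding ons_def by auto
qed

lemma hproj_mem [simp]: "ons H F ==> hproj H F x \<in> carr H"
 unfolding hproj_def by (auto simp: ons_carr)

lemma inn_lincomb:
 assumes "ons H F" "finite F" "e \<in> F"
 shows "inn H (\<Sum>b\<in>F. c b *\<^sub>C b) e = c e"
proof -
 have "inn H (\<Sum>b\<in>F. c b *\<^sub>C b) e = (\<Sum>b\<in>F. c b * inn H b e)"
  using assms by (simp add: s_sum s_scale ons_carr)
 also have "\<dots> = (\<Sum>b\<in>F. if b = e then c b else 0)"
  using assms by (intro sum.cong) (auto simp: ons_inn)
 also have "\<dots> = c e" using assms by simp
 finally show ?thesis .
qed

lemma hnorm_lincomb: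
 assumes "ons H F" "finite F"
 shows "(hnorm H (\<Sum>b\<in>F. c b *\<^sub>C b))\<^sup>2 = (\<Sum>b\<in>F. (cmod (c b))\<^sup>2)"
proof -
 let ?v = "\<Sum>b\<in>F. c b *\<^sub>C b"
 have v: "?v \<in> carr H" using assms by (auto simp: ons_carr)
 have "inn H ?v ?v = (\<Sum>b\<in>F. cnj (c b) * inn H ?v b)"
  using assms v by (subst s_sum_right) (auto simp: ons_carr s_scale_right)
 also have "\<dots> = (\<Sum>b\<in>F. of_real ((cmod (c b))\<^sup>2))"
  using assms by (intro sum.cong refl) (simp add: inn_lincomb mult_cnj_cmod)
 finally show ?thesis using v by (simp add: hnorm_sq)
qed

lemma hproj_inn: "ons H F ==> finite F ==> e \<in> F ==> inn H (hproj H F x) e = inn H x e"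
 unfolding hproj_def by (rule inn_lincomb)

lemma hproj_orth: "ons H F ==> finite F ==> e \<in> F ==> x \<in> carr H ==> inn H (x - hproj H F x) e = 0"
 by (simp add: s_diff hproj_inn ons_carr)

lemma hproj_norm: "ons H F ==> finite F ==> (hnorm H (hproj H F x))\<^sup>2 = (\<Sum>e\<in>F. (cmod (inn H x e))\<^sup>2)"
 unfolding hproj_def by (rule hnorm_lincomb)

lemma inn_hproj:
 assumes "ons H F" "finite F" "x \<in> carr H" "y \<in> carr H"
 shows "inn H y (hproj H F x) = (\<Sum>e\<in>F. cnj (inn H x e) * inn H y e)"
 using assms unfolding hproj_def by (subst s_sum_right) (auto simp: ons_carr s_scale_right)

lemma hproj_pythagoras:
 assumes "ons H F" "finite F" "x \<in> carr H"
 shows "(hnorm H (x - hproj H F x))\<^sup>2 = (hnorm H x)\<^sup>2 - (\<Sum>e\<in>F. (cmod (inn H x e))\<^sup>2)"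
proof -
 let ?p = "hproj H F x" and ?y = "x - hproj H F x"
 have "inn H ?y ?p = 0"
  using assms by (subst inn_hproj) (auto simp: hproj_orth)
 then have "(hnorm H (?y + ?p))\<^sup>2 = (hnorm H ?y)\<^sup>2 + (hnorm H ?p)\<^sup>2"
  using assms by (subst hnorm_add_sq) auto
 then show ?thesis using assms by (simp add: hproj_norm)
qed

lemma bessel:
 assumes "ons H F" "finite F" "x \<in> carr H"
 shows "(\<Sum>e\<in>F. (cmod (inn H x e))\<^sup>2) <= (hnorm H x)\<^sup>2"
 using hproj_pythagoras[OF assms] zero_le_power2[of "hnorm H (x - hproj H F x)"] by linarith

lemma bessel':
 assumes "ons H F" "finite F" "x \<in> carr H"
 shows "(\<Sum>e\<in>F. (cmod (inn H e x))\<^sup>2) <= (hnorm H x)\<^sup>2"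
proof -
 have "(\<Sum>e\<in>F. (cmod (inn H e x))\<^sup>2) = (\<Sum>e\<in>F. (cmod (inn H x e))\<^sup>2)"
  using assms by (intro sum.cong refl) (metis complex_mod_cnj ons_carr s_cnj)
 then show ?thesis using bessel[OF assms] by simp
qed

lemma cmod_inn_commute: "x \<in> carr H ==> y \<in> carr H ==> cmod (inn H x y) = cmod (inn H y x)"
 using s_cnj[of x y] by simp

text \<open>Puts two orthonormal families into the span of one orthonormal family that is no larger
  than their union. Membership in the span is expressed by \<open>x = hproj H B x\<close>, the form
  in which \<open>form_trace_mono\<close> consumes it.\<close>

lemma gram_schmidt:
 assumes "finite X" "X \<subseteq> carr H"
 shows "\<exists>B. ons H B \<and> finite B \<and> card B <= card X \<and> (\<forall>x\<in>X. x = hproj H B x)"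
 using assms
proof (induction X)
 case empty
 then show ?case by (intro exI[of _ "{}"]) auto
next
 case (insert v X)
 then obtain B where B: "ons H B" "finite B" "card B <= card X" "\<forall>x\<in>X. x = hproj H B x" by auto
 have v: "v \<in> carr H" and X: "X \<subseteq> carr H" using insert by auto
 define y where "y = v - hproj H B v"
 have y: "y \<in> carr H" using v B by (simp add: y_def)
 show ?case
 proof (cases "y = 0")
  case True
  then show ?thesis using B insert by (intro exI[of _ B]) (auto simp: y_def)
 next
  case False
  define n where "n = hnorm H y"
  have n: "n > 0" using False y hnorm_eq_0 hnorm_nonneg[OF y] by (simp add: n_def less_le)
  define u where "u = of_real (1 / n) *\<^sub>C y"
  have u: "u \<in> carr H" "hnorm H u = 1" using y n
   by (auto simp: u_def hnorm_scale n_def[symmetric] norm_divide)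
  have uB: "inn H u e = 0" if "e \<in> B" for e
   using that B v y by (simp add: u_def s_scale ons_carr y_def hproj_orth)
  then have O: "ons H (insert u B)" using ons_insert B u by blast
  have nin: "u \<notin> B" using uB u inn_self by fastforce
  have P: "hproj H (insert u B) x = inn H x u *\<^sub>C u + hproj H B x" for x
   using nin B by (simp add: hproj_def)
  have "hproj H (insert u B) x = x" if "x \<in> X" for x
  proof -
   have x: "x = hproj H B x" "x \<in> carr H" using that B X by auto
   have "inn H u x = inn H u (hproj H B x)" using x by simp
   also have "\<dots> = 0" using B x u by (subst inn_hproj) (auto simp: uB)
   finally have "inn H x u = 0" using s_cnj[of u x] u x by simp
   then show ?thesis using x by (simp add: P)
  qed
  moreover have "hproj H (insert u B) v = v"
  proof -
   have "inn H u (hproj H B v) = 0" using B v u by (subst inn_hproj) (auto simp: uB)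
   then have "inn H (hproj H B v) u = 0" using s_cnj[of u "hproj H B v"] u B by simp
   moreover have "v = of_real n *\<^sub>C u + hproj H B v"
    using n by (simp add: u_def y_def cvec.scale_scale)
   ultimately have "inn H v u = of_real n * inn H u u"
    using u B by (metis s_add s_scale add.right_neutral scale_mem hproj_mem)
   then have "inn H v u = of_real n" using u by (simp add: inn_self)
   then show ?thesis using \<open>v = _\<close> by (simp add: P)
  qed
  ultimately show ?thesis using O B insert nin
   by (intro exI[of _ "insert u B"]) auto
 qed
qed

end

section \<open>Spectral decomposition of compact positive operators\<close>

text \<open>The position of \<open>e\<close> is its rank: the number of elements with larger value,
  ties being broken by an injective index on the countable set \<open>E\<close>. Ranks are finite
  because only finitely many values exceed a positive bound.\<close>

lemma decreasing_enum:
 fixes E :: "'a set" and v :: "'a => real"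
 assumes pos: "\<And>e. e \<in> E ==> 0 < v e" and fin: "\<And>t. 0 < t ==> finite {e\<in>E. v e > t}"
 obtains \<rho> :: "'a => nat" and \<mu> :: "nat => real"
 where "inj_on \<rho> E" "decseq \<mu>" "\<And>n. 0 <= \<mu> n" "\<mu> \<longlonglongrightarrow> 0" "\<And>e. e \<in> E ==> \<mu> (\<rho> e) = v e"
  "\<And>n. n \<notin> \<rho> ` E ==> \<mu> n = 0"
proof -
 have "E = (\<Union>n. {e\<in>E. v e > 1 / real (Suc n)})"
  using pos reals_Archimedean by (fastforce simp: inverse_eq_divide)
 moreover have "countable (\<Union>n. {e\<in>E. v e > 1 / real (Suc n)})"
  by (rule countable_UN, simp, rule countable_finite, rule fin, simp)
 ultimately have cE: "countable E" by simp
 define idx where "idx = to_nat_on E"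
 have idx: "inj_on idx E" unfolding idx_def using cE by (rule inj_on_to_nat_on)
 define less where "less e' e \<longleftrightarrow> v e' > v e \<or> (v e' = v e \<and> idx e' < idx e)" for e' e
 define L where "L e = {e'\<in>E. less e' e}" for e
 define \<rho> where "\<rho> e = card (L e)" for e
 have finL: "finite (L e)" if "e \<in> E" for e
  by (rule finite_subset[OF _ fin[of "v e / 2"]]) (use pos[OF that] in \<open>auto simp: L_def less_def\<close>)
 have mono: "\<rho> e' < \<rho> e" if "e \<in> E" "e' \<in> E" "less e' e" for e e'
 proof -
  have "L e' \<subset> L e" using that by (auto simp: L_def less_def)
  then show ?thesis using finL that unfolding \<rho>_def by (intro psubset_card_mono) auto
 qed
 have inj: "inj_on \<rho> E"
 proof (rule inj_onI, rule ccontr)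
  fix e e' assume *: "e \<in> E" "e' \<in> E" "\<rho> e = \<rho> e'" "e \<noteq> e'"
  then have "idx e \<noteq> idx e'" using idx by (auto dest: inj_onD)
  then have "less e e' \<or> less e' e" by (auto simp: less_def)
  then show False using mono[of e e'] mono[of e' e] * by auto
 qed
 \<comment> \<open>The predecessors of \<open>e\<close> fill all the positions below
   \<open>\<rho> e\<close>, by injectivity and counting. So the occupied positions form an initial
   segment, and zeros come only after it.\<close>
 have init: "\<rho> ` L e = {..<\<rho> e}" if "e \<in> E" for e
 proof (rule card_subset_eq)
  show "\<rho> ` L e \<subseteq> {..<\<rho> e}" using mono that by (auto simp: L_def)
  have "inj_on \<rho> (L e)" by (rule inj_on_subset[OF inj]) (auto simp: L_def)
  then show "card (\<rho> ` L e) = card {..<\<rho> e}" by (simp add: card_image) (simp add: \<rho>_def)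
 qed simp
 define \<mu> where "\<mu> n = (if n \<in> \<rho> ` E then v (inv_into E \<rho> n) else 0)" for n
 have \<mu>: "\<mu> (\<rho> e) = v e" if "e \<in> E" for e
  using that inj by (auto simp: \<mu>_def inv_into_f_f)
 have \<mu>0: "0 <= \<mu> n" for n using pos \<mu> by (cases "n \<in> \<rho> ` E") (auto simp: less_imp_le, simp add: \<mu>_def)
 have dec: "decseq \<mu>"
 proof (rule decseq_SucI)
  fix n show "\<mu> (Suc n) <= \<mu> n"
  proof (cases "Suc n \<in> \<rho> ` E")
   case True
   then obtain e where e: "e \<in> E" "Suc n = \<rho> e" by auto
   then have "n \<in> \<rho> ` L e" using init[of e] by auto
   then obtain e' where e': "e' \<in> E" "less e' e" "n = \<rho> e'" by (auto simp: L_def)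
   then show ?thesis using e \<mu> by (auto simp: less_def)
  next
   case False then show ?thesis using \<mu>0 by (simp add: \<mu>_def)
  qed
 qed
 have lim: "\<mu> \<longlonglongrightarrow> 0"
 proof (rule order_tendstoI)
  fix a :: real assume "0 < a"
  have "{n. \<not> \<mu> n < a} \<subseteq> \<rho> ` {e\<in>E. v e > a/2}"
  proof
   fix n assume n: "n \<in> {n. \<not> \<mu> n < a}"
   then have "n \<in> \<rho> ` E" using \<open>0 < a\<close> by (auto simp: \<mu>_def split: if_splits)
   then show "n \<in> \<rho> ` {e\<in>E. v e > a/2}" using n \<mu> \<open>0 < a\<close> by auto
  qed
  then have "finite {n. \<not> \<mu> n < a}" using fin[of "a/2"] \<open>0 < a\<close> by (simp add: finite_subset)
  then show "\<forall>\<^sub>F n in sequentially. \<mu> n < a"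
   unfolding eventually_cofinite[symmetric] cofinite_eq_sequentially .
 next
  fix a :: real assume "a < 0" then show "\<forall>\<^sub>F n in sequentially. a < \<mu> n"
   by (intro always_eventually allI less_le_trans[OF _ \<mu>0])
 qed
 show thesis by (rule that[OF inj dec \<mu>0 lim \<mu>]) (auto simp: \<mu>_def)
qed

text \<open>The uniqueness behind \<open>eigval_seq\<close>: the multiplicities determine how many
  terms lie above each positive level, and these counts determine a decreasing sequence. The limit 0
  keeps the counted sets finite, so that \<open>card\<close> does not fall back to its default
  0.\<close>

lemma decreasing_multiplicity_unique:
 fixes \<mu> \<nu> :: "nat => real"
 assumes "decseq \<mu>" "\<And>n. 0 <= \<mu> n" "\<mu> \<longlonglongrightarrow> 0" "decseq \<nu>" "\<And>n. 0 <= \<nu> n" "\<nu> \<longlonglongrightarrow> 0"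
  and card: "\<And>t. 0 < t ==> card {n. \<mu> n = t} = card {n. \<nu> n = t}"
 shows "\<mu> = \<nu>"
proof -
 have fin: "finite {n. \<kappa> n \<ge> t}" if "\<kappa> \<longlonglongrightarrow> 0" "0 < t" for \<kappa> :: "nat => real" and t
 proof -
  have "\<forall>\<^sub>F n in sequentially. \<kappa> n < t" using order_tendstoD(2)[OF that(1) that(2)] .
  then show ?thesis unfolding cofinite_eq_sequentially[symmetric] eventually_cofinite
   by (simp add: not_less)
 qed
 have cnt: "card {n. \<kappa> n \<ge> t} = (\<Sum>s\<in>S. card {n. \<kappa> n = s})"
  if "\<kappa> \<longlonglongrightarrow> 0" "0 < t" "finite S" "\<kappa> ` {n. \<kappa> n \<ge> t} \<subseteq> S" "S \<subseteq> {t..}" for \<kappa> :: "nat => real" and t S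
 proof -
  have "{n. \<kappa> n \<ge> t} = (\<Union>s\<in>S. {n. \<kappa> n = s})" using that by auto
  moreover have "finite {n. \<kappa> n = s}" if "s \<in> S" for s
   by (rule finite_subset[OF _ fin[OF \<open>\<kappa> \<longlonglongrightarrow> 0\<close> \<open>0 < t\<close>]]) (use that \<open>S \<subseteq> {t..}\<close> in auto)
  ultimately show ?thesis using that(3) by (simp only:) (rule card_UN_disjoint, auto)
 qed
 have eq: "card {n. \<mu> n \<ge> t} = card {n. \<nu> n \<ge> t}" if t: "0 < t" for t
 proof -
  define S where "S = \<mu> ` {n. \<mu> n \<ge> t} \<union> \<nu> ` {n. \<nu> n \<ge> t}"
  have S: "finite S" "S \<subseteq> {t..}" using fin assms t by (auto simp: S_def)
  have "(\<Sum>s\<in>S. card {n. \<mu> n = s}) = (\<Sum>s\<in>S. card {n. \<nu> n = s})"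
   using S t by (intro sum.cong card) auto
  then show ?thesis using cnt[of \<mu> t S] cnt[of \<nu> t S] assms t S by (auto simp: S_def)
 qed
 have le: "\<mu> n <= \<nu> n" if "decseq \<mu>" "decseq \<nu>" "\<mu> \<longlonglongrightarrow> 0" "\<And>n. 0 <= \<nu> n"
  "\<And>t. 0 < t ==> card {n. \<mu> n \<ge> t} = card {n. \<nu> n \<ge> t}" for n and \<mu> \<nu> :: "nat => real"
 proof (rule ccontr)
  assume *: "\<not> \<mu> n <= \<nu> n"
  \<comment> \<open>At this level \<mu> has at least \<open>Suc n\<close> terms, but \<nu> has at
    most \<open>n\<close>.\<close>
  define t where "t = \<mu> n"
  have t: "0 < t" using * that(4)[of n] by (simp add: t_def)
  have "{..n} \<subseteq> {k. \<mu> k \<ge> t}" using that(1) by (auto simp: t_def decseq_def)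
  then have "Suc n <= card {k. \<mu> k \<ge> t}" using card_mono[OF fin[OF that(3) t], of "{..n}"] by simp
  moreover have "{k. \<nu> k \<ge> t} \<subseteq> {..<n}"
  proof (rule subsetI, rule ccontr)
   fix k assume "k \<in> {k. \<nu> k \<ge> t}" "k \<notin> {..<n}"
   then have "\<nu> k <= \<nu> n" "t <= \<nu> k" using that(2) by (auto simp: decseq_def)
   then show False using * by (simp add: t_def)
  qed
  then have "card {k. \<nu> k \<ge> t} <= n" using card_mono[of "{..<n}" "{k. \<nu> k \<ge> t}"] by simp
  ultimately show False using that(5)[OF t] by simp
 qed
 show ?thesis
 proof
  fix n show "\<mu> n = \<nu> n"
   using le[OF assms(1,4,3,5) eq] le[OF assms(4,1,6,2) eq[symmetric]] by (rule antisym)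
 qed
qed

section \<open>Bounded and positive operators, their quadratic forms and eigenvectors\<close>

lemma bounded_opsD:
 assumes "B \<in> bounded_ops H"
 shows "x \<in> carr H ==> B x \<in> carr H"
  and "x \<in> carr H ==> y \<in> carr H ==> B (x + y) = B x + B y"
  and "x \<in> carr H ==> B (a *\<^sub>C x) = a *\<^sub>C B x"
  and "x \<notin> carr H ==> B x = 0"
 using assms unfolding bounded_ops_def by auto

lemma positive_opD:
 assumes "positive_op H A"
 shows "A \<in> bounded_ops H" "x \<in> carr H ==> Im (inn H (A x) x) = 0" "x \<in> carr H ==> 0 <= Re (inn H (A x) x)"
 using assms unfolding positive_op_def by auto

definition qform :: "'v::complex_vector hilbert => ('v => 'v) => 'v => real"
 where "qform H A x = Re (inn H (A x) x)"

context pre_hilbert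
begin

lemma op_zero: "B \<in> bounded_ops H ==> B 0 = 0"
 using bounded_opsD(3)[of B H 0 0] by simp

lemma op_diff:
 assumes "B \<in> bounded_ops H" "x \<in> carr H" "y \<in> carr H"
 shows "B (x - y) = B x - B y"
proof -
 have "B (x + (-1) *\<^sub>C y) = B x + (-1) *\<^sub>C B y"
  using assms by (simp only: bounded_opsD scale_mem)
 then show ?thesis by (simp add: cvec.scale_minus_left)
qed

lemma op_sum:
 assumes "B \<in> bounded_ops H" "\<And>i. i \<in> I ==> f i \<in> carr H"
 shows "B (sum f I) = (\<Sum>i\<in>I. B (f i))"
 using assms(2) by (induction I rule: infinite_finite_induct)
  (auto simp: op_zero assms(1) bounded_opsD(2)[OF assms(1)])

lemma op_bound:
 assumes "B \<in> bounded_ops H"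
 obtains C where "C > 0" "\<And>x. x \<in> carr H ==> hnorm H (B x) <= C * hnorm H x"
proof -
 obtain C where C: "\<forall>x\<in>carr H. hnorm H (B x) <= C * hnorm H x"
  using assms unfolding bounded_ops_def by auto
 have "hnorm H (B x) <= (max C 1) * hnorm H x" if "x \<in> carr H" for x
  using C that hnorm_nonneg[OF that] by (meson max.cobounded1 mult_right_mono order_trans)
 then show thesis using that[of "max C 1"] by auto
qed

lemma op_ext:
 assumes "A \<in> bounded_ops H" "B \<in> bounded_ops H" "\<And>x. x \<in> carr H ==> A x = B x"
 shows "A = B"
 using assms bounded_opsD(4) by (metis ext)

text \<open>A sesquilinear form that is real on the diagonal is Hermitian: its values at
  \<open>x + y\<close> and at \<open>x + \<i> *\<^sub>C y\<close> give the imaginary and the real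
  part of the identity.\<close>

lemma pos_cnj:
 assumes "positive_op H A" "x \<in> carr H" "y \<in> carr H"
 shows "inn H (A y) x = cnj (inn H (A x) y)"
proof -
 note B = bounded_opsD[OF positive_opD(1)[OF assms(1)]]
 note [simp] = B(1-3) s_add s_add_right s_scale s_scale_right
 have "Im (inn H (A (x + y)) (x + y)) = 0" using assms by (intro positive_opD(2)) auto
 then have 1: "Im (inn H (A x) y) + Im (inn H (A y) x) = 0"
  using assms positive_opD(2)[OF assms(1)] by simp
 have "Im (inn H (A (x + \<i> *\<^sub>C y)) (x + \<i> *\<^sub>C y)) = 0" using assms by (intro positive_opD(2)) auto
 then have 2: "Re (inn H (A y) x) - Re (inn H (A x) y) = 0"
  using assms positive_opD(2)[OF assms(1)] by simp
 show ?thesis using 1 2 by (simp add: complex_eq_iff)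
qed

lemma pos_selfadjoint:
 assumes "positive_op H A" "x \<in> carr H" "y \<in> carr H"
 shows "inn H (A x) y = inn H x (A y)"
 using pos_cnj[OF assms(1,3,2)] s_cnj[of "A y" x] assms
  bounded_opsD(1)[OF positive_opD(1)[OF assms(1)]] by simp

lemma pos_semi:
 assumes A: "positive_op H A"
 shows "semi_inner (carr H) (%x y. inn H (A x) y)"
proof -
 note B = bounded_opsD(1-3)[OF positive_opD(1)[OF A]]
 show ?thesis
  by unfold_locales (auto simp: B s_add s_scale positive_opD(3)[OF A] intro: pos_cnj[OF A])
qed

lemma hadjoint_pos:
 assumes A: "positive_op H A"
 shows "hadjoint H A = A"
 unfolding hadjoint_def
proof (rule the_equality)
 note A1 = positive_opD(1)[OF A]
 show "A \<in> bounded_ops H \<and> (\<forall>x\<in>carr H. \<forall>y\<in>carr H. inn H (A x) y = inn H x (A y))"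
  using A1 pos_selfadjoint[OF A] by auto
 fix B assume B: "B \<in> bounded_ops H \<and> (\<forall>x\<in>carr H. \<forall>y\<in>carr H. inn H (A x) y = inn H x (B y))"
 show "B = A"
 proof (rule op_ext)
  fix y assume y: "y \<in> carr H"
  let ?z = "B y - A y"
  have z: "B y \<in> carr H" "A y \<in> carr H" using B A1 y bounded_opsD(1) by blast+
  then have "inn H ?z (B y) = inn H ?z (A y)"
   using B y pos_selfadjoint[OF A, of ?z y] by (metis diff_mem)
  then have "inn H ?z ?z = 0" using z by (subst s_diff_right) auto
  then have "?z = 0" using definite[of ?z] z by simp
  then show "B y = A y" by simp
 qed (rule conjunct1[OF B], rule A1)
qed

lemma qform_bound:
 assumes "A \<in> bounded_ops H"
 obtains C where "C > 0" "\<And>x. x \<in> carr H ==> \<bar>qform H A x\<bar> <= C * (hnorm H x)\<^sup>2"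
proof -
 obtain C where C: "C > 0" "\<And>x. x \<in> carr H ==> hnorm H (A x) <= C * hnorm H x" using op_bound[OF assms] by blast
 have "\<bar>qform H A x\<bar> <= C * (hnorm H x)\<^sup>2" if x: "x \<in> carr H" for x
 proof -
  have "\<bar>qform H A x\<bar> <= cmod (inn H (A x) x)" by (simp add: qform_def abs_Re_le_cmod)
  also have "\<dots> <= hnorm H (A x) * hnorm H x" using x bounded_opsD(1)[OF assms] by (intro CS)
  also have "\<dots> <= C * hnorm H x * hnorm H x" using C x hnorm_nonneg by (intro mult_right_mono) auto
  finally show ?thesis by (simp add: power2_eq_square mult.assoc)
 qed
 then show thesis using that C by blast
qed

lemma qform_scale:
 assumes "A \<in> bounded_ops H" "x \<in> carr H"
 shows "qform H A (a *\<^sub>C x) = (cmod a)\<^sup>2 * qform H A x"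
proof -
 have "inn H (A (a *\<^sub>C x)) (a *\<^sub>C x) = (a * cnj a) * inn H (A x) x"
  using assms by (simp add: bounded_opsD s_scale s_scale_right)
 also have "\<dots> = of_real ((cmod a)\<^sup>2) * inn H (A x) x" by (simp add: mult_cnj_cmod)
 finally show ?thesis unfolding qform_def by (simp only: Re_complex_of_real times_complex.sel Im_complex_of_real mult_zero_left diff_zero)
qed

lemma op_hlim:
 assumes "A \<in> bounded_ops H" "hlim H X x" "\<And>n. X n \<in> carr H" "x \<in> carr H"
 shows "hlim H (%n. A (X n)) (A x)"
proof -
 obtain C where C: "C > 0" "\<And>x. x \<in> carr H ==> hnorm H (A x) <= C * hnorm H x" using op_bound[OF assms(1)] by blast
 have "(%n. C * hnorm H (X n - x)) \<longlonglongrightarrow> C * 0" using assms(2) unfolding hlim_def by (intro tendsto_intros)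
 then have *: "(%n. C * hnorm H (X n - x)) \<longlonglongrightarrow> 0" by simp
 show ?thesis unfolding hlim_def
 proof (rule Lim_null_comparison[OF _ *], intro always_eventually allI)
  fix n
  have "0 <= hnorm H (A (X n) - A x)" using assms bounded_opsD(1) by (intro hnorm_nonneg diff_mem) auto
  then show "norm (hnorm H (A (X n) - A x)) <= C * hnorm H (X n - x)"
   using C(2)[of "X n - x"] assms by (simp add: op_diff)
 qed
qed

text \<open>Rayleigh's principle on the orthogonal complement of a set of eigenvectors: by
  compactness the supremum of the form over the unit ball of the complement is attained at an
  eigenvector. The vector \<open>y0\<close> only certifies that this supremum exceeds
  \<open>\<epsilon>\<close>.\<close>

lemma eigenvector_above:
 assumes pos: "positive_op H A" and comp: "compact_op H A"
  and F: "F \<subseteq> carr H" "\<And>f. f \<in> F ==> \<exists>c. A f = c *\<^sub>C f"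
  and y0: "y0 \<in> carr H" "\<And>f. f \<in> F ==> inn H y0 f = 0" and eps: "0 <= \<epsilon>" "\<epsilon> * (hnorm H y0)\<^sup>2 < qform H A y0"
 obtains z t where "z \<in> carr H" "hnorm H z = 1" "\<And>f. f \<in> F ==> inn H z f = 0" "t > \<epsilon>" "A z = of_real t *\<^sub>C z"
proof -
 interpret sa: semi_inner "carr H" "%x y. inn H (A x) y" by (rule pos_semi[OF pos])
 note Ab = positive_opD(1)[OF pos]
 note AD [simp] = bounded_opsD(1)[OF Ab]
 define M where "M = {y\<in>carr H. \<forall>f\<in>F. inn H y f = 0}"
 have Mc: "y \<in> M ==> y \<in> carr H" for y by (simp add: M_def)
 \<comment> \<open>The complement of eigenvectors is invariant, because \<open>A\<close> is
   self-adjoint.\<close>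
 have MA: "A y \<in> M" if "y \<in> M" for y
 proof -
  have "inn H (A y) f = 0" if f: "f \<in> F" for f
  proof -
   obtain c where "A f = c *\<^sub>C f" using F f by blast
   then show ?thesis using f F \<open>y \<in> M\<close> by (simp add: pos_selfadjoint[OF pos] M_def subset_iff s_scale_right)
  qed
  then show ?thesis using that by (simp add: M_def)
 qed
 have Ms: "a *\<^sub>C y \<in> M" if "y \<in> M" for y a using that F by (auto simp: M_def s_scale subset_iff)
 obtain C where C: "C > 0" "\<And>x. x \<in> carr H ==> \<bar>qform H A x\<bar> <= C * (hnorm H x)\<^sup>2" using qform_bound[OF Ab] by blast
 define S where "S = qform H A ` {y\<in>M. hnorm H y <= 1}"
 define s where "s = Sup S"
 have bdd: "bdd_above S"
 proof (rule bdd_aboveI[of _ C])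
  fix u assume "u \<in> S"
  then obtain y where y: "y \<in> M" "hnorm H y <= 1" "u = qform H A y" by (auto simp: S_def)
  have "u <= C * (hnorm H y)\<^sup>2" using C(2)[OF Mc[OF y(1)]] y by simp
  also have "\<dots> <= C * 1" using y C hnorm_nonneg[OF Mc[OF y(1)]] by (intro mult_left_mono) (auto simp: power_le_one)
  finally show "u <= C" by simp
 qed
 have unit: "qform H A y = qform H A (of_real (1 / hnorm H y) *\<^sub>C y) * (hnorm H y)\<^sup>2"
  "hnorm H (of_real (1 / hnorm H y) *\<^sub>C y) = 1" if "y \<in> carr H" "y \<noteq> 0" for y
  using that hnorm_eq_0[of y] hnorm_nonneg[of y] qform_scale[OF Ab that(1), of "of_real (1 / hnorm H y)"]
  by (auto simp: hnorm_scale norm_divide power_divide)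
 have qs: "qform H A y <= s * (hnorm H y)\<^sup>2" if y: "y \<in> M" for y
 proof (cases "y = 0")
  case True then show ?thesis using op_zero[OF Ab] by (simp add: qform_def)
 next
  case False
  have "qform H A (of_real (1 / hnorm H y) *\<^sub>C y) <= s"
   unfolding s_def by (rule cSup_upper[OF _ bdd]) (use unit[OF Mc[OF y] False] Ms[OF y] in \<open>auto simp: S_def\<close>)
  then show ?thesis using unit(1)[OF Mc[OF y] False] by (metis mult_right_mono zero_le_power2)
 qed
 have y0M: "y0 \<in> M" using y0 by (simp add: M_def)
 have "y0 \<noteq> 0" using eps op_zero[OF Ab] by (auto simp: qform_def)
 then have h0: "hnorm H y0 > 0" using hnorm_eq_0[of y0] hnorm_nonneg[of y0] y0 by simp
 have "\<epsilon> * (hnorm H y0)\<^sup>2 < s * (hnorm H y0)\<^sup>2" using qs[OF y0M] eps by simp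
 then have s: "\<epsilon> < s" using h0 by simp
 then have s0: "0 < s" using eps by simp
 have "\<exists>y. y \<in> M \<and> hnorm H y <= 1 \<and> s - 1 / real (Suc n) < qform H A y" for n
 proof -
  have "S \<noteq> {}" using zero_mem by (auto simp: S_def M_def intro!: exI[of _ 0]) (use F in auto)
  moreover have "s - 1 / real (Suc n) < Sup S" by (simp add: s_def)
  ultimately obtain u where "u \<in> S" "s - 1 / real (Suc n) < u" using less_cSup_iff[OF _ bdd] by blast
  then show ?thesis by (auto simp: S_def)
 qed
 then obtain Y where Y: "\<And>n. Y n \<in> M" "\<And>n. hnorm H (Y n) <= 1" "\<And>n. s - 1 / real (Suc n) < qform H A (Y n)"
  by metis
 have Yc [simp]: "Y n \<in> carr H" for n using Y Mc by blast
 obtain r z where r: "strict_mono r" and z: "z \<in> carr H" and lim: "hlim H (%n. A (Y (r n))) z"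
  using comp Y(2) Yc unfolding compact_op_def by blast
 \<comment> \<open>Cauchy-Schwarz for the form of \<open>A\<close> at \<open>y\<close> and
   \<open>A y\<close>. This bound, linear in the form, is what makes every maximizing sequence a
   sequence of approximate eigenvectors.\<close>
 have Ay: "(hnorm H (A y))\<^sup>2 <= s * qform H A y" if y: "y \<in> M" for y
 proof (cases "A y = 0")
  case True then show ?thesis using s0 positive_opD(3)[OF pos Mc[OF y]] by (simp add: qform_def)
 next
  case False
  have yc: "y \<in> carr H" by (rule Mc[OF y])
  have pos': "(hnorm H (A y))\<^sup>2 > 0" using False hnorm_eq_0[of "A y"] yc by simp
  have "((hnorm H (A y))\<^sup>2)\<^sup>2 = (cmod (inn H (A y) (A y)))\<^sup>2" using yc by (simp add: inn_self norm_power)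
  also have "\<dots> <= qform H A y * qform H A (A y)" unfolding qform_def using yc by (intro sa.s_CS) auto
  also have "\<dots> <= qform H A y * (s * (hnorm H (A y))\<^sup>2)"
   using qs[OF MA[OF y]] positive_opD(3)[OF pos yc] by (intro mult_left_mono) (auto simp: qform_def)
  finally have "(hnorm H (A y))\<^sup>2 * (hnorm H (A y))\<^sup>2 <= (s * qform H A y) * (hnorm H (A y))\<^sup>2"
   by (simp add: power2_eq_square mult_ac)
  then show ?thesis using pos' by (simp only: mult_le_cancel_right_pos)
 qed
 have gap: "(hnorm H (A (Y n) - of_real s *\<^sub>C Y n))\<^sup>2 <= s / real (Suc n)" for n
 proof -
  have "(hnorm H (A (Y n) - of_real s *\<^sub>C Y n))\<^sup>2
   = (hnorm H (A (Y n)))\<^sup>2 - 2 * s * qform H A (Y n) + s\<^sup>2 * (hnorm H (Y n))\<^sup>2"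
   using s_expand[of "A (Y n)" "Y n" "of_real s"] s0 by (simp add: hnorm_sq qform_def)
  also have "\<dots> <= s * qform H A (Y n) - 2 * s * qform H A (Y n) + s\<^sup>2 * 1"
   using Ay[OF Y(1)] Y(2)[of n] hnorm_nonneg[OF Yc[of n]] by (intro add_mono mult_left_mono) (auto simp: power_le_one)
  also have "\<dots> = s * (s - qform H A (Y n))" by (simp add: power2_eq_square algebra_simps)
  also have "\<dots> <= s * (1 / real (Suc n))" using Y(3)[of n] s0 by (intro mult_left_mono) auto
  finally show ?thesis by simp
 qed
 have "(%n. (hnorm H (A (Y n) - of_real s *\<^sub>C Y n))\<^sup>2) \<longlonglongrightarrow> 0"
 proof (rule Lim_null_comparison)
  show "(%n. s / real (Suc n)) \<longlonglongrightarrow> 0" using tendsto_mult_right_zero[OF LIMSEQ_inverse_real_of_nat, of s] by (simp add: field_simps)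
 qed (use gap in auto)
 then have "(%n. sqrt ((hnorm H (A (Y n) - of_real s *\<^sub>C Y n))\<^sup>2)) \<longlonglongrightarrow> sqrt 0" by (rule tendsto_real_sqrt)
 moreover have "sqrt ((hnorm H (A (Y n) - of_real s *\<^sub>C Y n))\<^sup>2) = hnorm H (A (Y n) - of_real s *\<^sub>C Y n)" for n
  using hnorm_nonneg[of "A (Y n) - of_real s *\<^sub>C Y n"] by simp
 ultimately have g0: "(%n. hnorm H (A (Y n) - of_real s *\<^sub>C Y n)) \<longlonglongrightarrow> 0" by simp
 \<comment> \<open>Compactness gives convergence of the images; since \<open>A (Y n) - s Y n\<close>
   tends to 0, the vectors themselves converge up to the factor \<open>s\<close>.\<close>
 have sY: "hlim H (%n. of_real s *\<^sub>C Y (r n)) z"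
  unfolding hlim_def
 proof (rule Lim_null_comparison)
  show "(%n. hnorm H (A (Y (r n)) - of_real s *\<^sub>C Y (r n)) + hnorm H (A (Y (r n)) - z)) \<longlonglongrightarrow> 0"
   using tendsto_add[OF LIMSEQ_subseq_LIMSEQ[OF g0 r] lim[unfolded hlim_def]] by (simp add: o_def)
  show "\<forall>\<^sub>F n in sequentially. norm (hnorm H (of_real s *\<^sub>C Y (r n) - z))
    <= hnorm H (A (Y (r n)) - of_real s *\<^sub>C Y (r n)) + hnorm H (A (Y (r n)) - z)"
  proof (intro always_eventually allI)
   fix n
   have "0 <= hnorm H (of_real s *\<^sub>C Y (r n) - z)" using z by (intro hnorm_nonneg) auto
   then show "norm (hnorm H (of_real s *\<^sub>C Y (r n) - z))
    <= hnorm H (A (Y (r n)) - of_real s *\<^sub>C Y (r n)) + hnorm H (A (Y (r n)) - z)"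
    using hnorm_triangle_dist[of "of_real s *\<^sub>C Y (r n)" "A (Y (r n))" z] z
     hnorm_minus_commute[of "of_real s *\<^sub>C Y (r n)" "A (Y (r n))"] by simp
  qed
 qed
 have "hlim H (%n. A (of_real s *\<^sub>C Y (r n))) (A z)" by (rule op_hlim[OF Ab sY]) (use z in auto)
 moreover have "hlim H (%n. A (of_real s *\<^sub>C Y (r n))) (of_real s *\<^sub>C z)"
 proof -
  have "hnorm H (A (of_real s *\<^sub>C Y (r n)) - of_real s *\<^sub>C z) = s * hnorm H (A (Y (r n)) - z)" for n
   using hnorm_scale[of "A (Y (r n)) - z" "of_real s"] z s0
   by (simp add: bounded_opsD(3)[OF Ab] cvec.scale_right_diff_distrib)
  then show ?thesis using tendsto_mult_right_zero[OF lim[unfolded hlim_def], of s] by (simp add: hlim_def)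
 qed
 ultimately have Az: "A z = of_real s *\<^sub>C z" by (rule hlim_unique) (use z in auto)
 \<comment> \<open>Excludes \<open>z = 0\<close>; only afterwards can \<open>z\<close> be
   normalized.\<close>
 have "s <= hnorm H z"
 proof (rule LIMSEQ_le)
  show "(%n. hnorm H (A (Y (r n)))) \<longlonglongrightarrow> hnorm H z" by (rule hlim_hnorm[OF lim]) (use z in auto)
  have "(%n. s - 1 / real (Suc n)) \<longlonglongrightarrow> s - 0"
   using LIMSEQ_inverse_real_of_nat by (intro tendsto_diff tendsto_const) (simp add: inverse_eq_divide)
  from LIMSEQ_subseq_LIMSEQ[OF this r] show "(%n. s - 1 / real (Suc (r n))) \<longlonglongrightarrow> s" by (simp add: o_def)
  have "s - 1 / real (Suc n) <= hnorm H (A (Y n))" for n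
  proof -
   have "qform H A (Y n) <= cmod (inn H (A (Y n)) (Y n))" by (simp add: qform_def complex_Re_le_cmod)
   also have "\<dots> <= hnorm H (A (Y n)) * hnorm H (Y n)" by (intro CS) auto
   also have "\<dots> <= hnorm H (A (Y n)) * 1" using Y by (intro mult_left_mono hnorm_nonneg) auto
   finally show ?thesis using Y(3)[of n] by simp
  qed
  then show "\<exists>N. \<forall>n\<ge>N. s - 1 / real (Suc (r n)) <= hnorm H (A (Y (r n)))" by auto
 qed
 then have hz: "hnorm H z > 0" using s0 by simp
 have zF: "inn H z f = 0" if f: "f \<in> F" for f
 proof -
  have "(%n. inn H (A (Y (r n))) f) \<longlonglongrightarrow> inn H z f" by (rule hlim_inn[OF lim]) (use z f F in auto)
  moreover have "inn H (A (Y (r n))) f = 0" for n using MA[OF Y(1)] f by (simp add: M_def)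
  ultimately show ?thesis by (simp add: LIMSEQ_const_iff)
 qed
 show thesis
 proof (rule that[of "of_real (1 / hnorm H z) *\<^sub>C z" s])
  show "hnorm H (of_real (1 / hnorm H z) *\<^sub>C z) = 1" using hz z by (simp add: hnorm_scale norm_divide)
  show "A (of_real (1 / hnorm H z) *\<^sub>C z) = of_real s *\<^sub>C of_real (1 / hnorm H z) *\<^sub>C z"
   using z Az by (simp add: bounded_opsD(3)[OF Ab] cvec.scale_scale mult.commute)
  show "inn H (of_real (1 / hnorm H z) *\<^sub>C z) f = 0" if "f \<in> F" for f
   using zF[OF that] z that F by (simp add: s_scale subset_iff)
 qed (use z s in auto)
qed

end

text \<open>Only eigenvectors with positive eigenvalue are listed. In place of an expansion of
  \<open>A\<close>, the condition \<open>tail\<close> bounds the form on vectors orthogonal to the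
  eigenvectors with eigenvalue above \<open>t\<close>; this also takes care of the kernel.\<close>

locale spectral = pre_hilbert H for H :: "'v::complex_vector hilbert" +
 fixes A :: "'v => 'v" and E :: "'v set"
 assumes pos: "positive_op H A" and ons: "ons H E"
  and eig: "e \<in> E ==> A e = of_real (qform H A e) *\<^sub>C e"
  and eig_pos: "e \<in> E ==> 0 < qform H A e"
  and eig_fin: "0 < t ==> finite {e\<in>E. qform H A e > t}"
  and tail: "0 < t ==> y \<in> carr H ==> (\<And>e. e \<in> E ==> qform H A e > t ==> inn H y e = 0) ==>
   qform H A y <= t * (hnorm H y)\<^sup>2"

text \<open>Zorn's lemma gives a maximal orthonormal set of eigenvectors with positive eigenvalue.
  If \<open>tail\<close> failed for it, \<open>eigenvector_above\<close> would provide a further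
  eigenvector.\<close>

lemma (in pre_hilbert) compact_spectral:
 assumes pos: "positive_op H A" and comp: "compact_op H A"
 obtains E where "spectral H A E"
proof -
 note Ab = positive_opD(1)[OF pos]
 define \<E> where "\<E> = {E. ons H E \<and> (\<forall>e\<in>E. A e = of_real (qform H A e) *\<^sub>C e \<and> 0 < qform H A e)}"
 have "\<exists>E\<in>\<E>. \<forall>X\<in>\<E>. E \<subseteq> X \<longrightarrow> X = E"
 proof (rule subset_Zorn')
  fix \<C> assume ch: "subset.chain \<E> \<C>"
  then have sub: "\<C> \<subseteq> \<E>" and tot: "\<And>X Y. X \<in> \<C> ==> Y \<in> \<C> ==> X \<subseteq> Y \<or> Y \<subseteq> X"
   unfolding subset_chain_def by auto
  have "inn H e e' = (if e = e' then 1 else 0)" if "e \<in> X" "X \<in> \<C>" "e' \<in> Y" "Y \<in> \<C>" for e e' X Y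
  proof -
   have "\<exists>Z\<in>\<C>. e \<in> Z \<and> e' \<in> Z" using tot[OF that(2,4)] that by blast
   then obtain Z where "Z \<in> \<C>" "e \<in> Z" "e' \<in> Z" by blast
   then show ?thesis using sub ons_inn[of H Z e e'] unfolding \<E>_def by blast
  qed
  then have "ons H (\<Union>\<C>)" using sub unfolding ons_def \<E>_def by blast
  then show "\<Union>\<C> \<in> \<E>" using sub unfolding \<E>_def by blast
 qed
 then obtain E where E: "E \<in> \<E>" and max: "\<And>X. X \<in> \<E> ==> E \<subseteq> X ==> X = E" by blast
 have oE: "ons H E" and eig: "\<And>e. e \<in> E ==> A e = of_real (qform H A e) *\<^sub>C e" "\<And>e. e \<in> E ==> 0 < qform H A e"
  using E by (auto simp: \<E>_def)
 have "spectral H A E"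
 proof (unfold_locales)
  fix t :: real assume t: "0 < t"
  show "finite {e\<in>E. qform H A e > t}"
  proof (rule ccontr)
   assume "infinite {e\<in>E. qform H A e > t}"
   then obtain X :: "nat => 'v" where X: "inj X" "range X \<subseteq> {e\<in>E. qform H A e > t}"
    by (meson infinite_countable_subset)
   have XE: "X n \<in> E" "qform H A (X n) > t" for n using X by auto
   have Xc: "X n \<in> carr H" "hnorm H (X n) = 1" for n using XE ons_carr[OF oE] ons_norm[OF oE] by auto
   obtain r y where r: "strict_mono r" and y: "y \<in> carr H" and lim: "hlim H (%n. A (X (r n))) y"
    using comp Xc unfolding compact_op_def by (metis order_refl)
   \<comment> \<open>Images of different members are orthogonal and longer than \<open>t\<close>, so
     no subsequence of the images can converge.\<close>
   have d: "t\<^sup>2 < (hnorm H (A (X n) - A (X m)))\<^sup>2" if "n \<noteq> m" for n m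
   proof -
    have ne: "X n \<noteq> X m" using X that by (auto dest: injD)
    have "(hnorm H (A (X n) - A (X m)))\<^sup>2 =
      Re (inn H (A (X n)) (A (X n))) + Re (inn H (X m) (X m)) * (qform H A (X m))\<^sup>2"
     unfolding eig(1)[OF XE(1)[of m]] using ne s_expand[of "A (X n)" "X m" "of_real (qform H A (X m))"] Xc
      ons_inn[OF oE XE(1)[of n] XE(1)[of m]] 
     by (simp add: hnorm_sq eig(1)[OF XE(1)[of n]] s_scale)
    also have "\<dots> > 0 + t\<^sup>2"
    proof (rule add_le_less_mono)
     show "0 <= Re (inn H (A (X n)) (A (X n)))" using Xc bounded_opsD(1)[OF Ab] by (intro s_pos) auto
     show "t\<^sup>2 < Re (inn H (X m) (X m)) * (qform H A (X m))\<^sup>2"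
      using XE(2)[of m] t ons_inn[OF oE XE(1)[of m] XE(1)[of m]] by (simp add: power_strict_mono)
    qed
    finally show ?thesis by simp
   qed
   have "\<forall>\<^sub>F n in sequentially. hnorm H (A (X (r n)) - y) < t / 2"
    using order_tendstoD(2)[OF lim[unfolded hlim_def], of "t/2"] t by simp
   then obtain N where N: "\<And>n. n \<ge> N ==> hnorm H (A (X (r n)) - y) < t / 2"
    unfolding eventually_sequentially by blast
   have "hnorm H (A (X (r N)) - A (X (r (Suc N)))) <= t"
    using hnorm_triangle_dist[of "A (X (r N))" y "A (X (r (Suc N)))"] N[of N] N[of "Suc N"] Xc y
     hnorm_minus_commute[of y "A (X (r (Suc N)))"] bounded_opsD(1)[OF Ab] by simp
   moreover have "0 <= hnorm H (A (X (r N)) - A (X (r (Suc N))))"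
    using Xc bounded_opsD(1)[OF Ab] by (intro hnorm_nonneg) auto
   ultimately have "(hnorm H (A (X (r N)) - A (X (r (Suc N)))))\<^sup>2 <= t\<^sup>2" by (intro power_mono)
   moreover have "r N \<noteq> r (Suc N)" using r by (metis lessI less_irrefl strict_mono_def)
   ultimately show False using d[of "r N" "r (Suc N)"] by simp
  qed
 next
  fix t :: real and y
  assume t: "0 < t" and y: "y \<in> carr H" and orth: "\<And>e. e \<in> E ==> qform H A e > t ==> inn H y e = 0"
  show "qform H A y <= t * (hnorm H y)\<^sup>2"
  proof (rule ccontr)
   assume *: "\<not> ?thesis"
   obtain z s where z: "z \<in> carr H" "hnorm H z = 1" "\<And>f. f \<in> {e\<in>E. qform H A e > t} ==> inn H z f = 0"
    "s > t" "A z = of_real s *\<^sub>C z"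
    by (rule eigenvector_above[OF pos comp, of "{e\<in>E. qform H A e > t}" y t])
     (use * t y orth ons_carr[OF oE] eig(1) in auto)
   have qz: "qform H A z = s" using z by (simp add: qform_def s_scale inn_self)
   \<comment> \<open>Eigenvectors with eigenvalue above \<open>t\<close> are excluded by
     construction; for the remaining ones the eigenvalue differs from \<open>s > t\<close>, and
     eigenvectors to different eigenvalues are orthogonal.\<close>
   have zE: "inn H z e = 0" if e: "e \<in> E" for e
   proof (cases "qform H A e > t")
    case True then show ?thesis using z e by simp
   next
    case False
    have ec: "e \<in> carr H" using e ons_carr[OF oE] by blast
    have "inn H (A z) e = inn H z (A e)" by (rule pos_selfadjoint[OF pos z(1) ec])
    then have "of_real s * inn H z e = of_real (qform H A e) * inn H z e"
     unfolding z(5) by (subst (asm) eig(1)[OF e]) (use z ec in \<open>simp add: s_scale s_scale_right\<close>)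
    moreover have "complex_of_real s \<noteq> of_real (qform H A e)" using False z(4) by simp
    ultimately show ?thesis by simp
   qed
   have "insert z E \<in> \<E>" using oE z t zE eig qz by (auto simp: \<E>_def intro!: ons_insert)
   then have "z \<in> E" using max[of "insert z E"] by auto
   then have "inn H z z = 0" using zE by blast
   then show False using z by (simp add: inn_self)
  qed
 qed (use pos oE eig in auto)
 then show thesis by (rule that)
qed

section \<open>Ky Fan sums and Dixmier traces\<close>

text \<open>For the form of a compact positive operator this is the sum of the \<open>N\<close>
  largest eigenvalues (\<open>eigval_seq_ky_fan\<close>). An arbitrary function \<open>q\<close> is
  allowed because sums of two forms occur as well. Families with at most \<open>N\<close> members
  include the empty one, so the supremum is over a nonempty set.\<close>

definition ky_fan :: "'v::complex_vector hilbert => ('v => real) => nat => real"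
 where "ky_fan H q N = (SUP F\<in>{F. finite F \<and> ons H F \<and> card F <= N}. \<Sum>e\<in>F. q e)"

lemma ky_fan_least:
 assumes "\<And>F. finite F ==> ons H F ==> card F <= N ==> (\<Sum>e\<in>F. q e) <= b"
 shows "ky_fan H q N <= b"
 unfolding ky_fan_def by (rule cSUP_least) (use assms in \<open>auto intro: exI[of _ "{}"]\<close>)

context pre_hilbert
begin

lemma ky_fan_upper:
 assumes C: "\<And>e. e \<in> carr H ==> hnorm H e = 1 ==> q e <= C"
  and F: "finite F" "ons H F" "card F <= N"
 shows "(\<Sum>e\<in>F. q e) <= ky_fan H q N"
 unfolding ky_fan_def
proof (rule cSUP_upper)
 show "bdd_above ((%F. \<Sum>e\<in>F. q e) ` {F. finite F \<and> ons H F \<and> card F <= N})"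
 proof (rule bdd_aboveI2[of _ _ "real N * \<bar>C\<bar>"])
  fix F assume F: "F \<in> {F. finite F \<and> ons H F \<and> card F <= N}"
  have "(\<Sum>e\<in>F. q e) <= (\<Sum>e\<in>F. \<bar>C\<bar>)"
   using F by (intro sum_mono order_trans[OF C]) (auto simp: ons_norm ons_carr)
  also have "\<dots> <= real N * \<bar>C\<bar>" using F by (simp add: mult_right_mono)
  finally show "(\<Sum>e\<in>F. q e) <= real N * \<bar>C\<bar>" .
 qed
qed (use F in simp)

lemma ky_fan_nonneg:
 assumes "\<And>e. e \<in> carr H ==> hnorm H e = 1 ==> q e <= C"
 shows "0 <= ky_fan H q N"
 using ky_fan_upper[of q C "{}" N] assms by simp

text \<open>Together with monotonicity this shows that consecutive logarithmic means differ by a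
  null sequence.\<close>

lemma ky_fan_Suc_le:
 assumes C: "\<And>e. e \<in> carr H ==> hnorm H e = 1 ==> q e <= C" "0 <= C"
 shows "ky_fan H q (Suc N) <= ky_fan H q N + C"
proof (rule ky_fan_least)
 fix F assume F: "finite F" "ons H F" "card F <= Suc N"
 show "(\<Sum>e\<in>F. q e) <= ky_fan H q N + C"
 proof (cases "F = {}")
  case True then show ?thesis using ky_fan_nonneg[of q C N] C by simp
 next
  case False
  then obtain e where e: "e \<in> F" by blast
  have "(\<Sum>e\<in>F. q e) = q e + (\<Sum>e\<in>F - {e}. q e)" using F e by (simp add: sum.remove)
  moreover have "(\<Sum>e\<in>F - {e}. q e) <= ky_fan H q N"
   using F e by (intro ky_fan_upper[OF C(1)]) (auto intro: ons_subset)
  moreover have "q e <= C" using F e by (intro C) (auto simp: ons_norm ons_carr)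
  ultimately show ?thesis by simp
 qed
qed

lemma ky_fan_mono:
 assumes C: "\<And>e. e \<in> carr H ==> hnorm H e = 1 ==> q e <= C" and "M <= N"
 shows "ky_fan H q M <= ky_fan H q N"
 using assms by (intro ky_fan_least ky_fan_upper[OF C]) auto

lemma ky_fan_add:
 assumes C: "\<And>e. e \<in> carr H ==> hnorm H e = 1 ==> p e <= C"
  "\<And>e. e \<in> carr H ==> hnorm H e = 1 ==> q e <= D"
 shows "ky_fan H (%x. p x + q x) N <= ky_fan H p N + ky_fan H q N"
 using C by (intro ky_fan_least) (auto simp: sum.distrib intro!: add_mono ky_fan_upper)

end

context spectral
begin

abbreviation "ev \<equiv> qform H A"

lemmas Ab = positive_opD(1)[OF pos]

lemma A_mem [simp]: "x \<in> carr H ==> A x \<in> carr H"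
 by (rule bounded_opsD(1)[OF Ab])

lemma ev_nonneg: "x \<in> carr H ==> 0 <= ev x"
 using positive_opD(3)[OF pos] by (simp add: qform_def)

lemma E_carr [simp]: "e \<in> E ==> e \<in> carr H"
 using ons_carr[OF ons] .

lemma A_eig: "e \<in> E ==> A (c *\<^sub>C e) = (c * of_real (ev e)) *\<^sub>C e"
 by (metis E_carr bounded_opsD(3)[OF Ab] cvec.scale_scale eig)

text \<open>The span of eigenvectors and its orthogonal complement are both invariant under
  \<open>A\<close>, so the form has no mixed terms.\<close>

lemma form_split:
 assumes F: "finite F" "F \<subseteq> E" and x: "x \<in> carr H"
 shows "ev x = (\<Sum>e\<in>F. ev e * (cmod (inn H x e))\<^sup>2) + ev (x - hproj H F x)"
proof -
 have oF: "ons H F" using ons_subset[OF ons F(2)] .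
 have FE: "\<And>e. e \<in> F ==> e \<in> E" using F by auto
 define p where "p = hproj H F x"
 define y where "y = x - p"
 have p: "p \<in> carr H" and y: "y \<in> carr H" using oF x by (auto simp: p_def y_def)
 have Ap: "A p = (\<Sum>e\<in>F. (inn H x e * of_real (ev e)) *\<^sub>C e)"
  unfolding p_def hproj_def using FE
  by (subst op_sum[OF Ab]) (auto simp: A_eig intro!: sum.cong)
 have yF: "inn H y e = 0" if "e \<in> F" for e using that oF F x by (simp add: y_def p_def hproj_orth)
 have 1: "inn H y (A p) = 0"
  unfolding Ap using FE y by (subst s_sum_right) (auto simp: s_scale_right yF)
 then have 2: "inn H (A p) y = 0" using s_cnj[of y "A p"] y p by simp
 have 3: "inn H (A y) p = 0" using pos_selfadjoint[OF pos y p] 1 by simp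
 have xe: "x = p + y" by (simp add: y_def)
 have "inn H (A x) x = inn H (A p) p + inn H (A y) y"
  unfolding xe using p y 2 3 by (simp add: bounded_opsD(2)[OF Ab] s_add s_add_right)
 then have "ev x = ev p + ev y" by (simp add: qform_def)
 moreover have "ev p = (\<Sum>e\<in>F. ev e * (cmod (inn H x e))\<^sup>2)"
 proof -
  have "inn H (A p) p = (\<Sum>e\<in>F. cnj (inn H x e) * inn H (A p) e)"
   unfolding p_def using oF F x by (subst inn_hproj) (auto simp: p_def[symmetric] p)
  also have "\<dots> = (\<Sum>e\<in>F. of_real (ev e * (cmod (inn H x e))\<^sup>2))"
  proof (rule sum.cong[OF refl])
   fix e assume e: "e \<in> F"
   have "inn H (A p) e = inn H x e * of_real (ev e)" unfolding Ap by (rule inn_lincomb[OF oF F(1) e])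
   then have "cnj (inn H x e) * inn H (A p) e = of_real (ev e) * (cnj (inn H x e) * inn H x e)" by simp
   also have "\<dots> = of_real (ev e * (cmod (inn H x e))\<^sup>2)" by (simp only: mult_cnj_cmod) simp
   finally show "cnj (inn H x e) * inn H (A p) e = of_real (ev e * (cmod (inn H x e))\<^sup>2)" .
  qed
  finally show ?thesis by (simp add: qform_def flip: of_real_sum)
 qed
 ultimately show ?thesis by (simp add: y_def p_def)
qed

lemma form_lower:
 assumes F: "finite F" "F \<subseteq> E" and x: "x \<in> carr H"
 shows "(\<Sum>e\<in>F. ev e * (cmod (inn H x e))\<^sup>2) <= ev x"
 using form_split[OF assms] ev_nonneg[of "x - hproj H F x"] x ons_subset[OF ons F(2)] by simp

lemma form_upper:
 assumes F: "finite F" "F \<subseteq> E" "{e\<in>E. ev e > t} \<subseteq> F" and x: "x \<in> carr H" and t: "0 < t"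
 shows "ev x <= (\<Sum>e\<in>F. ev e * (cmod (inn H x e))\<^sup>2) + t * (hnorm H x)\<^sup>2"
proof -
 have oF: "ons H F" using ons_subset[OF ons F(2)] .
 have "ev (x - hproj H F x) <= t * (hnorm H (x - hproj H F x))\<^sup>2"
  using F x oF t by (intro tail) (auto intro!: hproj_orth)
 also have "\<dots> <= t * (hnorm H x)\<^sup>2"
  using hproj_pythagoras[OF oF F(1) x] t by (intro mult_left_mono) (auto intro: sum_nonneg)
 finally show ?thesis using form_split[OF F(1,2) x] by simp
qed

text \<open>Enlarging the subspace increases the trace of a positive form. Up to \<epsilon> the form
  is a finite nonnegative combination of the functions \<open>(cmod (inn H x e))^2\<close>; for a
  single \<open>e\<close> the claim is Bessel's inequality for \<open>G\<close>, applied to the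
  projection of \<open>e\<close> onto the span of \<open>B\<close>.\<close>

lemma form_trace_mono:
 assumes B: "finite B" "ons H B" and G: "finite G" "ons H G" and span: "\<And>g. g \<in> G ==> g = hproj H B g"
 shows "(\<Sum>g\<in>G. ev g) <= (\<Sum>b\<in>B. ev b)"
proof (rule field_le_epsilon)
 fix \<epsilon> :: real assume \<epsilon>: "0 < \<epsilon>"
 define t where "t = \<epsilon> / (1 + card G)"
 have t: "0 < t" using \<epsilon> by (simp add: t_def)
 define F where "F = {e\<in>E. ev e > t}"
 have F: "finite F" "F \<subseteq> E" "{e\<in>E. ev e > t} \<subseteq> F" using eig_fin[OF t] by (auto simp: F_def)
 have le: "(\<Sum>g\<in>G. (cmod (inn H g x))\<^sup>2) <= (\<Sum>b\<in>B. (cmod (inn H b x))\<^sup>2)" if x: "x \<in> carr H" for x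
 proof -
  have p: "hproj H B x \<in> carr H" using B by simp
  have "inn H g x = inn H g (hproj H B x)" if g: "g \<in> G" for g
  proof -
   have "inn H g x = inn H (hproj H B g) x" using span[OF g] by simp
   also have "\<dots> = (\<Sum>b\<in>B. inn H g b * inn H b x)"
    unfolding hproj_def using B x by (subst s_sum) (auto simp: s_scale ons_carr)
   also have "\<dots> = inn H g (hproj H B x)"
    using B x g G by (subst inn_hproj) (auto simp: ons_carr s_cnj[of _ x] mult.commute)
   finally show ?thesis .
  qed
  then have "(\<Sum>g\<in>G. (cmod (inn H g x))\<^sup>2) = (\<Sum>g\<in>G. (cmod (inn H g (hproj H B x)))\<^sup>2)" by simp
  also have "\<dots> <= (hnorm H (hproj H B x))\<^sup>2" by (rule bessel'[OF G(2,1) p])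
  also have "\<dots> = (\<Sum>b\<in>B. (cmod (inn H b x))\<^sup>2)"
   using B x by (simp add: hproj_norm) (intro sum.cong refl, simp add: ons_carr cmod_inn_commute)
  finally show ?thesis .
 qed
 have "(\<Sum>g\<in>G. ev g) <= (\<Sum>g\<in>G. (\<Sum>e\<in>F. ev e * (cmod (inn H g e))\<^sup>2) + t)"
 proof (rule sum_mono)
  fix g assume g: "g \<in> G"
  show "ev g <= (\<Sum>e\<in>F. ev e * (cmod (inn H g e))\<^sup>2) + t"
   using form_upper[OF F ons_carr[OF G(2) g] t] ons_norm[OF G(2) g] by simp
 qed
 also have "\<dots> = (\<Sum>e\<in>F. ev e * (\<Sum>g\<in>G. (cmod (inn H g e))\<^sup>2)) + t * card G"
  by (simp add: sum.distrib sum.swap[of _ F] sum_distrib_left mult.commute)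
 also have "\<dots> <= (\<Sum>e\<in>F. ev e * (\<Sum>b\<in>B. (cmod (inn H b e))\<^sup>2)) + \<epsilon>"
 proof (intro add_mono sum_mono mult_left_mono le)
  show "t * real (card G) <= \<epsilon>" using \<epsilon> by (simp add: t_def field_simps)
 qed (use F in \<open>auto intro!: ev_nonneg\<close>)
 also have "(\<Sum>e\<in>F. ev e * (\<Sum>b\<in>B. (cmod (inn H b e))\<^sup>2)) = (\<Sum>b\<in>B. \<Sum>e\<in>F. ev e * (cmod (inn H b e))\<^sup>2)"
  by (simp add: sum.swap[of _ F] sum_distrib_left)
 also have "\<dots> <= (\<Sum>b\<in>B. ev b)"
  using B F by (intro sum_mono form_lower) (auto simp: ons_carr)
 finally show "(\<Sum>g\<in>G. ev g) <= (\<Sum>b\<in>B. ev b) + \<epsilon>" by simp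
qed

text \<open>Uniqueness of the positive square root. \<open>P\<close> and \<open>A\<close> agree on
  the eigenvectors in \<open>E\<close>; on the complement of those with eigenvalue above \<epsilon>
  they have equal norms and both are small.\<close>

lemma abs_op_eq: "abs_op H A = A"
 unfolding abs_op_def hadjoint_pos[OF pos]
proof (rule the_equality)
 show "positive_op H A \<and> A \<circ> A = A \<circ> A" using pos by simp
 fix P assume "positive_op H P \<and> P \<circ> P = A \<circ> A"
 then have P: "positive_op H P" and PP: "\<And>x. P (P x) = A (A x)" by (auto simp: fun_eq_iff)
 note Pb = positive_opD(1)[OF P]
 have Pm [simp]: "P x \<in> carr H" if "x \<in> carr H" for x using bounded_opsD(1)[OF Pb that] .
 obtain C where C: "C > 0" "\<And>x. x \<in> carr H ==> \<bar>ev x\<bar> <= C * (hnorm H x)\<^sup>2" using qform_bound[OF Ab] by blast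
 interpret sa: semi_inner "carr H" "%x y. inn H (A x) y" by (rule pos_semi[OF pos])
 have PE: "P e = A e" if e: "e \<in> E" for e
 proof -
  define t where "t = ev e"
  have t: "0 < t" "A e = of_real t *\<^sub>C e" using e eig_pos eig[OF e] by (auto simp: t_def)
  \<comment> \<open>Since \<open>P (P e) = t^2 e\<close>, this vector satisfies
    \<open>P z = - t z\<close>, and positivity of \<open>P\<close> leaves only
    \<open>z = 0\<close>.\<close>
  define z where "z = P e - of_real t *\<^sub>C e"
  have z: "z \<in> carr H" using e by (simp add: z_def)
  have "P z = - of_real t *\<^sub>C z" using e t
   by (simp add: z_def op_diff[OF Pb] PP bounded_opsD(3)[OF Pb] bounded_opsD(3)[OF Ab] cvec.scale_right_diff_distrib)
  then have "Re (inn H (P z) z) = - t * (hnorm H z)\<^sup>2"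
   using s_scale[OF z z, of "- of_real t"] z by (simp add: inn_self)
  moreover have "0 <= Re (inn H (P z) z)" using positive_opD(3)[OF P z] .
  moreover have "0 <= t * (hnorm H z)\<^sup>2" using t by simp
  ultimately have "hnorm H z = 0" using t by simp
  then show ?thesis using z hnorm_eq_0 t by (simp add: z_def)
 qed
 have sq: "(hnorm H (A y))\<^sup>2 <= C * ev y" if y: "y \<in> carr H" for y
 proof (cases "A y = 0")
  case True then show ?thesis using C ev_nonneg[OF y] by simp
 next
  case False
  have pos': "(hnorm H (A y))\<^sup>2 > 0" using False hnorm_eq_0[of "A y"] y by simp
  have "((hnorm H (A y))\<^sup>2)\<^sup>2 = (cmod (inn H (A y) (A y)))\<^sup>2" using y by (simp add: inn_self norm_power)
  also have "\<dots> <= ev y * ev (A y)" unfolding qform_def using y by (intro sa.s_CS) auto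
  also have "\<dots> <= ev y * (C * (hnorm H (A y))\<^sup>2)"
   using C(2)[of "A y"] y ev_nonneg by (intro mult_left_mono) auto
  finally have "(hnorm H (A y))\<^sup>2 * (hnorm H (A y))\<^sup>2 <= (C * ev y) * (hnorm H (A y))\<^sup>2"
   by (simp add: power2_eq_square mult_ac)
  then show ?thesis using pos' by (simp only: mult_le_cancel_right_pos)
 qed
 show "P = A"
 proof (rule op_ext[OF Pb Ab])
  fix x assume x: "x \<in> carr H"
  have le: "(hnorm H (P x - A x))\<^sup>2 <= \<epsilon> * (4 * C * (hnorm H x)\<^sup>2)" if \<epsilon>: "0 < \<epsilon>" for \<epsilon>
  proof -
   define F where "F = {e\<in>E. ev e > \<epsilon>}"
   have F: "finite F" "F \<subseteq> E" using eig_fin[OF \<epsilon>] by (auto simp: F_def)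
   have oF: "ons H F" using ons_subset[OF ons F(2)] .
   define y where "y = x - hproj H F x"
   have y: "y \<in> carr H" using x oF by (simp add: y_def)
   have "P (hproj H F x) = A (hproj H F x)"
    unfolding hproj_def using F oF
    by (subst op_sum[OF Pb], simp add: ons_carr, subst op_sum[OF Ab], simp add: ons_carr)
     (intro sum.cong refl, simp add: bounded_opsD(3)[OF Pb] bounded_opsD(3)[OF Ab] ons_carr PE subset_iff)
   then have d: "P x - A x = P y - A y" using x oF by (simp add: y_def op_diff[OF Pb] op_diff[OF Ab])
   \<comment> \<open>Both squared norms are the value at \<open>y\<close> of the form of the common
     square.\<close>
   have eq: "(hnorm H (P y))\<^sup>2 = (hnorm H (A y))\<^sup>2"
    using y pos_selfadjoint[OF P, of y "P y"] pos_selfadjoint[OF pos, of y "A y"] PP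
    by (simp add: hnorm_sq)
   then have "hnorm H (P y) = hnorm H (A y)"
    using y hnorm_nonneg[of "P y"] hnorm_nonneg[of "A y"] by simp
   then have "hnorm H (P x - A x) <= 2 * hnorm H (A y)"
    unfolding d using hnorm_triangle_diff[of "P y" "A y"] y by simp
   then have "(hnorm H (P x - A x))\<^sup>2 <= (2 * hnorm H (A y))\<^sup>2"
    using x by (intro power_mono hnorm_nonneg) auto
   also have "\<dots> = 4 * (hnorm H (A y))\<^sup>2" by (simp add: power_mult_distrib)
   also have "\<dots> <= 4 * (C * ev y)" using sq[OF y] by simp
   also have "ev y <= \<epsilon> * (hnorm H y)\<^sup>2"
    by (rule tail[OF \<epsilon> y]) (use F oF x in \<open>auto simp: y_def F_def intro!: hproj_orth\<close>)
   also have "(hnorm H y)\<^sup>2 <= (hnorm H x)\<^sup>2"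
    unfolding y_def hproj_pythagoras[OF oF F(1) x] by (simp add: sum_nonneg)
   finally show ?thesis using C \<epsilon> by (simp add: mult_ac)
  qed
  have "(hnorm H (P x - A x))\<^sup>2 <= 0 + e" if e: "0 < e" for e
  proof -
   define K where "K = 4 * C * (hnorm H x)\<^sup>2"
   have K: "0 <= K" using C by (simp add: K_def)
   have "(hnorm H (P x - A x))\<^sup>2 <= e / (K + 1) * K" unfolding K_def
    by (rule le) (use e K in \<open>simp add: K_def[symmetric] divide_pos_pos add_nonneg_pos\<close>)
   also have "\<dots> <= e" using e K by (simp add: field_simps)
   finally show ?thesis by simp
  qed
  then have "(hnorm H (P x - A x))\<^sup>2 <= 0" by (rule field_le_epsilon)
  then have "hnorm H (P x - A x) = 0" by simp
  then show "P x = A x" using x hnorm_eq_0[of "P x - A x"] by simp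
 qed
qed

text \<open>Connects the dimension in \<open>eigval_seq\<close> with the listed eigenvectors. The
  part of an eigenvector orthogonal to those with eigenvalue \<open>t\<close> is orthogonal to all
  of \<open>E\<close>, and \<open>tail\<close> with the bound \<open>t / 2\<close> forces it to be
  0.\<close>

lemma eigenspace_dim:
 assumes t: "0 < t"
 shows "cvec.dim {x \<in> carr H. A x = of_real t *\<^sub>C x} = card {e\<in>E. ev e = t}"
proof -
 define F where "F = {e\<in>E. ev e = t}"
 have F: "finite F" "F \<subseteq> E"
  using finite_subset[OF _ eig_fin[of "t/2"], of F] t by (auto simp: F_def subset_iff)
 have oF: "ons H F" using ons_subset[OF ons F(2)] .
 have ind: "cvec.independent F"
 proof (rule cvec.independent_if_scalars_zero[OF F(1)])
  fix f x assume "(\<Sum>x\<in>F. f x *\<^sub>C x) = 0" "x \<in> F"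
  then show "f x = 0" using inn_lincomb[OF oF F(1), of x f] ons_carr[OF oF, of x] by simp
 qed
 have "{x \<in> carr H. A x = of_real t *\<^sub>C x} = cvec.span F"
 proof (intro subset_antisym subsetI)
  fix x assume "x \<in> {x \<in> carr H. A x = of_real t *\<^sub>C x}"
  then have x: "x \<in> carr H" "A x = of_real t *\<^sub>C x" by auto
  define y where "y = x - hproj H F x"
  have y: "y \<in> carr H" using x oF by (simp add: y_def)
  have Ap: "A (hproj H F x) = of_real t *\<^sub>C hproj H F x"
  proof -
   have "A e = of_real t *\<^sub>C e" if "e \<in> F" for e using that eig[of e] by (simp add: F_def)
   then show ?thesis unfolding hproj_def using oF
    by (subst op_sum[OF Ab]) (auto simp: ons_carr bounded_opsD(3)[OF Ab] cvec.scale_sum_right cvec.scale_scale mult.commute intro!: sum.cong)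
  qed
  have Ay: "A y = of_real t *\<^sub>C y"
   using x oF Ap by (simp add: y_def op_diff[OF Ab] cvec.scale_right_diff_distrib)
  have "inn H y e = 0" if e: "e \<in> E" for e
  proof (cases "e \<in> F")
   case True then show ?thesis using oF F x by (simp add: y_def hproj_orth)
  next
   case False
   have "inn H (A y) e = inn H y (A e)" using e y by (intro pos_selfadjoint[OF pos]) auto
   then have "of_real t * inn H y e = of_real (ev e) * inn H y e"
    unfolding Ay by (subst (asm) eig[OF e]) (use e y in \<open>simp add: s_scale s_scale_right\<close>)
   moreover have "complex_of_real t \<noteq> of_real (ev e)" using False e by (simp add: F_def)
   ultimately show ?thesis by simp
  qed
  then have "ev y <= t / 2 * (hnorm H y)\<^sup>2" using t y by (intro tail) auto
  moreover have "ev y = t * (hnorm H y)\<^sup>2" using y by (simp add: qform_def Ay s_scale inn_self)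
  moreover have "0 <= t * (hnorm H y)\<^sup>2" using t by simp
  ultimately have "t * (hnorm H y)\<^sup>2 = 0" by simp
  then have "y = 0" using t y hnorm_eq_0 by simp
  then have "x = hproj H F x" by (simp add: y_def)
  then show "x \<in> cvec.span F" unfolding hproj_def
   by (metis (no_types, lifting) cvec.span_base cvec.span_scale cvec.span_sum)
 next
  fix x assume "x \<in> cvec.span F"
  then obtain c where x: "x = (\<Sum>e\<in>F. c e *\<^sub>C e)" using cvec.span_finite[OF F(1)] by auto
  have "A e = of_real t *\<^sub>C e" if "e \<in> F" for e using that eig[of e] by (simp add: F_def)
  then have "A x = of_real t *\<^sub>C x" unfolding x using oF
   by (subst op_sum[OF Ab]) (auto simp: ons_carr bounded_opsD(3)[OF Ab] cvec.scale_sum_right cvec.scale_scale mult.commute intro!: sum.cong)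
  then show "x \<in> {x \<in> carr H. A x = of_real t *\<^sub>C x}" using oF by (auto simp: x ons_carr)
 qed
 then show ?thesis using cvec.dim_span_eq_card_independent[OF ind] by (simp add: F_def)
qed

text \<open>Ky Fan's maximum principle. The eigenvectors of rank below \<open>N\<close> give the
  lower bound; for the upper bound the eigenvalues are compared with the threshold
  \<open>\<mu> N\<close>.\<close>

lemma eigval_seq_ky_fan:
 shows "(\<Sum>j<N. eigval_seq H A j) = ky_fan H ev N"
  and "0 <= eigval_seq H A j"
proof -
 obtain \<rho> \<mu> where \<rho>: "inj_on \<rho> E" and \<mu>: "decseq \<mu>" "\<And>n. 0 <= \<mu> n" "\<mu> \<longlonglongrightarrow> 0"
  and \<mu>\<rho>: "\<And>e. e \<in> E ==> \<mu> (\<rho> e) = ev e" and \<mu>0: "\<And>n. n \<notin> \<rho> ` E ==> \<mu> n = 0"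
  using decreasing_enum[of E ev, OF eig_pos eig_fin] by blast
 have cd: "card {n. \<mu> n = t} = cvec.dim {x \<in> carr H. A x = of_real t *\<^sub>C x}" if t: "0 < t" for t
 proof -
  have "{n. \<mu> n = t} = \<rho> ` {e\<in>E. ev e = t}"
  proof (intro subset_antisym subsetI)
   fix n assume n: "n \<in> {n. \<mu> n = t}"
   then have "n \<in> \<rho> ` E" using \<mu>0[of n] t by auto
   then show "n \<in> \<rho> ` {e\<in>E. ev e = t}" using \<mu>\<rho> n by auto
  qed (use \<mu>\<rho> in auto)
  moreover have "inj_on \<rho> {e\<in>E. ev e = t}" by (rule inj_on_subset[OF \<rho>]) auto
  ultimately show ?thesis using eigenspace_dim[OF t] by (simp add: card_image)
 qed
 have eq: "eigval_seq H A = \<mu>"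
  unfolding eigval_seq_def abs_op_eq
 proof (rule the_equality)
  show "decseq \<mu> \<and> (\<forall>n. 0 <= \<mu> n) \<and> \<mu> \<longlonglongrightarrow> 0 \<and>
   (\<forall>t>0. card {n. \<mu> n = t} = cvec.dim {x \<in> carr H. A x = of_real t *\<^sub>C x})" using \<mu> cd by blast
  fix \<nu> :: "nat => real"
  assume "decseq \<nu> \<and> (\<forall>n. 0 <= \<nu> n) \<and> \<nu> \<longlonglongrightarrow> 0 \<and>
   (\<forall>t>0. card {n. \<nu> n = t} = cvec.dim {x \<in> carr H. A x = of_real t *\<^sub>C x})"
  then show "\<nu> = \<mu>" using \<mu> cd by (intro decreasing_multiplicity_unique) auto
 qed
 show "0 <= eigval_seq H A j" by (simp add: eq \<mu>)
 obtain C where C: "C > 0" "\<And>x. x \<in> carr H ==> \<bar>ev x\<bar> <= C * (hnorm H x)\<^sup>2" using qform_bound[OF Ab] by blast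
 have C1: "ev e <= C" if "e \<in> carr H" "hnorm H e = 1" for e using C(2)[OF that(1)] that(2) by simp
 define G where "G = {e\<in>E. \<rho> e < N}"
 have \<rho>G: "inj_on \<rho> G" by (rule inj_on_subset[OF \<rho>]) (auto simp: G_def)
 have G: "finite G" by (rule finite_imageD[OF finite_subset[OF _ finite_lessThan[of N]] \<rho>G]) (auto simp: G_def)
 have Gc: "card G <= N" using card_inj_on_le[OF \<rho>G, of "{..<N}"] by (auto simp: G_def)
 have "(\<Sum>j<N. \<mu> j) = (\<Sum>j\<in>\<rho> ` G. \<mu> j)"
  by (rule sum.mono_neutral_right) (auto simp: G_def intro: \<mu>0)
 also have "\<dots> = (\<Sum>e\<in>G. ev e)"
  using \<mu>\<rho> by (subst sum.reindex[OF \<rho>G]) (auto simp: G_def)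
 finally have sumG: "(\<Sum>j<N. \<mu> j) = (\<Sum>e\<in>G. ev e)" .
 show "(\<Sum>j<N. eigval_seq H A j) = ky_fan H ev N"
  unfolding eq
 proof (rule antisym)
  show "(\<Sum>j<N. \<mu> j) <= ky_fan H ev N"
   unfolding sumG using G Gc ons_subset[OF ons, of G] by (intro ky_fan_upper[OF C1]) (auto simp: G_def)
  show "ky_fan H ev N <= (\<Sum>j<N. \<mu> j)"
  proof (rule ky_fan_least)
   fix X assume X: "finite X" "ons H X" "card X <= N"
   \<comment> \<open>The first eigenvalue left out of \<open>G\<close>. It is 0 when there are fewer
     than \<open>N\<close> eigenvectors, which is why \<open>tG\<close> holds in either
     case.\<close>
   define t where "t = \<mu> N"
   have tG: "t * N <= t * card G"
   proof (cases "t = 0")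
    case False
    have "{..<N} \<subseteq> \<rho> ` G"
    proof
     fix n assume n: "n \<in> {..<N}"
     then have "\<mu> N <= \<mu> n" using \<mu>(1) by (auto simp: decseq_def)
     then have "\<mu> n \<noteq> 0" using False \<mu>(2)[of N] by (auto simp: t_def)
     then show "n \<in> \<rho> ` G" using \<mu>0[of n] n by (auto simp: G_def)
    qed
    then have "N <= card (\<rho> ` G)" using card_mono[of "\<rho> ` G" "{..<N}"] G by simp
    then show ?thesis using \<mu>(2)[of N] by (simp add: card_image[OF \<rho>G] t_def mult_left_mono)
   qed simp
   have "(\<Sum>x\<in>X. ev x) <= (\<Sum>e\<in>G. ev e) + \<epsilon>" if \<epsilon>: "0 < \<epsilon>" for \<epsilon>
   proof -
    define \<delta> where "\<delta> = \<epsilon> / (1 + card X)"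
    have \<delta>: "0 < \<delta>" using \<epsilon> by (simp add: \<delta>_def)
    define F where "F = {e\<in>E. ev e > \<delta>} \<union> G"
    have F: "finite F" "F \<subseteq> E" "{e\<in>E. ev e > \<delta>} \<subseteq> F" "G \<subseteq> F"
     using eig_fin[OF \<delta>] G by (auto simp: F_def G_def)
    \<comment> \<open>The weight that the family \<open>X\<close> puts on \<open>e\<close>. Bessel's
      inequality for \<open>X\<close> bounds each weight by 1, and for \<open>F\<close> it bounds
      their sum by \<open>N\<close>; splitting \<open>ev e\<close> as \<open>(ev e - t) + t\<close>
      uses the first bound for one part and the second for the other.\<close>
    define \<tau> where "\<tau> e = (\<Sum>x\<in>X. (cmod (inn H x e))\<^sup>2)" for e
    have \<tau>: "0 <= \<tau> e" "\<tau> e <= 1" if "e \<in> E" for e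
     using bessel'[OF X(2,1), of e] ons_norm[OF ons that] that by (auto simp: \<tau>_def sum_nonneg)
    have "(\<Sum>e\<in>F. \<tau> e) = (\<Sum>x\<in>X. \<Sum>e\<in>F. (cmod (inn H x e))\<^sup>2)" unfolding \<tau>_def by (rule sum.swap)
    also have "\<dots> <= (\<Sum>x\<in>X. 1)"
    proof (rule sum_mono)
     fix x assume x: "x \<in> X"
     show "(\<Sum>e\<in>F. (cmod (inn H x e))\<^sup>2) <= 1"
      using bessel[OF ons_subset[OF ons F(2)] F(1), of x] ons_carr[OF X(2) x] ons_norm[OF X(2) x] by simp
    qed
    finally have \<tau>N: "(\<Sum>e\<in>F. \<tau> e) <= N" using X by simp
    have "(\<Sum>x\<in>X. ev x) <= (\<Sum>x\<in>X. (\<Sum>e\<in>F. ev e * (cmod (inn H x e))\<^sup>2) + \<delta>)"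
    proof (rule sum_mono)
     fix g assume g: "g \<in> X"
     show "ev g <= (\<Sum>e\<in>F. ev e * (cmod (inn H g e))\<^sup>2) + \<delta>"
      using form_upper[OF F(1-3) ons_carr[OF X(2) g] \<delta>] ons_norm[OF X(2) g] by simp
    qed
    also have "\<dots> = (\<Sum>e\<in>F. ev e * \<tau> e) + \<delta> * card X"
     by (simp add: \<tau>_def sum.distrib sum.swap[of _ F] sum_distrib_left mult.commute)
    also have "\<delta> * card X <= \<epsilon>" using \<epsilon> by (simp add: \<delta>_def field_simps)
    also have "(\<Sum>e\<in>F. ev e * \<tau> e) = (\<Sum>e\<in>F. (ev e - t) * \<tau> e) + t * (\<Sum>e\<in>F. \<tau> e)"
     by (simp add: left_diff_distrib sum_subtractf sum_distrib_left)
    also have "(\<Sum>e\<in>F. (ev e - t) * \<tau> e) <= (\<Sum>e\<in>F. if e \<in> G then ev e - t else 0)"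
    proof (rule sum_mono)
     fix e assume e: "e \<in> F"
     then have eE: "e \<in> E" using F by auto
     show "(ev e - t) * \<tau> e <= (if e \<in> G then ev e - t else 0)"
     proof (cases "e \<in> G")
      case True
      then have "\<mu> N <= \<mu> (\<rho> e)" using True by (intro decseqD[OF \<mu>(1)]) (simp add: G_def)
      then have "t <= ev e" using \<mu>\<rho>[OF eE] by (simp add: t_def)
      then show ?thesis using True \<tau>[OF eE] mult_left_mono[of "\<tau> e" 1 "ev e - t"] by simp
     next
      case False
      then have "\<mu> (\<rho> e) <= \<mu> N" using eE by (intro decseqD[OF \<mu>(1)]) (simp add: G_def)
      then have "ev e <= t" using \<mu>\<rho>[OF eE] by (simp add: t_def)
      then show ?thesis using False \<tau>[OF eE] by (simp add: mult_nonpos_nonneg)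
     qed
    qed
    also have "\<dots> = (\<Sum>e\<in>G. ev e - t)"
     using F G by (simp add: sum.If_cases Int_absorb1 Int_def[symmetric] inf.absorb2)
    also have "\<dots> = (\<Sum>e\<in>G. ev e) - t * card G" by (simp add: sum_subtractf)
    also have "t * (\<Sum>e\<in>F. \<tau> e) <= t * N" using \<tau>N \<mu>(2)[of N] by (simp add: t_def mult_left_mono)
    finally show ?thesis using tG by simp
   qed
   then show "(\<Sum>e\<in>X. ev e) <= (\<Sum>j<N. \<mu> j)" unfolding sumG by (rule field_le_epsilon)
  qed
 qed
qed

end

section \<open>Extended limits and additivity of the Dixmier trace\<close>

definition kf_means :: "'v::complex_vector hilbert => ('v => real) => nat => real"
 where "kf_means H q n = ky_fan H q (Suc n) / ln (1 + real (Suc n))"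

context pre_hilbert
begin

lemma log_means_eq:
 assumes "positive_op H A" "compact_op H A"
 shows "log_means H A = kf_means H (qform H A)"
proof -
 obtain E where "spectral H A E" using compact_spectral[OF assms] by blast
 then interpret spectral H A E .
 show ?thesis
  by (rule ext) (simp only: log_means_def kf_means_def lessThan_Suc_atMost[symmetric] eigval_seq_ky_fan)
qed

text \<open>Two families of at most \<open>N\<close> vectors lie in the span of at most
  \<open>2 * N\<close> orthonormal vectors, and neither trace decreases when passing to
  them.\<close>

lemma ky_fan_superadd:
 assumes A: "positive_op H A" "compact_op H A" and B: "positive_op H B" "compact_op H B"
 shows "ky_fan H (qform H A) N + ky_fan H (qform H B) N <= ky_fan H (%x. qform H A x + qform H B x) (2 * N)"
  (is "_ <= ?R")
proof -
 obtain C where C: "C > 0" "\<And>x. x \<in> carr H ==> \<bar>qform H A x\<bar> <= C * (hnorm H x)\<^sup>2"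
  using qform_bound[OF positive_opD(1)[OF A(1)]] by blast
 obtain D where D: "D > 0" "\<And>x. x \<in> carr H ==> \<bar>qform H B x\<bar> <= D * (hnorm H x)\<^sup>2"
  using qform_bound[OF positive_opD(1)[OF B(1)]] by blast
 obtain E where "spectral H A E" using compact_spectral[OF A] by blast
 then interpret sA: spectral H A E .
 obtain E' where "spectral H B E'" using compact_spectral[OF B] by blast
 then interpret sB: spectral H B E' .
 have *: "(\<Sum>f\<in>F. qform H A f) + (\<Sum>g\<in>G. qform H B g) <= ?R"
  if F: "finite F" "ons H F" "card F <= N" and G: "finite G" "ons H G" "card G <= N" for F G
 proof -
  have "\<exists>X. ons H X \<and> finite X \<and> card X <= card (F \<union> G) \<and> (\<forall>x\<in>F \<union> G. x = hproj H X x)"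
   using F G ons_carr by (intro gram_schmidt) auto
  then obtain X where X: "ons H X" "finite X" "card X <= card (F \<union> G)" "\<forall>x\<in>F \<union> G. x = hproj H X x" by blast
  have "(\<Sum>f\<in>F. qform H A f) <= (\<Sum>x\<in>X. qform H A x)" using X F by (intro sA.form_trace_mono) auto
  moreover have "(\<Sum>f\<in>G. qform H B f) <= (\<Sum>x\<in>X. qform H B x)" using X G by (intro sB.form_trace_mono) auto
  moreover have "(\<Sum>x\<in>X. qform H A x + qform H B x) <= ?R"
  proof (rule ky_fan_upper)
   show "qform H A e + qform H B e <= C + D" if "e \<in> carr H" "hnorm H e = 1" for e
    using C(2)[OF that(1)] D(2)[OF that(1)] that(2) by simp
   show "card X <= 2 * N" using X(3) F(3) G(3) card_Un_le[of F G] by simp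
  qed (use X in auto)
  ultimately show ?thesis by (simp add: sum.distrib)
 qed
 have "ky_fan H (qform H A) N <= ?R - (\<Sum>g\<in>G. qform H B g)" if G: "finite G" "ons H G" "card G <= N" for G
  using * G by (intro ky_fan_least) (simp add: algebra_simps)
 then have "ky_fan H (qform H B) N <= ?R - ky_fan H (qform H A) N"
  by (intro ky_fan_least) (simp add: algebra_simps)
 then show ?thesis by simp
qed

end

lemma extended_limitD:
 assumes "extended_limit w"
 shows "Bseq x ==> Bseq y ==> w (%n. x n + y n) = w x + w y"
  and "Bseq x ==> w (%n. a * x n) = a * w x"
  and "Bseq x ==> (\<And>n. Im (x n) = 0 \<and> 0 <= Re (x n)) ==> Im (w x) = 0 \<and> 0 <= Re (w x)"
  and "w (%_. 1) = 1"
  and "x \<longlonglongrightarrow> 0 ==> w x = 0"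
  and "Bseq x ==> w (%n. x (n div 2)) = w x"
 using assms unfolding extended_limit_def by blast+

lemma Bseq_plus:
 fixes x y :: "nat => 'a::real_normed_vector"
 assumes "Bseq x" "Bseq y"
 shows "Bseq (%n. x n + y n)"
proof -
 obtain K L where "\<And>n. norm (x n) <= K" "\<And>n. norm (y n) <= L" using assms by (auto elim!: BseqE)
 then show ?thesis by (intro BseqI'[of _ "K + L"] norm_triangle_mono) auto
qed

lemma Bseq_diff:
 fixes x y :: "nat => 'a::real_normed_vector"
 shows "Bseq x ==> Bseq y ==> Bseq (%n. x n - y n)"
 using Bseq_plus[of x "%n. - y n"] by (simp add: Bseq_minus_iff)

lemma extended_limit_diff:
 assumes w: "extended_limit w" and "Bseq x" "Bseq y"
 shows "w (%n. x n - y n) = w x - w y"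
proof -
 have "Bseq (%n. -1 * y n)" using assms(3) by (simp add: Bseq_minus_iff)
 then have "w (%n. x n + -1 * y n) = w x + -1 * w y"
  using extended_limitD(1,2)[OF w] assms by metis
 then show ?thesis by simp
qed

lemma extended_limit_cong:
 assumes w: "extended_limit w" and "Bseq x" "Bseq y" "(%n. x n - y n) \<longlonglongrightarrow> 0"
 shows "w x = w y"
 using extended_limit_diff[OF assms(1-3)] extended_limitD(5)[OF w assms(4)] by simp

lemma extended_limit_lim:
 assumes w: "extended_limit w" and x: "x \<longlonglongrightarrow> L"
 shows "w x = L"
proof -
 have "w x = w (%_. L)"
  using x by (intro extended_limit_cong[OF w]) (auto intro: convergent_imp_Bseq convergentI LIM_zero)
 also have "\<dots> = L * 1" using extended_limitD(2)[OF w, of "%_. 1" L] extended_limitD(4)[OF w] by simp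
 finally show ?thesis by simp
qed

lemma extended_limit_mono:
 fixes a b :: "nat => real"
 assumes w: "extended_limit w" and "Bseq a" "Bseq b" "\<And>n. a n <= b n"
 shows "Re (w (%n. of_real (a n))) <= Re (w (%n. of_real (b n)))"
proof -
 have B: "Bseq (%n. complex_of_real (a n))" "Bseq (%n. complex_of_real (b n))"
  using assms by (auto simp: Bseq_def)
 have "0 <= Re (w (%n. of_real (b n) - of_real (a n)))"
  using assms(4) by (intro conjunct2[OF extended_limitD(3)[OF w Bseq_diff[OF B(2,1)]]]) auto
 then show ?thesis by (simp add: extended_limit_diff[OF w B(2,1)])
qed

lemma extended_limit_real:
 fixes a :: "nat => real"
 assumes w: "extended_limit w" and "Bseq a" "\<And>n. 0 <= a n"
 shows "Im (w (%n. of_real (a n))) = 0"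
 using extended_limitD(3)[OF w, of "%n. of_real (a n)"] assms by (auto simp: Bseq_def)

lemma ln_at_top_shift: "filterlim (%n. ln (real n + 2)) at_top sequentially"
 by (intro filterlim_compose[OF ln_at_top] filterlim_at_top_mono[OF filterlim_real_sequentially]) auto

text \<open>The quotient of the normalizations of the logarithmic means at the positions
  \<open>2 * n + 1\<close> and \<open>n\<close>.\<close>

lemma ln_ratio_tendsto: "(%n. ln (2 * real n + 3) / ln (real n + 2)) \<longlonglongrightarrow> 1"
proof (rule tendsto_sandwich)
 show "\<forall>\<^sub>F n in sequentially. 1 <= ln (2 * real n + 3) / ln (real n + 2)"
  by (intro always_eventually allI) (simp add: le_divide_eq)
 show "\<forall>\<^sub>F n in sequentially. ln (2 * real n + 3) / ln (real n + 2) <= ln 2 / ln (real n + 2) + 1"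
 proof (intro always_eventually allI)
  fix n :: nat
  have "ln (2 * real n + 3) <= ln (2 * (real n + 2))" by simp
  also have "\<dots> = ln 2 + ln (real n + 2)" by (subst ln_mult) auto
  finally show "ln (2 * real n + 3) / ln (real n + 2) <= ln 2 / ln (real n + 2) + 1"
   by (simp add: field_simps)
 qed
 have "(%n. ln 2 / ln (real n + 2)) \<longlonglongrightarrow> 0"
  by (rule tendsto_divide_0[OF tendsto_const filterlim_at_top_imp_at_infinity[OF ln_at_top_shift]])
 then show "(%n. ln 2 / ln (real n + 2) + 1) \<longlonglongrightarrow> 1" by (auto intro: tendsto_eq_intros)
qed auto

text \<open>\<open>KF\<^sub>N(p) + KF\<^sub>N(q) <= KF\<^bsub>2N\<^esub>(p + q)\<close> and the dilation invariance of \<open>w\<close> give the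
 inequality that does not follow from subadditivity.\<close>

lemma (in pre_hilbert) extended_limit_kf_add:
 assumes w: "extended_limit w"
  and C: "\<And>e. e \<in> carr H ==> hnorm H e = 1 ==> p e <= C" "\<And>e. e \<in> carr H ==> hnorm H e = 1 ==> q e <= C"
  and super: "\<And>N. ky_fan H p N + ky_fan H q N <= ky_fan H (%x. p x + q x) (2 * N)"
  and bdd: "bdd_above (range (kf_means H p))" "bdd_above (range (kf_means H q))"
 shows "w (%n. of_real (kf_means H p n)) + w (%n. of_real (kf_means H q n))
  = w (%n. of_real (kf_means H (%x. p x + q x) n))"
proof -
 let ?s = "%x. p x + q x"
 define a where "a = kf_means H p"
 define b where "b = kf_means H q"
 define c where "c = kf_means H ?s"
 define D where "D = 2 * \<bar>C\<bar>"
 have D: "?s e <= D" if "e \<in> carr H" "hnorm H e = 1" for e using C[OF that] by (simp add: D_def)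
 have D0: "0 <= D" by (simp add: D_def)
 have nn: "0 <= a n" "0 <= b n" "0 <= c n" for n
  using ky_fan_nonneg[OF C(1)] ky_fan_nonneg[OF C(2)] ky_fan_nonneg[OF D]
  by (auto simp: a_def b_def c_def kf_means_def)
 have cab: "c n <= a n + b n" for n
  unfolding a_def b_def c_def kf_means_def add_divide_distrib[symmetric]
  using ky_fan_add[of p C q C] C by (intro divide_right_mono) auto
 obtain A where A: "\<And>n. a n <= A" using bdd(1) unfolding bdd_above_def a_def by blast
 obtain B where B: "\<And>n. b n <= B" using bdd(2) unfolding bdd_above_def b_def by blast
 have Ba: "Bseq a" "Bseq b" "Bseq c"
 proof -
  show "Bseq a" by (rule BseqI'[of _ A]) (use nn A in auto)
  show "Bseq b" by (rule BseqI'[of _ B]) (use nn B in auto)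
  show "Bseq c"
  proof (rule BseqI'[of _ "A + B"])
   fix n show "norm (c n) <= A + B" using nn(3)[of n] cab[of n] A[of n] B[of n] by simp
  qed
 qed
 have Bab: "Bseq (%n. a n + b n)" using Ba by (intro Bseq_plus) auto
 \<comment> \<open>Terms are indexed from 0, so position \<open>2 * n + 1\<close> holds the sum for
   \<open>2 * Suc n\<close> vectors. The sequence \<open>y'\<close> renormalizes it by the logarithm
   that belongs to position \<open>n\<close>.\<close>
 define y where "y n = c (2 * n + 1)" for n
 define y' where "y' n = y n * (ln (2 * real n + 3) / ln (real n + 2))" for n
 have By: "Bseq y" unfolding y_def using Bseq_subseq[OF Ba(3), of "%n. 2 * n + 1"] by (simp add: Bseq_def) 
 have By': "Bseq y'" unfolding y'_def using By convergent_imp_Bseq[OF convergentI[OF ln_ratio_tendsto]] by (intro Bseq_mult) auto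
 have aby: "a n + b n <= y' n" for n
 proof -
  have "a n + b n = (ky_fan H p (Suc n) + ky_fan H q (Suc n)) / ln (real n + 2)"
   by (simp add: a_def b_def kf_means_def add_divide_distrib add.commute)
  also have "\<dots> <= ky_fan H ?s (2 * Suc n) / ln (real n + 2)" by (intro divide_right_mono super) auto
  also have "\<dots> = y' n"
  proof -
   have "ln (2 * real n + 3) > 0" by simp
   moreover have "y n = ky_fan H ?s (2 * Suc n) / ln (2 * real n + 3)"
    by (simp add: y_def c_def kf_means_def algebra_simps)
   ultimately show ?thesis by (simp add: y'_def)
  qed
  finally show ?thesis .
 qed
 obtain K where K: "\<And>n. c n <= K" "K > 0" using Ba(3) nn(3) by (metis BseqE abs_of_nonneg real_norm_def)
 \<comment> \<open>Upwards, the Ky Fan sum grows by at most \<open>D\<close>. Downwards, the means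
   are bounded and the logarithm in the denominator grows by at most \<open>ln 2\<close>. Both
   effects vanish after division by the logarithm.\<close>
 have step: "(%n. c (Suc n) - c n) \<longlonglongrightarrow> 0"
 proof (rule tendsto_sandwich)
  have up: "c (Suc n) - c n <= D / ln (real n + 2)" for n
  proof -
   have "c (Suc n) <= ky_fan H ?s (Suc (Suc n)) / ln (real n + 2)"
    unfolding c_def kf_means_def using ky_fan_nonneg[OF D] by (intro divide_left_mono) auto
   also have "\<dots> <= (ky_fan H ?s (Suc n) + D) / ln (real n + 2)"
    using ky_fan_Suc_le[of ?s D] D D0 by (intro divide_right_mono) auto
   also have "\<dots> = c n + D / ln (real n + 2)" by (simp add: c_def kf_means_def add_divide_distrib add.commute)
   finally show ?thesis by simp
  qed
  have lo: "c (Suc n) - c n \<ge> - (K * ln 2 / ln (real n + 2))" for n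
  proof -
   have L: "ln (real n + 2) > 0" "ln (real n + 3) > 0" by auto
   have "ln (real n + 3) <= ln (2 * (real n + 2))" by simp
   also have "\<dots> = ln 2 + ln (real n + 2)" by (subst ln_mult) auto
   finally have l3: "ln (real n + 3) - ln (real n + 2) <= ln 2" by simp
   have mono: "ky_fan H ?s (Suc n) <= ky_fan H ?s (Suc (Suc n))" using ky_fan_mono[of ?s D] D by auto
   have "c n = ky_fan H ?s (Suc n) / ln (real n + 2)" by (simp add: c_def kf_means_def add.commute)
   then have k: "ky_fan H ?s (Suc n) = c n * ln (real n + 2)" using L by simp
   have "c (Suc n) = ky_fan H ?s (Suc (Suc n)) / ln (real n + 3)" by (simp add: c_def kf_means_def add.commute)
   also have "\<dots> \<ge> c n * ln (real n + 2) / ln (real n + 3)" using mono L k by (simp add: divide_right_mono)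
   finally have "c n - c (Suc n) <= c n - c n * ln (real n + 2) / ln (real n + 3)" by simp
   also have "\<dots> = c n * (ln (real n + 3) - ln (real n + 2)) / ln (real n + 3)" using L by (simp add: field_simps)
   also have "\<dots> <= K * ln 2 / ln (real n + 3)" using L l3 K nn by (intro divide_right_mono mult_mono) auto
   also have "\<dots> <= K * ln 2 / ln (real n + 2)" using L K by (intro divide_left_mono) auto
   finally show ?thesis by simp
  qed
  show "\<forall>\<^sub>F n in sequentially. - (K * ln 2 / ln (real n + 2)) <= c (Suc n) - c n" using lo by simp
  show "\<forall>\<^sub>F n in sequentially. c (Suc n) - c n <= D / ln (real n + 2)" using up by simp
  show "(%n. - (K * ln 2 / ln (real n + 2))) \<longlonglongrightarrow> 0"
   using tendsto_minus[OF tendsto_divide_0[OF tendsto_const filterlim_at_top_imp_at_infinity[OF ln_at_top_shift], of "K * ln 2"]] by simp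
  show "(%n. D / ln (real n + 2)) \<longlonglongrightarrow> 0"
   by (rule tendsto_divide_0[OF tendsto_const filterlim_at_top_imp_at_infinity[OF ln_at_top_shift]])
 qed
 let ?w = "%x. w (%n. complex_of_real (x n))"
 have cx: "Bseq (%n. complex_of_real (x n))" if "Bseq x" for x using that by (simp add: Bseq_def)
 have "?w y' = ?w y"
 proof (rule extended_limit_cong[OF w cx[OF By'] cx[OF By]])
  have "(%n. (ln (2 * real n + 3) / ln (real n + 2) - 1) * y n) \<longlonglongrightarrow> 0"
  proof -
   obtain K where K: "\<And>n. norm (y n) <= K" using By by (metis BseqE)
   show ?thesis
   proof (rule Lim_null_comparison)
    show "(%n. \<bar>ln (2 * real n + 3) / ln (real n + 2) - 1\<bar> * K) \<longlonglongrightarrow> 0"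
     using tendsto_mult_left_zero[OF tendsto_rabs_zero[OF LIM_zero[OF ln_ratio_tendsto]]] .
   qed (use K in \<open>auto simp: abs_mult intro!: mult_left_mono\<close>)
  qed
  then have "(%n. complex_of_real ((ln (2 * real n + 3) / ln (real n + 2) - 1) * y n)) \<longlonglongrightarrow> of_real 0" by (rule tendsto_of_real)
  then show "(%n. complex_of_real (y' n) - complex_of_real (y n)) \<longlonglongrightarrow> 0"
   unfolding of_real_diff[symmetric] y'_def by (simp add: algebra_simps)
 qed
 \<comment> \<open>Dilation invariance: repeating each term of \<open>y\<close> twice gives, at
   position \<open>n\<close>, the mean \<open>c\<close> at \<open>n\<close> or at
   \<open>Suc n\<close>, and by \<open>step\<close> this differs from \<open>c n\<close> by a null
   sequence.\<close>
 also have "\<dots> = w (%n. complex_of_real (y (n div 2)))" using extended_limitD(6)[OF w cx[OF By]] by simp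
 also have "\<dots> = ?w c"
 proof (rule extended_limit_cong[OF w _ cx[OF Ba(3)]])
  show "Bseq (%n. complex_of_real (y (n div 2)))" using By by (auto simp: Bseq_def)
  have *: "\<bar>y (n div 2) - c n\<bar> <= \<bar>c (Suc n) - c n\<bar>" for n
  proof (cases "even n")
   case True then have "2 * (n div 2) + 1 = Suc n" by simp
   then show ?thesis by (simp add: y_def)
  next
   case False then have "2 * (n div 2) + 1 = n" by simp
   then show ?thesis by (simp add: y_def)
  qed
  have "(%n. y (n div 2) - c n) \<longlonglongrightarrow> 0"
   by (rule Lim_null_comparison[OF _ tendsto_rabs_zero[OF step]]) (use * in simp)
  from tendsto_of_real[OF this] show "(%n. complex_of_real (y (n div 2)) - complex_of_real (c n)) \<longlonglongrightarrow> 0" by simp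
 qed
 finally have wy: "?w y' = ?w c" .
 have "Re (?w c) <= Re (?w (%n. a n + b n))" by (rule extended_limit_mono[OF w Ba(3) Bab cab])
 moreover have "Re (?w (%n. a n + b n)) <= Re (?w y')" by (rule extended_limit_mono[OF w Bab By' aby])
 ultimately have "Re (?w (%n. a n + b n)) = Re (?w c)" using wy by simp
 moreover have "Im (?w (%n. a n + b n)) = Im (?w c)"
  using extended_limit_real[OF w Bab] extended_limit_real[OF w Ba(3)] nn by simp
 moreover have "?w (%n. a n + b n) = ?w a + ?w b"
  using extended_limitD(1)[OF w cx[OF Ba(1)] cx[OF Ba(2)]] by simp
 ultimately show ?thesis by (simp add: complex_eq_iff a_def b_def c_def)
qed

text \<open>The right side involves only the sum of the two forms. Decompositions of an operator can
  thus be compared through their forms, without placing a sum of operators in the ideal.\<close>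

lemma (in pre_hilbert) dixmier_pos_add:
 assumes w: "extended_limit w"
  and A: "A \<in> dixmier_ideal H" "positive_op H A" and B: "B \<in> dixmier_ideal H" "positive_op H B"
 shows "dixmier_trace_pos H w A + dixmier_trace_pos H w B
  = w (%n. of_real (kf_means H (%x. qform H A x + qform H B x) n))"
proof -
 have c: "compact_op H A" "compact_op H B" using A B by (auto simp: dixmier_ideal_def)
 obtain C where C: "C > 0" "\<And>x. x \<in> carr H ==> \<bar>qform H A x\<bar> <= C * (hnorm H x)\<^sup>2"
  using qform_bound[OF positive_opD(1)[OF A(2)]] by blast
 obtain D where D: "D > 0" "\<And>x. x \<in> carr H ==> \<bar>qform H B x\<bar> <= D * (hnorm H x)\<^sup>2"
  using qform_bound[OF positive_opD(1)[OF B(2)]] by blast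
 show ?thesis
  unfolding dixmier_trace_pos_def log_means_eq[OF A(2) c(1)] log_means_eq[OF B(2) c(2)]
 proof (rule extended_limit_kf_add[OF w, where C = "max C D"])
  show "qform H A e <= max C D" if "e \<in> carr H" "hnorm H e = 1" for e using C(2)[OF that(1)] that(2) by simp
  show "qform H B e <= max C D" if "e \<in> carr H" "hnorm H e = 1" for e using D(2)[OF that(1)] that(2) by simp
  show "ky_fan H (qform H A) N + ky_fan H (qform H B) N <= ky_fan H (%x. qform H A x + qform H B x) (2 * N)" for N
   by (rule ky_fan_superadd[OF A(2) c(1) B(2) c(2)])
  show "bdd_above (range (kf_means H (qform H A)))" "bdd_above (range (kf_means H (qform H B)))"
   using A B log_means_eq[OF A(2) c(1)] log_means_eq[OF B(2) c(2)] by (auto simp: dixmier_ideal_def)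
 qed
qed

text \<open>Independence of the decomposition. The real and imaginary parts of
  \<open>inn H (T x) x\<close> show that, as forms, \<open>A + B'\<close> equals
  \<open>A' + B\<close> and \<open>C + E'\<close> equals \<open>C' + E\<close>; additivity on
  positive operators then equates the values.\<close>

lemma (in pre_hilbert) dixmier_trace_eq:
 assumes w: "extended_limit w"
  and P: "{A, B, C, E} \<subseteq> {P \<in> dixmier_ideal H. positive_op H P}"
  and T: "T = A - B + \<i> *\<^sub>C (C - E)"
 shows "dixmier_trace H w T = dixmier_trace_pos H w A - dixmier_trace_pos H w B
   + \<i> * (dixmier_trace_pos H w C - dixmier_trace_pos H w E)"
 unfolding dixmier_trace_def
proof (rule the_equality)
 show "\<exists>A' B' C' E'. {A', B', C', E'} \<subseteq> {P \<in> dixmier_ideal H. positive_op H P} \<and>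
   T = A' - B' + \<i> *\<^sub>C (C' - E') \<and>
   dixmier_trace_pos H w A - dixmier_trace_pos H w B
   + \<i> * (dixmier_trace_pos H w C - dixmier_trace_pos H w E)
   = dixmier_trace_pos H w A' - dixmier_trace_pos H w B'
   + \<i> * (dixmier_trace_pos H w C' - dixmier_trace_pos H w E')"
  using P T by blast
 fix z assume "\<exists>A B C E. {A, B, C, E} \<subseteq> {P \<in> dixmier_ideal H. positive_op H P} \<and>
   T = A - B + \<i> *\<^sub>C (C - E) \<and>
   z = dixmier_trace_pos H w A - dixmier_trace_pos H w B
   + \<i> * (dixmier_trace_pos H w C - dixmier_trace_pos H w E)"
 then obtain A' B' C' E' where P': "{A', B', C', E'} \<subseteq> {P \<in> dixmier_ideal H. positive_op H P}"
  and T': "T = A' - B' + \<i> *\<^sub>C (C' - E')"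
  and z: "z = dixmier_trace_pos H w A' - dixmier_trace_pos H w B'
   + \<i> * (dixmier_trace_pos H w C' - dixmier_trace_pos H w E')" by blast
 have form: "inn H (T x) x = of_real (qform H A x - qform H B x) + \<i> * of_real (qform H C x - qform H E x)"
  if P: "{A, B, C, E} \<subseteq> {P \<in> dixmier_ideal H. positive_op H P}" and T: "T = A - B + \<i> *\<^sub>C (C - E)"
   and x: "x \<in> carr H" for A B C E x
 proof -
  have m: "A x \<in> carr H" "B x \<in> carr H" "C x \<in> carr H" "E x \<in> carr H"
   using P bounded_opsD(1)[OF positive_opD(1) x] by auto
  have r: "inn H (Q x) x = of_real (qform H Q x)" if "positive_op H Q" for Q
   using positive_opD(2)[OF that x] by (simp add: qform_def complex_eq_iff)
  have "T x = A x - B x + \<i> *\<^sub>C (C x - E x)" by (simp add: T scaleC_fun_def)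
  then show ?thesis using m x P by (simp add: s_add s_diff s_scale r)
 qed
 have off: "Q x = 0" if "positive_op H Q" "x \<notin> carr H" for Q x
  using that bounded_opsD(4)[OF positive_opD(1)] by blast
 \<comment> \<open>The forms are substituted as functions on the whole ambient type, so vectors off
   the carrier, where all the operators vanish, have to be covered too.\<close>
 have ab: "qform H A x + qform H B' x = qform H A' x + qform H B x \<and>
  qform H C x + qform H E' x = qform H C' x + qform H E x" for x
 proof (cases "x \<in> carr H")
  case True
  from form[OF P T True] form[OF P' T' True] show ?thesis by (simp add: complex_eq_iff)
 next
  case False then show ?thesis using P P' by (simp add: qform_def off)
 qed
 have "dixmier_trace_pos H w A + dixmier_trace_pos H w B' = dixmier_trace_pos H w A' + dixmier_trace_pos H w B"
  using P P' ab by (simp add: dixmier_pos_add[OF w])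
 moreover have "dixmier_trace_pos H w C + dixmier_trace_pos H w E' = dixmier_trace_pos H w C' + dixmier_trace_pos H w E"
  using P P' ab by (simp add: dixmier_pos_add[OF w])
 ultimately have "dixmier_trace_pos H w A' - dixmier_trace_pos H w B' = dixmier_trace_pos H w A - dixmier_trace_pos H w B"
  "dixmier_trace_pos H w C' - dixmier_trace_pos H w E' = dixmier_trace_pos H w C - dixmier_trace_pos H w E"
  by (auto simp: algebra_simps)
 then show "z = dixmier_trace_pos H w A - dixmier_trace_pos H w B
   + \<i> * (dixmier_trace_pos H w C - dixmier_trace_pos H w E)" by (simp add: z)
qed

section \<open>The spaces \<open>L\<^sup>2([-l,l])\<close>\<close>

definition hcomplete :: "'v::complex_vector hilbert => bool"
 where "hcomplete H \<longleftrightarrow> (\<forall>X :: nat => 'v. (\<forall>n. X n \<in> carr H) \<and>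
  (\<forall>e>0. \<exists>N. \<forall>m\<ge>N. \<forall>n\<ge>N. hnorm H (X m - X n) < e) \<longrightarrow> (\<exists>x\<in>carr H. hlim H X x))"

abbreviation "meas \<equiv> borel_measurable lborel :: (real => complex) set"

lemma abs_rep_ae_fun: "abs_ae_fun (rep_ae_fun h) = h"
 by (rule Quotient_abs_rep[OF Quotient_ae_fun])

lemma rep_ae_fun_meas [measurable, simp]: "rep_ae_fun h \<in> meas"
 using Quotient_rep_reflp[OF Quotient_ae_fun, of h] by simp

lemma abs_ae_fun_eq_iff:
 "f \<in> meas ==> g \<in> meas ==> abs_ae_fun f = abs_ae_fun g \<longleftrightarrow> (AE x in lborel. f x = g x)"
 using Quotient_rel[OF Quotient_ae_fun, of f g] by auto

lemma rep_abs_ae_fun: "f \<in> meas ==> AE x in lborel. rep_ae_fun (abs_ae_fun f) x = f x"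
 using abs_ae_fun_eq_iff[of "rep_ae_fun (abs_ae_fun f)" f] by (simp add: abs_rep_ae_fun)

lemma ae_fun_cases: obtains f where "f \<in> meas" "h = abs_ae_fun f"
 using abs_rep_ae_fun[of h] rep_ae_fun_meas by metis

lemma abs_plus: "f \<in> meas ==> g \<in> meas ==> abs_ae_fun f + abs_ae_fun g = abs_ae_fun (%x. f x + g x)"
 by (rule plus_ae_fun.abs_eq) auto

lemma abs_minus: "f \<in> meas ==> g \<in> meas ==> abs_ae_fun f - abs_ae_fun g = abs_ae_fun (%x. f x - g x)"
 by (rule minus_ae_fun.abs_eq) auto

lemma abs_scale: "f \<in> meas ==> a *\<^sub>C abs_ae_fun f = abs_ae_fun (%x. a * f x)"
 by (rule scaleC_ae_fun.abs_eq) auto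

lemma abs_zero: "0 = abs_ae_fun (%_. 0)"
 by (simp add: zero_ae_fun_def)

lemma abs_in_L2: "f \<in> meas ==> in_L2 l (abs_ae_fun f) \<longleftrightarrow> (AE x in lborel. x \<notin> {-l..l} \<longrightarrow> f x = 0) \<and>
  set_integrable lborel {-l..l} (%x. (cmod (f x))\<^sup>2)"
 by (rule in_L2.abs_eq) auto

lemma abs_L2_inner: "f \<in> meas ==> g \<in> meas ==> L2_inner l (abs_ae_fun f) (abs_ae_fun g) =
  of_real (1 / (2 * l)) * (LINT x:{-l..l}|lborel. f x * cnj (g x))"
 by (rule L2_inner.abs_eq) auto

lemma cnj_meas [measurable]: "cnj \<in> borel_measurable borel"
 by (intro borel_measurable_continuous_onI continuous_intros)

lemma in_L2_integrable:
 assumes "f \<in> meas" "g \<in> meas" "in_L2 l (abs_ae_fun f)" "in_L2 l (abs_ae_fun g)"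
 shows "set_integrable lborel {-l..l} (%x. f x * cnj (g x))"
proof -
 have [measurable]: "f \<in> borel_measurable borel" "g \<in> borel_measurable borel" using assms by auto
 have "set_integrable lborel {-l..l} (%x. (cmod (f x))\<^sup>2 + (cmod (g x))\<^sup>2)"
  using assms by (intro set_integral_add) (auto simp: abs_in_L2)
 then show ?thesis unfolding set_integrable_def
 proof (rule Bochner_Integration.integrable_bound)
  show "AE x in lborel. norm (indicat_real {-l..l} x *\<^sub>R (f x * cnj (g x)))
   <= norm (indicat_real {-l..l} x *\<^sub>R ((cmod (f x))\<^sup>2 + (cmod (g x))\<^sup>2))"
  proof (rule AE_I2)
   fix x
   have "cmod (f x) * cmod (g x) <= (cmod (f x))\<^sup>2 + (cmod (g x))\<^sup>2"
    using sum_squares_bound[of "cmod (f x)" "cmod (g x)"] mult_nonneg_nonneg[OF norm_ge_zero[of "f x"] norm_ge_zero[of "g x"]] by linarith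
   then show "norm (indicat_real {-l..l} x *\<^sub>R (f x * cnj (g x)))
    <= norm (indicat_real {-l..l} x *\<^sub>R ((cmod (f x))\<^sup>2 + (cmod (g x))\<^sup>2))"
    by (auto simp: indicator_def norm_mult)
  qed
 qed measurable
qed

lemma L2_add:
 assumes "in_L2 l x" "in_L2 l y"
 shows "in_L2 l (x + y)"
proof -
 obtain f where f: "f \<in> meas" "x = abs_ae_fun f" by (rule ae_fun_cases)
 obtain g where g: "g \<in> meas" "y = abs_ae_fun g" by (rule ae_fun_cases)
 have [measurable]: "f \<in> borel_measurable borel" "g \<in> borel_measurable borel" using f g by auto
 have i: "set_integrable lborel {-l..l} (%x. 2 * (cmod (f x))\<^sup>2 + 2 * (cmod (g x))\<^sup>2)"
  using assms f g by (intro set_integral_add set_integrable_mult_right) (auto simp: abs_in_L2)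
 have "set_integrable lborel {-l..l} (%x. (cmod (f x + g x))\<^sup>2)"
  using i unfolding set_integrable_def
 proof (rule Bochner_Integration.integrable_bound)
  show "AE x in lborel. norm (indicat_real {-l..l} x *\<^sub>R (cmod (f x + g x))\<^sup>2)
   <= norm (indicat_real {-l..l} x *\<^sub>R (2 * (cmod (f x))\<^sup>2 + 2 * (cmod (g x))\<^sup>2))"
  proof (rule AE_I2)
   fix x
   have "(cmod (f x + g x))\<^sup>2 <= (cmod (f x) + cmod (g x))\<^sup>2" by (intro power_mono norm_triangle_ineq) simp
   also have "\<dots> <= 2 * (cmod (f x))\<^sup>2 + 2 * (cmod (g x))\<^sup>2"
    using sum_squares_bound[of "cmod (f x)" "cmod (g x)"] by (simp add: power2_sum)
   finally show "norm (indicat_real {-l..l} x *\<^sub>R (cmod (f x + g x))\<^sup>2)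
    <= norm (indicat_real {-l..l} x *\<^sub>R (2 * (cmod (f x))\<^sup>2 + 2 * (cmod (g x))\<^sup>2))"
    by (auto simp: indicator_def)
  qed
 qed measurable
 moreover have "AE x in lborel. x \<notin> {-l..l} \<longrightarrow> f x + g x = 0"
 proof -
  have "AE x in lborel. x \<notin> {-l..l} \<longrightarrow> f x = 0" "AE x in lborel. x \<notin> {-l..l} \<longrightarrow> g x = 0"
   using assms f g by (auto simp: abs_in_L2)
  then show ?thesis by eventually_elim auto
 qed
 ultimately show ?thesis using f g by (simp add: abs_plus abs_in_L2)
qed

lemma L2_scale:
 assumes "in_L2 l x"
 shows "in_L2 l (a *\<^sub>C x)"
proof -
 obtain f where f: "f \<in> meas" "x = abs_ae_fun f" by (rule ae_fun_cases)
 have "set_integrable lborel {-l..l} (%x. (cmod a)\<^sup>2 * (cmod (f x))\<^sup>2)"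
  using assms f by (intro set_integrable_mult_right) (auto simp: abs_in_L2)
 moreover have "AE x in lborel. x \<notin> {-l..l} \<longrightarrow> a * f x = 0"
 proof -
  have "AE x in lborel. x \<notin> {-l..l} \<longrightarrow> f x = 0" using assms f by (auto simp: abs_in_L2)
  then show ?thesis by eventually_elim auto
 qed
 ultimately show ?thesis using f by (simp add: abs_scale abs_in_L2 norm_mult power_mult_distrib)
qed

lemma L2_zero: "in_L2 l 0"
 unfolding abs_zero by (subst abs_in_L2) (auto simp: set_integrable_def)

lemma carr_L2: "h \<in> carr (L2_space l) \<longleftrightarrow> in_L2 l h"
 by (simp add: L2_space_def)

lemma inn_L2: "inn (L2_space l) = L2_inner l"
 by (simp add: L2_space_def)

lemma L2_inner_self:
 assumes "f \<in> meas" "in_L2 l (abs_ae_fun f)"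
 shows "L2_inner l (abs_ae_fun f) (abs_ae_fun f) = of_real (1 / (2 * l) * (LINT x:{-l..l}|lborel. (cmod (f x))\<^sup>2))"
proof -
 have "(LINT x:{-l..l}|lborel. f x * cnj (f x)) = (LINT x:{-l..l}|lborel. complex_of_real ((cmod (f x))\<^sup>2))"
  by (simp add: mult_cnj_cmod)
 also have "\<dots> = of_real (LINT x:{-l..l}|lborel. (cmod (f x))\<^sup>2)" by (rule set_integral_complex_of_real)
 finally show ?thesis using assms by (simp add: abs_L2_inner)
qed

lemma L2_pre_hilbert:
 assumes l: "0 < l"
 shows "pre_hilbert (L2_space l)"
proof (unfold_locales; (unfold carr_L2 inn_L2)?)
 show "in_L2 l 0" by (rule L2_zero)
 show "in_L2 l x ==> in_L2 l y ==> in_L2 l (x + y)" for x y by (rule L2_add)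
 show "in_L2 l x ==> in_L2 l (a *\<^sub>C x)" for x a by (rule L2_scale)
 fix x y z assume x: "in_L2 l x" and y: "in_L2 l y"
 obtain f where f: "f \<in> meas" "x = abs_ae_fun f" by (rule ae_fun_cases)
 obtain g where g: "g \<in> meas" "y = abs_ae_fun g" by (rule ae_fun_cases)
 have [measurable]: "f \<in> borel_measurable borel" "g \<in> borel_measurable borel" using f g by auto
 show "L2_inner l y x = cnj (L2_inner l x y)"
 proof -
  have "cnj (LINT x:{-l..l}|lborel. f x * cnj (g x)) = (LINT x:{-l..l}|lborel. g x * cnj (f x))"
   unfolding set_lebesgue_integral_def by (simp add: mult.commute Bochner_Integration.integral_cnj[symmetric] del: Bochner_Integration.integral_cnj)
  then show ?thesis using f g by (simp add: abs_L2_inner)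
 qed
 show "L2_inner l (a *\<^sub>C x) y = a * L2_inner l x y" for a
 proof -
  have "L2_inner l (a *\<^sub>C x) y = of_real (1 / (2 * l)) * (LINT x:{-l..l}|lborel. a * f x * cnj (g x))"
   unfolding f g abs_scale[OF f(1)] by (rule abs_L2_inner) (use g in auto)
  also have "\<dots> = a * L2_inner l x y" using f g by (simp add: abs_L2_inner mult.assoc)
  finally show ?thesis .
 qed
 show "L2_inner l (x + y) z = L2_inner l x z + L2_inner l y z" if z: "in_L2 l z"
 proof -
  obtain h where h: "h \<in> meas" "z = abs_ae_fun h" by (rule ae_fun_cases)
  have "L2_inner l (x + y) z = of_real (1 / (2 * l)) * (LINT x:{-l..l}|lborel. (f x + g x) * cnj (h x))"
   unfolding f g h abs_plus[OF f(1) g(1)] by (rule abs_L2_inner) (use h in auto)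
  also have "(LINT x:{-l..l}|lborel. (f x + g x) * cnj (h x)) =
   (LINT x:{-l..l}|lborel. f x * cnj (h x)) + (LINT x:{-l..l}|lborel. g x * cnj (h x))"
   using x y z f g h by (simp add: distrib_right in_L2_integrable set_integral_add)
  finally show ?thesis using f g h by (simp add: abs_L2_inner distrib_left)
 qed
 show "0 <= Re (L2_inner l x x)"
  using x f l by (simp only: f L2_inner_self Re_complex_of_real) (auto simp: set_lebesgue_integral_def intro!: mult_nonneg_nonneg)
 show "x = 0" if "L2_inner l x x = 0"
 proof -
  have v: "AE x in lborel. x \<notin> {-l..l} \<longrightarrow> f x = 0" and i: "set_integrable lborel {-l..l} (%x. (cmod (f x))\<^sup>2)"
   using x f by (auto simp: abs_in_L2)
  have "1 / (2 * l) * (LINT x:{-l..l}|lborel. (cmod (f x))\<^sup>2) = 0"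
   using that x f(1) unfolding f(2) by (subst (asm) L2_inner_self) (auto simp del: of_real_mult)
  then have "(LINT x:{-l..l}|lborel. (cmod (f x))\<^sup>2) = 0" using l by simp
  then have "AE x in lborel. indicat_real {-l..l} x *\<^sub>R (cmod (f x))\<^sup>2 = 0"
   using i unfolding set_lebesgue_integral_def set_integrable_def
   by (subst (asm) integral_nonneg_eq_0_iff_AE) auto
  with v have "AE x in lborel. f x = 0" by eventually_elim (auto simp: indicator_def split: if_splits)
  then show ?thesis unfolding f(2) abs_zero using f(1) by (subst abs_ae_fun_eq_iff) auto
 qed
qed

text \<open>The norm as a nonnegative integral, which is the shape required by Fatou's lemma and by
  estimates where integrability is still to be shown.\<close>

lemma hnorm_L2:
 assumes l: "0 < l" and f: "f \<in> meas" "in_L2 l (abs_ae_fun f)"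
 shows "(\<integral>\<^sup>+x. ennreal (indicat_real {-l..l} x * (cmod (f x))\<^sup>2) \<partial>lborel) = ennreal (2 * l * (hnorm (L2_space l) (abs_ae_fun f))\<^sup>2)"
proof -
 interpret pre_hilbert "L2_space l" by (rule L2_pre_hilbert[OF l])
 have "(hnorm (L2_space l) (abs_ae_fun f))\<^sup>2 = Re (L2_inner l (abs_ae_fun f) (abs_ae_fun f))"
  using f by (simp add: hnorm_sq carr_L2 inn_L2)
 also have "\<dots> = 1 / (2 * l) * (LINT x:{-l..l}|lborel. (cmod (f x))\<^sup>2)"
  using f by (subst L2_inner_self) (auto simp del: of_real_mult)
 finally have "2 * l * (hnorm (L2_space l) (abs_ae_fun f))\<^sup>2 = (LINT x|lborel. indicat_real {-l..l} x * (cmod (f x))\<^sup>2)"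
  using l by (simp add: set_lebesgue_integral_def)
 then show ?thesis using f
  by (subst nn_integral_eq_integral) (auto simp: abs_in_L2 set_integrable_def)
qed

lemma in_L2_I:
 assumes f: "f \<in> meas" and "AE x in lborel. x \<notin> {-l..l} \<longrightarrow> f x = 0"
  and "(\<integral>\<^sup>+x. ennreal (indicat_real {-l..l} x * (cmod (f x))\<^sup>2) \<partial>lborel) < \<infinity>"
 shows "in_L2 l (abs_ae_fun f)"
proof -
 have [measurable]: "f \<in> borel_measurable borel" using f by auto
 have "integrable lborel (%x. indicat_real {-l..l} x * (cmod (f x))\<^sup>2)"
  using assms by (intro integrableI_bounded) (auto simp: ennreal_mult abs_mult)
 then show ?thesis using assms by (simp add: abs_in_L2 set_integrable_def)
qed

text \<open>Along a rapidly converging subsequence the increments are absolutely summable almost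
  everywhere, which gives a pointwise limit; Fatou's lemma shows that it is also the limit in
  norm.\<close>

theorem L2_complete:
 assumes l: "0 < l"
 shows "hcomplete (L2_space l)"
 unfolding hcomplete_def
proof (intro allI impI, elim conjE)
 let ?H = "L2_space l" and ?I = "%x. indicat_real {-l..l} x"
 interpret pre_hilbert ?H by (rule L2_pre_hilbert[OF l])
 fix X :: "nat => ae_fun"
 assume X: "\<forall>n. X n \<in> carr ?H" and cauchy: "\<forall>e>0. \<exists>N. \<forall>m\<ge>N. \<forall>n\<ge>N. hnorm ?H (X m - X n) < e"
 have "\<exists>N. \<forall>m\<ge>N. \<forall>n\<ge>N. hnorm ?H (X m - X n) < (1/2) ^ k" for k using cauchy by simp
 then obtain N :: "nat => nat" where N: "\<And>k m n. m \<ge> N k ==> n \<ge> N k ==> hnorm ?H (X m - X n) < (1/2) ^ k" by metis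
 \<comment> \<open>The sum dominates every \<open>N i\<close> with \<open>i <= k\<close>, so the
   position \<open>r k\<close> is late enough for all these accuracies at once.\<close>
 define r where "r k = (\<Sum>i\<le>k. N i)" for k
 have r: "N i <= r k" if "i <= k" for i k
  unfolding r_def using that by (intro member_le_sum) auto
 define f where "f k = rep_ae_fun (X (r k))" for k
 have f [measurable]: "f k \<in> borel_measurable borel" for k using rep_ae_fun_meas by (simp add: f_def)
 have fm: "f k \<in> meas" for k by simp
 have fX: "abs_ae_fun (f k) = X (r k)" for k by (simp add: f_def abs_rep_ae_fun)
 have f2: "in_L2 l (abs_ae_fun (f k))" for k using X by (simp add: fX carr_L2)
 have nd: "(\<integral>\<^sup>+x. ennreal (?I x * (cmod (f k x - f m x))\<^sup>2) \<partial>lborel) <= ennreal (2 * l * (1/4) ^ k)" if "k <= m" for k m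
 proof -
  have s: "abs_ae_fun (%x. f k x - f m x) = X (r k) - X (r m)" using abs_minus[OF fm fm] fX by simp
  have c: "X (r k) - X (r m) \<in> carr ?H" using X by simp
  have "(\<integral>\<^sup>+x. ennreal (?I x * (cmod (f k x - f m x))\<^sup>2) \<partial>lborel) = ennreal (2 * l * (hnorm ?H (X (r k) - X (r m)))\<^sup>2)"
   by (subst hnorm_L2[OF l]) (use c in \<open>auto simp: s carr_L2\<close>)
  also have "\<dots> <= ennreal (2 * l * ((1/2) ^ k)\<^sup>2)"
  proof (intro ennreal_leI mult_left_mono power_mono)
   show "hnorm ?H (X (r k) - X (r m)) <= (1/2) ^ k"
    using N[of k "r k" "r m"] r[of k k] r[of k m] that by simp
  qed (use l c in \<open>auto intro: hnorm_nonneg\<close>)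
  also have "((1/2) ^ k)\<^sup>2 = (1/4 :: real) ^ k" by (simp add: power2_eq_square flip: power_mult_distrib)
  finally show ?thesis .
 qed
 define u where "u k x = ?I x * cmod (f (Suc k) x - f k x)" for k x
 have u [measurable]: "u k \<in> borel_measurable borel" for k unfolding u_def by measurable
 have u0: "0 <= u k x" for k x by (simp add: u_def)
 have "(\<integral>\<^sup>+x. ennreal (u k x) \<partial>lborel) <= ennreal (4 * l * (1/2) ^ k)" for k
 proof -
  \<comment> \<open>From \<open>a <= q + a^2 / q\<close> with \<open>q = (1/2) ^ k\<close>: on a
    bounded interval this turns the bound on the square integral into a summable bound on the
    integral.\<close>
  have "u k x <= (1/2) ^ k * ?I x + 2 ^ k * (?I x * (cmod (f k x - f (Suc k) x))\<^sup>2)" for x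
  proof -
   define a where "a = cmod (f k x - f (Suc k) x)"
   have "a <= (1/2) ^ k + 2 ^ k * a\<^sup>2"
   proof (cases "a <= (1/2) ^ k")
    case False
    then have "(1/2) ^ k * a <= a * a" by (intro mult_right_mono) (auto simp: a_def)
    then have "2 ^ k * ((1/2) ^ k * a) <= 2 ^ k * a\<^sup>2" by (simp add: power2_eq_square)
    also have "2 ^ k * ((1/2) ^ k * a) = a" by (simp add: power_one_over)
    finally show ?thesis by (simp add: add_increasing)
   qed (simp add: add_increasing2)
   then show ?thesis by (auto simp: u_def a_def indicator_def norm_minus_commute)
  qed
  then have "ennreal (u k x) <= ennreal ((1/2) ^ k) * indicator {-l..l} x
    + ennreal (2 ^ k) * ennreal (?I x * (cmod (f k x - f (Suc k) x))\<^sup>2)" for x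
  proof -
   have "ennreal (u k x) <= ennreal ((1/2) ^ k * ?I x + 2 ^ k * (?I x * (cmod (f k x - f (Suc k) x))\<^sup>2))"
    by (rule ennreal_leI) fact
   also have "\<dots> = ennreal ((1/2) ^ k) * ennreal (?I x) + ennreal (2 ^ k) * ennreal (?I x * (cmod (f k x - f (Suc k) x))\<^sup>2)"
    by (subst ennreal_plus) (simp_all add: ennreal_mult del: ennreal_power ennreal_indicator)
   finally show ?thesis by (simp only: ennreal_indicator)
  qed
  then have "(\<integral>\<^sup>+x. ennreal (u k x) \<partial>lborel) <=
    (\<integral>\<^sup>+x. ennreal ((1/2) ^ k) * indicator {-l..l} x + ennreal (2 ^ k) * ennreal (?I x * (cmod (f k x - f (Suc k) x))\<^sup>2) \<partial>lborel)"
   by (intro nn_integral_mono)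
  also have "\<dots> = ennreal ((1/2) ^ k) * emeasure lborel {-l..l} + ennreal (2 ^ k) * (\<integral>\<^sup>+x. ennreal (?I x * (cmod (f k x - f (Suc k) x))\<^sup>2) \<partial>lborel)"
   by (simp add: nn_integral_add nn_integral_cmult)
  also have "\<dots> <= ennreal ((1/2) ^ k) * ennreal (2 * l) + ennreal (2 ^ k) * ennreal (2 * l * (1/4) ^ k)"
   using l by (intro add_mono mult_left_mono nd) auto
  also have "\<dots> = ennreal ((1/2) ^ k * (2 * l) + 2 ^ k * (2 * l * (1/4) ^ k))"
   using l by (simp add: ennreal_mult[symmetric] ennreal_plus[symmetric] del: ennreal_plus)
  also have "2 ^ k * (2 * l * (1/4) ^ k) = (1/2) ^ k * (2 * l)"
   by (simp add: power_mult_distrib[symmetric] mult.left_commute[of _ l] mult_ac)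
  finally show ?thesis by (simp add: mult_ac)
 qed
 then have "(\<Sum>k. \<integral>\<^sup>+x. ennreal (u k x) \<partial>lborel) <= (\<Sum>k. ennreal (4 * l * (1/2) ^ k))"
  by (intro suminf_le) auto
 also have "\<dots> = ennreal (\<Sum>k. 4 * l * (1/2) ^ k)"
  using l by (intro suminf_ennreal2) (auto intro!: summable_mult summable_geometric)
 finally have "(\<integral>\<^sup>+x. (\<Sum>k. ennreal (u k x)) \<partial>lborel) < \<infinity>"
  by (subst nn_integral_suminf) (auto simp: le_less_trans[OF _ ennreal_less_top])
 then have AEu: "AE x in lborel. (\<Sum>k. ennreal (u k x)) \<noteq> \<infinity>"
  by (intro nn_integral_PInf_AE) auto
 define F where "F x = (if x \<in> {-l..l} then lim (%k. f k x) else 0)" for x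
 have Fm [measurable]: "F \<in> borel_measurable borel"
  unfolding F_def by measurable
 have conv: "AE x in lborel. x \<in> {-l..l} \<longrightarrow> (%k. f k x) \<longlonglongrightarrow> F x"
  using AEu
 proof eventually_elim
  case (elim x)
  show ?case
  proof
   assume x: "x \<in> {-l..l}"
   have "summable (%k. u k x)" using elim u0 by (intro summable_suminf_not_top) auto
   then have "summable (%k. norm (f (Suc k) x - f k x))" using x by (simp add: u_def)
   then have "summable (%k. f (Suc k) x - f k x)" by (rule summable_norm_cancel)
   then have "(%n. \<Sum>k<n. f (Suc k) x - f k x) \<longlonglongrightarrow> (\<Sum>k. f (Suc k) x - f k x)" by (rule summable_LIMSEQ)
   then have "(%n. f n x - f 0 x) \<longlonglongrightarrow> (\<Sum>k. f (Suc k) x - f k x)" by (simp only: sum_lessThan_telescope[of "%n. f n x"])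
   from tendsto_add[OF this tendsto_const[of "f 0 x"]] have "convergent (%n. f n x)" by (auto simp: convergent_def)
   then show "(%k. f k x) \<longlonglongrightarrow> F x" using x by (simp add: F_def convergent_LIMSEQ_iff)
  qed
 qed
 \<comment> \<open>Fatou's lemma in the second index \<open>m\<close>, with \<open>k\<close>
   fixed.\<close>
 have Fd: "(\<integral>\<^sup>+x. ennreal (?I x * (cmod (f k x - F x))\<^sup>2) \<partial>lborel) <= ennreal (2 * l * (1/4) ^ k)" for k
 proof -
  have "AE x in lborel. ennreal (?I x * (cmod (f k x - F x))\<^sup>2) = liminf (%m. ennreal (?I x * (cmod (f k x - f m x))\<^sup>2))"
   using conv
  proof eventually_elim
   case (elim x)
   have "(%m. ennreal (?I x * (cmod (f k x - f m x))\<^sup>2)) \<longlonglongrightarrow> ennreal (?I x * (cmod (f k x - F x))\<^sup>2)"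
    using elim by (cases "x \<in> {-l..l}") (auto intro!: tendsto_intros simp: indicator_def)
   then show ?case by (rule lim_imp_Liminf[OF trivial_limit_sequentially, symmetric])
  qed
  then have "(\<integral>\<^sup>+x. ennreal (?I x * (cmod (f k x - F x))\<^sup>2) \<partial>lborel) = (\<integral>\<^sup>+x. liminf (%m. ennreal (?I x * (cmod (f k x - f m x))\<^sup>2)) \<partial>lborel)"
   by (rule nn_integral_cong_AE)
  also have "\<dots> <= liminf (%m. \<integral>\<^sup>+x. ennreal (?I x * (cmod (f k x - f m x))\<^sup>2) \<partial>lborel)"
   by (rule nn_integral_liminf) measurable
  also have "\<dots> <= liminf (%m. ennreal (2 * l * (1/4) ^ k))"
   by (intro Liminf_mono eventually_sequentiallyI[of k] nd)
  finally show ?thesis by (simp add: Liminf_const)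
 qed
 have FV: "AE x in lborel. x \<notin> {-l..l} \<longrightarrow> F x = 0" by (simp add: F_def)
 have fV: "AE x in lborel. x \<notin> {-l..l} \<longrightarrow> f k x = 0" for k using f2[of k] by (simp add: abs_in_L2)
 have d2: "in_L2 l (abs_ae_fun (%x. f k x - F x))" for k
 proof (rule in_L2_I)
  show "AE x in lborel. x \<notin> {-l..l} \<longrightarrow> f k x - F x = 0" using FV fV[of k] by eventually_elim auto
  show "(\<integral>\<^sup>+x. ennreal (?I x * (cmod (f k x - F x))\<^sup>2) \<partial>lborel) < \<infinity>"
   using Fd[of k] by (simp add: le_less_trans[OF _ ennreal_less_top])
 qed simp
 have deq: "X (r k) - abs_ae_fun F = abs_ae_fun (%x. f k x - F x)" for k
  using abs_minus[OF fm, of F k] fX by simp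
 have dc: "X (r k) - abs_ae_fun F \<in> carr ?H" for k using d2[of k] by (simp add: carr_L2 deq)
 have F2: "abs_ae_fun F \<in> carr ?H"
  using diff_mem[OF X[rule_format, of "r 0"] dc[of 0]] by simp
 have le: "hnorm ?H (X (r k) - abs_ae_fun F) <= (1/2) ^ k" for k
 proof -
  have "ennreal (2 * l * (hnorm ?H (X (r k) - abs_ae_fun F))\<^sup>2) <= ennreal (2 * l * (1/4) ^ k)"
   using Fd[of k] hnorm_L2[OF l _ d2[of k]] by (simp add: deq)
  then have "(hnorm ?H (X (r k) - abs_ae_fun F))\<^sup>2 <= (1/4) ^ k" using l by (simp add: ennreal_le_iff)
  also have "(1/4 :: real) ^ k = ((1/2) ^ k)\<^sup>2" by (simp add: power2_eq_square flip: power_mult_distrib)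
  finally show ?thesis by (rule power2_le_imp_le) simp
 qed
 have "hlim ?H X (abs_ae_fun F)"
  unfolding hlim_def
 proof (rule LIMSEQ_I)
  fix e :: real assume e: "0 < e"
  obtain k where k: "(1/2 :: real) ^ k < e / 2" using real_arch_pow_inv[of "e/2" "1/2"] e by auto
  have "norm (hnorm ?H (X n - abs_ae_fun F) - 0) < e" if n: "n \<ge> N k" for n
  proof -
   have "hnorm ?H (X n - abs_ae_fun F) <= hnorm ?H (X n - X (r k)) + hnorm ?H (X (r k) - abs_ae_fun F)"
    using X F2 by (intro hnorm_triangle_dist) auto
   also have "\<dots> < (1/2) ^ k + (1/2) ^ k"
    using N[OF n r[of k k]] le[of k] by simp
   finally show ?thesis using k X F2 hnorm_nonneg[of "X n - abs_ae_fun F"] by simp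
  qed
  then show "\<exists>no. \<forall>n\<ge>no. norm (hnorm ?H (X n - abs_ae_fun F) - 0) < e" by blast
 qed
 then show "\<exists>x\<in>carr ?H. hlim ?H X x" using F2 by blast
qed

section \<open>Fourier coefficients on a symmetric interval and their uniqueness\<close>

definition fexp :: "real => int => real => complex"
 where "fexp l k x = exp (\<i> * of_real (pi * of_int k * x / l))"

lemma fexp_mult: "fexp l j x * fexp l k x = fexp l (j + k) x"
 by (simp add: fexp_def exp_add[symmetric] add_divide_distrib[symmetric] algebra_simps)

lemma norm_fexp [simp]: "cmod (fexp l k x) = 1"
 by (simp add: fexp_def)

lemma cnj_fexp: "cnj (fexp l k x) = fexp l (- k) x"
 by (simp add: fexp_def exp_cnj)

lemma continuous_fexp: "continuous_on A (fexp l k)"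
 unfolding fexp_def divide_inverse by (intro continuous_intros)

lemma fexp_meas [measurable]: "fexp l k \<in> borel_measurable borel"
 by (intro borel_measurable_continuous_onI continuous_fexp)

lemma fexp_0 [simp]: "fexp l 0 x = 1"
 by (simp add: fexp_def)

lemma fexp_deriv: "(fexp l k has_vector_derivative \<i> * of_real (pi * of_int k / l) * fexp l k x) (at x within A)"
proof -
 define c where "c = \<i> * complex_of_real (pi * of_int k / l)"
 have "((%z. exp (c * z)) has_field_derivative c * exp (c * of_real x)) (at (of_real x))"
  by (auto intro!: derivative_eq_intros simp: mult.commute)
 then have "((%x. exp (c * of_real x)) has_vector_derivative c * exp (c * of_real x)) (at x within A)"
  by (intro has_vector_derivative_real_field) (auto intro: has_field_derivative_at_within)
 moreover have "exp (c * of_real x) = fexp l k x" for x by (simp add: c_def fexp_def mult_ac)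
 ultimately show ?thesis by (simp add: c_def)
qed

lemma fexp_periodic: "0 < l ==> fexp l k l = fexp l k (- l)"
proof -
 assume "0 < l"
 then have "fexp l k l = exp (\<i> * of_real (pi * of_int k))" "fexp l k (-l) = exp (\<i> * of_real (- pi * of_int k))"
  by (simp_all add: fexp_def)
 moreover have "exp (\<i> * of_real (pi * of_int k)) = exp (\<i> * of_real (- pi * of_int k)) * exp ((2 * of_int k * pi) * \<i>)"
  unfolding exp_add[symmetric] by (rule arg_cong[where f = exp]) (simp add: algebra_simps)
 moreover have "exp ((2 * of_int k * pi) * \<i>) = 1" using exp_integer_2pi[of "of_int k"] by simp
 ultimately show ?thesis by simp
qed

lemma fexp_integral:
 assumes l: "0 < l"
 shows "(LINT x:{-l..l}|lborel. fexp l k x) = (if k = 0 then of_real (2 * l) else 0)"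
proof (cases "k = 0")
 case True then show ?thesis using l by (simp add: set_lebesgue_integral_def scaleR_conv_of_real)
next
 case False
 define c where "c = \<i> * complex_of_real (pi * of_int k / l)"
 have c: "c \<noteq> 0" using False l by (simp add: c_def)
 have "(LINT x|lborel. indicat_real {-l..l} x *\<^sub>R fexp l k x) = fexp l k l / c - fexp l k (- l) / c"
 proof (rule integral_FTC_Icc)
  show "((%x. fexp l k x / c) has_vector_derivative fexp l k x) (at x within {-l..l})" for x
  proof -
   have "((%x. (1 / c) * fexp l k x) has_vector_derivative (1 / c) * (c * fexp l k x)) (at x within {-l..l})"
    unfolding c_def by (intro has_vector_derivative_mult_right fexp_deriv)
   then show ?thesis using c by simp
  qed
 qed (use l continuous_fexp in auto)
 then show ?thesis using False fexp_periodic[OF l, of k] by (simp add: set_lebesgue_integral_def)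
qed

text \<open>The base case for polynomials on the circle: a real linear function of
  \<open>cis\<close> is a combination of two exponentials, and multiplication by these only shifts
  the Fourier index.\<close>

lemma lin_cis:
 assumes "bounded_linear (p :: complex => real)"
 shows "of_real (p (cis (pi * x / l))) = ((p 1 - \<i> * p \<i>) / 2) * fexp l 1 x + ((p 1 + \<i> * p \<i>) / 2) * fexp l (- 1) x"
proof -
 let ?t = "pi * x / l"
 interpret bounded_linear p by fact
 have "cis ?t = cos ?t *\<^sub>R 1 + sin ?t *\<^sub>R \<i>" by (simp add: complex_eq_iff)
 then have "p (cis ?t) = cos ?t * p 1 + sin ?t * p \<i>" by (simp add: add scaleR)
 moreover have "fexp l 1 x = cis ?t" by (simp add: fexp_def cis_conv_exp)
 moreover from this have "fexp l (- 1) x = cnj (cis ?t)" using cnj_fexp[of l 1 x] by simp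
 ultimately show ?thesis by (simp add: complex_eq_iff field_simps)
qed

text \<open>By Stone-Weierstrass on the unit circle, \<open>F\<close> is orthogonal to every
  continuous function of \<open>cis (pi * x / l)\<close>, and such functions approximate the
  indicator of \<open>K\<close>. The set \<open>K\<close> stays away from both endpoints because the
  circle identifies them.\<close>

lemma fourier_closed:
 fixes F :: "real => complex"
 assumes l: "0 < l" and F: "integrable lborel F" and F0: "\<And>x. x \<notin> {-l..l} ==> F x = 0"
  and orth: "\<And>k. (LINT x|lborel. F x * fexp l k x) = 0" and K: "compact K" "K \<subseteq> {-l<..<l}"
 shows "(LINT x:K|lborel. F x) = 0"
proof -
 have [measurable]: "F \<in> borel_measurable borel" using F by auto
 \<comment> \<open>Orthogonality is required after multiplication by every exponential, so that the
   property survives products in the induction over polynomials; boundedness keeps all the integrals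
   finite.\<close>
 define good where "good \<psi> \<longleftrightarrow> \<psi> \<in> borel_measurable borel \<and> (\<exists>B. \<forall>x. cmod (\<psi> x) <= B) \<and>
  (\<forall>k. (LINT x|lborel. F x * (\<psi> x * fexp l k x)) = 0)" for \<psi> :: "real => complex"
 have int: "integrable lborel (%x. F x * \<psi> x)"
  if "\<psi> \<in> borel_measurable borel" "\<And>x. cmod (\<psi> x) <= B" for \<psi> B
 proof (rule Bochner_Integration.integrable_bound)
  show "integrable lborel (%x. F x * complex_of_real B)" using F by simp
  show "AE x in lborel. norm (F x * \<psi> x) <= norm (F x * complex_of_real B)"
  proof (rule AE_I2)
   fix x
   have "cmod (\<psi> x) <= \<bar>B\<bar>" using that(2)[of x] by simp
   then show "norm (F x * \<psi> x) <= norm (F x * complex_of_real B)" by (simp add: norm_mult mult_left_mono)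
  qed
 qed (use that in measurable)
 have g1: "good (%_. 1)" using orth by (auto simp: good_def intro: exI[of _ 1])
 have gscale: "good (%x. c * \<psi> x)" if \<psi>: "good \<psi>" for c \<psi>
 proof -
  obtain B where "\<forall>x. cmod (\<psi> x) <= B" using \<psi> by (auto simp: good_def)
  then have "\<forall>x. cmod (c * \<psi> x) <= cmod c * B" by (simp add: norm_mult mult_left_mono)
  moreover have "(LINT x|lborel. F x * (c * \<psi> x * fexp l k x)) = c * (LINT x|lborel. F x * (\<psi> x * fexp l k x))" for k
   by (subst integral_mult_right_zero[symmetric]) (simp add: mult_ac)
  ultimately show ?thesis using \<psi> by (auto simp: good_def intro: borel_measurable_times)
 qed
 have gadd: "good (%x. \<phi> x + \<psi> x)" if \<phi>: "good \<phi>" and \<psi>: "good \<psi>" for \<phi> \<psi>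
 proof -
  obtain B where B: "\<forall>x. cmod (\<phi> x) <= B" using \<phi> by (auto simp: good_def)
  obtain C where C: "\<forall>x. cmod (\<psi> x) <= C" using \<psi> by (auto simp: good_def)
  have [measurable]: "\<phi> \<in> borel_measurable borel" "\<psi> \<in> borel_measurable borel" using \<phi> \<psi> by (auto simp: good_def)
  have "cmod (\<phi> x + \<psi> x) <= B + C" for x using B C norm_triangle_mono by blast
  moreover have "(LINT x|lborel. F x * ((\<phi> x + \<psi> x) * fexp l k x)) = 0" for k
  proof -
   have "(LINT x|lborel. F x * ((\<phi> x + \<psi> x) * fexp l k x)) =
     (LINT x|lborel. F x * (\<phi> x * fexp l k x) + F x * (\<psi> x * fexp l k x))"
    by (simp add: algebra_simps)
   also have "\<dots> = (LINT x|lborel. F x * (\<phi> x * fexp l k x)) + (LINT x|lborel. F x * (\<psi> x * fexp l k x))"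
    by (intro Bochner_Integration.integral_add int[of _ B] int[of _ C]) (use B C in \<open>auto simp: norm_mult\<close>)
   finally show ?thesis using \<phi> \<psi> by (simp add: good_def)
  qed
  ultimately show ?thesis by (auto simp: good_def)
 qed
 have gexp: "good (%x. fexp l j x * \<psi> x)" if \<psi>: "good \<psi>" for j \<psi>
 proof -
  have [measurable]: "\<psi> \<in> borel_measurable borel" using \<psi> by (auto simp: good_def)
  have "fexp l j x * \<psi> x * fexp l k x = \<psi> x * fexp l (j + k) x" for x k by (simp add: fexp_mult[symmetric] mult_ac)
  then have "(LINT x|lborel. F x * (fexp l j x * \<psi> x * fexp l k x)) = 0" for k
   using \<psi> unfolding good_def by presburger
  then show ?thesis using \<psi> by (auto simp: good_def norm_mult)
 qed
 have gpoly: "good (%x. of_real (p (cis (pi * x / l))) * \<psi> x)" if "real_polynomial_function p" "good \<psi>" for p \<psi>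
  using that
 proof (induction p arbitrary: \<psi> rule: real_polynomial_function.induct)
  case (linear p)
  have "good (%x. ((p 1 - \<i> * p \<i>) / 2) * (fexp l 1 x * \<psi> x) + ((p 1 + \<i> * p \<i>) / 2) * (fexp l (- 1) x * \<psi> x))"
   by (intro gadd gscale gexp linear)
  then show ?case unfolding lin_cis[OF linear(1)] by (simp add: algebra_simps)
 next
  case (const c) then show ?case using gscale by simp
 next
  case (add f g)
  then have "good (%x. of_real (f (cis (pi * x / l))) * \<psi> x + of_real (g (cis (pi * x / l))) * \<psi> x)" by (intro gadd) auto
  then show ?case by (simp add: algebra_simps)
 next
  case (mult f g)
  then have "good (%x. of_real (f (cis (pi * x / l))) * (of_real (g (cis (pi * x / l))) * \<psi> x))" by blast
  then show ?case by (simp add: mult.assoc)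
 qed
 have J0: "(LINT x|lborel. F x * of_real (\<phi> (cis (pi * x / l)))) = 0"
  if \<phi>: "continuous_on UNIV \<phi>" "\<And>z. \<bar>\<phi> z\<bar> <= 1" for \<phi> :: "complex => real"
 proof -
  have le: "cmod (LINT x|lborel. F x * of_real (\<phi> (cis (pi * x / l)))) <= 0 + e" if e: "0 < e" for e
  proof -
   define I where "I = (LINT x|lborel. cmod (F x))"
   have I: "0 <= I" by (simp add: I_def)
   define \<delta> where "\<delta> = e / (I + 1)"
   have \<delta>: "0 < \<delta>" using e I by (simp add: \<delta>_def)
   obtain p where p: "real_polynomial_function p" "\<And>z. z \<in> sphere 0 1 ==> \<bar>\<phi> z - p z\<bar> < \<delta>"
    by (rule Stone_Weierstrass_real_polynomial_function[of "sphere 0 1" \<phi> \<delta>])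
     (use \<phi>(1) \<delta> in \<open>auto intro: continuous_on_subset\<close>)
   have g: "good (%x. of_real (p (cis (pi * x / l))) * 1)" by (rule gpoly[OF p(1) g1])
   have cm: "continuous_on UNIV (%x. \<phi> (cis (pi * x / l)))"
    by (intro continuous_on_compose2[OF \<phi>(1)] continuous_intros) (use l in auto)
   have [measurable]: "(%x. \<phi> (cis (pi * x / l))) \<in> borel_measurable borel"
    using cm by (intro borel_measurable_continuous_onI)
   have pz: "(LINT x|lborel. F x * of_real (p (cis (pi * x / l)))) = 0"
    using g unfolding good_def by (auto dest: spec[of _ 0])
   obtain B where B: "\<And>x. cmod (of_real (p (cis (pi * x / l)))) <= B" using g by (auto simp: good_def)
   have [measurable]: "(%x. complex_of_real (p (cis (pi * x / l)))) \<in> borel_measurable borel" using g by (auto simp: good_def)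
   have i1: "integrable lborel (%x. F x * complex_of_real (\<phi> (cis (pi * x / l))))"
    by (rule int[of _ 1]) (use \<phi>(2) in auto)
   have i2: "integrable lborel (%x. F x * complex_of_real (p (cis (pi * x / l))))"
    by (rule int[of _ B]) (use B in auto)
   have "(LINT x|lborel. F x * of_real (\<phi> (cis (pi * x / l)))) =
    (LINT x|lborel. F x * of_real (\<phi> (cis (pi * x / l))) - F x * of_real (p (cis (pi * x / l))))"
    using pz by (subst Bochner_Integration.integral_diff[OF i1 i2]) simp
   also have "cmod \<dots> <= (LINT x|lborel. cmod (F x) * \<delta>)"
   proof (rule order_trans[OF integral_norm_bound integral_mono])
    show "integrable lborel (%x. norm (F x * of_real (\<phi> (cis (pi * x / l))) - F x * of_real (p (cis (pi * x / l)))))"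
     by (intro integrable_norm Bochner_Integration.integrable_diff i1 i2)
    show "integrable lborel (%x. cmod (F x) * \<delta>)" using F by simp
    fix x
    have "\<bar>\<phi> (cis (pi * x / l)) - p (cis (pi * x / l))\<bar> <= \<delta>" using p(2)[of "cis (pi * x / l)"] by simp
    then show "norm (F x * of_real (\<phi> (cis (pi * x / l))) - F x * of_real (p (cis (pi * x / l)))) <= cmod (F x) * \<delta>"
     unfolding right_diff_distrib[symmetric] of_real_diff[symmetric] norm_mult norm_of_real by (intro mult_left_mono) auto
   qed
   also have "\<dots> = I * \<delta>" by (simp add: I_def)
   also have "\<dots> <= e" using e I by (simp add: \<delta>_def field_simps)
   finally show ?thesis by simp
  qed
  have "cmod (LINT x|lborel. F x * of_real (\<phi> (cis (pi * x / l)))) <= 0" by (rule field_le_epsilon) (rule le)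
  then show ?thesis by simp
 qed
 show ?thesis
 proof (cases "K = {}")
  case True then show ?thesis by (simp add: set_lebesgue_integral_def)
 next
  case False
  define Z where "Z = (%x. cis (pi * x / l)) ` K"
  have Z: "compact Z" "Z \<noteq> {}" using False K
   by (auto simp: Z_def intro!: compact_continuous_image continuous_intros)
  \<comment> \<open>The parametrization of the circle is injective once \<open>- l\<close>, which
    has the same image as \<open>l\<close>, is left out.\<close>
  have mem: "cis (pi * x / l) \<in> Z \<longleftrightarrow> x \<in> K" if x: "x \<in> {-l..l}" "x \<noteq> -l" for x
  proof
   assume "cis (pi * x / l) \<in> Z"
   then obtain y where y: "y \<in> K" "cis (pi * x / l) = cis (pi * y / l)" by (auto simp: Z_def)
   have *: "pi * u / l \<in> {-pi<..pi}" if "u \<in> {-l<..l}" for u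
   proof -
    have "-1 < u / l" "u / l <= 1" using that l by (auto simp: field_simps)
    then have "pi * -1 < pi * (u / l)" "pi * (u / l) <= pi * 1" by (intro mult_strict_left_mono mult_left_mono; simp)+
    then show ?thesis by simp
   qed
   have "pi * x / l = pi * y / l"
    using Arg_cis[OF *[of x]] Arg_cis[OF *[of y]] x y K by (auto simp: subset_iff)
   then show "x \<in> K" using y l by simp
  qed (auto simp: Z_def)
  \<comment> \<open>Tents over the closed set \<open>Z\<close> that decrease to its indicator
    function: off \<open>Z\<close> the distance is positive and they vanish eventually.\<close>
  define \<phi> where "\<phi> n z = max 0 (1 - real n * infdist z Z)" for n z
  have \<phi>: "continuous_on UNIV (\<phi> n)" "\<bar>\<phi> n z\<bar> <= 1" for n z
   unfolding \<phi>_def by (intro continuous_intros) (auto simp: max_def infdist_nonneg)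
  have lim: "(%n. \<phi> n z) \<longlonglongrightarrow> indicat_real Z z" for z
  proof (cases "z \<in> Z")
   case True then show ?thesis by (simp add: \<phi>_def)
  next
   case False
   then have d: "infdist z Z > 0" using Z by (intro infdist_pos_not_in_closed compact_imp_closed) auto
   obtain N where N: "1 / infdist z Z < real N" using reals_Archimedean2 by blast
   have "\<phi> n z = 0" if "n \<ge> N" for n
   proof -
    have "1 / infdist z Z < real n" using N that by linarith
    then show ?thesis using d by (simp add: \<phi>_def field_simps)
   qed
   then have "\<forall>\<^sub>F n in sequentially. \<phi> n z = 0" by (auto simp: eventually_sequentially)
   then show ?thesis using False by (simp add: tendsto_eventually)
  qed
  have "(%n. LINT x|lborel. F x * of_real (\<phi> n (cis (pi * x / l)))) \<longlonglongrightarrow> (LINT x|lborel. indicat_real K x *\<^sub>R F x)"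
  proof (rule integral_dominated_convergence[where w = "%x. cmod (F x)"])
   have [measurable]: "K \<in> sets borel" using K compact_imp_closed by (auto intro: borel_closed)
   show "(%x. indicat_real K x *\<^sub>R F x) \<in> borel_measurable lborel" by measurable
   show "(%x. F x * of_real (\<phi> n (cis (pi * x / l)))) \<in> borel_measurable lborel" for n
   proof -
    have "(%x. \<phi> n (cis (pi * x / l))) \<in> borel_measurable borel"
     by (intro borel_measurable_continuous_onI continuous_on_compose2[OF \<phi>(1)] continuous_intros) (use l in auto)
    then show ?thesis by measurable
   qed
   show "integrable lborel (%x. cmod (F x))" using F by simp
   show "AE x in lborel. norm (F x * of_real (\<phi> n (cis (pi * x / l)))) <= cmod (F x)" for n
    using \<phi>(2) by (auto simp: norm_mult intro!: mult_left_le)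
   have "AE x in lborel. x \<noteq> -l" by (rule AE_lborel_singleton)
   then show "AE x in lborel. (%n. F x * of_real (\<phi> n (cis (pi * x / l)))) \<longlonglongrightarrow> indicat_real K x *\<^sub>R F x"
   proof eventually_elim
    case (elim x)
    show ?case
    proof (cases "x \<in> {-l..l}")
     case True
     have "(%n. F x * of_real (\<phi> n (cis (pi * x / l)))) \<longlonglongrightarrow> F x * of_real (indicat_real Z (cis (pi * x / l)))"
      by (intro tendsto_intros lim)
     then show ?thesis using mem[OF True elim] by (cases "x \<in> K") simp_all
    qed (simp add: F0)
   qed
  qed
  moreover have "(LINT x|lborel. F x * of_real (\<phi> n (cis (pi * x / l)))) = 0" for n by (rule J0[OF \<phi>])
  ultimately show ?thesis by (simp add: set_lebesgue_integral_def LIMSEQ_const_iff)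
 qed
qed

text \<open>The sets over which \<open>F\<close> integrates to 0 form a Dynkin system that contains
  the closed sets, hence all the Borel sets; this forces \<open>F = 0\<close> almost
  everywhere.\<close>

lemma fourier_unique:
 fixes F :: "real => complex"
 assumes l: "0 < l" and F: "integrable lborel F" and F0: "\<And>x. x \<notin> {-l..l} ==> F x = 0"
  and orth: "\<And>k. (LINT x|lborel. F x * fexp l k x) = 0"
 shows "AE x in lborel. F x = 0"
proof (rule sigma_finite_measure.density_zero[OF lborel.sigma_finite_measure_axioms F])
 have [measurable]: "F \<in> borel_measurable borel" using F by auto
 have cl: "(LINT x:A|lborel. F x) = 0" if A: "closed A" for A
 proof -
  \<comment> \<open>Compact subsets of the open interval that exhaust \<open>A\<close> inside it;
    the two endpoints form a null set.\<close>
  define K where "K n = A \<inter> {-l + 1 / real (Suc n) .. l - 1 / real (Suc n)}" for n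
  have K: "compact (K n)" "K n \<subseteq> {-l<..<l}" for n
  proof -
   show "compact (K n)" unfolding K_def using A by (intro closed_Int_compact) auto
   have "1 / real (Suc n) > 0" by simp
   then show "K n \<subseteq> {-l<..<l}" unfolding K_def by (smt (verit) Int_iff atLeastAtMost_iff greaterThanLessThan_iff subsetI)
  qed
  have "(%n. LINT x|lborel. indicat_real (K n) x *\<^sub>R F x) \<longlonglongrightarrow> (LINT x|lborel. indicat_real A x *\<^sub>R F x)"
  proof (rule integral_dominated_convergence[where w = "%x. cmod (F x)"])
   have [measurable]: "A \<in> sets borel" "K n \<in> sets borel" for n
    using A K(1) compact_imp_closed by (auto intro: borel_closed)
   show "(%x. indicat_real A x *\<^sub>R F x) \<in> borel_measurable lborel" by measurable
   show "(%x. indicat_real (K n) x *\<^sub>R F x) \<in> borel_measurable lborel" for n by measurable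
   show "integrable lborel (%x. cmod (F x))" using F by simp
   show "AE x in lborel. norm (indicat_real (K n) x *\<^sub>R F x) <= cmod (F x)" for n by (auto simp: indicator_def)
   have "AE x in lborel. x \<noteq> -l \<and> x \<noteq> l" using AE_lborel_singleton[of "-l"] AE_lborel_singleton[of l] by eventually_elim auto
   then show "AE x in lborel. (%n. indicat_real (K n) x *\<^sub>R F x) \<longlonglongrightarrow> indicat_real A x *\<^sub>R F x"
   proof eventually_elim
    case (elim x)
    show ?case
    proof (cases "x \<in> {-l<..<l}")
     case True
     define d where "d = min (x + l) (l - x)"
     have d: "0 < d" using True by (simp add: d_def)
     obtain N where N: "1 / real (Suc N) < d" using reals_Archimedean[OF d] by (auto simp: inverse_eq_divide)
     have "indicat_real (K n) x = indicat_real A x" if "n \<ge> N" for n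
     proof -
      have "1 / real (Suc n) <= 1 / real (Suc N)" using that by (intro divide_left_mono) auto
      then have "1 / real (Suc n) < d" using N by linarith
      then show ?thesis by (auto simp: K_def indicator_def d_def)
     qed
     then have "\<forall>\<^sub>F n in sequentially. indicat_real (K n) x *\<^sub>R F x = indicat_real A x *\<^sub>R F x"
      by (auto simp: eventually_sequentially)
     then show ?thesis by (rule tendsto_eventually)
    next
     case False
     then have "x \<notin> {-l..l}" using elim by auto
     then show ?thesis by (simp add: F0)
    qed
   qed
  qed
  moreover have "(LINT x|lborel. indicat_real (K n) x *\<^sub>R F x) = 0" for n
   using fourier_closed[OF assms K] by (simp add: set_lebesgue_integral_def)
  ultimately show ?thesis by (simp add: set_lebesgue_integral_def LIMSEQ_const_iff)
 qed
 have si: "set_integrable lborel A F" if "A \<in> sets borel" for A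
  using that F unfolding set_integrable_def by (intro integrable_mult_indicator) auto
 fix A :: "real set" assume "A \<in> sets lborel"
 then have A: "A \<in> sigma_sets UNIV {S. closed S}" by (simp add: borel_eq_closed)
 have 1: "Int_stable {S :: real set. closed S}" by (auto simp: Int_stable_def)
 have 2: "{S :: real set. closed S} \<subseteq> Pow UNIV" by simp
 from 1 2 A show "(LINT x:A|lborel. F x) = 0"
 proof (induction A rule: sigma_sets_induct_disjoint)
  case (basic A) then show ?case using cl by simp
 next
  case empty then show ?case by (simp add: set_lebesgue_integral_def)
 next
  case (compl A)
  then have A: "A \<in> sets borel" by (simp add: borel_eq_closed)
  have "(LINT x:A \<union> (UNIV - A)|lborel. F x) = (LINT x:A|lborel. F x) + (LINT x:UNIV - A|lborel. F x)"
   using A by (intro set_integral_Un si) auto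
  then show ?case using compl cl[of UNIV] by simp
 next
  case (union A)
  have "A i \<in> sigma_sets UNIV {S. closed S}" for i using union(2) by blast
  then have A: "\<And>i. A i \<in> sets borel" by (simp add: borel_eq_closed)
  have "(LINT x:(\<Union>i. A i)|lborel. F x) = (\<Sum>i. (LINT x:(A i)|lborel. F x))"
   using A union by (intro lebesgue_integral_countable_add si) (auto simp: disjoint_family_on_def)
  then show ?case using union by simp
 qed
qed

section \<open>The exponentials as an orthonormal basis\<close>

definition fbasis :: "real => int => ae_fun"
 where "fbasis l k = L2_class l (fexp l k)"

lemma L2_class_meas [measurable]:
 assumes "h \<in> borel_measurable borel"
 shows "(%x. if x \<in> {-l..l} then h x else 0) \<in> meas"
 using assms by measurable

lemma L2_class_carr:
 assumes h: "h \<in> borel_measurable borel" and B: "\<And>x. x \<in> {-l..l} ==> cmod (h x) <= B"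
 shows "L2_class l h \<in> carr (L2_space l)"
 unfolding L2_class_def carr_L2
proof (rule in_L2_I[OF L2_class_meas[OF h]])
 have "(\<integral>\<^sup>+x. ennreal (indicat_real {-l..l} x * (cmod (if x \<in> {-l..l} then h x else 0))\<^sup>2) \<partial>lborel)
   <= (\<integral>\<^sup>+x. ennreal (B\<^sup>2) * indicator {-l..l} x \<partial>lborel)"
  using B by (intro nn_integral_mono) (auto simp: indicator_def intro!: ennreal_leI power_mono)
 also have "\<dots> < \<infinity>" by (simp add: nn_integral_cmult ennreal_mult_less_top emeasure_lborel_Icc_eq)
 finally show "(\<integral>\<^sup>+x. ennreal (indicat_real {-l..l} x * (cmod (if x \<in> {-l..l} then h x else 0))\<^sup>2) \<partial>lborel) < \<infinity>" .
qed auto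

lemma fbasis_carr [simp]: "fbasis l k \<in> carr (L2_space l)"
 unfolding fbasis_def by (rule L2_class_carr[where B = 1]) (auto simp: fexp_meas)

lemma inn_fbasis:
 assumes f: "f \<in> meas" "in_L2 l (abs_ae_fun f)"
 shows "inn (L2_space l) (abs_ae_fun f) (fbasis l k) = of_real (1 / (2 * l)) * (LINT x:{-l..l}|lborel. f x * fexp l (- k) x)"
proof -
 have "inn (L2_space l) (abs_ae_fun f) (fbasis l k) =
  of_real (1 / (2 * l)) * (LINT x:{-l..l}|lborel. f x * cnj (if x \<in> {-l..l} then fexp l k x else 0))"
  unfolding inn_L2 fbasis_def L2_class_def by (rule abs_L2_inner[OF f(1) L2_class_meas[OF fexp_meas]])
 also have "(LINT x:{-l..l}|lborel. f x * cnj (if x \<in> {-l..l} then fexp l k x else 0)) = (LINT x:{-l..l}|lborel. f x * fexp l (- k) x)"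
  by (rule set_lebesgue_integral_cong) (auto simp: cnj_fexp)
 finally show ?thesis .
qed

lemma fbasis_orthonormal:
 assumes l: "0 < l"
 shows "inn (L2_space l) (fbasis l j) (fbasis l k) = (if j = k then 1 else 0)"
proof -
 have "inn (L2_space l) (fbasis l j) (fbasis l k) =
  of_real (1 / (2 * l)) * (LINT x:{-l..l}|lborel. (if x \<in> {-l..l} then fexp l j x else 0) * fexp l (- k) x)"
  using fbasis_carr[of l j] unfolding fbasis_def[of l j] L2_class_def
  by (intro inn_fbasis) (auto simp: carr_L2 intro: L2_class_meas fexp_meas)
 also have "(LINT x:{-l..l}|lborel. (if x \<in> {-l..l} then fexp l j x else 0) * fexp l (- k) x)
  = (LINT x:{-l..l}|lborel. fexp l (j - k) x)"
  by (rule set_lebesgue_integral_cong) (auto simp: fexp_mult)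
 also have "\<dots> = (if j = k then of_real (2 * l) else 0)" by (simp add: fexp_integral[OF l])
 finally show ?thesis using l by simp
qed

lemma fbasis_complete:
 assumes l: "0 < l" and u: "u \<in> carr (L2_space l)" and orth: "\<And>k. inn (L2_space l) u (fbasis l k) = 0"
 shows "u = 0"
proof -
 obtain f where f: "f \<in> meas" "u = abs_ae_fun f" by (rule ae_fun_cases)
 have f2: "in_L2 l (abs_ae_fun f)" using u f by (simp add: carr_L2)
 have one: "L2_class l (%_. 1) \<in> carr (L2_space l)" by (rule L2_class_carr[where B = 1]) auto
 \<comment> \<open>Pairing with the constant 1 shows that a square integrable function on the
   bounded interval is integrable, as \<open>fourier_unique\<close> demands.\<close>
 have "set_integrable lborel {-l..l} (%x. f x * cnj (if x \<in> {-l..l} then 1 else 0))"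
  using one f2 f(1) by (intro in_L2_integrable) (auto simp: L2_class_def carr_L2)
 then have F: "integrable lborel (%x. indicat_real {-l..l} x *\<^sub>R f x)"
  unfolding set_integrable_def by (rule Bochner_Integration.integrable_cong[THEN iffD1, rotated 2]) (auto simp: indicator_def)
 have "AE x in lborel. indicat_real {-l..l} x *\<^sub>R f x = 0"
 proof (rule fourier_unique[OF l F])
  fix k
  have "(LINT x:{-l..l}|lborel. f x * fexp l k x) = 0"
   using orth[of "-k"] inn_fbasis[OF f(1) f2, of "-k"] l f(2) by simp
  then show "(LINT x|lborel. (indicat_real {-l..l} x *\<^sub>R f x) * fexp l k x) = 0"
   by (simp add: set_lebesgue_integral_def)
 qed auto
 moreover have "AE x in lborel. x \<notin> {-l..l} \<longrightarrow> f x = 0" using f2 f(1) by (simp add: abs_in_L2)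
 ultimately have "AE x in lborel. f x = 0" by eventually_elim (auto simp: indicator_def split: if_splits)
 then show ?thesis unfolding f(2) abs_zero using f(1) by (subst abs_ae_fun_eq_iff) auto
qed

section \<open>Multiplication operators\<close>

locale curve_mult =
 fixes l :: real and R :: "real => 'x"
 assumes l: "0 < l"
begin

sublocale pre_hilbert "L2_space l" by (rule L2_pre_hilbert[OF l])

text \<open>The representation sees \<open>f\<close> only along the curve, so continuity and
  boundedness are asked there only; \<open>\<bar>x\<bar>\<close> traverses the curve twice.\<close>

definition ok :: "('x => complex) => real => bool"
 where "ok f B \<longleftrightarrow> continuous_on {-l..l} (%x. f (R \<bar>x\<bar>)) \<and> (\<forall>t\<in>{0..l}. cmod (f (R t)) <= B)"

text \<open>The multiplier cut off outside the interval: this makes it a bounded Borel function on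
  the whole line, whatever \<open>R\<close> does beyond \<open>l\<close>.\<close>

definition mf :: "('x => complex) => real => complex"
 where "mf f x = indicat_real {-l..l} x *\<^sub>R f (R \<bar>x\<bar>)"

lemma mf_meas [measurable]: "ok f B ==> mf f \<in> borel_measurable borel"
 unfolding mf_def ok_def by (intro borel_measurable_continuous_on_indicator) auto

lemma mf_bound: "ok f B ==> cmod (mf f x) <= \<bar>B\<bar>"
 unfolding mf_def ok_def by (cases "x \<in> {-l..l}") (auto simp: indicator_def intro!: order_trans[OF _ abs_ge_self])

lemma curve_rep_abs:
 assumes ok: "ok f B" and u: "u \<in> meas" "in_L2 l (abs_ae_fun u)"
 shows "curve_rep l R f (abs_ae_fun u) = abs_ae_fun (%x. mf f x * u x)"
proof -
 note [measurable] = mf_meas[OF ok]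
 have [measurable]: "u \<in> borel_measurable borel" using u by simp
 have r [measurable]: "rep_ae_fun (abs_ae_fun u) \<in> borel_measurable borel" using rep_ae_fun_meas by simp
 have eq: "(%x. if x \<in> {-l..l} then f (R \<bar>x\<bar>) * rep_ae_fun (abs_ae_fun u) x else 0)
  = (%x. mf f x * rep_ae_fun (abs_ae_fun u) x)" by (auto simp: mf_def)
 have "abs_ae_fun (%x. mf f x * rep_ae_fun (abs_ae_fun u) x) = abs_ae_fun (%x. mf f x * u x)"
 proof (subst abs_ae_fun_eq_iff)
  show "AE x in lborel. mf f x * rep_ae_fun (abs_ae_fun u) x = mf f x * u x"
   using rep_abs_ae_fun[OF u(1)] by eventually_elim simp
 qed measurable
 then show ?thesis using u unfolding curve_rep_def carr_L2 L2_class_def eq by simp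
qed

lemma curve_rep_bound:
 assumes ok: "ok f B" and h: "h \<in> carr (L2_space l)"
 shows "curve_rep l R f h \<in> carr (L2_space l)"
  and "hnorm (L2_space l) (curve_rep l R f h) <= \<bar>B\<bar> * hnorm (L2_space l) h"
proof -
 note [measurable] = mf_meas[OF ok]
 obtain u where u: "u \<in> meas" "h = abs_ae_fun u" by (rule ae_fun_cases)
 have [measurable]: "u \<in> borel_measurable borel" using u by simp
 have u2: "in_L2 l (abs_ae_fun u)" using h u by (simp add: carr_L2)
 have v: "AE x in lborel. x \<notin> {-l..l} \<longrightarrow> mf f x * u x = 0" by (auto simp: mf_def)
 have "(\<integral>\<^sup>+x. ennreal (indicat_real {-l..l} x * (cmod (mf f x * u x))\<^sup>2) \<partial>lborel)
  <= (\<integral>\<^sup>+x. ennreal (B\<^sup>2) * ennreal (indicat_real {-l..l} x * (cmod (u x))\<^sup>2) \<partial>lborel)"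
 proof (rule nn_integral_mono)
  fix x
  have "(cmod (mf f x))\<^sup>2 <= B\<^sup>2" using power_mono[OF mf_bound[OF ok, of x], of 2] by simp
  then have "(cmod (mf f x * u x))\<^sup>2 <= B\<^sup>2 * (cmod (u x))\<^sup>2"
   by (simp add: norm_mult power_mult_distrib mult_right_mono)
  then show "ennreal (indicat_real {-l..l} x * (cmod (mf f x * u x))\<^sup>2) <= ennreal (B\<^sup>2) * ennreal (indicat_real {-l..l} x * (cmod (u x))\<^sup>2)"
   by (auto simp: indicator_def ennreal_mult[symmetric] simp del: ennreal_power intro!: ennreal_leI)
 qed
 also have "\<dots> = ennreal (B\<^sup>2) * ennreal (2 * l * (hnorm (L2_space l) h)\<^sup>2)"
  using hnorm_L2[OF l u(1) u2] u by (subst nn_integral_cmult) auto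
 also have "\<dots> = ennreal (2 * l * (\<bar>B\<bar> * hnorm (L2_space l) h)\<^sup>2)"
  using l by (simp add: ennreal_mult[symmetric] power_mult_distrib mult_ac del: ennreal_power)
 finally have le: "(\<integral>\<^sup>+x. ennreal (indicat_real {-l..l} x * (cmod (mf f x * u x))\<^sup>2) \<partial>lborel)
  <= ennreal (2 * l * (\<bar>B\<bar> * hnorm (L2_space l) h)\<^sup>2)" .
 have m: "(%x. mf f x * u x) \<in> meas" by measurable
 have i: "in_L2 l (abs_ae_fun (%x. mf f x * u x))"
  by (rule in_L2_I[OF m v le_less_trans[OF le]]) simp
 have e: "curve_rep l R f h = abs_ae_fun (%x. mf f x * u x)" unfolding u by (rule curve_rep_abs[OF ok u(1) u2])
 show "curve_rep l R f h \<in> carr (L2_space l)" using i by (simp add: e carr_L2)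
 have "2 * l * (hnorm (L2_space l) (curve_rep l R f h))\<^sup>2 <= 2 * l * (\<bar>B\<bar> * hnorm (L2_space l) h)\<^sup>2"
  using le l unfolding hnorm_L2[OF l m i] e by (subst (asm) ennreal_le_iff) auto
 then show "hnorm (L2_space l) (curve_rep l R f h) <= \<bar>B\<bar> * hnorm (L2_space l) h"
  using l hnorm_nonneg[OF h] by - (rule power2_le_imp_le, simp_all)
qed

lemma curve_rep_add:
 assumes ok: "ok f B" and h: "h \<in> carr (L2_space l)" "g \<in> carr (L2_space l)"
 shows "curve_rep l R f (h + g) = curve_rep l R f h + curve_rep l R f g"
proof -
 note [measurable] = mf_meas[OF ok]
 obtain u where u: "u \<in> meas" "h = abs_ae_fun u" by (rule ae_fun_cases)
 obtain v where v: "v \<in> meas" "g = abs_ae_fun v" by (rule ae_fun_cases)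
 have [measurable]: "u \<in> borel_measurable borel" "v \<in> borel_measurable borel" using u v by auto
 have 2: "in_L2 l (abs_ae_fun u)" "in_L2 l (abs_ae_fun v)" "in_L2 l (abs_ae_fun (%x. u x + v x))"
  using h u v L2_add[of l h g] by (auto simp: carr_L2 abs_plus)
 show ?thesis unfolding u v abs_plus[OF u(1) v(1)]
  using 2 u v by (subst (1 2 3) curve_rep_abs[OF ok]) (auto simp: abs_plus distrib_left)
qed

lemma curve_rep_scale:
 assumes ok: "ok f B" and h: "h \<in> carr (L2_space l)"
 shows "curve_rep l R f (a *\<^sub>C h) = a *\<^sub>C curve_rep l R f h"
proof -
 note [measurable] = mf_meas[OF ok]
 obtain u where u: "u \<in> meas" "h = abs_ae_fun u" by (rule ae_fun_cases)
 have [measurable]: "u \<in> borel_measurable borel" using u by auto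
 have 2: "in_L2 l (abs_ae_fun u)" "in_L2 l (abs_ae_fun (%x. a * u x))"
  using h u L2_scale[of l h a] by (auto simp: carr_L2 abs_scale)
 show ?thesis unfolding u abs_scale[OF u(1)]
  using 2 u by (subst (1 2) curve_rep_abs[OF ok]) (auto simp: abs_scale mult_ac)
qed

lemma curve_rep_lin:
 assumes ok: "ok f B" "ok g C" "ok k D" and h: "h \<in> carr (L2_space l)"
  and k: "\<And>t. t \<in> {0..l} ==> k (R t) = f (R t) + c * g (R t)"
 shows "curve_rep l R k h = curve_rep l R f h + c *\<^sub>C curve_rep l R g h"
proof -
 note [measurable] = mf_meas[OF ok(1)] mf_meas[OF ok(2)] mf_meas[OF ok(3)]
 obtain u where u: "u \<in> meas" "h = abs_ae_fun u" by (rule ae_fun_cases)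
 have [measurable]: "u \<in> borel_measurable borel" using u by auto
 have 2: "in_L2 l (abs_ae_fun u)" using h u by (auto simp: carr_L2)
 have e: "mf k x = mf f x + c * mf g x" for x using k[of "\<bar>x\<bar>"] by (auto simp: mf_def indicator_def)
 show ?thesis unfolding u curve_rep_abs[OF ok(1) u(1) 2] curve_rep_abs[OF ok(2) u(1) 2] curve_rep_abs[OF ok(3) u(1) 2]
  by (simp add: abs_scale abs_plus e algebra_simps)
qed

lemma curve_rep_const:
 assumes h: "h \<in> carr (L2_space l)"
 shows "curve_rep l R (%_. c) h = c *\<^sub>C h"
proof -
 have ok: "ok (%_. c) (cmod c)" by (simp add: ok_def)
 note [measurable] = mf_meas[OF ok]
 obtain u where u: "u \<in> meas" "h = abs_ae_fun u" by (rule ae_fun_cases)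
 have [measurable]: "u \<in> borel_measurable borel" using u by auto
 have 2: "in_L2 l (abs_ae_fun u)" using h u by (auto simp: carr_L2)
 then have "AE x in lborel. x \<notin> {-l..l} \<longrightarrow> u x = 0" using u by (simp add: abs_in_L2)
 then have "AE x in lborel. mf (%_. c) x * u x = c * u x" by eventually_elim (auto simp: mf_def indicator_def)
 then show ?thesis unfolding u curve_rep_abs[OF ok u(1) 2] abs_scale[OF u(1)]
  by (subst abs_ae_fun_eq_iff) auto
qed

lemma curve_rep_adjoint:
 assumes ok: "ok f B" "ok (%x. cnj (f x)) C" and h: "h \<in> carr (L2_space l)" "g \<in> carr (L2_space l)"
 shows "inn (L2_space l) (curve_rep l R f h) g = inn (L2_space l) h (curve_rep l R (%x. cnj (f x)) g)"
proof -
 note [measurable] = mf_meas[OF ok(1)] mf_meas[OF ok(2)]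
 obtain u where u: "u \<in> meas" "h = abs_ae_fun u" by (rule ae_fun_cases)
 obtain v where v: "v \<in> meas" "g = abs_ae_fun v" by (rule ae_fun_cases)
 have [measurable]: "u \<in> borel_measurable borel" "v \<in> borel_measurable borel" using u v by auto
 have 2: "in_L2 l (abs_ae_fun u)" "in_L2 l (abs_ae_fun v)" using h u v by (auto simp: carr_L2)
 have e: "mf (%x. cnj (f x)) x = cnj (mf f x)" for x by (simp add: mf_def)
 show ?thesis
  unfolding inn_L2 u v curve_rep_abs[OF ok(1) u(1) 2(1)] curve_rep_abs[OF ok(2) v(1) 2(2)]
  by (subst (1 2) abs_L2_inner) (auto simp: e mult_ac)
qed

end

section \<open>The Dirac operator of a curve\<close>

definition dirac_ev :: "real => int => real"
 where "dirac_ev l k = (2 * of_int k + 1) * pi / (2 * l)"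

lemma L2_class_scale:
 assumes "h \<in> borel_measurable borel"
 shows "L2_class l (%x. c * h x) = c *\<^sub>C L2_class l h"
proof -
 have "(%x. if x \<in> {-l..l} then c * h x else 0) = (%x. c * (if x \<in> {-l..l} then h x else 0))" by auto
 then show ?thesis unfolding L2_class_def by (simp only: abs_scale[OF L2_class_meas[OF assms]])
qed

lemma L2_class_sum:
 assumes "finite A"
 shows "L2_class l (%x. \<Sum>k\<in>A. c k * fexp l k x) = (\<Sum>k\<in>A. c k *\<^sub>C fbasis l k)"
 using assms
proof (induction A)
 case empty
 show ?case by (simp add: L2_class_def abs_zero)
next
 case (insert a A)
 have m: "(%x. \<Sum>k\<in>A. c k * fexp l k x) \<in> borel_measurable borel" by measurable
 have m': "(%x. c a * fexp l a x) \<in> borel_measurable borel" by measurable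
 have "L2_class l (%x. \<Sum>k\<in>insert a A. c k * fexp l k x) =
  abs_ae_fun (%x. (if x \<in> {-l..l} then c a * fexp l a x else 0) + (if x \<in> {-l..l} then \<Sum>k\<in>A. c k * fexp l k x else 0))"
  unfolding L2_class_def using insert by (intro arg_cong[where f = abs_ae_fun]) auto
 also have "\<dots> = L2_class l (%x. c a * fexp l a x) + L2_class l (%x. \<Sum>k\<in>A. c k * fexp l k x)"
  unfolding L2_class_def by (rule abs_plus[symmetric]) (intro L2_class_meas m m')+
 also have "L2_class l (%x. c a * fexp l a x) = c a *\<^sub>C fbasis l a"
  unfolding fbasis_def by (rule L2_class_scale[OF fexp_meas])
 finally show ?case using insert by simp
qed

lemma trig_polys_graph:
 assumes p: "p \<in> trig_polys l"
 obtains A c where "finite A" "L2_class l p = (\<Sum>k\<in>A. c k *\<^sub>C fbasis l k)"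
  "L2_class l (%x. - \<i> * vector_derivative p (at x)) = (\<Sum>k\<in>A. (c k * of_real (pi * of_int k / l)) *\<^sub>C fbasis l k)"
proof -
 obtain A c where A: "finite A" and p: "p = (%x. \<Sum>k\<in>A. c k * fexp l k x)"
  using p unfolding trig_polys_def fexp_def by auto
 have "(p has_vector_derivative (\<Sum>k\<in>A. c k * (\<i> * of_real (pi * of_int k / l) * fexp l k x))) (at x)" for x
  unfolding p by (intro has_vector_derivative_sum has_vector_derivative_mult_right fexp_deriv)
 then have "(%x. - \<i> * vector_derivative p (at x)) = (%x. - \<i> * (\<Sum>k\<in>A. c k * (\<i> * of_real (pi * of_int k / l) * fexp l k x)))"
  using vector_derivative_at by fastforce
 also have "\<dots> = (%x. \<Sum>k\<in>A. (c k * of_real (pi * of_int k / l)) * fexp l k x)"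
 proof (rule ext)
  fix x
  have "- \<i> * (c k * (\<i> * z * w)) = (c k * z) * w" for k z w by (simp add: algebra_simps)
  then show "- \<i> * (\<Sum>k\<in>A. c k * (\<i> * of_real (pi * of_int k / l) * fexp l k x)) =
   (\<Sum>k\<in>A. (c k * of_real (pi * of_int k / l)) * fexp l k x)" by (simp only: sum_distrib_left)
 qed
 finally have "L2_class l (%x. - \<i> * vector_derivative p (at x)) = (\<Sum>k\<in>A. (c k * of_real (pi * of_int k / l)) *\<^sub>C fbasis l k)"
  by (simp only: L2_class_sum[OF A])
 moreover have "L2_class l p = (\<Sum>k\<in>A. c k *\<^sub>C fbasis l k)" unfolding p by (rule L2_class_sum[OF A])
 ultimately show thesis by (intro that[OF A])
qed

context
 fixes l :: real
 assumes l: "0 < l"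
begin

interpretation pre_hilbert "L2_space l" by (rule L2_pre_hilbert[OF l])

lemma fbasis_ons: "ons (L2_space l) (range (fbasis l))"
 unfolding ons_def
proof (intro conjI ballI)
 fix e e' assume "e \<in> range (fbasis l)" "e' \<in> range (fbasis l)"
 then obtain j k where jk: "e = fbasis l j" "e' = fbasis l k" by auto
 show "inn (L2_space l) e e' = (if e = e' then 1 else 0)"
  using fbasis_orthonormal[OF l, of j k] fbasis_orthonormal[OF l, of j j] by (auto simp: jk split: if_splits)
qed auto

lemma inn_fbasis_sum:
 assumes "finite A"
 shows "inn (L2_space l) (\<Sum>k\<in>A. c k *\<^sub>C fbasis l k) (fbasis l j) = (if j \<in> A then c j else 0)"
proof -
 have "inn (L2_space l) (\<Sum>k\<in>A. c k *\<^sub>C fbasis l k) (fbasis l j) = (\<Sum>k\<in>A. if k = j then c k else 0)"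
  by (subst s_sum) (auto simp: s_scale fbasis_orthonormal[OF l] intro!: sum.cong)
 then show ?thesis using assms by simp
qed

text \<open>The relation between Fourier coefficients holds for trigonometric polynomials and passes
  to limits of graphs. Together with the eigenvectors in the graph, it is all that
  \<open>fun_calc_eq_diag\<close> asks of an operator.\<close>

lemma deriv_op_mem:
 assumes "(u, v) \<in> deriv_op l"
 shows "u \<in> carr (L2_space l)" "v \<in> carr (L2_space l)"
  "inn (L2_space l) v (fbasis l k) = of_real (pi * of_int k / l) * inn (L2_space l) u (fbasis l k)"
proof -
 obtain U V where UV: "\<And>n. (U n, V n) \<in> {(L2_class l p, L2_class l (%x. - \<i> * vector_derivative p (at x))) | p. p \<in> trig_polys l}"
  and lim: "hlim (L2_space l) U u" "hlim (L2_space l) V v" and uv: "u \<in> carr (L2_space l)" "v \<in> carr (L2_space l)"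
  using assms unfolding deriv_op_def closure_graph_def by auto
 show "u \<in> carr (L2_space l)" "v \<in> carr (L2_space l)" by (rule uv)+
 have n: "U n \<in> carr (L2_space l) \<and> V n \<in> carr (L2_space l) \<and>
  inn (L2_space l) (V n) (fbasis l k) = of_real (pi * of_int k / l) * inn (L2_space l) (U n) (fbasis l k)" for n
 proof -
  obtain p where p: "p \<in> trig_polys l" "U n = L2_class l p" "V n = L2_class l (%x. - \<i> * vector_derivative p (at x))"
   using UV[of n] by auto
  show ?thesis
   by (rule trig_polys_graph[OF p(1)]) (auto simp: p(2,3) inn_fbasis_sum)
 qed
 have "(%n. inn (L2_space l) (V n) (fbasis l k)) \<longlonglongrightarrow> inn (L2_space l) v (fbasis l k)"
  by (rule hlim_inn[OF lim(2)]) (use n uv in auto)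
 moreover have "(%n. of_real (pi * of_int k / l) * inn (L2_space l) (U n) (fbasis l k)) \<longlonglongrightarrow>
   of_real (pi * of_int k / l) * inn (L2_space l) u (fbasis l k)"
  by (intro tendsto_mult tendsto_const hlim_inn[OF lim(1)]) (use n uv in auto)
 ultimately show "inn (L2_space l) v (fbasis l k) = of_real (pi * of_int k / l) * inn (L2_space l) u (fbasis l k)"
  using n LIMSEQ_unique by simp
qed

lemma deriv_op_poly:
 assumes "p \<in> trig_polys l" "L2_class l p = u" "L2_class l (%x. - \<i> * vector_derivative p (at x)) = v"
  and "u \<in> carr (L2_space l)" "v \<in> carr (L2_space l)"
 shows "(u, v) \<in> deriv_op l"
proof -
 have "hlim (L2_space l) (%_. u) u" "hlim (L2_space l) (%_. v) v" by (simp_all add: hlim_def)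
 moreover have "(u, v) \<in> {(L2_class l p, L2_class l (%x. - \<i> * vector_derivative p (at x))) | p. p \<in> trig_polys l}"
  using assms(1-3) by blast
 ultimately show ?thesis using assms(4,5) unfolding deriv_op_def closure_graph_def
  by (intro CollectI case_prodI conjI exI[of _ "%_. u"] exI[of _ "%_. v"] allI) simp_all
qed

lemma deriv_op_fbasis: "(fbasis l k, of_real (pi * of_int k / l) *\<^sub>C fbasis l k) \<in> deriv_op l"
proof (rule deriv_op_poly)
 show "fexp l k \<in> trig_polys l" unfolding trig_polys_def fexp_def
  by (auto intro!: exI[of _ "{k}"] exI[of _ "%_. 1"])
 show "L2_class l (fexp l k) = fbasis l k" by (simp add: fbasis_def)
 have "vector_derivative (fexp l k) (at x) = \<i> * of_real (pi * of_int k / l) * fexp l k x" for x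
  by (rule vector_derivative_at[OF fexp_deriv])
 moreover have "- \<i> * (\<i> * z * w) = z * w" for z w by (simp add: algebra_simps)
 ultimately have "(%x. - \<i> * vector_derivative (fexp l k) (at x)) = (%x. of_real (pi * of_int k / l) * fexp l k x)" by (simp only:)
 then show "L2_class l (%x. - \<i> * vector_derivative (fexp l k) (at x)) = of_real (pi * of_int k / l) *\<^sub>C fbasis l k"
  unfolding fbasis_def by (simp only: L2_class_scale[OF fexp_meas])
qed auto

lemma deriv_op_zero: "(0, 0) \<in> deriv_op l"
proof (rule deriv_op_poly)
 show "(%_. 0) \<in> trig_polys l" unfolding trig_polys_def by (auto intro!: exI[of _ "{}"])
 show "0 \<in> carr (L2_space l)" "0 \<in> carr (L2_space l)" by simp_all
qed (simp_all add: L2_class_def abs_zero)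

lemma curve_dirac_mem:
 assumes "(u, v) \<in> curve_dirac l"
 shows "u \<in> carr (L2_space l)" "v \<in> carr (L2_space l)"
  "inn (L2_space l) v (fbasis l k) = of_real (dirac_ev l k) * inn (L2_space l) u (fbasis l k)"
proof -
 obtain v' where v: "v = v' + of_real (pi / (2 * l)) *\<^sub>C u" and uv: "(u, v') \<in> deriv_op l"
  using assms unfolding curve_dirac_def by auto
 note m = deriv_op_mem[OF uv]
 show "u \<in> carr (L2_space l)" by (rule m)
 show "v \<in> carr (L2_space l)" using m by (simp add: v)
 have e: "dirac_ev l k = pi * of_int k / l + pi / (2 * l)" using l by (simp add: dirac_ev_def field_simps)
 show "inn (L2_space l) v (fbasis l k) = of_real (dirac_ev l k) * inn (L2_space l) u (fbasis l k)"
  unfolding e v using m by (simp add: s_add s_scale distrib_right)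
qed

lemma curve_dirac_fbasis: "(fbasis l k, of_real (dirac_ev l k) *\<^sub>C fbasis l k) \<in> curve_dirac l"
proof -
 have e: "dirac_ev l k = pi * of_int k / l + pi / (2 * l)" using l by (simp add: dirac_ev_def field_simps)
 have "of_real (dirac_ev l k) *\<^sub>C fbasis l k = of_real (pi * of_int k / l) *\<^sub>C fbasis l k + of_real (pi / (2 * l)) *\<^sub>C fbasis l k"
  unfolding e of_real_add by (rule cvec.scale_left_distrib)
 then show ?thesis unfolding curve_dirac_def using deriv_op_fbasis[of k] by blast
qed

text \<open>An eigenvector of the direct sum is zero in all components but one, and these components
  too must lie in the graphs.\<close>

lemma curve_dirac_zero: "(0, 0) \<in> curve_dirac l"
 unfolding curve_dirac_def using deriv_op_zero by (force intro: exI[of _ 0])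

end

section \<open>Diagonal operators in Hilbert spaces\<close>

text \<open>Tychonoff's theorem for countably many closed disks takes the place of a diagonal
  argument.\<close>

lemma coordinatewise_subsequence:
 fixes f :: "nat => nat => complex"
 assumes "\<And>n i. cmod (f n i) <= 1"
 obtains r g where "strict_mono (r :: nat => nat)" "\<And>i. (%n. f (r n) i) \<longlonglongrightarrow> g i"
proof -
 have "compactin (product_topology (%_::nat. euclidean) UNIV) (\<Pi>\<^sub>E i\<in>UNIV. cball (0::complex) 1)"
  by (subst compactin_PiE) (auto simp: compactin_euclidean_iff)
 then have "compact (\<Pi>\<^sub>E i\<in>(UNIV::nat set). cball (0::complex) 1)"
  by (simp add: euclidean_product_topology compactin_euclidean_iff)
 then have sc: "seq_compact (\<Pi>\<^sub>E i\<in>(UNIV::nat set). cball (0::complex) 1)"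
  by (rule compact_imp_seq_compact)
 obtain g r where g: "strict_mono (r :: nat => nat)" "(f \<circ> r) \<longlonglongrightarrow> g"
  by (rule seq_compactE[OF sc, of f]) (use assms in auto)
 have "(%n. f (r n) i) \<longlonglongrightarrow> g i" for i
  using continuous_on_tendsto_compose[OF continuous_on_product_coordinates[of i] g(2)] by (simp add: o_def)
 then show thesis using that g by blast
qed

text \<open>The image is described by its coefficients: for bounded weights it exists by the
  Riesz-Fischer theorem, and completeness of the basis makes it unique.\<close>

definition diag_op :: "'v::complex_vector hilbert => 'v set => ('v => real) => 'v => 'v"
 where "diag_op H E ew x = (if x \<in> carr H
  then THE y. y \<in> carr H \<and> (\<forall>e\<in>E. inn H y e = of_real (ew e) * inn H x e) else 0)"

lemma (in pre_hilbert) op_comp: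
 assumes A: "A \<in> bounded_ops H" and B: "B \<in> bounded_ops H"
 shows "A \<circ> B \<in> bounded_ops H"
proof -
 note a = bounded_opsD[OF A] and b = bounded_opsD[OF B]
 obtain C where C: "C > 0" "\<And>x. x \<in> carr H ==> hnorm H (A x) <= C * hnorm H x" using op_bound[OF A] by blast
 obtain D where D: "D > 0" "\<And>x. x \<in> carr H ==> hnorm H (B x) <= D * hnorm H x" using op_bound[OF B] by blast
 have "hnorm H (A (B x)) <= (C * D) * hnorm H x" if "x \<in> carr H" for x
 proof -
  have "hnorm H (A (B x)) <= C * hnorm H (B x)" using C b that by blast
  also have "\<dots> <= C * (D * hnorm H x)" using C D that by (intro mult_left_mono) auto
  finally show ?thesis by (simp add: mult.assoc)
 qed
 then show ?thesis unfolding bounded_ops_def using a b op_zero[OF A] by (auto intro!: exI[of _ "C * D"])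
qed

lemma (in pre_hilbert) compact_sandwich:
 assumes A: "A \<in> bounded_ops H" and B: "B \<in> bounded_ops H" and G: "compact_op H G"
 shows "compact_op H (A \<circ> (G \<circ> B))"
proof -
 have Gb: "G \<in> bounded_ops H" using G by (simp add: compact_op_def)
 obtain D where D: "D > 0" "\<And>x. x \<in> carr H ==> hnorm H (B x) <= D * hnorm H x" using op_bound[OF B] by blast
 show ?thesis unfolding compact_op_def
 proof (intro conjI allI impI)
  show "A \<circ> (G \<circ> B) \<in> bounded_ops H" by (intro op_comp A B Gb)
  fix X :: "nat => 'v" assume X: "\<forall>n. X n \<in> carr H \<and> hnorm H (X n) <= 1"
  \<comment> \<open>Rescaling by the bound of \<open>B\<close> returns the vectors to the unit ball,
    where compactness of \<open>G\<close> is formulated.\<close>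
  define Y where "Y n = of_real (1 / D) *\<^sub>C B (X n)" for n
  have BX: "B (X n) \<in> carr H" for n using X bounded_opsD(1)[OF B] by blast
  have Y: "Y n \<in> carr H" for n using BX by (simp add: Y_def)
  have "hnorm H (Y n) <= 1" for n
  proof -
   have "hnorm H (B (X n)) <= D * 1" using D X by (meson mult_left_mono less_imp_le order_trans)
   then show ?thesis using BX D by (simp add: Y_def hnorm_scale norm_divide field_simps)
  qed
  then obtain r z where r: "strict_mono r" and z: "z \<in> carr H" and lim: "hlim H (%n. G (Y (r n))) z"
   using G Y unfolding compact_op_def by blast
  have GY: "G (Y n) \<in> carr H" for n using Y bounded_opsD(1)[OF Gb] by blast
  have "of_real D *\<^sub>C G (Y n) = G (B (X n))" for n
  proof -
   have "of_real D *\<^sub>C Y n = B (X n)" using D by (simp add: Y_def cvec.scale_scale)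
   then show ?thesis using bounded_opsD(3)[OF Gb Y] by metis
  qed
  moreover have "hnorm H (of_real D *\<^sub>C G (Y (r n)) - of_real D *\<^sub>C z) = D * hnorm H (G (Y (r n)) - z)" for n
   using hnorm_scale[of "G (Y (r n)) - z" "of_real D"] GY z D by (simp add: cvec.scale_right_diff_distrib)
  ultimately have "hlim H (%n. G (B (X (r n)))) (of_real D *\<^sub>C z)"
   using tendsto_mult_right_zero[OF lim[unfolded hlim_def], of D] by (simp add: hlim_def)
  then have "hlim H (%n. A (G (B (X (r n))))) (A (of_real D *\<^sub>C z))"
   by (rule op_hlim[OF A]) (use BX z bounded_opsD(1)[OF Gb] in auto)
  then show "\<exists>r y. strict_mono r \<and> y \<in> carr H \<and> hlim H (%n. (A \<circ> (G \<circ> B)) (X (r n))) y"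
   using r z bounded_opsD(1)[OF A] by (auto intro!: exI[of _ r] exI[of _ "A (of_real D *\<^sub>C z)"])
 qed
qed

lemma (in pre_hilbert) hproj_dist_antimono:
 assumes "ons H G" "finite G" "F \<subseteq> G" "x \<in> carr H"
 shows "hnorm H (x - hproj H G x) <= hnorm H (x - hproj H F x)"
proof (rule power2_le_imp_le)
 have oF: "ons H F" "finite F" using assms ons_subset finite_subset by auto
 have "(\<Sum>e\<in>F. (cmod (inn H x e))\<^sup>2) <= (\<Sum>e\<in>G. (cmod (inn H x e))\<^sup>2)"
  using assms by (intro sum_mono2) auto
 then show "(hnorm H (x - hproj H G x))\<^sup>2 <= (hnorm H (x - hproj H F x))\<^sup>2"
  using hproj_pythagoras[OF assms(1,2,4)] hproj_pythagoras[OF oF assms(4)] by simp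
 show "0 <= hnorm H (x - hproj H F x)" using oF assms by (intro hnorm_nonneg) auto
qed

text \<open>The family may be uncountable. An increasing sequence of finite sets whose coefficient
  sums approach the supremum gives a Cauchy sequence of partial sums.\<close>

lemma (in pre_hilbert) riesz_fischer:
 assumes comp: "hcomplete H" and E: "ons H E" and M: "\<And>F. finite F ==> F \<subseteq> E ==> (\<Sum>e\<in>F. (cmod (c e))\<^sup>2) <= M"
 obtains x where "x \<in> carr H" "\<And>e. e \<in> E ==> inn H x e = c e"
  "\<And>\<epsilon>. 0 < \<epsilon> ==> \<exists>F. finite F \<and> F \<subseteq> E \<and> hnorm H (x - (\<Sum>e\<in>F. c e *\<^sub>C e)) < \<epsilon>"
proof -
 define \<S> where "\<S> = {F. finite F \<and> F \<subseteq> E}"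
 define \<sigma> where "\<sigma> F = (\<Sum>e\<in>F. (cmod (c e))\<^sup>2)" for F
 define S where "S = (SUP F\<in>\<S>. \<sigma> F)"
 have bdd: "bdd_above (\<sigma> ` \<S>)" using M by (auto simp: \<S>_def \<sigma>_def intro!: bdd_aboveI2)
 have ne: "\<S> \<noteq> {}" by (auto simp: \<S>_def)
 have le: "\<sigma> F <= S" if "F \<in> \<S>" for F unfolding S_def by (rule cSUP_upper[OF that bdd])
 have "\<exists>F\<in>\<S>. S - (1/2) ^ n < \<sigma> F" for n
  using less_cSUP_iff[OF ne bdd, of "S - (1/2) ^ n"] by (simp add: S_def)
 then obtain F where F: "\<And>n. F n \<in> \<S>" "\<And>n. S - (1/2) ^ n < \<sigma> (F n)" by metis
 define G where "G n = (\<Union>i\<le>n. F i)" for n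
 have G: "G n \<in> \<S>" for n using F(1) by (auto simp: G_def \<S>_def)
 have Gf: "finite (G n)" "G n \<subseteq> E" for n using G[of n] by (auto simp: \<S>_def)
 have Gm: "n <= m ==> G n \<subseteq> G m" for n m by (fastforce simp: G_def)
 have GS: "S - (1/2) ^ n < \<sigma> (G n)" for n
 proof -
  have "\<sigma> (F n) <= \<sigma> (G n)" unfolding \<sigma>_def using Gf by (intro sum_mono2) (auto simp: G_def)
  then show ?thesis using F(2)[of n] by simp
 qed
 define X where "X n = (\<Sum>e\<in>G n. c e *\<^sub>C e)" for n
 have Xc: "X n \<in> carr H" for n using Gf E by (auto simp: X_def ons_carr subset_iff)
 have d: "(hnorm H (X m - X n))\<^sup>2 <= (1/2) ^ n" if "n <= m" for n m
 proof -
  have "X m - X n = (\<Sum>e\<in>G m - G n. c e *\<^sub>C e)"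
   unfolding X_def using Gf Gm[OF that] by (simp add: sum_diff)
  then have "(hnorm H (X m - X n))\<^sup>2 = (\<Sum>e\<in>G m - G n. (cmod (c e))\<^sup>2)"
   using hnorm_lincomb[of "G m - G n" c] E Gf ons_subset[of H E "G m - G n"] by auto
  also have "\<dots> = \<sigma> (G m) - \<sigma> (G n)" unfolding \<sigma>_def using Gf Gm[OF that] by (simp add: sum_diff)
  also have "\<dots> <= (1/2) ^ n" using le[OF G, of m] GS[of n] by simp
  finally show ?thesis .
 qed
 have small: "\<exists>N. \<forall>m\<ge>N. \<forall>n\<ge>N. hnorm H (X m - X n) < e" if e: "0 < e" for e
 proof -
  obtain N where N: "(1/2 :: real) ^ N < (e/2)\<^sup>2" using real_arch_pow_inv[of "(e/2)\<^sup>2" "1/2"] e by auto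
  have h: "hnorm H (X m - X N) < e / 2" if "m \<ge> N" for m
  proof (rule power2_less_imp_less)
   show "(hnorm H (X m - X N))\<^sup>2 < (e / 2)\<^sup>2" using d[OF that] N by simp
  qed (use e in simp)
  then have "hnorm H (X m - X n) < e" if "m \<ge> N" "n \<ge> N" for m n
   using hnorm_triangle_dist[OF Xc[of m] Xc[of N] Xc[of n]] hnorm_minus_commute[OF Xc[of N] Xc[of n]]
    h[OF that(1)] h[OF that(2)] by linarith
  then show ?thesis by blast
 qed
 then obtain x where x: "x \<in> carr H" "hlim H X x" using comp Xc unfolding hcomplete_def by blast
 have ix: "inn H x e = c e" if e: "e \<in> E" for e
 proof -
  have l: "(%n. inn H (X n) e) \<longlonglongrightarrow> inn H x e" by (rule hlim_inn[OF x(2) Xc x(1) ons_carr[OF E e]])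
  have v: "inn H (X n) e = (if e \<in> G n then c e else 0)" for n
  proof (cases "e \<in> G n")
   case True
   then show ?thesis unfolding X_def using inn_lincomb[OF ons_subset[OF E Gf(2)] Gf(1) True] by simp
  next
   case False
   have "inn H (X n) e = (\<Sum>b\<in>G n. c b * inn H b e)"
    unfolding X_def using E e Gf by (subst s_sum) (auto simp: ons_carr subset_iff s_scale intro!: sum.cong)
   also have "\<dots> = 0" using False E e Gf by (intro sum.neutral) (auto simp: ons_inn subset_iff)
   finally show ?thesis using False by simp
  qed
  show ?thesis
  proof (cases "\<exists>n. e \<in> G n")
   case True
   then obtain n where "e \<in> G n" by blast
   then have "\<forall>\<^sub>F m in sequentially. inn H (X m) e = c e"
    using Gm v by (auto simp: eventually_sequentially intro!: exI[of _ n])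
   then have "(%n. inn H (X n) e) \<longlonglongrightarrow> c e" by (rule tendsto_eventually)
   then show ?thesis using l LIMSEQ_unique by blast
  next
   \<comment> \<open>An index that is in no \<open>G n\<close> could be added to each of them. Their
     sums are within \<open>(1/2) ^ n\<close> of the supremum, so the coefficient of this index is
     0.\<close>
   case False
   have "(cmod (c e))\<^sup>2 <= (1/2) ^ n" for n
   proof -
    have "insert e (G n) \<in> \<S>" using e Gf by (auto simp: \<S>_def)
    then have "\<sigma> (insert e (G n)) <= S" by (rule le)
    then show ?thesis using False Gf GS[of n] by (simp add: \<sigma>_def)
   qed
   moreover have "(%n. (1/2 :: real) ^ n) \<longlonglongrightarrow> 0" by (intro LIMSEQ_power_zero) simp
   ultimately have "(cmod (c e))\<^sup>2 <= 0" by (intro LIMSEQ_le_const) auto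
   then have "c e = 0" by simp
   moreover have "inn H x e = 0" using l v False by (simp add: LIMSEQ_const_iff)
   ultimately show ?thesis by simp
  qed
 qed
 have "\<exists>F. finite F \<and> F \<subseteq> E \<and> hnorm H (x - (\<Sum>e\<in>F. c e *\<^sub>C e)) < \<epsilon>" if "0 < \<epsilon>" for \<epsilon>
 proof -
  have "\<forall>\<^sub>F n in sequentially. hnorm H (X n - x) < \<epsilon>"
   using order_tendstoD(2)[OF x(2)[unfolded hlim_def] that] .
  then obtain n where "hnorm H (X n - x) < \<epsilon>" by (auto simp: eventually_sequentially)
  then show ?thesis using Gf[of n] hnorm_minus_commute[OF Xc[of n] x(1)] by (auto simp: X_def intro!: exI[of _ "G n"])
 qed
 then show thesis using that x ix by blast
qed

locale onb = pre_hilbert H for H :: "'v::complex_vector hilbert" +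
 fixes E :: "'v set"
 assumes complete: "hcomplete H" and onb: "is_onb H E"
begin

lemma ons_E: "ons H E"
 using onb by (simp add: is_onb_def ons_def)

lemma E_mem [simp]: "e \<in> E ==> e \<in> carr H"
 using ons_carr[OF ons_E] .

lemma onb_zero: "x \<in> carr H ==> (\<And>e. e \<in> E ==> inn H x e = 0) ==> x = 0"
 using onb by (simp add: is_onb_def)

lemma onb_eq:
 assumes "x \<in> carr H" "y \<in> carr H" "\<And>e. e \<in> E ==> inn H x e = inn H y e"
 shows "x = y"
 using onb_zero[of "x - y"] assms by (simp add: s_diff)

text \<open>Stated for all the finite sets above \<open>F0\<close>, so that finitely many vectors
  can be expanded over one common set.\<close>

lemma expansion:
 assumes x: "x \<in> carr H" and \<epsilon>: "0 < \<epsilon>"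
 obtains F0 where "finite F0" "F0 \<subseteq> E" "\<And>F. finite F ==> F0 \<subseteq> F ==> F \<subseteq> E ==> hnorm H (x - hproj H F x) < \<epsilon>"
proof -
 have b: "(\<Sum>e\<in>F. (cmod (inn H x e))\<^sup>2) <= (hnorm H x)\<^sup>2" if "finite F" "F \<subseteq> E" for F
  by (rule bessel[OF ons_subset[OF ons_E that(2)] that(1) x])
 obtain y where y: "y \<in> carr H" "\<And>e. e \<in> E ==> inn H y e = inn H x e"
  and F: "\<exists>F. finite F \<and> F \<subseteq> E \<and> hnorm H (y - (\<Sum>e\<in>F. inn H x e *\<^sub>C e)) < \<epsilon>"
  by (rule riesz_fischer[OF complete ons_E b]) (use \<epsilon> in auto)
 have "y = x" by (rule onb_eq[OF y(1) x y(2)])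
 with F obtain F0 where F0: "finite F0" "F0 \<subseteq> E" "hnorm H (x - hproj H F0 x) < \<epsilon>" by (auto simp: hproj_def)
 have "hnorm H (x - hproj H F x) < \<epsilon>" if "finite F" "F0 \<subseteq> F" "F \<subseteq> E" for F
  using hproj_dist_antimono[OF ons_subset[OF ons_E that(3)] that(1,2) x] F0(3) by simp
 then show thesis using that F0 by blast
qed

lemma parseval:
 assumes x: "x \<in> carr H" and \<epsilon>: "0 < \<epsilon>"
 obtains F0 where "finite F0" "F0 \<subseteq> E"
  "\<And>F. finite F ==> F0 \<subseteq> F ==> F \<subseteq> E ==> (hnorm H x)\<^sup>2 < (\<Sum>e\<in>F. (cmod (inn H x e))\<^sup>2) + \<epsilon>"
proof -
 obtain F0 where F0: "finite F0" "F0 \<subseteq> E" "\<And>F. finite F ==> F0 \<subseteq> F ==> F \<subseteq> E ==> hnorm H (x - hproj H F x) < sqrt \<epsilon>"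
  using expansion[OF x, of "sqrt \<epsilon>"] \<epsilon> by auto
 have "(hnorm H x)\<^sup>2 < (\<Sum>e\<in>F. (cmod (inn H x e))\<^sup>2) + \<epsilon>" if F: "finite F" "F0 \<subseteq> F" "F \<subseteq> E" for F
 proof -
  have oF: "ons H F" using ons_subset[OF ons_E F(3)] .
  have "(hnorm H (x - hproj H F x))\<^sup>2 < (sqrt \<epsilon>)\<^sup>2"
   using F0(3)[OF F] oF x by (intro power_strict_mono hnorm_nonneg) auto
  then show ?thesis using hproj_pythagoras[OF oF F(1) x] \<epsilon> by simp
 qed
 then show thesis using that F0 by blast
qed

lemma norm_le_of_coeffs:
 assumes u: "u \<in> carr H" and v: "v \<in> carr H" and K: "0 <= K"
  and le: "\<And>e. e \<in> E ==> cmod (inn H v e) <= K * cmod (inn H u e)"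
 shows "hnorm H v <= K * hnorm H u"
proof (rule power2_le_imp_le)
 have "(hnorm H v)\<^sup>2 <= (K * hnorm H u)\<^sup>2 + \<epsilon>" if \<epsilon>: "0 < \<epsilon>" for \<epsilon>
 proof -
  obtain F where F: "finite F" "F \<subseteq> E" "(hnorm H v)\<^sup>2 < (\<Sum>e\<in>F. (cmod (inn H v e))\<^sup>2) + \<epsilon>"
   using parseval[OF v \<epsilon>] by (metis order_refl)
  have "(\<Sum>e\<in>F. (cmod (inn H v e))\<^sup>2) <= (\<Sum>e\<in>F. (K * cmod (inn H u e))\<^sup>2)"
   using F le by (intro sum_mono power_mono) auto
  also have "\<dots> = K\<^sup>2 * (\<Sum>e\<in>F. (cmod (inn H u e))\<^sup>2)" by (simp add: power_mult_distrib sum_distrib_left)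
  also have "\<dots> <= K\<^sup>2 * (hnorm H u)\<^sup>2"
   by (intro mult_left_mono bessel[OF ons_subset[OF ons_E F(2)] F(1) u]) simp
  finally show ?thesis using F(3) by (simp add: power_mult_distrib)
 qed
 then show "(hnorm H v)\<^sup>2 <= (K * hnorm H u)\<^sup>2" by (rule field_le_epsilon)
 show "0 <= K * hnorm H u" using K hnorm_nonneg[OF u] by simp
qed

lemma bounded_ops_eq_on_basis:
 assumes A: "A \<in> bounded_ops H" and B: "B \<in> bounded_ops H" and eq: "\<And>e. e \<in> E ==> A e = B e"
 shows "A = B"
proof (rule op_ext[OF A B])
 fix x assume x: "x \<in> carr H"
 note a = bounded_opsD[OF A] and b = bounded_opsD[OF B]
 obtain C where C: "C > 0" "\<And>x. x \<in> carr H ==> hnorm H (A x) <= C * hnorm H x" using op_bound[OF A] by blast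
 obtain D where D: "D > 0" "\<And>x. x \<in> carr H ==> hnorm H (B x) <= D * hnorm H x" using op_bound[OF B] by blast
 have "hnorm H (A x - B x) <= 0 + \<epsilon>" if \<epsilon>: "0 < \<epsilon>" for \<epsilon>
 proof -
  have "0 < \<epsilon> / (C + D)" using C D \<epsilon> by simp
  from expansion[OF x this] obtain F where F: "finite F" "F \<subseteq> E" "hnorm H (x - hproj H F x) < \<epsilon> / (C + D)"
   by (metis order_refl)
  have oF: "ons H F" using ons_subset[OF ons_E F(2)] .
  define y where "y = x - hproj H F x"
  have y: "y \<in> carr H" using x oF by (simp add: y_def)
  have "A (hproj H F x) = B (hproj H F x)"
   unfolding hproj_def using F oF
   by (subst op_sum[OF A], simp add: ons_carr, subst op_sum[OF B], simp add: ons_carr)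
    (intro sum.cong refl, simp add: a(3) b(3) ons_carr eq subset_iff)
  then have "A x - B x = A y - B y" using x oF by (simp add: y_def op_diff[OF A] op_diff[OF B])
  then have "hnorm H (A x - B x) <= C * hnorm H y + D * hnorm H y"
   using hnorm_triangle_diff[of "A y" "B y"] C(2)[OF y] D(2)[OF y] a(1)[OF y] b(1)[OF y] by simp
  also have "\<dots> = (C + D) * hnorm H y" by (simp add: distrib_right)
  also have "\<dots> <= (C + D) * (\<epsilon> / (C + D))" using F(3) C D by (intro mult_left_mono) (auto simp: y_def)
  finally show ?thesis using C D by simp
 qed
 then have "hnorm H (A x - B x) <= 0" by (rule field_le_epsilon)
 moreover have "A x - B x \<in> carr H" using a b x by simp
 ultimately have "A x - B x = 0" using hnorm_eq_0 hnorm_nonneg by force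
 then show "A x = B x" by simp
qed

context
 fixes ew :: "'v => real" and C :: real
 assumes C: "\<And>e. e \<in> E ==> \<bar>ew e\<bar> <= C" and C0: "0 <= C"
begin

lemma diag_op_char:
 assumes x: "x \<in> carr H"
 shows "diag_op H E ew x \<in> carr H \<and> (\<forall>e\<in>E. inn H (diag_op H E ew x) e = of_real (ew e) * inn H x e)"
proof -
 have M: "(\<Sum>e\<in>F. (cmod (of_real (ew e) * inn H x e))\<^sup>2) <= C\<^sup>2 * (hnorm H x)\<^sup>2" if F: "finite F" "F \<subseteq> E" for F
 proof -
  have "(\<Sum>e\<in>F. (cmod (of_real (ew e) * inn H x e))\<^sup>2) <= (\<Sum>e\<in>F. (C * cmod (inn H x e))\<^sup>2)"
   using F C by (intro sum_mono power_mono) (auto simp: norm_mult intro!: mult_right_mono)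
  also have "\<dots> = C\<^sup>2 * (\<Sum>e\<in>F. (cmod (inn H x e))\<^sup>2)" by (simp add: power_mult_distrib sum_distrib_left)
  also have "\<dots> <= C\<^sup>2 * (hnorm H x)\<^sup>2"
   by (intro mult_left_mono bessel[OF ons_subset[OF ons_E F(2)] F(1) x]) simp
  finally show ?thesis .
 qed
 obtain y where y: "y \<in> carr H" "\<And>e. e \<in> E ==> inn H y e = of_real (ew e) * inn H x e"
  by (rule riesz_fischer[OF complete ons_E M]) auto
 have "\<exists>!y. y \<in> carr H \<and> (\<forall>e\<in>E. inn H y e = of_real (ew e) * inn H x e)"
  by (rule ex1I[of _ y]) (use y onb_eq in auto)
 from theI'[OF this] show ?thesis using x by (simp add: diag_op_def)
qed

lemma diag_mem [simp]: "x \<in> carr H ==> diag_op H E ew x \<in> carr H"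
 using diag_op_char by blast

lemma diag_inn: "x \<in> carr H ==> e \<in> E ==> inn H (diag_op H E ew x) e = of_real (ew e) * inn H x e"
 using diag_op_char by blast

lemma diag_norm: "x \<in> carr H ==> hnorm H (diag_op H E ew x) <= C * hnorm H x"
 using C by (intro norm_le_of_coeffs C0) (auto simp: diag_inn norm_mult intro!: mult_right_mono)

lemma diag_bounded: "diag_op H E ew \<in> bounded_ops H"
 unfolding bounded_ops_def
proof (intro CollectI conjI ballI allI impI)
 fix x y assume xy: "x \<in> carr H" "y \<in> carr H"
 show "diag_op H E ew (x + y) = diag_op H E ew x + diag_op H E ew y"
  using xy by (intro onb_eq) (auto simp: diag_inn s_add distrib_left)
next
 fix a x assume x: "x \<in> carr H"
 show "diag_op H E ew (a *\<^sub>C x) = a *\<^sub>C diag_op H E ew x"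
  using x by (intro onb_eq) (auto simp: diag_inn s_scale)
next
 show "\<exists>C. \<forall>x\<in>carr H. hnorm H (diag_op H E ew x) <= C * hnorm H x" using diag_norm by blast
next
 fix x assume "x \<notin> carr H" then show "diag_op H E ew x = 0" by (simp add: diag_op_def)
qed (rule diag_mem)

lemma diag_basis:
 assumes "e \<in> E" shows "diag_op H E ew e = of_real (ew e) *\<^sub>C e"
 using assms by (intro onb_eq) (auto simp: diag_inn s_scale ons_inn[OF ons_E])

lemma diag_form_approx:
 assumes y: "y \<in> carr H" and \<epsilon>: "0 < \<epsilon>"
 obtains F0 where "finite F0" "F0 \<subseteq> E" "\<And>F. finite F ==> F0 \<subseteq> F ==> F \<subseteq> E ==>
  cmod (inn H (diag_op H E ew y) y - of_real (\<Sum>e\<in>F. ew e * (cmod (inn H y e))\<^sup>2)) < \<epsilon>"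
proof -
 define K where "K = C * hnorm H y + 1"
 have K: "0 < K" using C0 hnorm_nonneg[OF y] by (simp add: K_def add_nonneg_pos)
 obtain F0 where F0: "finite F0" "F0 \<subseteq> E" "\<And>F. finite F ==> F0 \<subseteq> F ==> F \<subseteq> E ==> hnorm H (y - hproj H F y) < \<epsilon> / K"
  using expansion[OF y, of "\<epsilon> / K"] \<epsilon> K by auto
 have "cmod (inn H (diag_op H E ew y) y - of_real (\<Sum>e\<in>F. ew e * (cmod (inn H y e))\<^sup>2)) < \<epsilon>"
  if F: "finite F" "F0 \<subseteq> F" "F \<subseteq> E" for F
 proof -
  have oF: "ons H F" using ons_subset[OF ons_E F(3)] .
  have "inn H (diag_op H E ew y) (hproj H F y) = (\<Sum>e\<in>F. cnj (inn H y e) * inn H (diag_op H E ew y) e)"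
   using oF F y by (subst inn_hproj) auto
  also have "\<dots> = (\<Sum>e\<in>F. of_real (ew e * (cmod (inn H y e))\<^sup>2))"
  proof (rule sum.cong[OF refl])
   fix e assume "e \<in> F"
   then have "cnj (inn H y e) * inn H (diag_op H E ew y) e = of_real (ew e) * (cnj (inn H y e) * inn H y e)"
    using F y by (subst diag_inn) auto
   then show "cnj (inn H y e) * inn H (diag_op H E ew y) e = of_real (ew e * (cmod (inn H y e))\<^sup>2)"
    by (simp only: mult_cnj_cmod) simp
  qed
  finally have "inn H (diag_op H E ew y) y - of_real (\<Sum>e\<in>F. ew e * (cmod (inn H y e))\<^sup>2)
   = inn H (diag_op H E ew y) (y - hproj H F y)"
   using oF y by (simp add: s_diff_right)
  also have "cmod \<dots> <= hnorm H (diag_op H E ew y) * hnorm H (y - hproj H F y)" using oF y by (intro CS) auto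
  also have "\<dots> <= K * hnorm H (y - hproj H F y)"
   using diag_norm[OF y] oF y by (intro mult_right_mono hnorm_nonneg) (auto simp: K_def)
  also have "\<dots> < K * (\<epsilon> / K)" using F0(3)[OF F] K by (intro mult_strict_left_mono)
  finally show ?thesis using K by simp
 qed
 then show thesis using that F0 by blast
qed

lemma diag_form_real:
 assumes y: "y \<in> carr H" shows "Im (inn H (diag_op H E ew y) y) = 0"
proof -
 have "\<bar>Im (inn H (diag_op H E ew y) y)\<bar> <= 0 + \<epsilon>" if \<epsilon>: "0 < \<epsilon>" for \<epsilon>
 proof -
  obtain F where F: "finite F" "F \<subseteq> E" "\<And>F'. finite F' ==> F \<subseteq> F' ==> F' \<subseteq> E ==>
   cmod (inn H (diag_op H E ew y) y - of_real (\<Sum>e\<in>F'. ew e * (cmod (inn H y e))\<^sup>2)) < \<epsilon>"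
   using diag_form_approx[OF y \<epsilon>] by blast
  from F(3)[OF F(1) order_refl F(2)] show ?thesis
   using abs_Im_le_cmod[of "inn H (diag_op H E ew y) y - of_real (\<Sum>e\<in>F. ew e * (cmod (inn H y e))\<^sup>2)"] by simp
 qed
 then have "\<bar>Im (inn H (diag_op H E ew y) y)\<bar> <= 0" by (rule field_le_epsilon)
 then show ?thesis by simp
qed

lemma diag_form_lower:
 assumes y: "y \<in> carr H" and nn: "\<And>e. e \<in> E ==> 0 <= ew e" and F: "finite F" "F \<subseteq> E"
 shows "(\<Sum>e\<in>F. ew e * (cmod (inn H y e))\<^sup>2) <= qform H (diag_op H E ew) y"
proof (rule field_le_epsilon)
 fix \<epsilon> :: real assume \<epsilon>: "0 < \<epsilon>"
 obtain F0 where F0: "finite F0" "F0 \<subseteq> E" "\<And>F. finite F ==> F0 \<subseteq> F ==> F \<subseteq> E ==>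
  cmod (inn H (diag_op H E ew y) y - of_real (\<Sum>e\<in>F. ew e * (cmod (inn H y e))\<^sup>2)) < \<epsilon>"
  using diag_form_approx[OF y \<epsilon>] by blast
 let ?G = "F0 \<union> F"
 have "\<bar>Re (inn H (diag_op H E ew y) y - of_real (\<Sum>e\<in>?G. ew e * (cmod (inn H y e))\<^sup>2))\<bar> < \<epsilon>"
  by (rule le_less_trans[OF abs_Re_le_cmod F0(3)]) (use F F0 in auto)
 then have "(\<Sum>e\<in>?G. ew e * (cmod (inn H y e))\<^sup>2) <= qform H (diag_op H E ew) y + \<epsilon>"
  by (simp add: qform_def)
 moreover have "(\<Sum>e\<in>F. ew e * (cmod (inn H y e))\<^sup>2) <= (\<Sum>e\<in>?G. ew e * (cmod (inn H y e))\<^sup>2)"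
  using F F0 nn by (intro sum_mono2) auto
 ultimately show "(\<Sum>e\<in>F. ew e * (cmod (inn H y e))\<^sup>2) <= qform H (diag_op H E ew) y + \<epsilon>" by simp
qed

lemma diag_positive:
 assumes nn: "\<And>e. e \<in> E ==> 0 <= ew e"
 shows "positive_op H (diag_op H E ew)"
 unfolding positive_op_def
proof (intro conjI ballI)
 fix x assume x: "x \<in> carr H"
 show "Im (inn H (diag_op H E ew x) x) = 0" by (rule diag_form_real[OF x])
 show "0 <= Re (inn H (diag_op H E ew x) x)"
  using diag_form_lower[OF x nn, of "{}"] by (simp add: qform_def)
qed (rule diag_bounded)

text \<open>\<open>T\<close> is a parameter because the form is evaluated at images of an
  orthonormal family under a bounded operator, and for traces at the family itself.\<close>

lemma diag_form_upper:
 assumes X: "finite X" and XE: "\<And>x. x \<in> X ==> T x \<in> carr H" and \<epsilon>: "0 < \<epsilon>"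
 obtains F where "finite F" "F \<subseteq> E"
  "(\<Sum>x\<in>X. qform H (diag_op H E ew) (T x)) <= (\<Sum>e\<in>F. ew e * (\<Sum>x\<in>X. (cmod (inn H (T x) e))\<^sup>2)) + \<epsilon>"
proof -
 define \<delta> where "\<delta> = \<epsilon> / (1 + card X)"
 have \<delta>: "0 < \<delta>" using \<epsilon> by (simp add: \<delta>_def)
 have "\<forall>x\<in>X. \<exists>F0. finite F0 \<and> F0 \<subseteq> E \<and> (\<forall>F. finite F \<longrightarrow> F0 \<subseteq> F \<longrightarrow> F \<subseteq> E \<longrightarrow>
  cmod (inn H (diag_op H E ew (T x)) (T x) - of_real (\<Sum>e\<in>F. ew e * (cmod (inn H (T x) e))\<^sup>2)) < \<delta>)"
  (is "\<forall>x\<in>X. \<exists>F0. ?P x F0")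
 proof
  fix x assume x: "x \<in> X"
  obtain F0 where F0: "finite F0" "F0 \<subseteq> E" "\<And>F. finite F ==> F0 \<subseteq> F ==> F \<subseteq> E ==>
   cmod (inn H (diag_op H E ew (T x)) (T x) - of_real (\<Sum>e\<in>F. ew e * (cmod (inn H (T x) e))\<^sup>2)) < \<delta>"
   using diag_form_approx[OF XE[OF x] \<delta>] by blast
  show "\<exists>F0. ?P x F0" by (intro exI[of _ F0] conjI allI impI F0)
 qed
 from bchoice[OF this] obtain F0 where P: "\<forall>x\<in>X. ?P x (F0 x)" by blast
 then have F0: "\<And>x. x \<in> X ==> finite (F0 x)" "\<And>x. x \<in> X ==> F0 x \<subseteq> E"
  "\<And>x F. x \<in> X ==> finite F ==> F0 x \<subseteq> F ==> F \<subseteq> E ==>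
  cmod (inn H (diag_op H E ew (T x)) (T x) - of_real (\<Sum>e\<in>F. ew e * (cmod (inn H (T x) e))\<^sup>2)) < \<delta>"
  by (auto simp del: of_real_sum)
 define F where "F = (\<Union>x\<in>X. F0 x)"
 have F: "finite F" "F \<subseteq> E" using F0 X by (auto simp: F_def)
 have "(\<Sum>x\<in>X. qform H (diag_op H E ew) (T x)) <= (\<Sum>x\<in>X. (\<Sum>e\<in>F. ew e * (cmod (inn H (T x) e))\<^sup>2) + \<delta>)"
 proof (rule sum_mono)
  fix x assume x: "x \<in> X"
  have "\<bar>Re (inn H (diag_op H E ew (T x)) (T x) - of_real (\<Sum>e\<in>F. ew e * (cmod (inn H (T x) e))\<^sup>2))\<bar> < \<delta>"
   by (rule le_less_trans[OF abs_Re_le_cmod F0(3)]) (use x F in \<open>auto simp: F_def\<close>)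
  then show "qform H (diag_op H E ew) (T x) <= (\<Sum>e\<in>F. ew e * (cmod (inn H (T x) e))\<^sup>2) + \<delta>"
   by (simp add: qform_def)
 qed
 also have "\<dots> = (\<Sum>e\<in>F. ew e * (\<Sum>x\<in>X. (cmod (inn H (T x) e))\<^sup>2)) + card X * \<delta>"
  by (simp add: sum.distrib sum.swap[of _ F] sum_distrib_left)
 also have "card X * \<delta> <= \<epsilon>" using \<epsilon> by (simp add: \<delta>_def field_simps)
 finally show thesis using that F by simp
qed

end

end

section \<open>Functional calculus, compactness and traces of diagonal operators\<close>

context onb
begin

text \<open>Pins down the description in \<open>fun_calc\<close>. An eigenvector for
  \<open>s\<close> has nonzero coefficients only at basis vectors with \<open>t e = s\<close>, so
  the diagonal operator acts on it by \<open>g s\<close>; conversely the values on the basis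
  determine a bounded operator.\<close>

lemma fun_calc_eq_diag:
 assumes D1: "\<And>e. e \<in> E ==> (e, of_real (t e) *\<^sub>C e) \<in> D"
  and D2: "\<And>u v. (u, v) \<in> D ==> u \<in> carr H \<and> v \<in> carr H \<and> (\<forall>e\<in>E. inn H v e = of_real (t e) * inn H u e)"
  and C: "\<And>e. e \<in> E ==> \<bar>g (t e)\<bar> <= C" "0 <= C"
 shows "fun_calc H D g = diag_op H E (%e. g (t e))"
 unfolding fun_calc_def
proof (rule the_equality)
 show "diag_op H E (%e. g (t e)) \<in> bounded_ops H \<and>
  (\<forall>u s. (u, of_real s *\<^sub>C u) \<in> D \<longrightarrow> diag_op H E (%e. g (t e)) u = of_real (g s) *\<^sub>C u)"
 proof (intro conjI allI impI)
  show "diag_op H E (%e. g (t e)) \<in> bounded_ops H" by (rule diag_bounded[OF C])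
  fix u s assume "(u, of_real s *\<^sub>C u) \<in> D"
  then have u: "u \<in> carr H" and c: "\<And>e. e \<in> E ==> inn H (of_real s *\<^sub>C u) e = of_real (t e) * inn H u e" using D2 by blast+
  show "diag_op H E (%e. g (t e)) u = of_real (g s) *\<^sub>C u"
  proof (rule onb_eq)
   fix e assume e: "e \<in> E"
   have "s = t e \<or> inn H u e = 0" using c[OF e] u e by (auto simp: s_scale)
   then show "inn H (diag_op H E (%e. g (t e)) u) e = inn H (of_real (g s) *\<^sub>C u) e"
    using u e by (auto simp: diag_inn[OF C] s_scale)
  qed (use u in \<open>auto intro: diag_mem[OF C]\<close>)
 qed
 fix B assume B: "B \<in> bounded_ops H \<and> (\<forall>u s. (u, of_real s *\<^sub>C u) \<in> D \<longrightarrow> B u = of_real (g s) *\<^sub>C u)"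
 show "B = diag_op H E (%e. g (t e))"
 proof (rule bounded_ops_eq_on_basis)
  show "B e = diag_op H E (%e. g (t e)) e" if "e \<in> E" for e
   using B D1[OF that] diag_basis[OF C that] by simp
 qed (use B diag_bounded[OF C] in auto)
qed

text \<open>Pass to a subsequence along which the coefficients at all nonzero weights converge. The
  finitely many large weights then act on small coefficients, and the small weights act on bounded
  vectors.\<close>

lemma diag_compact:
 assumes C: "\<And>e. e \<in> E ==> \<bar>ew e\<bar> <= C" "0 <= C"
  and fin: "\<And>\<tau>. 0 < \<tau> ==> finite {e\<in>E. \<bar>ew e\<bar> > \<tau>}"
 shows "compact_op H (diag_op H E ew)"
 unfolding compact_op_def
proof (intro conjI allI impI)
 let ?D = "diag_op H E ew"
 have Db: "?D \<in> bounded_ops H" by (rule diag_bounded[OF C])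
 show "?D \<in> bounded_ops H" by (rule Db)
 fix X :: "nat => 'v" assume X: "\<forall>n. X n \<in> carr H \<and> hnorm H (X n) <= 1"
 define P where "P = {e\<in>E. ew e \<noteq> 0}"
 have "P \<subseteq> (\<Union>n. {e\<in>E. \<bar>ew e\<bar> > 1 / real (Suc n)})"
 proof
  fix e assume "e \<in> P"
  then have "e \<in> E" "0 < \<bar>ew e\<bar>" by (auto simp: P_def)
  then show "e \<in> (\<Union>n. {e\<in>E. \<bar>ew e\<bar> > 1 / real (Suc n)})"
   using reals_Archimedean[of "\<bar>ew e\<bar>"] by (auto simp: inverse_eq_divide)
 qed
 moreover have "countable (\<Union>n. {e\<in>E. \<bar>ew e\<bar> > 1 / real (Suc n)})"
  by (rule countable_UN, simp, rule countable_finite, rule fin, simp)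
 ultimately have cP: "countable P" by (rule countable_subset)
 \<comment> \<open>\<open>from_nat_into\<close> returns an arbitrary point when \<open>P\<close> is
   empty; the guard keeps the values bounded by 1 in that case.\<close>
 define f where "f n i = (if from_nat_into P i \<in> E then inn H (X n) (from_nat_into P i) else 0)" for n i
 have "cmod (f n i) <= 1" for n i
 proof (cases "from_nat_into P i \<in> E")
  case True
  have "cmod (inn H (X n) (from_nat_into P i)) <= hnorm H (X n) * hnorm H (from_nat_into P i)"
   using X True by (intro CS) auto
  then show ?thesis using X ons_norm[OF ons_E True] True by (simp add: f_def) (meson order_trans)
 qed (simp add: f_def)
 then obtain r g where r: "strict_mono (r :: nat => nat)" and g: "\<And>i. (%n. f (r n) i) \<longlonglongrightarrow> g i"
  using coordinatewise_subsequence[of f] by blast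
 define h where "h e = g (to_nat_on P e)" for e
 have h: "(%n. inn H (X (r n)) e) \<longlonglongrightarrow> h e" if e: "e \<in> P" for e
  using g[of "to_nat_on P e"] e from_nat_into_to_nat_on[OF cP e] by (simp add: f_def h_def P_def)
 have Xc: "X n \<in> carr H" "hnorm H (X n) <= 1" for n using X by auto
 have "\<exists>N. \<forall>m\<ge>N. \<forall>n\<ge>N. hnorm H (?D (X (r m)) - ?D (X (r n))) < \<epsilon>" if \<epsilon>: "0 < \<epsilon>" for \<epsilon>
 proof -
  \<comment> \<open>The small weights act on a difference of norm at most 2 and contribute at most
    \<open>\<epsilon> / 3\<close>; the constant \<open>\<delta>\<close> below is chosen so that the
    large weights contribute at most \<open>\<epsilon> / 2\<close>.\<close>
  define \<tau> where "\<tau> = \<epsilon> / 6"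
  have \<tau>: "0 < \<tau>" using \<epsilon> by (simp add: \<tau>_def)
  define F where "F = {e\<in>E. \<bar>ew e\<bar> > \<tau>}"
  have F: "finite F" "F \<subseteq> E" "F \<subseteq> P" using fin[OF \<tau>] \<tau> by (auto simp: F_def P_def)
  have oF: "ons H F" using ons_subset[OF ons_E F(2)] .
  define \<delta> where "\<delta> = \<epsilon> / (4 * (C + 1) * (card F + 1))"
  have \<delta>: "0 < \<delta>" using \<epsilon> C(2) by (simp add: \<delta>_def)
  have "\<forall>\<^sub>F n in sequentially. \<forall>e\<in>F. cmod (inn H (X (r n)) e - h e) < \<delta>"
  proof (rule eventually_ball_finite[OF F(1)], rule ballI)
   fix e assume "e \<in> F"
   then show "\<forall>\<^sub>F n in sequentially. cmod (inn H (X (r n)) e - h e) < \<delta>"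
    using tendstoD[OF h \<delta>, of e] F by (auto simp: dist_norm)
  qed
  then obtain N where N: "\<And>n e. n \<ge> N ==> e \<in> F ==> cmod (inn H (X (r n)) e - h e) < \<delta>"
   by (auto simp: eventually_sequentially)
  have "hnorm H (?D (X (r m)) - ?D (X (r n))) < \<epsilon>" if mn: "m \<ge> N" "n \<ge> N" for m n
  proof -
   define u where "u = X (r m) - X (r n)"
   have u: "u \<in> carr H" using Xc by (simp add: u_def)
   have u2: "hnorm H u <= 2" using hnorm_triangle_diff[OF Xc(1)[of "r m"] Xc(1)[of "r n"]] Xc(2)[of "r m"] Xc(2)[of "r n"]
    by (simp add: u_def)
   define p where "p = hproj H F u"
   define z where "z = u - p"
   have pz: "p \<in> carr H" "z \<in> carr H" "u = p + z" using u oF by (auto simp: p_def z_def)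
   have z2: "hnorm H z <= 2"
    using hproj_dist_antimono[OF oF F(1), of "{}" u] u u2 by (simp add: z_def p_def) (simp add: hproj_def)
   have "hnorm H (?D z) <= \<tau> * hnorm H z"
   proof (rule norm_le_of_coeffs[OF pz(2)])
    fix e assume e: "e \<in> E"
    show "cmod (inn H (?D z) e) <= \<tau> * cmod (inn H z e)"
    proof (cases "e \<in> F")
     case True then show ?thesis using hproj_orth[OF oF F(1) True u] e pz(2)
      by (simp add: diag_inn[OF C] z_def p_def)
    next
     case False then show ?thesis using e pz(2)
      by (simp add: diag_inn[OF C] norm_mult F_def mult_right_mono)
    qed
   qed (use \<tau> diag_mem[OF C pz(2)] in auto)
   also have "\<dots> <= \<tau> * 2" using z2 \<tau> by (intro mult_left_mono) auto
   finally have Dz: "hnorm H (?D z) <= \<epsilon> / 3" by (simp add: \<tau>_def)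
   have Dp: "hnorm H (?D p) <= card F * (C * (2 * \<delta>))"
   proof (rule power2_le_imp_le)
    have "?D p = (\<Sum>e\<in>F. (inn H u e * of_real (ew e)) *\<^sub>C e)"
     unfolding p_def hproj_def using F oF
     by (subst op_sum[OF Db]) (auto simp: ons_carr bounded_opsD(3)[OF Db] diag_basis[OF C] subset_iff cvec.scale_scale intro!: sum.cong)
    then have "(hnorm H (?D p))\<^sup>2 = (\<Sum>e\<in>F. (cmod (inn H u e * of_real (ew e)))\<^sup>2)"
     using hnorm_lincomb[OF oF F(1)] by simp
    also have "\<dots> <= (\<Sum>e\<in>F. (C * (2 * \<delta>))\<^sup>2)"
    proof (rule sum_mono, rule power_mono)
     fix e assume e: "e \<in> F"
     have ec: "e \<in> carr H" using e oF ons_carr by blast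
     have "inn H u e = (inn H (X (r m)) e - h e) - (inn H (X (r n)) e - h e)"
      using Xc ec by (simp add: u_def s_diff)
     then have "cmod (inn H u e) <= \<delta> + \<delta>"
      using N[OF mn(1) e] N[OF mn(2) e] norm_triangle_ineq4[of "inn H (X (r m)) e - h e" "inn H (X (r n)) e - h e"] by simp
     then have "cmod (inn H u e) * \<bar>ew e\<bar> <= (2 * \<delta>) * C"
      using C(1)[of e] e F \<delta> by (intro mult_mono) auto
     then show "cmod (inn H u e * of_real (ew e)) <= C * (2 * \<delta>)" by (simp add: norm_mult mult.commute)
    qed simp
    also have "\<dots> = card F * (C * (2 * \<delta>))\<^sup>2" by simp
    also have "\<dots> <= (real (card F))\<^sup>2 * (C * (2 * \<delta>))\<^sup>2"
    proof (rule mult_right_mono)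
     have "real n <= (real n)\<^sup>2" for n by (cases n) (auto simp: power2_eq_square)
     then show "real (card F) <= (real (card F))\<^sup>2" .
    qed simp
    finally show "(hnorm H (?D p))\<^sup>2 <= (card F * (C * (2 * \<delta>)))\<^sup>2" by (simp add: power_mult_distrib)
   qed (use C(2) \<delta> in auto)
   have "card F * (C * (2 * \<delta>)) <= (card F + 1) * ((C + 1) * (2 * \<delta>))"
    using C(2) \<delta> by (intro mult_mono) auto
   also have "\<dots> = \<epsilon> / 2"
   proof -
    have "b * (a * (2 * (\<epsilon> / (4 * a * b)))) = \<epsilon> / 2" if "a \<noteq> 0" "b \<noteq> 0" for a b :: real
     using that by (simp add: field_simps)
    from this[of "C + 1" "real (card F) + 1"] show ?thesis using C(2) by (simp add: \<delta>_def add.commute)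
   qed
   finally have "hnorm H (?D p) <= \<epsilon> / 2" using Dp by simp
   moreover have "?D (X (r m)) - ?D (X (r n)) = ?D p + ?D z"
    using op_diff[OF Db Xc(1)[of "r m"] Xc(1)[of "r n"]] bounded_opsD(2)[OF Db pz(1,2)] pz(3) by (simp add: u_def)
   ultimately show ?thesis
    using hnorm_triangle[OF bounded_opsD(1)[OF Db pz(1)] bounded_opsD(1)[OF Db pz(2)]] Dz \<epsilon> by simp
  qed
  then show ?thesis by blast
 qed
 then obtain y where "y \<in> carr H" "hlim H (%n. ?D (X (r n))) y"
  using complete[unfolded hcomplete_def, THEN spec, of "%n. ?D (X (r n))"] bounded_opsD(1)[OF Db Xc(1)] by blast
 then show "\<exists>r y. strict_mono r \<and> y \<in> carr H \<and> hlim H (%n. ?D (X (r n))) y" using r by blast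
qed

section \<open>Ky Fan bounds for a diagonal operator between an operator and its adjoint\<close>

context
 fixes ew :: "'v => real" and C :: real and T T' :: "'v => 'v" and M :: real
 assumes C: "\<And>e. e \<in> E ==> \<bar>ew e\<bar> <= C" "0 <= C" and nn: "\<And>e. e \<in> E ==> 0 <= ew e"
  and T: "T \<in> bounded_ops H" "T' \<in> bounded_ops H"
  and adj: "\<And>x y. x \<in> carr H ==> y \<in> carr H ==> inn H (T x) y = inn H x (T' y)"
  and M: "\<And>x. x \<in> carr H ==> hnorm H (T' x) <= M * hnorm H x"
begin

abbreviation (input) "sandw \<equiv> T \<circ> (diag_op H E ew \<circ> T')"

lemma sandwich_form: "x \<in> carr H ==> inn H (sandw x) x = inn H (diag_op H E ew (T' x)) (T' x)"
 using adj[of "diag_op H E ew (T' x)" x] bounded_opsD(1)[OF T(2)] diag_mem[OF C] by simp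

lemma sandwich_positive: "positive_op H sandw"
 unfolding positive_op_def
proof (intro conjI ballI)
 show "sandw \<in> bounded_ops H" by (intro op_comp T diag_bounded[OF C])
 fix x assume x: "x \<in> carr H"
 have T'x: "T' x \<in> carr H" using bounded_opsD(1)[OF T(2) x] .
 show "Im (inn H (sandw x) x) = 0" "0 <= Re (inn H (sandw x) x)"
  using sandwich_form[OF x] positive_opD(2,3)[OF diag_positive[OF C nn] T'x] by auto
qed

lemma sandwich_qform: "x \<in> carr H ==> qform H sandw x = qform H (diag_op H E ew) (T' x)"
 using sandwich_form by (simp add: qform_def)

text \<open>For indices in \<open>I\<close> the operator is moved onto the basis vector, and
  Bessel's inequality for the test family bounds the total by \<open>(hnorm H (T e))^2\<close>,
  whatever its size. Outside \<open>I\<close> the weights are at most \<open>s\<close>, and each of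
  at most \<open>N\<close> test vectors has an image of norm at most \<open>M\<close>.\<close>

lemma sandwich_ky_fan_upper:
 assumes U: "\<And>F. finite F ==> F \<subseteq> E \<inter> I ==> (\<Sum>e\<in>F. ew e * (hnorm H (T e))\<^sup>2) <= U"
  and s: "\<And>e. e \<in> E ==> e \<notin> I ==> ew e <= s" "0 <= s"
 shows "ky_fan H (qform H sandw) N <= U + s * real N * M\<^sup>2"
proof (rule ky_fan_least)
 fix X assume X: "finite X" "ons H X" "card X <= N"
 have Xc: "x \<in> carr H" if "x \<in> X" for x using ons_carr[OF X(2) that] .
 have TXc: "T' x \<in> carr H" if "x \<in> X" for x using bounded_opsD(1)[OF T(2) Xc[OF that]] .
 show "(\<Sum>x\<in>X. qform H sandw x) <= U + s * real N * M\<^sup>2"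
 proof (rule field_le_epsilon)
  fix \<epsilon> :: real assume \<epsilon>: "0 < \<epsilon>"
  obtain F where F: "finite F" "F \<subseteq> E"
   "(\<Sum>x\<in>X. qform H (diag_op H E ew) (T' x)) <= (\<Sum>e\<in>F. ew e * (\<Sum>x\<in>X. (cmod (inn H (T' x) e))\<^sup>2)) + \<epsilon>"
   by (rule diag_form_upper[OF C X(1) TXc \<epsilon>])
  define \<tau> where "\<tau> e = (\<Sum>x\<in>X. (cmod (inn H (T' x) e))\<^sup>2)" for e
  have \<tau>0: "0 <= \<tau> e" for e by (simp add: \<tau>_def sum_nonneg)
  have "(\<Sum>e\<in>F. ew e * \<tau> e) = (\<Sum>e\<in>F \<inter> I. ew e * \<tau> e) + (\<Sum>e\<in>F - I. ew e * \<tau> e)"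
   by (rule sum.Int_Diff[OF F(1)])
  also have "(\<Sum>e\<in>F \<inter> I. ew e * \<tau> e) <= (\<Sum>e\<in>F \<inter> I. ew e * (hnorm H (T e))\<^sup>2)"
  proof (intro sum_mono mult_left_mono)
   fix e assume e: "e \<in> F \<inter> I"
   then have eE: "e \<in> E" using F by blast
   have Te: "T e \<in> carr H" using bounded_opsD(1)[OF T(1)] eE by simp
   have "cmod (inn H (T' x) e) = cmod (inn H x (T e))" if "x \<in> X" for x
    using adj[OF E_mem[OF eE] Xc[OF that]] cmod_inn_commute[OF TXc[OF that] E_mem[OF eE]]
     cmod_inn_commute[OF Xc[OF that] Te] by simp
   then have "\<tau> e = (\<Sum>x\<in>X. (cmod (inn H x (T e)))\<^sup>2)" by (simp add: \<tau>_def)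
   then show "\<tau> e <= (hnorm H (T e))\<^sup>2" using bessel'[OF X(2,1) Te] by simp
   show "0 <= ew e" using nn eE .
  qed
  also have "\<dots> <= U" using F by (intro U) auto
  also have "(\<Sum>e\<in>F - I. ew e * \<tau> e) <= (\<Sum>e\<in>F - I. s * \<tau> e)"
   using F s \<tau>0 by (intro sum_mono mult_right_mono) auto
  also have "\<dots> <= (\<Sum>e\<in>F. s * \<tau> e)" using F s \<tau>0 by (intro sum_mono2) auto
  also have "\<dots> = s * (\<Sum>x\<in>X. \<Sum>e\<in>F. (cmod (inn H (T' x) e))\<^sup>2)"
   by (simp add: \<tau>_def sum.swap[of _ F] flip: sum_distrib_left)
  also have "\<dots> <= s * (\<Sum>x\<in>X. M\<^sup>2)"
  proof (intro mult_left_mono sum_mono s(2))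
   fix x assume x: "x \<in> X"
   have "(\<Sum>e\<in>F. (cmod (inn H (T' x) e))\<^sup>2) <= (hnorm H (T' x))\<^sup>2"
    by (rule bessel[OF ons_subset[OF ons_E F(2)] F(1) TXc[OF x]])
   also have "\<dots> <= M\<^sup>2" using M[OF Xc[OF x]] ons_norm[OF X(2) x] hnorm_nonneg[OF TXc[OF x]] by (intro power_mono) auto
   finally show "(\<Sum>e\<in>F. (cmod (inn H (T' x) e))\<^sup>2) <= M\<^sup>2" .
  qed
  also have "\<dots> <= s * (real N * M\<^sup>2)" using X(3) s(2) by (intro mult_left_mono) (auto intro: mult_right_mono)
  finally have "(\<Sum>e\<in>F. ew e * \<tau> e) <= U + s * real N * M\<^sup>2" by (simp add: mult.assoc)
  moreover have "(\<Sum>x\<in>X. qform H sandw x) = (\<Sum>x\<in>X. qform H (diag_op H E ew) (T' x))"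
   using Xc by (intro sum.cong sandwich_qform) auto
  ultimately show "(\<Sum>x\<in>X. qform H sandw x) <= U + s * real N * M\<^sup>2 + \<epsilon>"
   using F(3) by (simp add: \<tau>_def)
 qed
qed

text \<open>The basis vectors themselves serve as test family, and of \<open>T' e\<close> only the
  coefficient at \<open>e\<close> is kept.\<close>

lemma sandwich_ky_fan_lower:
 assumes F: "finite F" "F \<subseteq> E" "card F <= N"
 shows "(\<Sum>e\<in>F. ew e * (cmod (inn H (T e) e))\<^sup>2) <= ky_fan H (qform H sandw) N"
proof -
 obtain K where K: "K > 0" "\<And>x. x \<in> carr H ==> \<bar>qform H sandw x\<bar> <= K * (hnorm H x)\<^sup>2"
  using qform_bound[OF positive_opD(1)[OF sandwich_positive]] by blast
 have "(\<Sum>e\<in>F. ew e * (cmod (inn H (T e) e))\<^sup>2) <= (\<Sum>e\<in>F. qform H sandw e)"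
 proof (rule sum_mono)
  fix e assume e: "e \<in> F"
  then have eE: "e \<in> E" using F by auto
  have c: "T e \<in> carr H" "T' e \<in> carr H" using bounded_opsD(1)[OF T(1)] bounded_opsD(1)[OF T(2)] E_mem[OF eE] by auto
  have "cmod (inn H (T e) e) = cmod (inn H (T' e) e)"
   using adj[OF E_mem[OF eE] E_mem[OF eE]] cmod_inn_commute[OF c(2) E_mem[OF eE]] by simp
  then have "ew e * (cmod (inn H (T e) e))\<^sup>2 <= qform H (diag_op H E ew) (T' e)"
   using diag_form_lower[OF C c(2) nn, where F = "{e}"] eE by simp
  then show "ew e * (cmod (inn H (T e) e))\<^sup>2 <= qform H sandw e" using sandwich_qform[of e] eE by simp
 qed
 also have "\<dots> <= ky_fan H (qform H sandw) N"
 proof (rule ky_fan_upper)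
  show "qform H sandw e <= K" if "e \<in> carr H" "hnorm H e = 1" for e using K(2)[OF that(1)] that(2) by simp
 qed (use F ons_subset[OF ons_E F(2)] in auto)
 finally show ?thesis .
qed

end

text \<open>\<open>trace_op\<close> sums over a basis selected by \<open>SOME\<close>, so the bound
  is derived for an arbitrary one: by Bessel's inequality each weight is counted at most
  once.\<close>

lemma trace_diag_finite:
 assumes C: "\<And>e. e \<in> E ==> \<bar>ew e\<bar> <= C" "0 <= C" and nn: "\<And>e. e \<in> E ==> 0 <= ew e"
  and S: "\<And>F. finite F ==> F \<subseteq> E ==> (\<Sum>e\<in>F. ew e) <= S"
 shows "trace_op H (diag_op H E ew) < \<infinity>"
proof -
 define E' where "E' = (SOME E. is_onb H E)"
 have E': "is_onb H E'" unfolding E'_def by (rule someI[of _ E]) (rule onb)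
 interpret E': onb H E' by unfold_locales (use complete E' in auto)
 have nnq: "0 <= qform H (diag_op H E ew) x" if "x \<in> carr H" for x
  using positive_opD(3)[OF diag_positive[OF C nn] that] by (simp add: qform_def)
 have fin: "(\<Sum>x\<in>X. qform H (diag_op H E ew) x) <= S" if X: "finite X" "X \<subseteq> E'" for X
 proof (rule field_le_epsilon)
  fix \<epsilon> :: real assume \<epsilon>: "0 < \<epsilon>"
  have oX: "ons H X" using ons_subset[OF E'.ons_E X(2)] .
  obtain F where F: "finite F" "F \<subseteq> E"
   "(\<Sum>x\<in>X. qform H (diag_op H E ew) x) <= (\<Sum>e\<in>F. ew e * (\<Sum>x\<in>X. (cmod (inn H x e))\<^sup>2)) + \<epsilon>"
   by (rule diag_form_upper[where T = "%x. x", OF C X(1) _ \<epsilon>]) (use X(2) E'.E_mem in auto)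
  have "(\<Sum>e\<in>F. ew e * (\<Sum>x\<in>X. (cmod (inn H x e))\<^sup>2)) <= (\<Sum>e\<in>F. ew e * 1)"
  proof (intro sum_mono mult_left_mono)
   fix e assume "e \<in> F"
   then have e: "e \<in> E" using F by blast
   show "(\<Sum>x\<in>X. (cmod (inn H x e))\<^sup>2) <= 1" using bessel'[OF oX X(1) E_mem[OF e]] ons_norm[OF ons_E e] by simp
   show "0 <= ew e" using nn e .
  qed
  also have "\<dots> <= S" using S F by simp
  finally show "(\<Sum>x\<in>X. qform H (diag_op H E ew) x) <= S + \<epsilon>" using F(3) by simp
 qed
 have "trace_op H (diag_op H E ew) = (SUP X\<in>{X. finite X \<and> X \<subseteq> E'}. \<Sum>x\<in>X. ennreal (qform H (diag_op H E ew) x))"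
  unfolding trace_op_def E'_def[symmetric] qform_def by (rule nonneg_infsum_complete) simp
 also have "\<dots> <= ennreal S"
 proof (rule SUP_least)
  fix X assume X: "X \<in> {X. finite X \<and> X \<subseteq> E'}"
  have "(\<Sum>x\<in>X. ennreal (qform H (diag_op H E ew) x)) = ennreal (\<Sum>x\<in>X. qform H (diag_op H E ew) x)"
   using X by (intro sum_ennreal nnq) auto
  also have "\<dots> <= ennreal S" using fin X by (intro ennreal_leI) auto
  finally show "(\<Sum>x\<in>X. ennreal (qform H (diag_op H E ew) x)) <= ennreal S" .
 qed
 finally show ?thesis by (simp add: le_less_trans[OF _ ennreal_less_top])
qed

text \<open>The converse comparison of bases: by Parseval, finitely many vectors of \<open>E\<close>
  are captured up to \<delta> by finitely many vectors of the selected basis.\<close>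

lemma trace_diag_finite_imp:
 assumes C: "\<And>e. e \<in> E ==> \<bar>ew e\<bar> <= C" "0 <= C" and nn: "\<And>e. e \<in> E ==> 0 <= ew e"
  and fin: "trace_op H (diag_op H E ew) < \<infinity>"
 obtains S where "\<And>F. finite F ==> F \<subseteq> E ==> (\<Sum>e\<in>F. ew e) <= S"
proof -
 define E' where "E' = (SOME E. is_onb H E)"
 have E': "is_onb H E'" unfolding E'_def by (rule someI[of _ E]) (rule onb)
 interpret E': onb H E' by unfold_locales (use complete E' in auto)
 have nnq: "0 <= qform H (diag_op H E ew) x" if "x \<in> carr H" for x
  using positive_opD(3)[OF diag_positive[OF C nn] that] by (simp add: qform_def)
 obtain S where S: "0 <= S" "trace_op H (diag_op H E ew) = ennreal S"
  using fin by (cases "trace_op H (diag_op H E ew)") auto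
 have le: "(\<Sum>x\<in>X. qform H (diag_op H E ew) x) <= S" if X: "finite X" "X \<subseteq> E'" for X
 proof -
  have "ennreal (\<Sum>x\<in>X. qform H (diag_op H E ew) x) = (\<Sum>x\<in>X. ennreal (qform H (diag_op H E ew) x))"
   using X by (intro sum_ennreal[symmetric] nnq) auto
  also have "\<dots> <= (SUP X\<in>{X. finite X \<and> X \<subseteq> E'}. \<Sum>x\<in>X. ennreal (qform H (diag_op H E ew) x))"
   using X by (intro SUP_upper) auto
  also have "\<dots> = trace_op H (diag_op H E ew)"
   unfolding trace_op_def E'_def[symmetric] qform_def by (rule nonneg_infsum_complete[symmetric]) simp
  finally show ?thesis using S by (simp add: ennreal_le_iff)
 qed
 have "(\<Sum>e\<in>F. ew e) <= S" if F: "finite F" "F \<subseteq> E" for F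
 proof (rule field_le_epsilon)
  fix \<epsilon> :: real assume \<epsilon>: "0 < \<epsilon>"
  \<comment> \<open>The loss \<delta> is multiplied by the sum of the weights over \<open>F\<close>,
    which is at most \<open>C * card F\<close>.\<close>
  define \<delta> where "\<delta> = \<epsilon> / (1 + C * card F)"
  have K: "0 < 1 + C * card F" using C(2) by (simp add: add_pos_nonneg)
  have \<delta>: "0 < \<delta>" using \<epsilon> K by (simp add: \<delta>_def)
  have "\<forall>e\<in>F. \<exists>X. finite X \<and> X \<subseteq> E' \<and> (\<forall>Y. finite Y \<longrightarrow> X \<subseteq> Y \<longrightarrow> Y \<subseteq> E' \<longrightarrow>
    (hnorm H e)\<^sup>2 < (\<Sum>x\<in>Y. (cmod (inn H e x))\<^sup>2) + \<delta>)" (is "\<forall>e\<in>F. \<exists>X. ?P e X")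
  proof
   fix e assume "e \<in> F"
   then have ec: "e \<in> carr H" using F by auto
   obtain X where "finite X" "X \<subseteq> E'" "\<And>Y. finite Y ==> X \<subseteq> Y ==> Y \<subseteq> E' ==>
    (hnorm H e)\<^sup>2 < (\<Sum>x\<in>Y. (cmod (inn H e x))\<^sup>2) + \<delta>"
    by (rule E'.parseval[OF ec \<delta>]) blast
   then show "\<exists>X. ?P e X" by blast
  qed
  from bchoice[OF this] obtain X where X: "\<forall>e\<in>F. ?P e (X e)" by blast
  define Y where "Y = (\<Union>e\<in>F. X e)"
  have Y: "finite Y" "Y \<subseteq> E'" using X F by (auto simp: Y_def)
  have "(\<Sum>e\<in>F. ew e) <= (\<Sum>e\<in>F. ew e * ((\<Sum>x\<in>Y. (cmod (inn H e x))\<^sup>2) + \<delta>))"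
  proof (rule sum_mono)
   fix e assume e: "e \<in> F"
   then have eE: "e \<in> E" using F by auto
   have "X e \<subseteq> Y" using e by (auto simp: Y_def)
   then have "(hnorm H e)\<^sup>2 < (\<Sum>x\<in>Y. (cmod (inn H e x))\<^sup>2) + \<delta>" using X e Y by blast
   then have "1 <= (\<Sum>x\<in>Y. (cmod (inn H e x))\<^sup>2) + \<delta>" using ons_norm[OF ons_E eE] by simp
   then have "ew e * 1 <= ew e * ((\<Sum>x\<in>Y. (cmod (inn H e x))\<^sup>2) + \<delta>)" using nn[OF eE] by (intro mult_left_mono)
   then show "ew e <= ew e * ((\<Sum>x\<in>Y. (cmod (inn H e x))\<^sup>2) + \<delta>)" by simp
  qed
  also have "\<dots> = (\<Sum>x\<in>Y. \<Sum>e\<in>F. ew e * (cmod (inn H e x))\<^sup>2) + (\<Sum>e\<in>F. ew e) * \<delta>"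
   by (simp add: distrib_left sum.distrib sum_distrib_left sum_distrib_right sum.swap[of _ F])
  also have "(\<Sum>x\<in>Y. \<Sum>e\<in>F. ew e * (cmod (inn H e x))\<^sup>2) <= (\<Sum>x\<in>Y. qform H (diag_op H E ew) x)"
  proof (rule sum_mono)
   fix x assume "x \<in> Y"
   then have x: "x \<in> carr H" using Y by auto
   have "(\<Sum>e\<in>F. ew e * (cmod (inn H e x))\<^sup>2) = (\<Sum>e\<in>F. ew e * (cmod (inn H x e))\<^sup>2)"
    using F x by (intro sum.cong refl) (auto simp: cmod_inn_commute[OF x E_mem] subset_iff)
   then show "(\<Sum>e\<in>F. ew e * (cmod (inn H e x))\<^sup>2) <= qform H (diag_op H E ew) x"
    using diag_form_lower[OF C x nn F] by simp
  qed
  also have "\<dots> <= S" by (rule le[OF Y])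
  also have "(\<Sum>e\<in>F. ew e) * \<delta> <= (C * card F) * \<delta>"
  proof (rule mult_right_mono)
   have "(\<Sum>e\<in>F. ew e) <= (\<Sum>e\<in>F. C)" using C(1) F by (intro sum_mono) (auto intro: order_trans[OF abs_ge_self])
   then show "(\<Sum>e\<in>F. ew e) <= C * card F" by (simp add: mult.commute)
  qed (use \<delta> in simp)
  also have "(C * card F) * \<delta> <= \<epsilon>"
  proof -
   have "(C * card F) * \<delta> <= (1 + C * card F) * \<delta>" using \<delta> by (intro mult_right_mono) auto
   then show ?thesis using K by (simp add: \<delta>_def)
  qed
  finally show "(\<Sum>e\<in>F. ew e) <= S + \<epsilon>" by simp
 qed
 then show thesis by (rule that)
qed

end

section \<open>Direct sums of Hilbert spaces\<close>

definition single :: "nat => 'v::zero => nat => 'v"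
 where "single j v = (%i. if i = j then v else 0)"

locale direct_sum =
 fixes Hs :: "nat => 'v::complex_vector hilbert"
 assumes ph: "\<And>j. pre_hilbert (Hs j)" and comp: "\<And>j. hcomplete (Hs j)"
begin

abbreviation "H \<equiv> direct_sum_space Hs"

lemma carr_ds: "h \<in> carr H \<longleftrightarrow> (\<forall>j. h j \<in> carr (Hs j)) \<and> summable (%j. (hnorm (Hs j) (h j))\<^sup>2)"
 by (simp add: direct_sum_space_def)

lemma inn_ds: "inn H g h = (\<Sum>j. inn (Hs j) (g j) (h j))"
 by (simp add: direct_sum_space_def)

lemma carr_comp: "h \<in> carr H ==> h j \<in> carr (Hs j)"
 by (simp add: carr_ds)

lemma summable_inn:
 assumes g: "g \<in> carr H" and h: "h \<in> carr H"
 shows "summable (%j. inn (Hs j) (g j) (h j))"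
proof (rule summable_comparison_test)
 show "summable (%j. (hnorm (Hs j) (g j))\<^sup>2 + (hnorm (Hs j) (h j))\<^sup>2)"
  using g h by (intro summable_add) (auto simp: carr_ds)
 show "\<exists>N. \<forall>n\<ge>N. norm (inn (Hs n) (g n) (h n)) <= (hnorm (Hs n) (g n))\<^sup>2 + (hnorm (Hs n) (h n))\<^sup>2"
 proof (intro exI allI impI)
  fix n
  interpret pre_hilbert "Hs n" by (rule ph)
  have c: "g n \<in> carr (Hs n)" "h n \<in> carr (Hs n)" using g h carr_comp by auto
  have "0 <= hnorm (Hs n) (g n) * hnorm (Hs n) (h n)" using c hnorm_nonneg by auto
  then show "norm (inn (Hs n) (g n) (h n)) <= (hnorm (Hs n) (g n))\<^sup>2 + (hnorm (Hs n) (h n))\<^sup>2"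
   using CS[OF c] sum_squares_bound[of "hnorm (Hs n) (g n)" "hnorm (Hs n) (h n)"] by linarith
 qed
qed

lemma ds_pre_hilbert: "pre_hilbert H"
proof unfold_locales
 interpret P: pre_hilbert "Hs j" for j by (rule ph)
 show "0 \<in> carr H" by (simp add: carr_ds)
 show "x + y \<in> carr H" if x: "x \<in> carr H" and y: "y \<in> carr H" for x y
  unfolding carr_ds
 proof
  show "\<forall>j. (x + y) j \<in> carr (Hs j)" using x y carr_comp by auto
  show "summable (%j. (hnorm (Hs j) ((x + y) j))\<^sup>2)"
  proof (rule summable_comparison_test)
   show "summable (%j. 2 * (hnorm (Hs j) (x j))\<^sup>2 + 2 * (hnorm (Hs j) (y j))\<^sup>2)"
    using x y by (intro summable_add summable_mult) (auto simp: carr_ds)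
   show "\<exists>N. \<forall>n\<ge>N. norm ((hnorm (Hs n) ((x + y) n))\<^sup>2) <= 2 * (hnorm (Hs n) (x n))\<^sup>2 + 2 * (hnorm (Hs n) (y n))\<^sup>2"
   proof (intro exI allI impI)
    fix n
    have c: "x n \<in> carr (Hs n)" "y n \<in> carr (Hs n)" using x y carr_comp by auto
    have "(hnorm (Hs n) (x n + y n))\<^sup>2 <= (hnorm (Hs n) (x n) + hnorm (Hs n) (y n))\<^sup>2"
     using P.hnorm_triangle[OF c] c by (intro power_mono P.hnorm_nonneg) auto
    also have "\<dots> <= 2 * (hnorm (Hs n) (x n))\<^sup>2 + 2 * (hnorm (Hs n) (y n))\<^sup>2"
     using sum_squares_bound[of "hnorm (Hs n) (x n)" "hnorm (Hs n) (y n)"] by (simp add: power2_sum)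
    finally show "norm ((hnorm (Hs n) ((x + y) n))\<^sup>2) <= 2 * (hnorm (Hs n) (x n))\<^sup>2 + 2 * (hnorm (Hs n) (y n))\<^sup>2" by simp
   qed
  qed
 qed
 show "a *\<^sub>C x \<in> carr H" if x: "x \<in> carr H" for x a
 proof -
  have "(%j. (hnorm (Hs j) ((a *\<^sub>C x) j))\<^sup>2) = (%j. (cmod a)\<^sup>2 * (hnorm (Hs j) (x j))\<^sup>2)"
   using carr_comp[OF x] by (auto simp: scaleC_fun_def P.hnorm_scale power_mult_distrib)
  then show ?thesis using x unfolding carr_ds by (auto simp: scaleC_fun_def intro: summable_mult)
 qed
 fix x y z assume x: "x \<in> carr H" and y: "y \<in> carr H"
 show "inn H (x + y) z = inn H x z + inn H y z" if z: "z \<in> carr H"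
  unfolding inn_ds using suminf_add[OF summable_inn[OF x z] summable_inn[OF y z]] carr_comp x y z
  by (simp add: P.s_add)
 show "inn H (a *\<^sub>C x) y = a * inn H x y" for a
  unfolding inn_ds using suminf_mult[OF summable_inn[OF x y], of a] carr_comp x y
  by (simp add: scaleC_fun_def P.s_scale)
 show "inn H y x = cnj (inn H x y)"
 proof -
  have "inn (Hs j) (y j) (x j) = cnj (inn (Hs j) (x j) (y j))" for j
   by (intro P.s_cnj carr_comp x y)
  then show ?thesis unfolding inn_ds
   using bounded_linear.suminf[OF bounded_linear_cnj summable_inn[OF x y]] by simp
 qed
 have self: "inn H x x = of_real (\<Sum>j. (hnorm (Hs j) (x j))\<^sup>2)"
  unfolding inn_ds using x carr_comp by (subst suminf_of_real) (auto simp: carr_ds P.inn_self)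
 show "0 <= Re (inn H x x)"
  unfolding self using x by (auto simp: carr_ds intro: suminf_nonneg)
 show "x = 0" if "inn H x x = 0"
 proof -
  have "(\<Sum>j. (hnorm (Hs j) (x j))\<^sup>2) = 0" using that self by simp
  then have "\<forall>j. (hnorm (Hs j) (x j))\<^sup>2 = 0"
   using x by (subst (asm) suminf_eq_zero_iff) (auto simp: carr_ds)
  then show ?thesis using P.hnorm_eq_0[OF carr_comp[OF x]] by (auto simp: fun_eq_iff)
 qed
qed

sublocale pre_hilbert H by (rule ds_pre_hilbert)

lemma hnorm_ds:
 assumes x: "x \<in> carr H"
 shows "(hnorm H x)\<^sup>2 = (\<Sum>j. (hnorm (Hs j) (x j))\<^sup>2)"
proof -
 interpret P: pre_hilbert "Hs j" for j by (rule ph)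
 have "inn H x x = of_real (\<Sum>j. (hnorm (Hs j) (x j))\<^sup>2)"
  unfolding inn_ds using x carr_comp by (subst suminf_of_real) (auto simp: carr_ds P.inn_self)
 then show ?thesis using x by (simp add: hnorm_sq)
qed

lemma hnorm_comp_le:
 assumes x: "x \<in> carr H"
 shows "hnorm (Hs j) (x j) <= hnorm H x"
proof (rule power2_le_imp_le)
 show "(hnorm (Hs j) (x j))\<^sup>2 <= (hnorm H x)\<^sup>2"
  unfolding hnorm_ds[OF x] using x sum_le_suminf[of "%j. (hnorm (Hs j) (x j))\<^sup>2" "{j}"] by (simp add: carr_ds)
qed (use x hnorm_nonneg in auto)

text \<open>Limits are taken in each component. The Cauchy bound holds for finite partial sums,
  passes to the limit in them, and yields both membership of the limit and convergence in
  norm.\<close>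

lemma ds_complete: "hcomplete H"
 unfolding hcomplete_def
proof (intro allI impI, elim conjE)
 interpret P: pre_hilbert "Hs j" for j by (rule ph)
 fix X :: "nat => nat => 'v"
 assume X: "\<forall>n. X n \<in> carr H" and cauchy: "\<forall>e>0. \<exists>N. \<forall>m\<ge>N. \<forall>n\<ge>N. hnorm H (X m - X n) < e"
 have Xc: "X n \<in> carr H" "X n j \<in> carr (Hs j)" for n j using X carr_comp by auto
 have "\<exists>y. y \<in> carr (Hs j) \<and> hlim (Hs j) (%n. X n j) y" for j
 proof -
  have "\<exists>N. \<forall>m\<ge>N. \<forall>n\<ge>N. hnorm (Hs j) (X m j - X n j) < e" if e: "0 < e" for e
  proof -
   obtain N where N: "\<forall>m\<ge>N. \<forall>n\<ge>N. hnorm H (X m - X n) < e" using cauchy e by blast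
   have "hnorm (Hs j) (X m j - X n j) <= hnorm H (X m - X n)" for m n
    using hnorm_comp_le[of "X m - X n" j] Xc by simp
   then show ?thesis using N by (meson le_less_trans)
  qed
  then show ?thesis using comp[of j, unfolded hcomplete_def, THEN spec, of "%n. X n j"] Xc by blast
 qed
 then obtain y where y: "\<And>j. y j \<in> carr (Hs j)" "\<And>j. hlim (Hs j) (%n. X n j) (y j)" by metis
 have tail: "X n - y \<in> carr H \<and> (hnorm H (X n - y))\<^sup>2 <= e\<^sup>2"
  if N: "\<forall>m\<ge>N. \<forall>n\<ge>N. hnorm H (X m - X n) < e" and n: "n \<ge> N" for N n e
 proof -
  have e: "0 <= e" using N n hnorm_nonneg[of "X n - X n"] Xc by (meson diff_mem less_imp_le order_trans)
  have fin: "(\<Sum>j<J. (hnorm (Hs j) (X n j - y j))\<^sup>2) <= e\<^sup>2" for J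
  proof (rule LIMSEQ_le_const2)
   show "(%m. \<Sum>j<J. (hnorm (Hs j) (X n j - X m j))\<^sup>2) \<longlonglongrightarrow> (\<Sum>j<J. (hnorm (Hs j) (X n j - y j))\<^sup>2)"
   proof (intro tendsto_sum tendsto_power)
    fix j
    have "hnorm (Hs j) (X n j - X m j - (X n j - y j)) = hnorm (Hs j) (X m j - y j)" for m
     using P.hnorm_minus_commute[OF Xc(2)[of m j] y(1)[of j]] by simp
    then have "hlim (Hs j) (%m. X n j - X m j) (X n j - y j)"
     using y(2)[of j] unfolding hlim_def by simp
    then show "(%m. hnorm (Hs j) (X n j - X m j)) \<longlonglongrightarrow> hnorm (Hs j) (X n j - y j)"
     by (rule P.hlim_hnorm) (use Xc y in auto)
   qed
   have "(\<Sum>j<J. (hnorm (Hs j) (X n j - X m j))\<^sup>2) <= e\<^sup>2" if m: "m \<ge> N" for m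
   proof -
    have c: "X n - X m \<in> carr H" using Xc by simp
    have "(\<Sum>j<J. (hnorm (Hs j) (X n j - X m j))\<^sup>2) <= (hnorm H (X n - X m))\<^sup>2"
     unfolding hnorm_ds[OF c] using c sum_le_suminf[of "%j. (hnorm (Hs j) ((X n - X m) j))\<^sup>2" "{..<J}"]
     by (simp add: carr_ds)
    also have "\<dots> <= e\<^sup>2" using N n m c by (intro power_mono hnorm_nonneg) (auto intro: less_imp_le)
    finally show ?thesis .
   qed
   then show "\<exists>N. \<forall>m\<ge>N. (\<Sum>j<J. (hnorm (Hs j) (X n j - X m j))\<^sup>2) <= e\<^sup>2" by blast
  qed
  have sm: "summable (%j. (hnorm (Hs j) (X n j - y j))\<^sup>2)"
   by (rule summableI_nonneg_bounded[where x = "e\<^sup>2"]) (use fin in auto)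
  have c: "X n - y \<in> carr H" unfolding carr_ds using sm Xc y by simp
  have "(\<Sum>j. (hnorm (Hs j) (X n j - y j))\<^sup>2) <= e\<^sup>2" by (rule suminf_le_const[OF sm fin])
  then show ?thesis using c by (simp add: hnorm_ds[OF c])
 qed
 obtain N1 where N1: "\<forall>m\<ge>N1. \<forall>n\<ge>N1. hnorm H (X m - X n) < 1" using cauchy by (meson zero_less_one)
 have yc: "y \<in> carr H"
  using diff_mem[OF Xc(1)[of N1] conjunct1[OF tail[OF N1 order_refl]]] by simp
 have "hlim H X y"
  unfolding hlim_def
 proof (rule LIMSEQ_I)
  fix e :: real assume e: "0 < e"
  then obtain N where N: "\<forall>m\<ge>N. \<forall>n\<ge>N. hnorm H (X m - X n) < e / 2" using cauchy by (meson half_gt_zero)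
  have "norm (hnorm H (X n - y) - 0) < e" if n: "n \<ge> N" for n
  proof -
   have "hnorm H (X n - y) <= e / 2" using tail[OF N n] e by (intro power2_le_imp_le[of "hnorm H (X n - y)" "e / 2"]) auto
   then show ?thesis using e hnorm_nonneg[of "X n - y"] Xc yc by simp
  qed
  then show "\<exists>N. \<forall>n\<ge>N. norm (hnorm H (X n - y) - 0) < e" by blast
 qed
 then show "\<exists>x\<in>carr H. hlim H X x" using yc by blast
qed

lemma single_carr:
 assumes v: "v \<in> carr (Hs j)"
 shows "single j v \<in> carr H"
proof -
 interpret P: pre_hilbert "Hs i" for i by (rule ph)
 have "summable (%i. (hnorm (Hs i) (single j v i))\<^sup>2)"
  by (rule summable_finite[of "{j}"]) (auto simp: single_def)
 then show ?thesis using v by (auto simp: carr_ds single_def)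
qed

lemma inn_single:
 assumes h: "h \<in> carr H" and v: "v \<in> carr (Hs j)"
 shows "inn H h (single j v) = inn (Hs j) (h j) v"
proof -
 interpret P: pre_hilbert "Hs i" for i by (rule ph)
 have "inn H h (single j v) = (\<Sum>i\<in>{j}. inn (Hs i) (h i) (single j v i))"
  unfolding inn_ds by (rule suminf_finite) (use h carr_comp in \<open>auto simp: single_def\<close>)
 then show ?thesis by (simp add: single_def)
qed

lemma ds_onb:
 assumes Es: "\<And>j. is_onb (Hs j) (Es j)"
 shows "onb H (\<Union>j. single j ` Es j)"
proof unfold_locales
 interpret P: pre_hilbert "Hs i" for i by (rule ph)
 have E: "e \<in> carr (Hs j)" if "e \<in> Es j" for e j using Es[of j] that by (auto simp: is_onb_def)
 show "hcomplete H" by (rule ds_complete)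
 show "is_onb H (\<Union>j. single j ` Es j)"
  unfolding is_onb_def
 proof (intro conjI ballI impI subsetI)
  fix x assume "x \<in> (\<Union>j. single j ` Es j)"
  then show "x \<in> carr H" using E single_carr by auto
 next
  fix a b assume "a \<in> (\<Union>j. single j ` Es j)" "b \<in> (\<Union>j. single j ` Es j)"
  then obtain i j u v where a: "a = single i u" "u \<in> Es i" and b: "b = single j v" "v \<in> Es j" by auto
  have "inn H a b = inn (Hs j) (single i u j) v"
   unfolding a b using a b E by (intro inn_single single_carr) auto
  \<comment> \<open>Needed because \<open>single i u\<close> determines \<open>i\<close> only for
    nonzero \<open>u\<close>.\<close>
  moreover have "u \<noteq> 0"
  proof
   assume "u = 0" then have "inn (Hs i) u u = 0" using E[OF a(2)] by simp
   moreover have "inn (Hs i) u u = 1" using Es[of i] a(2) by (auto simp: is_onb_def)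
   ultimately show False by simp
  qed
  moreover have "inn (Hs j) u v = (if u = v then 1 else 0)" if "i = j"
   using Es[of j] a b that by (auto simp: is_onb_def)
  moreover have "a = b \<longleftrightarrow> i = j \<and> u = v"
  proof
   assume ab: "a = b"
   have "single i u i = single j v i" using ab a b by simp
   then have ij: "i = j" using \<open>u \<noteq> 0\<close> by (auto simp: single_def split: if_splits)
   then show "i = j \<and> u = v" using \<open>single i u i = single j v i\<close> by (simp add: single_def)
  qed (simp add: a b)
  ultimately show "inn H a b = (if a = b then 1 else 0)"
   using E[OF b(2)] by (auto simp: single_def)
 next
  fix x assume x: "x \<in> carr H" and o: "\<forall>e\<in>\<Union>j. single j ` Es j. inn H x e = 0"
  have "x j = 0" for j
  proof -
   have "inn (Hs j) (x j) e = 0" if "e \<in> Es j" for e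
    using o inn_single[OF x E[OF that]] that by auto
   then show ?thesis using Es[of j] carr_comp[OF x, of j] by (auto simp: is_onb_def)
  qed
  then show "x = 0" by (simp add: fun_eq_iff)
 qed
qed

end

section \<open>Direct sums of spectral triples of curves\<close>

text \<open>Lengths at most 1 keep the eigenvalues of the Dirac operator at absolute value at least
  1 (\<open>abs_tev_ge\<close>), so that their negative powers are bounded by 1.\<close>

locale curves =
 fixes l :: "nat => real" and R :: "nat => real => 'x::topological_space" and X :: "'x set"
 assumes l_pos: "\<And>j. 0 < l j" and l_le: "\<And>j. l j <= 1"
begin

sublocale direct_sum "%j. L2_space (l j)"
 by (intro direct_sum.intro L2_pre_hilbert L2_complete l_pos)

abbreviation "S \<equiv> direct_sum_triple (%j. curve_triple X (l j) (R j))"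

lemma st_space_S: "st_space S = H"
 by (simp add: direct_sum_triple_def curve_triple_def Let_def)

lemma st_rep_S: "st_rep S f h = (if h \<in> carr H then (%j. curve_rep (l j) (R j) f (h j)) else 0)"
 by (simp add: direct_sum_triple_def curve_triple_def Let_def)

lemma st_dirac_S: "st_dirac S = {(g, h). g \<in> carr H \<and> h \<in> carr H \<and> (\<forall>j. (g j, h j) \<in> curve_dirac (l j))}"
 by (simp add: direct_sum_triple_def curve_triple_def Let_def)

definition e :: "nat \<times> int => nat => ae_fun"
 where "e jk = single (fst jk) (fbasis (l (fst jk)) (snd jk))"

abbreviation "E \<equiv> range e"

lemma fbasis_onb: "is_onb (L2_space (l j)) (range (fbasis (l j)))"
 using fbasis_ons[OF l_pos, of j] fbasis_complete[OF l_pos] by (auto simp: is_onb_def ons_def)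

lemma E_eq: "E = (\<Union>j. single j ` range (fbasis (l j)))"
proof (intro subset_antisym subsetI)
 fix v assume "v \<in> (\<Union>j. single j ` range (fbasis (l j)))"
 then obtain j k where "v = single j (fbasis (l j) k)" by auto
 then have "v = e (j, k)" by (simp add: e_def)
 then show "v \<in> E" by simp
qed (auto simp: e_def)

sublocale onb "direct_sum_space (%j. L2_space (l j))" "range e"
 unfolding E_eq by (rule ds_onb) (rule fbasis_onb)

lemma e_carr [simp]: "e jk \<in> carr H"
 by (simp add: E_mem)

lemma inn_e: "h \<in> carr H ==> inn H h (e jk) = inn (L2_space (l (fst jk))) (h (fst jk)) (fbasis (l (fst jk)) (snd jk))"
 unfolding e_def by (rule inn_single) auto

lemma inn_e_e: "inn H (e a) (e b) = (if a = b then 1 else 0)"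
proof -
 interpret P: pre_hilbert "L2_space (l (fst b))" by (rule ph)
 have "inn H (e a) (e b) = inn (L2_space (l (fst b))) (e a (fst b)) (fbasis (l (fst b)) (snd b))"
  by (rule inn_e) simp
 then show ?thesis using fbasis_orthonormal[OF l_pos, of "fst b" "snd a" "snd b"]
  by (auto simp: e_def single_def prod_eq_iff)
qed

lemma inj_e: "inj e"
proof (rule injI)
 fix a b assume "e a = e b"
 then have "inn H (e a) (e b) = 1" using inn_e_e[of b b] by simp
 then show "a = b" by (simp add: inn_e_e split: if_splits)
qed

text \<open>\<open>diag_op\<close> takes weights on vectors, so the pair of curve and frequency has
  to be read off from a basis vector.\<close>

definition ix :: "(nat => ae_fun) => nat \<times> int"
 where "ix = inv e"

lemma ix_e [simp]: "ix (e jk) = jk"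
 by (simp add: ix_def inj_e)

definition tev :: "nat \<times> int => real"
 where "tev jk = dirac_ev (l (fst jk)) (snd jk)"

lemma e_comp: "e jk i = (if i = fst jk then fbasis (l i) (snd jk) else 0)"
 by (simp add: e_def single_def)

lemma fun_calc_S:
 assumes "\<And>jk. \<bar>g (tev jk)\<bar> <= C" "0 <= C"
 shows "fun_calc H (st_dirac S) g = diag_op H E (%v. g (tev (ix v)))"
proof (rule fun_calc_eq_diag[where C = C])
 fix v assume "v \<in> E"
 then obtain jk where v: "v = e jk" by auto
 show "(v, of_real (tev (ix v)) *\<^sub>C v) \<in> st_dirac S"
  unfolding st_dirac_S v
 proof (intro CollectI case_prodI conjI allI)
  show "of_real (tev (ix (e jk))) *\<^sub>C e jk \<in> carr H" by (rule scale_mem) simp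
  show "(e jk j, (of_real (tev (ix (e jk))) *\<^sub>C e jk) j) \<in> curve_dirac (l j)" for j
   using curve_dirac_fbasis[OF l_pos] curve_dirac_zero[OF l_pos] by (auto simp: scaleC_fun_def e_comp tev_def)
 qed simp
next
 fix u v assume uv: "(u, v) \<in> st_dirac S"
 then have c: "u \<in> carr H" "v \<in> carr H" and d: "\<And>j. (u j, v j) \<in> curve_dirac (l j)" by (auto simp: st_dirac_S)
 show "u \<in> carr H \<and> v \<in> carr H \<and> (\<forall>x\<in>E. inn H v x = of_real (tev (ix x)) * inn H u x)"
  using c curve_dirac_mem(3)[OF l_pos d] by (auto simp: inn_e tev_def)
qed (use assms in auto)

definition okf :: "('x => complex) => real => bool"
 where "okf f B \<longleftrightarrow> (\<forall>j. continuous_on {- l j..l j} (%x. f (R j \<bar>x\<bar>)) \<and> (\<forall>t\<in>{0..l j}. cmod (f (R j t)) <= B))"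

lemma cm: "curve_mult (l j)"
 by unfold_locales (rule l_pos)

lemma okfD: "okf f B ==> curve_mult.ok (l j) (R j) f B"
 by (simp add: okf_def curve_mult.ok_def[OF cm])

lemma okf_cnj: "okf f B ==> okf (%x. cnj (f x)) B"
 by (auto simp: okf_def intro!: continuous_intros)

lemma okf_nonneg: "okf f B ==> 0 <= B"
 unfolding okf_def using l_pos[of 0] by (meson atLeastAtMost_iff less_imp_le norm_ge_zero order_refl order_trans)

lemma rep_comp: "h \<in> carr H ==> st_rep S f h j = curve_rep (l j) (R j) f (h j)"
 by (simp add: st_rep_S)

lemma rep_bound:
 assumes ok: "okf f B" and h: "h \<in> carr H"
 shows "st_rep S f h \<in> carr H" "hnorm H (st_rep S f h) <= B * hnorm H h"
proof -
 interpret P: pre_hilbert "L2_space (l j)" for j by (rule ph)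
 have B: "0 <= B" by (rule okf_nonneg[OF ok])
 have hj: "h j \<in> carr (L2_space (l j))" for j by (rule carr_comp[OF h])
 have c: "curve_rep (l j) (R j) f (h j) \<in> carr (L2_space (l j))" for j
  by (rule curve_mult.curve_rep_bound(1)[OF cm okfD[OF ok] hj])
 have le: "(hnorm (L2_space (l j)) (curve_rep (l j) (R j) f (h j)))\<^sup>2 <= B\<^sup>2 * (hnorm (L2_space (l j)) (h j))\<^sup>2" for j
  using power_mono[OF curve_mult.curve_rep_bound(2)[OF cm okfD[OF ok] hj] P.hnorm_nonneg[OF c], of j 2] B
  by (simp add: power_mult_distrib)
 have sh: "summable (%j. B\<^sup>2 * (hnorm (L2_space (l j)) (h j))\<^sup>2)" using h by (intro summable_mult) (simp add: carr_ds)
 have s: "summable (%j. (hnorm (L2_space (l j)) (curve_rep (l j) (R j) f (h j)))\<^sup>2)"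
  by (rule summable_comparison_test'[OF sh]) (use le in auto)
 show m: "st_rep S f h \<in> carr H" using s c h by (simp add: carr_ds rep_comp)
 show "hnorm H (st_rep S f h) <= B * hnorm H h"
 proof (rule power2_le_imp_le)
  have "(hnorm H (st_rep S f h))\<^sup>2 = (\<Sum>j. (hnorm (L2_space (l j)) (curve_rep (l j) (R j) f (h j)))\<^sup>2)"
   using h by (simp add: hnorm_ds[OF m] rep_comp)
  also have "\<dots> <= (\<Sum>j. B\<^sup>2 * (hnorm (L2_space (l j)) (h j))\<^sup>2)" by (rule suminf_le[OF le s sh])
  also have "\<dots> = (B * hnorm H h)\<^sup>2"
   using h by (subst suminf_mult) (auto simp: carr_ds hnorm_ds power_mult_distrib)
  finally show "(hnorm H (st_rep S f h))\<^sup>2 <= (B * hnorm H h)\<^sup>2" .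
 qed (use B hnorm_nonneg[OF h] in simp)
qed

lemma rep_bounded_ops:
 assumes ok: "okf f B"
 shows "st_rep S f \<in> bounded_ops H"
 unfolding bounded_ops_def
proof (intro CollectI conjI ballI allI impI)
 fix x y assume xy: "x \<in> carr H" "y \<in> carr H"
 show "st_rep S f (x + y) = st_rep S f x + st_rep S f y"
  using xy carr_comp by (auto simp: fun_eq_iff rep_comp curve_mult.curve_rep_add[OF cm okfD[OF ok]])
next
 fix a x assume x: "x \<in> carr H"
 show "st_rep S f (a *\<^sub>C x) = a *\<^sub>C st_rep S f x"
 proof
  fix j
  have "st_rep S f (a *\<^sub>C x) j = curve_rep (l j) (R j) f ((a *\<^sub>C x) j)" by (rule rep_comp) (simp add: x)
  then show "st_rep S f (a *\<^sub>C x) j = (a *\<^sub>C st_rep S f x) j"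
   using x carr_comp by (simp add: rep_comp scaleC_fun_def curve_mult.curve_rep_scale[OF cm okfD[OF ok]])
 qed
next
 show "\<exists>C. \<forall>x\<in>carr H. hnorm H (st_rep S f x) <= C * hnorm H x" using rep_bound(2)[OF ok] by blast
next
 fix x assume "x \<notin> carr H" then show "st_rep S f x = 0" by (simp add: st_rep_S)
qed (rule rep_bound(1)[OF ok])

lemma rep_adjoint:
 assumes ok: "okf f B" and x: "x \<in> carr H" and y: "y \<in> carr H"
 shows "inn H (st_rep S f x) y = inn H x (st_rep S (%x. cnj (f x)) y)"
 unfolding inn_ds using x y carr_comp
 by (simp add: rep_comp curve_mult.curve_rep_adjoint[OF cm okfD[OF ok] okfD[OF okf_cnj[OF ok]]])

lemma rep_lin:
 assumes ok: "okf f B" "okf g C" "okf k D" and h: "h \<in> carr H"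
  and k: "\<And>j t. t \<in> {0..l j} ==> k (R j t) = f (R j t) + c * g (R j t)"
 shows "st_rep S k h = st_rep S f h + c *\<^sub>C st_rep S g h"
 using h carr_comp curve_mult.curve_rep_lin[OF cm okfD[OF ok(1)] okfD[OF ok(2)] okfD[OF ok(3)] _ k]
 by (auto simp: fun_eq_iff rep_comp scaleC_fun_def)

lemma rep_const: "h \<in> carr H ==> st_rep S (%_. c) h = c *\<^sub>C h"
 using carr_comp by (auto simp: fun_eq_iff rep_comp scaleC_fun_def curve_mult.curve_rep_const[OF cm])

lemma curve_osc:
 assumes ok: "okf f B" and osc: "\<And>t. t \<in> {0..l j} ==> cmod (f (R j t) - c) <= \<omega>"
  and u: "u = fbasis (l j) k"
 shows "hnorm (L2_space (l j)) (curve_rep (l j) (R j) f u - c *\<^sub>C u) <= \<omega>"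
  "curve_rep (l j) (R j) f u \<in> carr (L2_space (l j))"
proof -
 interpret C: curve_mult "l j" "R j" by (rule cm)
 have uc: "u \<in> carr (L2_space (l j))" and u1: "hnorm (L2_space (l j)) u = 1"
  using fbasis_orthonormal[OF l_pos, of j k k] by (auto simp: u hnorm_def)
 have o: "C.ok f B" by (rule okfD[OF ok])
 have w0: "0 <= \<omega>" using osc[of 0] l_pos[of j] by (meson atLeastAtMost_iff less_imp_le norm_ge_zero order_refl order_trans)
 have oc: "C.ok (%_. c) (cmod c)" by (simp add: C.ok_def)
 have od: "C.ok (%x. f x - c) \<omega>" using o osc by (auto simp: C.ok_def intro: continuous_intros)
 have "curve_rep (l j) (R j) f u = curve_rep (l j) (R j) (%_. c) u + 1 *\<^sub>C curve_rep (l j) (R j) (%x. f x - c) u"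
  by (rule C.curve_rep_lin[OF oc od o uc]) simp
 then have "curve_rep (l j) (R j) f u - c *\<^sub>C u = curve_rep (l j) (R j) (%x. f x - c) u"
  by (simp add: C.curve_rep_const[OF uc] scaleC_one)
 then show "hnorm (L2_space (l j)) (curve_rep (l j) (R j) f u - c *\<^sub>C u) <= \<omega>"
  using C.curve_rep_bound(2)[OF od uc] w0 u1 by simp
 show "curve_rep (l j) (R j) f u \<in> carr (L2_space (l j))" by (rule C.curve_rep_bound(1)[OF o uc])
qed

text \<open>If \<open>f\<close> is within \<omega> of the constant \<open>c\<close> along a curve,
  every exponential on this curve is an approximate eigenvector of the representation. The two
  estimates feed the upper and the lower Ky Fan bound, and neither depends on the frequency.\<close>

lemma rep_e:
 assumes ok: "okf f B" and osc: "\<And>t. t \<in> {0..l j} ==> cmod (f (R j t) - c) <= \<omega>"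
 shows "hnorm H (st_rep S f (e (j, k))) <= cmod c + \<omega>"
  "cmod c - \<omega> <= cmod (inn H (st_rep S f (e (j, k))) (e (j, k)))"
proof -
 interpret P: pre_hilbert "L2_space (l j)" by (rule ph)
 let ?u = "fbasis (l j) k" and ?v = "curve_rep (l j) (R j) f (fbasis (l j) k)"
 note co = curve_osc[OF ok osc refl, of k]
 have u1: "hnorm (L2_space (l j)) ?u = 1" "inn (L2_space (l j)) ?u ?u = 1"
  using fbasis_orthonormal[OF l_pos, of j k k] by (auto simp: hnorm_def)
 have m: "st_rep S f (e (j, k)) \<in> carr H" by (rule rep_bound(1)[OF ok e_carr])
 have comp: "st_rep S f (e (j, k)) i = (if i = j then ?v else 0)" for i
 proof -
  have "curve_rep (l i) (R i) f 0 = 0"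
   using curve_mult.curve_rep_scale[OF cm okfD[OF ok], of 0 i 0] pre_hilbert.semi[OF ph, of i]
   by (simp add: semi_inner_def)
  then show ?thesis by (simp add: rep_comp e_comp)
 qed
 have "(hnorm H (st_rep S f (e (j, k))))\<^sup>2 = (\<Sum>i\<in>{j}. (hnorm (L2_space (l i)) (st_rep S f (e (j, k)) i))\<^sup>2)"
  unfolding hnorm_ds[OF m] by (rule suminf_finite) (auto simp: comp hnorm_def semi_inner.s_zero_left[OF pre_hilbert.semi[OF ph]] semi_inner.zero_mem[OF pre_hilbert.semi[OF ph]])
 then have "hnorm H (st_rep S f (e (j, k))) = hnorm (L2_space (l j)) ?v"
  using hnorm_nonneg[OF m] P.hnorm_nonneg[OF co(2)] by (simp add: comp)
 moreover have "hnorm (L2_space (l j)) ?v <= cmod c + \<omega>"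
  using P.hnorm_triangle_sub[OF co(2), of "c *\<^sub>C ?u"] co(1) u1 by (simp add: P.hnorm_scale)
 ultimately show "hnorm H (st_rep S f (e (j, k))) <= cmod c + \<omega>" by simp
 have "inn H (st_rep S f (e (j, k))) (e (j, k)) = inn (L2_space (l j)) ?v ?u"
  using m by (simp add: inn_e comp)
 also have "\<dots> = c + inn (L2_space (l j)) (?v - c *\<^sub>C ?u) ?u"
  using co(2) u1 by (simp add: P.s_diff P.s_scale)
 finally have "inn H (st_rep S f (e (j, k))) (e (j, k)) = c + inn (L2_space (l j)) (?v - c *\<^sub>C ?u) ?u" .
 moreover have "cmod (inn (L2_space (l j)) (?v - c *\<^sub>C ?u) ?u) <= \<omega>"
  using P.CS[of "?v - c *\<^sub>C ?u" ?u] co u1 by simp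
 ultimately show "cmod c - \<omega> <= cmod (inn H (st_rep S f (e (j, k))) (e (j, k)))"
  using norm_triangle_ineq2[of c "- inn (L2_space (l j)) (?v - c *\<^sub>C ?u) ?u"] by simp
qed

lemma abs_tev: "\<bar>tev (j, k)\<bar> = pi * \<bar>of_int (2 * k + 1)\<bar> / (2 * l j)"
 using l_pos[of j] by (simp add: tev_def dirac_ev_def abs_mult)

lemma abs_tev_ge: "1 <= \<bar>tev jk\<bar>"
proof -
 obtain j k where jk: "jk = (j, k)" by force
 have "(1::int) <= \<bar>2 * k + 1\<bar>" by presburger
 then have "1 <= \<bar>of_int (2 * k + 1) :: real\<bar>" by linarith
 then have "2 * 1 <= pi * \<bar>of_int (2 * k + 1)\<bar>" using pi_ge_two by (intro mult_mono) auto
 then show ?thesis unfolding jk abs_tev using l_pos[of j] l_le[of j] by (simp add: le_divide_eq)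
qed

end

section \<open>Ky Fan bounds for the representation of a function\<close>

locale curves_dim = curves l R X
 for l :: "nat => real" and R :: "nat => real => 'x::topological_space" and X :: "'x set" +
 fixes d :: real
 assumes d1: "1 < d"
begin

text \<open>The factor of the eigenvalue of the negative power of the Dirac operator that depends on
  the frequency only; by \<open>tev_powr\<close> the other factor is a power of the length.\<close>

definition \<kappa> :: "int => real"
 where "\<kappa> k = (2 / (pi * \<bar>of_int (2 * k + 1)\<bar>)) powr d"

lemma tev_powr: "\<bar>tev (j, k)\<bar> powr - d = l j powr d * \<kappa> k"
proof -
 have "\<bar>of_int (2 * k + 1) :: real\<bar> > 0"
 proof -
  have "2 * k + 1 \<noteq> 0" by presburger
  then show ?thesis by (simp del: of_int_add of_int_mult)
 qed
 moreover define y where "y = 2 / (pi * \<bar>of_int (2 * k + 1) :: real\<bar>)"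
 ultimately have "\<bar>tev (j, k)\<bar> powr - d = (l j * (2 / (pi * \<bar>of_int (2 * k + 1)\<bar>))) powr d"
  unfolding abs_tev powr_minus using l_pos[of j] by (simp add: powr_divide powr_mult field_simps del: of_int_add of_int_mult)
 also have "\<dots> = l j powr d * \<kappa> k" unfolding \<kappa>_def y_def[symmetric] using l_pos[of j] by (simp add: y_def powr_mult del: of_int_add of_int_mult times_divide_eq_right)
 finally show ?thesis .
qed

lemma \<kappa>_nonneg: "0 <= \<kappa> k" by (simp add: \<kappa>_def)

lemma \<kappa>_le_1: "\<kappa> k <= 1"
proof -
 have "(1::int) <= \<bar>2 * k + 1\<bar>" by presburger
 then have "1 <= \<bar>of_int (2 * k + 1) :: real\<bar>" by linarith
 then have "2 * 1 <= pi * \<bar>of_int (2 * k + 1) :: real\<bar>" using pi_ge_two by (intro mult_mono) auto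
 then have "2 / (pi * \<bar>of_int (2 * k + 1)\<bar>) <= (1::real)" by (simp add: divide_le_eq)
 then show ?thesis using d1 powr_mono2[of d "2 / (pi * \<bar>of_int (2 * k + 1)\<bar>)" "1::real"] by (simp add: \<kappa>_def del: of_int_add of_int_mult)
qed

definition ewt :: "(nat => ae_fun) => real"
 where "ewt v = \<bar>tev (ix v)\<bar> powr - d"

lemma ewt_e: "ewt (e (j, k)) = l j powr d * \<kappa> k"
 by (simp add: ewt_def tev_powr)

lemma ewt_bound: "v \<in> E ==> 0 <= ewt v" "v \<in> E ==> \<bar>ewt v\<bar> <= 1"
proof -
 have "\<bar>tev jk\<bar> powr - d <= 1" for jk
  using abs_tev_ge[of jk] d1 powr_mono2'[of "- d" 1 "\<bar>tev jk\<bar>"] by simp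
 then show "v \<in> E ==> 0 <= ewt v" "v \<in> E ==> \<bar>ewt v\<bar> <= 1" by (auto simp: ewt_def)
qed

abbreviation "G \<equiv> diag_op H E ewt"

lemma fun_calc_G: "fun_calc H (st_dirac S) (%t. \<bar>t\<bar> powr - d) = G"
proof -
 have "\<bar>\<bar>tev jk\<bar> powr - d\<bar> <= 1" for jk using ewt_bound(2)[of "e jk"] by (simp add: ewt_def)
 from fun_calc_S[where g = "%t. \<bar>t\<bar> powr - d" and C = 1, OF this] show ?thesis by (simp add: ewt_def[abs_def])
qed

text \<open>A positive operator for every \<open>f\<close>, unlike
  \<open>st_rep S f \<circ> G\<close>, whose factors do not commute in general. Four such operators
  recover that product in \<open>rep_G_decomp\<close>.\<close>

definition Af :: "('x => complex) => (nat => ae_fun) => nat => ae_fun"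
 where "Af f = st_rep S f \<circ> (G \<circ> st_rep S (%x. cnj (f x)))"

lemma Af_positive:
 assumes ok: "okf f B"
 shows "positive_op H (Af f)"
 unfolding Af_def
 by (rule sandwich_positive[where C = 1 and M = B])
  (use ewt_bound rep_bounded_ops[OF ok] rep_bounded_ops[OF okf_cnj[OF ok]] rep_adjoint[OF ok] rep_bound(2)[OF okf_cnj[OF ok]] in auto)

text \<open>On the finitely many curves in \<open>J\<close> all frequencies are counted at once, at
  the cost \<open>Z\<close>. The curves outside \<open>J\<close> have weights at most
  \<open>s\<close> and enter only through the number \<open>N\<close> of test vectors.\<close>

lemma Af_ky_fan_upper:
 assumes ok: "okf f B" and osc: "\<And>j t. t \<in> {0..l j} ==> cmod (f (R j t) - c j) <= \<omega> j"
  and Z: "\<And>A. finite A ==> sum \<kappa> A <= Z" and J: "finite J" and s: "\<And>j. j \<notin> J ==> l j powr d <= s" "0 <= s"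
 shows "ky_fan H (qform H (Af f)) N <= Z * (\<Sum>j\<in>J. l j powr d * (cmod (c j) + \<omega> j)\<^sup>2) + s * real N * B\<^sup>2"
 unfolding Af_def
proof (rule sandwich_ky_fan_upper[where I = "e ` (J \<times> UNIV)" and C = 1])
 fix F assume F: "finite F" "F \<subseteq> E \<inter> e ` (J \<times> UNIV)"
 \<comment> \<open>The frequencies that occur in \<open>F\<close>; enlarging \<open>F\<close> to a
   full product of curves and frequencies lets the sum factor.\<close>
 define A where "A = snd ` ix ` F"
 have A: "finite A" using F by (simp add: A_def)
 have FA: "F \<subseteq> e ` (J \<times> A)"
 proof
  fix v assume v: "v \<in> F"
  then obtain j k where "v = e (j, k)" "j \<in> J" using F by auto
  moreover from this have "k \<in> A" using v by (force simp: A_def)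
  ultimately show "v \<in> e ` (J \<times> A)" by auto
 qed
 have "(\<Sum>v\<in>F. ewt v * (hnorm H (st_rep S f v))\<^sup>2) <= (\<Sum>v\<in>e ` (J \<times> A). ewt v * (hnorm H (st_rep S f v))\<^sup>2)"
  using FA J A by (intro sum_mono2) (auto intro!: mult_nonneg_nonneg ewt_bound)
 also have "\<dots> = (\<Sum>jk\<in>J \<times> A. ewt (e jk) * (hnorm H (st_rep S f (e jk)))\<^sup>2)"
  by (subst sum.reindex) (auto intro: inj_on_subset[OF inj_e])
 also have "\<dots> = (\<Sum>j\<in>J. \<Sum>k\<in>A. ewt (e (j, k)) * (hnorm H (st_rep S f (e (j, k))))\<^sup>2)"
  by (simp add: sum.cartesian_product)
 also have "\<dots> <= (\<Sum>j\<in>J. \<Sum>k\<in>A. \<kappa> k * (l j powr d * (cmod (c j) + \<omega> j)\<^sup>2))"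
 proof (intro sum_mono)
  fix j k
  have "(hnorm H (st_rep S f (e (j, k))))\<^sup>2 <= (cmod (c j) + \<omega> j)\<^sup>2"
   using rep_e(1)[OF ok osc] by (intro power_mono hnorm_nonneg rep_bound(1)[OF ok]) auto
  then have "(\<kappa> k * l j powr d) * (hnorm H (st_rep S f (e (j, k))))\<^sup>2 <= (\<kappa> k * l j powr d) * (cmod (c j) + \<omega> j)\<^sup>2"
   using \<kappa>_nonneg by (intro mult_left_mono) auto
  then show "ewt (e (j, k)) * (hnorm H (st_rep S f (e (j, k))))\<^sup>2 <= \<kappa> k * (l j powr d * (cmod (c j) + \<omega> j)\<^sup>2)"
   by (simp add: ewt_e mult_ac)
 qed
 also have "\<dots> = sum \<kappa> A * (\<Sum>j\<in>J. l j powr d * (cmod (c j) + \<omega> j)\<^sup>2)"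
  by (simp add: sum_product sum.swap[of _ J])
 also have "\<dots> <= Z * (\<Sum>j\<in>J. l j powr d * (cmod (c j) + \<omega> j)\<^sup>2)"
  using Z[OF A] by (intro mult_right_mono sum_nonneg) auto
 finally show "(\<Sum>v\<in>F. ewt v * (hnorm H (st_rep S f v))\<^sup>2) <= Z * (\<Sum>j\<in>J. l j powr d * (cmod (c j) + \<omega> j)\<^sup>2)" .
next
 fix v assume v: "v \<in> E" "v \<notin> e ` (J \<times> UNIV)"
 then obtain j k where "v = e (j, k)" "j \<notin> J" by force
 then show "ewt v <= s" using s(1)[of j] \<kappa>_nonneg[of k] \<kappa>_le_1[of k] s(2) mult_mono[of "l j powr d" s "\<kappa> k" 1]
  by (simp add: ewt_e)
qed (use ewt_bound rep_bounded_ops[OF ok] rep_bounded_ops[OF okf_cnj[OF ok]] rep_adjoint[OF ok]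
  rep_bound(2)[OF okf_cnj[OF ok]] s in auto)

text \<open>The truncation by \<open>max 0\<close> keeps the squared lower bound valid when the
  oscillation exceeds \<open>cmod (c j)\<close>.\<close>

lemma Af_ky_fan_lower:
 assumes ok: "okf f B" and osc: "\<And>j t. t \<in> {0..l j} ==> cmod (f (R j t) - c j) <= \<omega> j"
  and J: "finite J" "finite A" "card J * card A <= N"
 shows "sum \<kappa> A * (\<Sum>j\<in>J. l j powr d * (max 0 (cmod (c j) - \<omega> j))\<^sup>2) <= ky_fan H (qform H (Af f)) N"
proof -
 have "sum \<kappa> A * (\<Sum>j\<in>J. l j powr d * (max 0 (cmod (c j) - \<omega> j))\<^sup>2)
  = (\<Sum>j\<in>J. \<Sum>k\<in>A. \<kappa> k * (l j powr d * (max 0 (cmod (c j) - \<omega> j))\<^sup>2))"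
  by (simp add: sum_product sum.swap[of _ J])
 also have "\<dots> <= (\<Sum>j\<in>J. \<Sum>k\<in>A. ewt (e (j, k)) * (cmod (inn H (st_rep S f (e (j, k))) (e (j, k))))\<^sup>2)"
 proof (intro sum_mono)
  fix j k
  have "(max 0 (cmod (c j) - \<omega> j))\<^sup>2 <= (cmod (inn H (st_rep S f (e (j, k))) (e (j, k))))\<^sup>2"
   using rep_e(2)[OF ok osc] by (intro power_mono) auto
  then have "(\<kappa> k * l j powr d) * (max 0 (cmod (c j) - \<omega> j))\<^sup>2 <= (\<kappa> k * l j powr d) * (cmod (inn H (st_rep S f (e (j, k))) (e (j, k))))\<^sup>2"
   using \<kappa>_nonneg by (intro mult_left_mono) auto
  then show "\<kappa> k * (l j powr d * (max 0 (cmod (c j) - \<omega> j))\<^sup>2) <= ewt (e (j, k)) * (cmod (inn H (st_rep S f (e (j, k))) (e (j, k))))\<^sup>2"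
   by (simp add: ewt_e mult_ac)
 qed
 also have "\<dots> = (\<Sum>v\<in>e ` (J \<times> A). ewt v * (cmod (inn H (st_rep S f v) v))\<^sup>2)"
  by (subst sum.reindex) (auto intro: inj_on_subset[OF inj_e] simp: sum.cartesian_product)
 also have "\<dots> <= ky_fan H (qform H (Af f)) N"
  unfolding Af_def
 proof (rule sandwich_ky_fan_lower[where C = 1 and M = B])
  show "card (e ` (J \<times> A)) <= N" using J by (simp add: card_image[OF inj_on_subset[OF inj_e]] card_cartesian_product)
 qed (use J ewt_bound rep_bounded_ops[OF ok] rep_bounded_ops[OF okf_cnj[OF ok]] rep_adjoint[OF ok] rep_bound(2)[OF okf_cnj[OF ok]] in auto)
 finally show ?thesis .
qed

end

section \<open>Hausdorff measure\<close>

definition hcover :: "real => 'a::metric_space set => (nat => 'a set) => bool"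
 where "hcover \<delta> A U \<longleftrightarrow> A \<subseteq> (\<Union>i. U i) \<and> (\<forall>i. bounded (U i) \<and> diameter (U i) <= \<delta>)"

definition hcost :: "real => (nat => 'a::metric_space set) => ennreal"
 where "hcost s U = (\<Sum>i. ennreal (diameter (U i) powr s))"

lemma hausdorff_pre_eq: "hausdorff_pre s \<delta> A = (INF U\<in>{U. hcover \<delta> A U}. hcost s U)"
 unfolding hausdorff_pre_def hcover_def hcost_def by (rule arg_cong[where f = Inf]) auto

lemma hausdorff_pre_le: "hcover \<delta> A U ==> hausdorff_pre s \<delta> A <= hcost s U"
 unfolding hausdorff_pre_eq by (rule INF_lower) simp

lemma hausdorff_pre_ge: "(\<And>U. hcover \<delta> A U ==> c <= hcost s U) ==> c <= hausdorff_pre s \<delta> A"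
 unfolding hausdorff_pre_eq by (rule INF_greatest) simp

lemma hausdorff_pre_mono: "A \<subseteq> B ==> hausdorff_pre s \<delta> A <= hausdorff_pre s \<delta> B"
 by (rule hausdorff_pre_ge, rule hausdorff_pre_le) (auto simp: hcover_def)

lemma hausdorff_pre_antimono: "\<delta> <= \<delta>' ==> hausdorff_pre s \<delta>' A <= hausdorff_pre s \<delta> A"
 by (rule hausdorff_pre_ge, rule hausdorff_pre_le) (auto simp: hcover_def intro: order_trans)

lemma hausdorff_pre_single:
 fixes A :: "'a::metric_space set"
 assumes "bounded A" "diameter A <= \<delta>" "0 <= \<delta>"
 shows "hausdorff_pre s \<delta> A <= ennreal (diameter A powr s)"
proof -
 define U where "U i = (if i = 0 then A else {})" for i :: nat
 have "hausdorff_pre s \<delta> A <= hcost s U"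
  by (rule hausdorff_pre_le) (use assms in \<open>auto simp: hcover_def U_def intro: exI[of _ 0]\<close>)
 also have "hcost s U = (\<Sum>i\<in>{0}. ennreal (diameter (U i) powr s))"
  unfolding hcost_def by (rule suminf_finite) (auto simp: U_def)
 finally show ?thesis by (simp add: U_def)
qed

lemma hausdorff_pre_empty: "0 <= \<delta> ==> hausdorff_pre s \<delta> {} = 0"
 using hausdorff_pre_single[of "{}" \<delta> s] by simp

text \<open>Covers of the single sets, optimal up to \<open>e / 2 ^ (i + 1)\<close>, are merged into
  one sequence by the pairing of natural numbers.\<close>

lemma hausdorff_pre_countable_subadditive:
 "hausdorff_pre s \<delta> (\<Union>i. A i) <= (\<Sum>i::nat. hausdorff_pre s \<delta> (A i))"
proof (rule ennreal_le_epsilon)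
 fix e :: real assume fin: "(\<Sum>i. hausdorff_pre s \<delta> (A i)) < top" and e: "0 < e"
 have "\<exists>U. hcover \<delta> (A i) U \<and> hcost s U <= hausdorff_pre s \<delta> (A i) + ennreal (e * (1/2) ^ Suc i)" for i
 proof -
  have "hausdorff_pre s \<delta> (A i) < hausdorff_pre s \<delta> (A i) + ennreal (e * (1/2) ^ Suc i)"
  proof -
   have "hausdorff_pre s \<delta> (A i) <= (\<Sum>i. hausdorff_pre s \<delta> (A i))"
    using sum_le_suminf[of "%i. hausdorff_pre s \<delta> (A i)" "{i}"] by simp
   then have "hausdorff_pre s \<delta> (A i) < top" using fin by simp
   then show ?thesis using e by (cases "hausdorff_pre s \<delta> (A i)") (auto simp: ennreal_plus[symmetric] ennreal_less_iff simp del: ennreal_plus)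
  qed
  then obtain U where "hcover \<delta> (A i) U" "hcost s U < hausdorff_pre s \<delta> (A i) + ennreal (e * (1/2) ^ Suc i)"
   unfolding hausdorff_pre_eq INF_less_iff by auto
  then show ?thesis by (auto intro: less_imp_le)
 qed
 then obtain U where U: "\<And>i. hcover \<delta> (A i) (U i)"
  "\<And>i. hcost s (U i) <= hausdorff_pre s \<delta> (A i) + ennreal (e * (1/2) ^ Suc i)" by metis
 define V where "V k = U (fst (prod_decode k)) (snd (prod_decode k))" for k
 have "hcover \<delta> (\<Union>i. A i) V"
  unfolding hcover_def
 proof
  show "(\<Union>i. A i) \<subseteq> (\<Union>k. V k)"
  proof
   fix x assume "x \<in> (\<Union>i. A i)"
   then obtain i where "x \<in> A i" by auto
   then obtain j where "x \<in> U i j" using U(1)[of i] by (auto simp: hcover_def)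
   then show "x \<in> (\<Union>k. V k)" by (auto simp: V_def intro!: exI[of _ "prod_encode (i, j)"])
  qed
 qed (use U(1) in \<open>auto simp: hcover_def V_def\<close>)
 then have "hausdorff_pre s \<delta> (\<Union>i. A i) <= hcost s V" by (rule hausdorff_pre_le)
 also have "hcost s V = (\<Sum>k. (%(i, j). ennreal (diameter (U i j) powr s)) (prod_decode k))"
  unfolding hcost_def V_def by (simp add: split_beta)
 also have "\<dots> = (\<Sum>i. hcost s (U i))"
  by (rule suminf_ennreal_2dimen) (simp add: hcost_def)
 also have "\<dots> <= (\<Sum>i. hausdorff_pre s \<delta> (A i) + ennreal (e * (1/2) ^ Suc i))"
  by (intro suminf_le U) auto
 also have "\<dots> = (\<Sum>i. hausdorff_pre s \<delta> (A i)) + (\<Sum>i. ennreal (e * (1/2) ^ Suc i))"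
  by (intro suminf_add[symmetric]) auto
 also have "(\<Sum>i. ennreal (e * (1/2) ^ Suc i)) = ennreal e"
  using sums_mult[OF power_half_series, of e] e by (intro suminf_ennreal_eq) auto
 finally show "hausdorff_pre s \<delta> (\<Union>i. A i) <= (\<Sum>i. hausdorff_pre s \<delta> (A i)) + ennreal e" .
qed

lemma hausdorff_outer_upper: "0 < \<delta> ==> hausdorff_pre s \<delta> A <= hausdorff_outer s A"
 unfolding hausdorff_outer_def by (rule SUP_upper) simp

lemma hausdorff_outer_least: "(\<And>\<delta>. 0 < \<delta> ==> hausdorff_pre s \<delta> A <= c) ==> hausdorff_outer s A <= c"
 unfolding hausdorff_outer_def by (rule SUP_least) simp

lemma hausdorff_outer_mono: "A \<subseteq> B ==> hausdorff_outer s A <= hausdorff_outer s B"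
 by (rule hausdorff_outer_least) (meson hausdorff_pre_mono hausdorff_outer_upper order_trans)

lemma hausdorff_outer_empty: "hausdorff_outer s {} = 0"
proof -
 have "hausdorff_outer s {} <= 0" by (rule hausdorff_outer_least) (simp add: hausdorff_pre_empty)
 then show ?thesis by simp
qed

lemma hausdorff_outer_countable_subadditive:
 "hausdorff_outer s (\<Union>i. A i) <= (\<Sum>i::nat. hausdorff_outer s (A i))"
proof (rule hausdorff_outer_least)
 fix \<delta> :: real assume \<delta>: "0 < \<delta>"
 have "hausdorff_pre s \<delta> (\<Union>i. A i) <= (\<Sum>i. hausdorff_pre s \<delta> (A i))" by (rule hausdorff_pre_countable_subadditive)
 also have "\<dots> <= (\<Sum>i. hausdorff_outer s (A i))" using \<delta> by (intro suminf_le hausdorff_outer_upper) auto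
 finally show "hausdorff_pre s \<delta> (\<Union>i. A i) <= (\<Sum>i. hausdorff_outer s (A i))" .
qed

lemma hausdorff_outer_Un: "hausdorff_outer s (A \<union> B) <= hausdorff_outer s A + hausdorff_outer s B"
proof -
 define C where "C i = (if i = 0 then A else if i = Suc 0 then B else {})" for i :: nat
 have "A \<union> B = (\<Union>i. C i)" by (auto simp: C_def split: if_splits)
 then have "hausdorff_outer s (A \<union> B) <= (\<Sum>i. hausdorff_outer s (C i))"
  using hausdorff_outer_countable_subadditive[of s C] by simp
 also have "\<dots> = (\<Sum>i\<in>{0, Suc 0}. hausdorff_outer s (C i))"
  by (rule suminf_finite) (auto simp: C_def hausdorff_outer_empty)
 finally show ?thesis by (simp add: C_def)
qed

text \<open>A set of diameter less than \<eta> meets at most one of \<open>A\<close> and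
  \<open>B\<close>, so a cover of the union splits into two covers without sharing any set.\<close>

lemma hausdorff_pre_separated:
 fixes A B :: "'a::metric_space set"
 assumes sep: "\<And>x y. x \<in> A ==> y \<in> B ==> \<eta> <= dist x y" and \<delta>: "0 <= \<delta>" "\<delta> < \<eta>"
 shows "hausdorff_pre s \<delta> A + hausdorff_pre s \<delta> B <= hausdorff_pre s \<delta> (A \<union> B)"
proof (rule hausdorff_pre_ge)
 fix U assume U: "hcover \<delta> (A \<union> B) U"
 define V where "V C i = (if U i \<inter> C \<noteq> {} then U i else {})" for C i
 have cov: "hcover \<delta> C (V C)" if CAB: "C \<subseteq> A \<union> B" for C
  unfolding hcover_def
 proof (intro conjI allI)
  show "C \<subseteq> (\<Union>i. V C i)"
  proof
   fix x assume x: "x \<in> C"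
   then obtain i where "x \<in> U i" using U CAB unfolding hcover_def by blast
   then show "x \<in> (\<Union>i. V C i)" using x by (auto simp: V_def intro!: exI[of _ i])
  qed
  fix i show "bounded (V C i)" "diameter (V C i) <= \<delta>" using U \<delta> by (auto simp: V_def hcover_def)
 qed
 have "hausdorff_pre s \<delta> A + hausdorff_pre s \<delta> B <= hcost s (V A) + hcost s (V B)"
  by (intro add_mono hausdorff_pre_le cov) auto
 also have "\<dots> = (\<Sum>i. ennreal (diameter (V A i) powr s) + ennreal (diameter (V B i) powr s))"
  unfolding hcost_def by (intro suminf_add) auto
 also have "\<dots> <= (\<Sum>i. ennreal (diameter (U i) powr s))"
 proof (intro suminf_le allI)
  fix i
  have "U i \<inter> A = {} \<or> U i \<inter> B = {}"
  proof (rule ccontr)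
   assume "\<not> ?thesis"
   then obtain x y where xy: "x \<in> U i" "x \<in> A" "y \<in> U i" "y \<in> B" by auto
   have "dist x y <= diameter (U i)" using U xy by (intro diameter_bounded_bound) (auto simp: hcover_def)
   also have "\<dots> <= \<delta>" using U by (auto simp: hcover_def)
   finally show False using sep[OF xy(2,4)] \<delta> by simp
  qed
  then show "ennreal (diameter (V A i) powr s) + ennreal (diameter (V B i) powr s) <= ennreal (diameter (U i) powr s)"
   by (auto simp: V_def)
 qed auto
 finally show "hausdorff_pre s \<delta> A + hausdorff_pre s \<delta> B <= hcost s U" by (simp add: hcost_def)
qed

lemma hausdorff_outer_seq: "hausdorff_outer s A = (SUP n. hausdorff_pre s (1 / real (Suc n)) A)"
proof (rule antisym)
 show "hausdorff_outer s A <= (SUP n. hausdorff_pre s (1 / real (Suc n)) A)"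
 proof (rule hausdorff_outer_least)
  fix \<delta> :: real assume "0 < \<delta>"
  then obtain n where n: "1 / real (Suc n) < \<delta>" using reals_Archimedean by (auto simp: inverse_eq_divide)
  then have "hausdorff_pre s \<delta> A <= hausdorff_pre s (1 / real (Suc n)) A" by (intro hausdorff_pre_antimono) simp
  also have "\<dots> <= (SUP n. hausdorff_pre s (1 / real (Suc n)) A)" by (rule SUP_upper) simp
  finally show "hausdorff_pre s \<delta> A <= (SUP n. hausdorff_pre s (1 / real (Suc n)) A)" .
 qed
qed (auto intro!: SUP_least hausdorff_outer_upper)

lemma hausdorff_outer_separated:
 fixes A B :: "'a::metric_space set"
 assumes sep: "\<And>x y. x \<in> A ==> y \<in> B ==> \<eta> <= dist x y" and \<eta>: "0 < \<eta>"
 shows "hausdorff_outer s A + hausdorff_outer s B <= hausdorff_outer s (A \<union> B)"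
proof -
 have inc: "incseq (%n. hausdorff_pre s (1 / real (Suc n)) C)" for C :: "'a set"
  by (intro incseq_SucI hausdorff_pre_antimono) (simp add: field_simps)
 have "hausdorff_outer s A + hausdorff_outer s B
  = (SUP n. hausdorff_pre s (1 / real (Suc n)) A + hausdorff_pre s (1 / real (Suc n)) B)"
  unfolding hausdorff_outer_seq by (rule ennreal_SUP_add[symmetric]) (intro inc)+
 also have "\<dots> <= hausdorff_outer s (A \<union> B)"
 proof (rule SUP_least)
  fix n
  define \<delta> where "\<delta> = min (1 / real (Suc n)) (\<eta> / 2)"
  have \<delta>: "0 < \<delta>" "\<delta> < \<eta>" "\<delta> <= 1 / real (Suc n)" using \<eta> by (auto simp: \<delta>_def)
  have "hausdorff_pre s (1 / real (Suc n)) A + hausdorff_pre s (1 / real (Suc n)) B <= hausdorff_pre s \<delta> A + hausdorff_pre s \<delta> B"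
   using \<delta> by (intro add_mono hausdorff_pre_antimono)
  also have "\<dots> <= hausdorff_pre s \<delta> (A \<union> B)" by (rule hausdorff_pre_separated[OF sep]) (use \<delta> in auto)
  also have "\<dots> <= hausdorff_outer s (A \<union> B)" using \<delta> by (intro hausdorff_outer_upper)
  finally show "hausdorff_pre s (1 / real (Suc n)) A + hausdorff_pre s (1 / real (Suc n)) B <= hausdorff_outer s (A \<union> B)" .
 qed
 finally show ?thesis .
qed

text \<open>Caratheodory's criterion for metric outer measures. \<open>A - C\<close> is the union of
  \<open>B n\<close>, which keeps a positive distance from \<open>C\<close>, and of thin shells
  \<open>D j\<close> around \<open>C\<close>. The shells have finite total measure, so the tails of
  their sum vanish.\<close>

lemma hausdorff_outer_caratheodory:
 fixes A C :: "'a::metric_space set"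
 assumes C: "closed C"
 shows "hausdorff_outer s (A \<inter> C) + hausdorff_outer s (A - C) <= hausdorff_outer s A"
proof (cases "hausdorff_outer s A = top \<or> C = {}")
 case True then show ?thesis by (auto simp: hausdorff_outer_empty)
next
 case False
 then have fin: "hausdorff_outer s A < top" and ne: "C \<noteq> {}" by (auto simp: top.not_eq_extremum)
 let ?m = "hausdorff_outer s"
 define \<phi> where "\<phi> x = infdist x C" for x
 have lip: "\<phi> x - \<phi> y <= dist x y" for x y
  using infdist_triangle[of x C y] by (simp add: \<phi>_def)
 have \<phi>0: "\<phi> x > 0" if "x \<notin> C" for x using infdist_pos_not_in_closed[OF C ne that] by (simp add: \<phi>_def)
 define B where "B n = {x\<in>A. 1 / real (Suc n) <= \<phi> x}" for n
 define D where "D n = {x\<in>A. 1 / real (Suc (Suc n)) <= \<phi> x \<and> \<phi> x < 1 / real (Suc n)}" for n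
 have DA: "D n \<subseteq> A" for n by (auto simp: D_def)
 have AC: "A - C \<subseteq> B n \<union> (\<Union>j. D (j + n))" for n
 proof
  fix x assume x: "x \<in> A - C"
  show "x \<in> B n \<union> (\<Union>j. D (j + n))"
  proof (cases "1 / real (Suc n) <= \<phi> x")
   case True then show ?thesis using x by (auto simp: B_def)
  next
   case False
   have ex: "\<exists>m. 1 / real (Suc m) <= \<phi> x" using reals_Archimedean[OF \<phi>0[of x]] x by (auto simp: inverse_eq_divide intro: less_imp_le)
   define m where "m = (LEAST m. 1 / real (Suc m) <= \<phi> x)"
   have m: "1 / real (Suc m) <= \<phi> x" unfolding m_def by (rule LeastI_ex[OF ex])
   have "n < m"
   proof (rule ccontr)
    assume "\<not> n < m"
    then have "1 / real (Suc n) <= 1 / real (Suc m)" by (intro divide_left_mono) auto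
    then show False using m False by simp
   qed
   then obtain k where k: "m = Suc k" "n <= k" by (cases m) auto
   have "\<not> 1 / real (Suc k) <= \<phi> x" using not_less_Least[of k "%m. 1 / real (Suc m) <= \<phi> x"] k by (simp add: m_def)
   then have "x \<in> D k" using m k x by (simp add: D_def)
   then show ?thesis using k(2) by (auto intro!: exI[of _ "k - n"])
  qed
 qed
 \<comment> \<open>Neighbouring shells may touch, but shells of equal parity are separated, so their
   measures add. The case \<open>n = 0\<close> is split off since for \<open>p = 0\<close> the
   separation would involve \<open>1 / 0\<close>.\<close>
 have alt: "(\<Sum>i<n. ?m (D (2 * i + p))) <= ?m (\<Union>i<n. D (2 * i + p))" for n p
 proof (induction n)
  case (Suc n)
  show ?case
  proof (cases "n = 0")
   case False
   have "(\<Sum>i<Suc n. ?m (D (2 * i + p))) <= ?m (\<Union>i<n. D (2 * i + p)) + ?m (D (2 * n + p))"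
    using Suc by (simp add: add_right_mono)
   also have "\<dots> <= ?m ((\<Union>i<n. D (2 * i + p)) \<union> D (2 * n + p))"
   proof (rule hausdorff_outer_separated[where \<eta> = "1 / real (2 * n + p) - 1 / real (2 * n + p + 1)"])
    fix x y assume "x \<in> (\<Union>i<n. D (2 * i + p))" and y: "y \<in> D (2 * n + p)"
    then obtain i where i: "i < n" "x \<in> D (2 * i + p)" by auto
    have "1 / real (2 * n + p) <= 1 / real (Suc (Suc (2 * i + p)))" using i by (intro divide_left_mono) auto
    then have "1 / real (2 * n + p) <= \<phi> x" using i by (simp add: D_def)
    moreover have "\<phi> y < 1 / real (2 * n + p + 1)" using y by (simp add: D_def)
    ultimately show "1 / real (2 * n + p) - 1 / real (2 * n + p + 1) <= dist x y" using lip[of x y] by simp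
   next
    show "0 < 1 / real (2 * n + p) - 1 / real (2 * n + p + 1)"
     using False by (simp add: frac_less2)
   qed
   also have "(\<Union>i<n. D (2 * i + p)) \<union> D (2 * n + p) = (\<Union>i<Suc n. D (2 * i + p))" by (auto simp: less_Suc_eq)
   finally show ?thesis .
  qed (simp add: lessThan_Suc)
 qed simp
 have sum_le: "(\<Sum>j<n. ?m (D j)) <= ?m A + ?m A" for n
 proof -
  have "(\<Sum>j<n. ?m (D j)) <= (\<Sum>j<2 * n. ?m (D j))" by (intro sum_mono2) auto
  also have "\<dots> = (\<Sum>i<n. ?m (D (2 * i + 0))) + (\<Sum>i<n. ?m (D (2 * i + 1)))"
   by (induction n) (auto simp: add_ac)
  also have "\<dots> <= ?m (\<Union>i<n. D (2 * i + 0)) + ?m (\<Union>i<n. D (2 * i + 1))" by (intro add_mono alt)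
  also have "\<dots> <= ?m A + ?m A" using DA by (intro add_mono hausdorff_outer_mono) auto
  finally show ?thesis .
 qed
 have "(\<Sum>j. ?m (D j)) <= ?m A + ?m A" unfolding suminf_eq_SUP by (rule SUP_least) (rule sum_le)
 then have S: "(\<Sum>j. ?m (D j)) \<noteq> top" using fin by (auto simp: top_unique)
 define b where "b j = enn2real (?m (D j))" for j
 have "?m (D j) < top" for j using hausdorff_outer_mono[OF DA, of s j] fin by (rule le_less_trans)
 then have b: "?m (D j) = ennreal (b j)" "0 <= b j" for j by (auto simp: b_def)
 have sb: "summable b" using b(2) S unfolding b(1) by (rule summable_suminf_not_top)
 have AB: "?m (A \<inter> C) + ?m (B n) <= ?m A" for n
 proof -
  have "?m (A \<inter> C) + ?m (B n) <= ?m ((A \<inter> C) \<union> B n)"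
  proof (rule hausdorff_outer_separated[where \<eta> = "1 / real (Suc n)"])
   fix x y assume "x \<in> A \<inter> C" "y \<in> B n"
   then show "1 / real (Suc n) <= dist x y" using lip[of y x] by (simp add: \<phi>_def B_def dist_commute)
  qed simp
  also have "\<dots> <= ?m A" by (intro hausdorff_outer_mono) (auto simp: B_def)
  finally show ?thesis .
 qed
 show ?thesis
 proof (rule ennreal_le_epsilon)
  fix r :: real assume r: "0 < r"
  obtain N where N: "\<And>n. n \<ge> N ==> norm (\<Sum>i. b (i + n)) < r" using suminf_exist_split[OF r sb] by blast
  have "?m (A - C) <= ?m (B N \<union> (\<Union>j. D (j + N)))" by (rule hausdorff_outer_mono[OF AC])
  also have "\<dots> <= ?m (B N) + ?m (\<Union>j. D (j + N))" by (rule hausdorff_outer_Un)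
  also have "?m (\<Union>j. D (j + N)) <= (\<Sum>j. ?m (D (j + N)))" by (rule hausdorff_outer_countable_subadditive)
  also have "(\<Sum>j. ?m (D (j + N))) = ennreal (\<Sum>j. b (j + N))"
   using b(2) sb unfolding b(1) by (intro suminf_ennreal2) (auto simp: summable_iff_shift)
  also have "\<dots> <= ennreal r" using N[of N] by (intro ennreal_leI) auto
  finally have "?m (A - C) <= ?m (B N) + ennreal r" by (simp add: add_left_mono)
  then have "?m (A \<inter> C) + ?m (A - C) <= (?m (A \<inter> C) + ?m (B N)) + ennreal r" by (simp add: add_left_mono add.assoc)
  also have "\<dots> <= ?m A + ennreal r" by (intro add_right_mono AB)
  finally show "?m (A \<inter> C) + ?m (A - C) <= ?m A + ennreal r" .
 qed
qed

text \<open>\<open>measure_of\<close> yields the zero measure unless the given function is a measure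
  on the generated algebra; this fact is what gives \<open>hausdorff_measure\<close> its
  values.\<close>

lemma hausdorff_measure_space: "measure_space (UNIV :: 'a::metric_space set) (sets borel) (hausdorff_outer s)"
proof -
 interpret P: sigma_algebra "UNIV :: 'a set" "Pow UNIV" by (rule sigma_algebra_Pow)
 have "outer_measure_space (Pow UNIV) (hausdorff_outer s :: 'a set => ennreal)"
  unfolding outer_measure_space_def positive_def increasing_def countably_subadditive_def
  by (auto simp: hausdorff_outer_empty intro: hausdorff_outer_mono hausdorff_outer_countable_subadditive)
 from P.caratheodory_lemma[OF this]
 have ms: "measure_space UNIV (lambda_system UNIV (Pow UNIV) (hausdorff_outer s)) (hausdorff_outer s :: 'a set => ennreal)" .
 have cl: "C \<in> lambda_system UNIV (Pow UNIV) (hausdorff_outer s)" if C: "closed C" for C :: "'a set"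
  unfolding lambda_system_def
 proof (intro CollectI conjI ballI)
  fix A :: "'a set"
  have "hausdorff_outer s A <= hausdorff_outer s (A \<inter> C) + hausdorff_outer s (A - C)"
   using hausdorff_outer_Un[of s "A \<inter> C" "A - C"] by (simp add: Int_Diff_Un)
  with hausdorff_outer_caratheodory[OF C, of s A]
  have "hausdorff_outer s (A \<inter> C) + hausdorff_outer s (A - C) = hausdorff_outer s A" by (rule order.antisym)
  moreover have "C \<inter> A = A \<inter> C" "(UNIV - C) \<inter> A = A - C" by auto
  ultimately show "hausdorff_outer s (C \<inter> A) + hausdorff_outer s ((UNIV - C) \<inter> A) = hausdorff_outer s A" by simp
 qed simp
 have "sigma_algebra UNIV (lambda_system UNIV (Pow UNIV) (hausdorff_outer s :: 'a set => ennreal))"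
  using ms by (simp add: measure_space_def)
 from sigma_algebra.sigma_sets_subset[OF this, of "{C. closed C}"] cl
 have "sets (borel :: 'a measure) \<subseteq> lambda_system UNIV (Pow UNIV) (hausdorff_outer s)"
  by (auto simp: borel_eq_closed)
 from measure_down[OF ms _ this] show ?thesis using sets.sigma_algebra_axioms[of "borel :: 'a measure"] by simp
qed

section \<open>Values of the Hausdorff measure, Lipschitz images and segments\<close>

lemma emeasure_hausdorff: "A \<in> sets borel ==> emeasure (hausdorff_measure s) A = hausdorff_outer s A"
 unfolding hausdorff_measure_def using hausdorff_measure_space[of s]
 by (intro emeasure_measure_of_sigma) (auto simp: measure_space_def)

lemma sets_hausdorff [simp, measurable_cong]: "sets (hausdorff_measure s) = sets borel"
 unfolding hausdorff_measure_def using sets.sigma_sets_eq[of borel] by (simp add: sets_measure_of_conv)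

lemma space_hausdorff [simp]: "space (hausdorff_measure s) = UNIV"
 unfolding hausdorff_measure_def by (simp add: space_measure_of_conv)

lemma hausdorff_outer_lipschitz:
 fixes f :: "'a::metric_space => 'b::metric_space"
 assumes lip: "\<And>x y. dist (f x) (f y) <= \<rho> * dist x y" and \<rho>: "0 < \<rho>" and s: "0 < s"
 shows "hausdorff_outer s (f ` A) <= ennreal (\<rho> powr s) * hausdorff_outer s A"
proof (rule hausdorff_outer_least)
 fix \<delta>' :: real assume "0 < \<delta>'"
 define \<delta> where "\<delta> = \<delta>' / \<rho>"
 have \<delta>: "0 < \<delta>" "\<delta>' = \<rho> * \<delta>" using \<open>0 < \<delta>'\<close> \<rho> by (auto simp: \<delta>_def)
 have "ennreal (1 / \<rho> powr s) * hausdorff_pre s \<delta>' (f ` A) <= hausdorff_pre s \<delta> A"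
 proof (rule hausdorff_pre_ge)
  fix U assume U: "hcover \<delta> A U"
  have bU: "bounded (U i)" "diameter (U i) <= \<delta>" for i using U by (auto simp: hcover_def)
  have d: "dist (f x) (f y) <= \<rho> * diameter (U i)" if "x \<in> U i" "y \<in> U i" for x y i
   using lip[of x y] diameter_bounded_bound[OF bU(1) that] \<rho> by (meson less_imp_le mult_left_mono order_trans)
  have fb: "bounded (f ` U i)" for i
   unfolding bounded_two_points using d by blast
  have fd: "diameter (f ` U i) <= \<rho> * diameter (U i)" for i
  proof (cases "U i = {}")
   case False
   then show ?thesis unfolding diameter_def[of "f ` U i"] using d by (auto intro!: cSUP_least)
  qed simp
  have "hcover \<delta>' (f ` A) (%i. f ` U i)"
   unfolding hcover_def
  proof (intro conjI allI fb)
   show "f ` A \<subseteq> (\<Union>i. f ` U i)" using U unfolding hcover_def by blast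
   fix i show "diameter (f ` U i) <= \<delta>'"
    using order_trans[OF fd[of i] mult_left_mono[OF bU(2)[of i] less_imp_le[OF \<rho>]]] \<delta> by simp
  qed
  then have "hausdorff_pre s \<delta>' (f ` A) <= hcost s (%i. f ` U i)" by (rule hausdorff_pre_le)
  also have "\<dots> <= (\<Sum>i. ennreal (\<rho> powr s) * ennreal (diameter (U i) powr s))"
   unfolding hcost_def
  proof (intro suminf_le)
   fix i
   have "diameter (f ` U i) powr s <= (\<rho> * diameter (U i)) powr s"
    using fd s diameter_ge_0[OF fb] by (intro powr_mono2) auto
   then show "ennreal (diameter (f ` U i) powr s) <= ennreal (\<rho> powr s) * ennreal (diameter (U i) powr s)"
    using \<rho> diameter_ge_0[OF bU(1)] by (simp add: powr_mult ennreal_mult[symmetric] ennreal_leI)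
  qed auto
  also have "\<dots> = ennreal (\<rho> powr s) * hcost s U" unfolding hcost_def by simp
  finally have "ennreal (1 / \<rho> powr s) * hausdorff_pre s \<delta>' (f ` A) <= ennreal (1 / \<rho> powr s) * (ennreal (\<rho> powr s) * hcost s U)"
   by (rule mult_left_mono) simp
  also have "\<dots> = hcost s U" using \<rho> by (simp add: mult.assoc[symmetric] ennreal_mult[symmetric])
  finally show "ennreal (1 / \<rho> powr s) * hausdorff_pre s \<delta>' (f ` A) <= hcost s U" .
 qed
 also have "\<dots> <= hausdorff_outer s A" using \<delta> by (intro hausdorff_outer_upper)
 finally have "ennreal (\<rho> powr s) * (ennreal (1 / \<rho> powr s) * hausdorff_pre s \<delta>' (f ` A)) <= ennreal (\<rho> powr s) * hausdorff_outer s A"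
  by (rule mult_left_mono) simp
 then show "hausdorff_pre s \<delta>' (f ` A) <= ennreal (\<rho> powr s) * hausdorff_outer s A"
  using \<rho> by (simp add: mult.assoc[symmetric] ennreal_mult[symmetric])
qed

text \<open>\<open>Suc n\<close> intervals of length \<open>1 / Suc n\<close> cost
  \<open>Suc n powr (1 - s)\<close>, which tends to 0. This is the source of the fact that joining
  edges carry no measure.\<close>

lemma hausdorff_outer_unit_interval:
 assumes s: "1 < s"
 shows "hausdorff_outer s {0..1::real} = 0"
proof -
 have pre: "hausdorff_pre s (1 / real (Suc n)) {0..1::real} <= ennreal (real (Suc n) powr (1 - s))" for n
 proof -
  define h where "h = 1 / real (Suc n)"
  have h: "0 < h" "real (Suc n) * h = 1" by (auto simp: h_def)
  define U where "U i = (if i <= n then {real i * h .. real i * h + h} else {})" for i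
  have dU: "diameter (U i) = (if i <= n then h else 0)" for i using h by (simp add: U_def)
  have "hcover h {0..1} U"
   unfolding hcover_def
  proof (intro conjI allI subsetI)
   fix x :: real assume x: "x \<in> {0..1}"
   show "x \<in> (\<Union>i. U i)"
   proof (cases "x = 1")
    case True
    have "x \<in> U n" using True h by (simp add: U_def algebra_simps)
    then show ?thesis by blast
   next
    case False
    define i where "i = nat \<lfloor>x * real (Suc n)\<rfloor>"
    have "0 <= x * real (Suc n)" using x by simp
    then have i: "real i <= x * real (Suc n)" "x * real (Suc n) < real i + 1" unfolding i_def by linarith+
    have "x * real (Suc n) < 1 * real (Suc n)" using False x by (intro mult_strict_right_mono) auto
    with i(1) have "real i < 1 * real (Suc n)" by (rule le_less_trans)
    then have "i <= n" by simp
    moreover have "real i * h <= x" "x <= real i * h + h" using i by (auto simp: h_def field_simps)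
    ultimately have "x \<in> U i" by (simp add: U_def)
    then show ?thesis by blast
   qed
  qed (use h dU in \<open>auto simp: U_def\<close>)
  then have "hausdorff_pre s h {0..1::real} <= hcost s U" by (rule hausdorff_pre_le)
  also have "hcost s U = (\<Sum>i\<in>{..n}. ennreal (diameter (U i) powr s))"
   unfolding hcost_def by (rule suminf_finite) (auto simp: dU)
  also have "\<dots> = ennreal (\<Sum>i\<in>{..n}. h powr s)" by (subst sum_ennreal) (auto simp: dU)
  also have "(\<Sum>i\<in>{..n}. h powr s) = real (Suc n) powr (1 - s)"
   by (simp add: h_def powr_divide powr_diff)
  finally show ?thesis by (simp add: h_def)
 qed
 have lim: "(%n. real (Suc n) powr (1 - s)) \<longlonglongrightarrow> 0"
  using s by (intro tendsto_neg_powr filterlim_compose[OF filterlim_real_sequentially filterlim_Suc]) auto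
 have inc: "incseq (%n. hausdorff_pre s (1 / real (Suc n)) {0..1::real})"
  by (intro incseq_SucI hausdorff_pre_antimono) (simp add: field_simps)
 have "(%n. ennreal (real (Suc n) powr (1 - s))) \<longlonglongrightarrow> ennreal 0" by (intro tendsto_ennrealI lim)
 then have "(SUP n. hausdorff_pre s (1 / real (Suc n)) {0..1::real}) <= ennreal 0"
  by (rule LIMSEQ_le[OF LIMSEQ_SUP[OF inc]]) (use pre in auto)
 then show ?thesis by (simp add: hausdorff_outer_seq)
qed

lemma hausdorff_outer_segment:
 fixes a b :: "'a::real_normed_vector"
 assumes s: "1 < s"
 shows "hausdorff_outer s (closed_segment a b) = 0"
proof -
 let ?f = "%t. a + t *\<^sub>R (b - a)"
 have "closed_segment a b = ?f ` {0..1}" unfolding closed_segment_image_interval by (rule image_cong) (auto simp: algebra_simps)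
 also have "hausdorff_outer s (?f ` {0..1}) <= ennreal ((norm (b - a) + 1) powr s) * hausdorff_outer s {0..1::real}"
 proof (rule hausdorff_outer_lipschitz)
  fix x y
  have "?f x - ?f y = (x - y) *\<^sub>R (b - a)" by (simp add: scaleR_left_diff_distrib)
  then have "dist (?f x) (?f y) = \<bar>x - y\<bar> * norm (b - a)" by (simp only: dist_norm norm_scaleR)
  then show "dist (?f x) (?f y) <= (norm (b - a) + 1) * dist x y" by (simp add: dist_real_def mult.commute mult_left_mono)
 qed (use s in \<open>auto simp: add_nonneg_pos\<close>)
 finally show ?thesis using hausdorff_outer_unit_interval[OF s] by simp
qed

section \<open>The gasket in barycentric coordinates\<close>

text \<open>Keeps the index 1 from being rewritten to \<open>Suc 0\<close>, so that it still matches
  the members of \<open>{1, 2, 3}\<close>.\<close>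

declare One_nat_def [simp del]

text \<open>The attractor is the intersection of the iterated images of \<open>T\<close>. A set
  \<open>E\<close> that is covered by its own images survives in every iterate; this is how the
  sides of the triangle are placed inside the gasket.\<close>

lemma attractor_exists:
 fixes F :: "'i => 'a::heine_borel => 'a"
 assumes I: "finite I" and cont: "\<And>j. j \<in> I ==> continuous_on UNIV (F j)"
  and T: "compact T" "T \<noteq> {}" "\<And>j. j \<in> I ==> F j ` T \<subseteq> T" and ne: "I \<noteq> {}"
  and E: "E \<subseteq> T" "E \<subseteq> (\<Union>j\<in>I. F j ` E)"
 obtains K where "compact K" "K \<noteq> {}" "K = (\<Union>j\<in>I. F j ` K)" "E \<subseteq> K" "K \<subseteq> T"
proof -
 define \<Phi> where "\<Phi> A = (\<Union>j\<in>I. F j ` A)" for A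
 have mono: "A \<subseteq> B ==> \<Phi> A \<subseteq> \<Phi> B" for A B by (auto simp: \<Phi>_def)
 define t where "t n = (\<Phi> ^^ n) T" for n
 have tS: "t (Suc n) = \<Phi> (t n)" and t0: "t 0 = T" for n by (auto simp: t_def)
 have tc: "compact (t n)" for n
  by (induction n) (auto simp: t0 tS T \<Phi>_def I intro!: compact_UN compact_continuous_image continuous_on_subset[OF cont])
 have tne: "t n \<noteq> {}" for n by (induction n) (use ne T in \<open>auto simp: t0 tS \<Phi>_def\<close>)
 have dec1: "t (Suc n) \<subseteq> t n" for n
 proof (induction n)
  case 0 then show ?case using T by (auto simp: t0 tS \<Phi>_def)
 next
  case (Suc n) then show ?case using mono by (simp add: tS)
 qed
 have dec: "m <= n ==> t n \<subseteq> t m" for m n 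
  using lift_Suc_antimono_le[of t, OF dec1] by blast
 have Et: "E \<subseteq> t n" for n
 proof (induction n)
  case (Suc n)
  have "E \<subseteq> \<Phi> E" using E(2) by (simp add: \<Phi>_def)
  also have "\<dots> \<subseteq> t (Suc n)" unfolding tS by (rule mono[OF Suc])
  finally show ?case .
 qed (use E in \<open>simp add: t0\<close>)
 define K where "K = (\<Inter>n. t n)"
 have K1: "\<Phi> K \<subseteq> K"
 proof -
  have "\<Phi> K \<subseteq> t (Suc n)" for n unfolding tS by (rule mono) (auto simp: K_def)
  then show ?thesis using dec1 unfolding K_def by blast
 qed
 have K2: "K \<subseteq> \<Phi> K"
 proof
  fix x assume x: "x \<in> K"
  \<comment> \<open>As \<open>I\<close> is finite and the iterates decrease, one index serves all
    levels. The preimages of \<open>x\<close> in the iterates are then nested nonempty compact sets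
    and have a common point.\<close>
  have "\<exists>j\<in>I. \<forall>n. x \<in> F j ` t n"
  proof (rule ccontr)
   assume "\<not> ?thesis"
   then have "\<forall>j\<in>I. \<exists>n. x \<notin> F j ` t n" by blast
   from bchoice[OF this] obtain m where m: "\<forall>j\<in>I. x \<notin> F j ` t (m j)" by blast
   define N where "N = Max (m ` I)"
   have "x \<in> t (Suc N)" using x unfolding K_def by blast
   then obtain j where j: "j \<in> I" "x \<in> F j ` t N" unfolding tS \<Phi>_def by blast
   have "m j <= N" using j I by (simp add: N_def)
   then show False using dec[of "m j" N] m j by blast
  qed
  then obtain j where j: "j \<in> I" "\<And>n. x \<in> F j ` t n" by blast
  define P where "P n = t n \<inter> F j -` {x}" for n
  have "\<Inter> (range P) \<noteq> {}"
  proof (rule compact_nest)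
   fix n :: nat
   have "closed (F j -` {x})" using continuous_closed_vimage[of "{x}" "F j"] cont[OF j(1)]
    by (simp add: continuous_on_eq_continuous_at)
   then show "compact (P n)" unfolding P_def by (intro compact_Int_closed tc)
   show "P n \<noteq> {}" using j(2)[of n] by (auto simp: P_def)
  next
   fix m n :: nat assume "m <= n" then show "P n \<subseteq> P m" using dec[of m n] by (auto simp: P_def)
  qed
  then obtain y where "\<And>n. y \<in> P n" by blast
  then have "y \<in> K" "F j y = x" by (auto simp: P_def K_def)
  then show "x \<in> \<Phi> K" using j(1) by (auto simp: \<Phi>_def)
 qed
 show thesis
 proof (rule that)
  show "compact K" unfolding K_def using tc by (intro compact_Inter) auto
  show "K \<noteq> {}" unfolding K_def by (rule compact_nest[OF tc tne dec])
  show "K = (\<Union>j\<in>I. F j ` K)" using K1 K2 by (auto simp: \<Phi>_def)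
  show "E \<subseteq> K" using Et by (auto simp: K_def)
  show "K \<subseteq> T" using t0 by (auto simp: K_def)
 qed
qed

text \<open>A point of \<open>K\<close> at maximal distance from \<open>L\<close> is the image of
  another point of \<open>K\<close>, so its distance is at most \<open>\<rho>\<close> times the
  maximum; hence the maximum is 0.\<close>

lemma attractor_subset:
 fixes F :: "'i => 'a::heine_borel => 'a"
 assumes lip: "\<And>j x y. j \<in> I ==> dist (F j x) (F j y) <= \<rho> * dist x y" and \<rho>: "0 <= \<rho>" "\<rho> < 1"
  and K: "compact K" "K \<noteq> {}" "K \<subseteq> (\<Union>j\<in>I. F j ` K)"
  and L: "compact L" "L \<noteq> {}" "(\<Union>j\<in>I. F j ` L) \<subseteq> L"
 shows "K \<subseteq> L"
proof -
 obtain x0 where x0: "x0 \<in> K" "\<And>x. x \<in> K ==> infdist x L <= infdist x0 L"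
 proof -
  have "continuous_on K (%x. infdist x L)" by (intro continuous_intros)
  then show thesis using continuous_attains_sup[OF K(1,2)] that by blast
 qed
 obtain j y where j: "j \<in> I" "y \<in> K" "x0 = F j y" using x0(1) K(3) by blast
 obtain z where z: "z \<in> L" "infdist y L = dist y z"
  using infdist_attains_inf[OF compact_imp_closed[OF L(1)] L(2)] by blast
 have "F j z \<in> L" using L(3) j z by blast
 then have "infdist x0 L <= dist (F j y) (F j z)" unfolding j(3) by (rule infdist_le)
 also have "\<dots> <= \<rho> * infdist y L" using lip[OF j(1)] z by simp
 also have "\<dots> <= \<rho> * infdist x0 L" using \<rho> x0(2)[OF j(2)] by (intro mult_left_mono)
 finally have "(1 - \<rho>) * infdist x0 L <= 0" by (simp add: algebra_simps)
 then have "infdist x0 L <= 0" using \<rho> by (simp add: mult_le_0_iff)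
 then have "infdist x L = 0" if "x \<in> K" for x using x0(2)[OF that] infdist_nonneg[of x L] by simp
 then show ?thesis using in_closed_iff_infdist_zero[OF compact_imp_closed[OF L(1)] L(2)] by blast
qed

text \<open>Barycentric coordinates for the vertices \<open>gpt 1\<close>, \<open>gpt 2\<close>,
  \<open>gpt 3\<close>; every index other than 1 and 2 is read as 3. They remove
  \<open>sqrt 3\<close> from the formulas of the six maps.\<close>

definition bc :: "nat => real^2 => real"
 where "bc i x = (if i = 1 then 1 - x $ 1 - x $ 2 / sqrt 3 else if i = 2 then 2 * x $ 2 / sqrt 3
  else x $ 1 - x $ 2 / sqrt 3)"

lemma bc_sum: "bc 1 x = 1 - bc 2 x - bc 3 x"
 by (simp add: bc_def field_simps)

lemma coord_bc: "x $ 1 = bc 3 x + bc 2 x / 2" "x $ 2 = bc 2 x * sqrt 3 / 2"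
 by (simp_all add: bc_def)

lemma bc_eqI: "bc 2 x = bc 2 y ==> bc 3 x = bc 3 y ==> x = y"
 by (simp add: vec_eq_iff forall_2 coord_bc)

lemma bc_affine: "u + v = 1 ==> bc i (u *\<^sub>R x + v *\<^sub>R y) = u * bc i x + v * bc i y"
 by (auto simp: bc_def algebra_simps add_divide_distrib)

lemma dist_bc: "(dist x y)\<^sup>2 = (bc 2 x - bc 2 y)\<^sup>2 + (bc 3 x - bc 3 y)\<^sup>2 + (bc 2 x - bc 2 y) * (bc 3 x - bc 3 y)"
proof -
 have "(dist x y)\<^sup>2 = (x $ 1 - y $ 1)\<^sup>2 + (x $ 2 - y $ 2)\<^sup>2"
  by (simp add: dist_norm norm_vec_def L2_set_def sum_2)
 also have "\<dots> = (bc 3 x - bc 3 y + (bc 2 x - bc 2 y) / 2)\<^sup>2 + 3 / 4 * (bc 2 x - bc 2 y)\<^sup>2"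
 proof -
  have "x $ 2 - y $ 2 = (bc 2 x - bc 2 y) * (sqrt 3 / 2)" by (simp add: coord_bc algebra_simps)
  then have "(x $ 2 - y $ 2)\<^sup>2 = 3 / 4 * (bc 2 x - bc 2 y)\<^sup>2" by (simp only: power_mult_distrib) (simp add: power_divide)
  moreover have "x $ 1 - y $ 1 = bc 3 x - bc 3 y + (bc 2 x - bc 2 y) / 2" by (simp add: coord_bc diff_divide_distrib)
  ultimately show ?thesis by simp
 qed
 finally show ?thesis by (simp add: power2_eq_square field_simps)
qed

text \<open>The optimal constant would be \<open>2 / sqrt 3\<close>; with 2 the differences below
  are visible sums of squares.\<close>

lemma bc_lipschitz:
 assumes "i \<in> {1, 2, 3}"
 shows "\<bar>bc i x - bc i y\<bar> <= 2 * dist x y"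
proof (rule power2_le_imp_le)
 define p q where "p = bc 2 x - bc 2 y" and "q = bc 3 x - bc 3 y"
 have d: "(2 * dist x y)\<^sup>2 = 4 * (p\<^sup>2 + q\<^sup>2 + p * q)" by (simp add: power_mult_distrib dist_bc p_def q_def)
 have "bc 1 x - bc 1 y = - (p + q)" by (simp add: bc_sum p_def q_def)
 then have "\<bar>bc 1 x - bc 1 y\<bar>\<^sup>2 = (p + q)\<^sup>2" by (simp only: power2_abs power2_minus)
 then consider "\<bar>bc i x - bc i y\<bar>\<^sup>2 = (p + q)\<^sup>2" | "\<bar>bc i x - bc i y\<bar>\<^sup>2 = p\<^sup>2" | "\<bar>bc i x - bc i y\<bar>\<^sup>2 = q\<^sup>2"
  using assms unfolding p_def q_def by (auto simp del: power2_abs)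
 then show "\<bar>bc i x - bc i y\<bar>\<^sup>2 <= (2 * dist x y)\<^sup>2"
 proof cases
  case 1
  have "4 * (p\<^sup>2 + q\<^sup>2 + p * q) - (p + q)\<^sup>2 = 2 * p\<^sup>2 + 2 * q\<^sup>2 + (p + q)\<^sup>2" by (simp add: power2_eq_square algebra_simps)
  moreover have "0 <= 2 * p\<^sup>2 + 2 * q\<^sup>2 + (p + q)\<^sup>2" by simp
  ultimately show ?thesis unfolding d 1 by linarith
 next
  case 2
  have "4 * (p\<^sup>2 + q\<^sup>2 + p * q) - p\<^sup>2 = p\<^sup>2 + 2 * q\<^sup>2 + 2 * (p + q)\<^sup>2" by (simp add: power2_eq_square algebra_simps)
  moreover have "0 <= p\<^sup>2 + 2 * q\<^sup>2 + 2 * (p + q)\<^sup>2" by simp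
  ultimately show ?thesis unfolding d 2 by linarith
 next
  case 3
  have "4 * (p\<^sup>2 + q\<^sup>2 + p * q) - q\<^sup>2 = q\<^sup>2 + 2 * p\<^sup>2 + 2 * (p + q)\<^sup>2" by (simp add: power2_eq_square algebra_simps)
  moreover have "0 <= q\<^sup>2 + 2 * p\<^sup>2 + 2 * (p + q)\<^sup>2" by simp
  ultimately show ?thesis unfolding d 3 by linarith
 qed
qed simp

lemma bc_gpt:
 "bc 1 (gpt 1) = 1" "bc 2 (gpt 1) = 0" "bc 3 (gpt 1) = 0"
 "bc 1 (gpt 2) = 0" "bc 2 (gpt 2) = 1" "bc 3 (gpt 2) = 0"
 "bc 1 (gpt 3) = 0" "bc 2 (gpt 3) = 0" "bc 3 (gpt 3) = 1"
 by (simp_all add: bc_def gpt_def)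

abbreviation "L3 \<equiv> {1, 2, 3 :: nat}"

lemma bc_gpt': "i \<in> L3 ==> j \<in> L3 ==> bc i (gpt j) = (if i = j then 1 else 0)"
 using bc_gpt by auto

definition tri :: "(real^2) set"
 where "tri = convex hull (gpt ` {1, 2, 3})"

lemma tri_bc: "x \<in> tri ==> i \<in> L3 ==> 0 <= bc i x"
proof -
 assume x: "x \<in> tri" and i: "i \<in> L3"
 have "convex {x. 0 <= bc i x}"
  by (auto simp: convex_def bc_affine intro!: add_nonneg_nonneg mult_nonneg_nonneg)
 moreover have "gpt ` {1, 2, 3} \<subseteq> {x. 0 <= bc i x}" using i bc_gpt' by auto
 ultimately have "tri \<subseteq> {x. 0 <= bc i x}" unfolding tri_def by (intro hull_minimal)
 then show "0 <= bc i x" using x by blast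
qed

lemma tri_bc_le: "x \<in> tri ==> i \<in> L3 ==> bc i x <= 1"
 using tri_bc[of x 1] tri_bc[of x 2] tri_bc[of x 3] bc_sum[of x] by auto

lemma bc_tri: "(\<And>i. i \<in> L3 ==> 0 <= bc i x) ==> x \<in> tri"
proof -
 assume b: "\<And>i. i \<in> L3 ==> 0 <= bc i x"
 have "x = bc 1 x *\<^sub>R gpt 1 + bc 2 x *\<^sub>R gpt 2 + bc 3 x *\<^sub>R gpt 3"
  by (rule bc_eqI) (simp_all add: bc_def gpt_def field_simps)
 moreover have "0 <= bc 1 x" "0 <= bc 2 x" "0 <= bc 3 x" "bc 1 x + bc 2 x + bc 3 x = 1"
  using b[of 1] b[of 2] b[of 3] bc_sum[of x] by auto
 ultimately show "x \<in> tri" unfolding tri_def by (simp add: convex_hull_3) metis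
qed

lemma tri_gpt: "i \<in> L3 ==> gpt i \<in> tri"
 unfolding tri_def by (intro hull_inc) auto

lemma tri_compact: "compact tri"
 unfolding tri_def by (intro compact_convex_hull finite_imp_compact) simp

lemma tri_segment: "x \<in> tri ==> y \<in> tri ==> closed_segment x y \<subseteq> tri"
 unfolding tri_def by (intro closed_segment_subset) (auto simp: convex_convex_hull)

text \<open>With \<open>ob\<close>, the two other indices in increasing order: the ends of the side
  opposite to the vertex \<open>i\<close>.\<close>

definition oa :: "nat => nat" where "oa i = (if i = 1 then 2 else 1)"
definition ob :: "nat => nat" where "ob i = (if i = 3 then 2 else 3)"

section \<open>The six maps, the sides of the triangle and the attractor\<close>

locale gasket_loc =
 fixes \<alpha> :: real
 assumes a0: "0 < \<alpha>" and a1: "\<alpha> < 1 / 3"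
begin

definition r :: real where "r = (1 - \<alpha>) / 2"

lemma r_bounds: "1 / 3 < r" "r < 1 / 2" "0 < r" "\<alpha> < r" "1 - 2 * r = \<alpha>"
 using a0 a1 by (auto simp: r_def field_simps)

lemma gmap_affine: "u + v = 1 ==> gmap \<alpha> j (u *\<^sub>R x + v *\<^sub>R y) = u *\<^sub>R gmap \<alpha> j x + v *\<^sub>R gmap \<alpha> j y"
proof -
 assume uv: "u + v = 1"
 have "u *\<^sub>R x + v *\<^sub>R y - gpt j = u *\<^sub>R (x - gpt j) + v *\<^sub>R (y - gpt j)"
  using uv by (simp add: algebra_simps flip: scaleR_left_distrib)
 moreover have "gpt j = u *\<^sub>R gpt j + v *\<^sub>R gpt j" using uv by (simp flip: scaleR_left_distrib)
 ultimately show ?thesis unfolding gmap_def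
  by (simp add: matrix_vector_right_distrib matrix_vector_mult_scaleR scaleR_right_distrib)
qed

lemma gmap_123: "a \<in> L3 ==> gmap \<alpha> a x = r *\<^sub>R (x - gpt a) + gpt a"
 unfolding gmap_def gmat_def r_def
 by (simp add: vec_eq_iff forall_2 matrix_vector_mult_def sum_2 mat_def)

lemma bc_gmap: "a \<in> L3 ==> i \<in> L3 ==> bc i (gmap \<alpha> a x) = r * bc i x + (if i = a then 1 - r else 0)"
proof -
 assume ai: "a \<in> L3" "i \<in> L3"
 have "gmap \<alpha> a x = r *\<^sub>R x + (1 - r) *\<^sub>R gpt a" by (simp add: gmap_123[OF ai(1)] algebra_simps)
 then show ?thesis using ai by (simp add: bc_affine bc_gpt' del: insert_iff)
qed

text \<open>A joining map collapses the plane onto a side: only the difference of the two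
  coordinates belonging to the ends of this side survives, scaled by \<open>\<alpha>\<close> about
  the midpoint.\<close>

lemma gmap_456:
 "bc 1 (gmap \<alpha> 4 x) = 0" "bc 2 (gmap \<alpha> 4 x) = (1 - \<alpha> * (bc 3 x - bc 2 x)) / 2" "bc 3 (gmap \<alpha> 4 x) = (1 + \<alpha> * (bc 3 x - bc 2 x)) / 2"
 "bc 1 (gmap \<alpha> 5 x) = (1 - \<alpha> * (bc 3 x - bc 1 x)) / 2" "bc 2 (gmap \<alpha> 5 x) = 0" "bc 3 (gmap \<alpha> 5 x) = (1 + \<alpha> * (bc 3 x - bc 1 x)) / 2"
 "bc 1 (gmap \<alpha> 6 x) = (1 - \<alpha> * (bc 2 x - bc 1 x)) / 2" "bc 2 (gmap \<alpha> 6 x) = (1 + \<alpha> * (bc 2 x - bc 1 x)) / 2" "bc 3 (gmap \<alpha> 6 x) = 0"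
proof -
 note D = gmap_def gmat_def gpt_def bc_def matrix_vector_mult_def sum_2
 have s: "sqrt 3 * (sqrt 3 * z) = 3 * z" for z by (simp flip: mult.assoc)
 show "bc 1 (gmap \<alpha> 4 x) = 0" "bc 2 (gmap \<alpha> 4 x) = (1 - \<alpha> * (bc 3 x - bc 2 x)) / 2" "bc 3 (gmap \<alpha> 4 x) = (1 + \<alpha> * (bc 3 x - bc 2 x)) / 2"
  "bc 1 (gmap \<alpha> 5 x) = (1 - \<alpha> * (bc 3 x - bc 1 x)) / 2" "bc 2 (gmap \<alpha> 5 x) = 0" "bc 3 (gmap \<alpha> 5 x) = (1 + \<alpha> * (bc 3 x - bc 1 x)) / 2"
  "bc 1 (gmap \<alpha> 6 x) = (1 - \<alpha> * (bc 2 x - bc 1 x)) / 2" "bc 2 (gmap \<alpha> 6 x) = (1 + \<alpha> * (bc 2 x - bc 1 x)) / 2" "bc 3 (gmap \<alpha> 6 x) = 0"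
  by (simp_all add: D s field_simps)
qed

lemma gmap_joint:
 assumes i: "i \<in> L3"
 shows "bc i (gmap \<alpha> (i + 3) x) = 0"
  "bc (oa i) (gmap \<alpha> (i + 3) x) = (1 - \<alpha> * (bc (ob i) x - bc (oa i) x)) / 2"
  "bc (ob i) (gmap \<alpha> (i + 3) x) = (1 + \<alpha> * (bc (ob i) x - bc (oa i) x)) / 2"
 using i gmap_456 by (auto simp: oa_def ob_def)

lemma o_L3: "i \<in> L3 ==> oa i \<in> L3" "i \<in> L3 ==> ob i \<in> L3" "i \<in> L3 ==> oa i \<noteq> i" "i \<in> L3 ==> ob i \<noteq> i" "i \<in> L3 ==> oa i \<noteq> ob i"
 by (auto simp: oa_def ob_def)

lemma L3_cases: "i \<in> L3 ==> j \<in> L3 ==> j = i \<or> j = oa i \<or> j = ob i"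
 by (auto simp: oa_def ob_def)

lemma dist_gmap: "a \<in> L3 ==> dist (gmap \<alpha> a x) (gmap \<alpha> a y) = r * dist x y"
proof -
 assume a: "a \<in> L3"
 have "gmap \<alpha> a x - gmap \<alpha> a y = r *\<^sub>R (x - y)" by (simp add: gmap_123[OF a] algebra_simps)
 then show ?thesis using r_bounds by (simp add: dist_norm)
qed

text \<open>The squared distance is \<open>c\<close> plus \<open>3 / 4\<close> of a square. The
  latter is the squared component orthogonal to the side, which the map forgets.\<close>

lemma dist_gmap_joint:
 assumes "i \<in> L3"
 shows "dist (gmap \<alpha> (i + 3) x) (gmap \<alpha> (i + 3) y) <= \<alpha> * dist x y"
proof (rule power2_le_imp_le)
 define p q where "p = bc 2 x - bc 2 y" and "q = bc 3 x - bc 3 y"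
 have b1: "bc 1 x - bc 1 y = - (p + q)" by (simp add: bc_sum p_def q_def)
 have d: "(\<alpha> * dist x y)\<^sup>2 = \<alpha>\<^sup>2 * (p\<^sup>2 + q\<^sup>2 + p * q)" by (simp add: power_mult_distrib dist_bc p_def q_def)
 have "\<exists>c. (dist (gmap \<alpha> (i + 3) x) (gmap \<alpha> (i + 3) y))\<^sup>2 = \<alpha>\<^sup>2 * c \<and> c <= p\<^sup>2 + q\<^sup>2 + p * q"
 proof -
  consider "i = 1" | "i = 2" | "i = 3" using assms by auto
  then show ?thesis
  proof cases
   case 1
   have "(dist (gmap \<alpha> (i + 3) x) (gmap \<alpha> (i + 3) y))\<^sup>2 = \<alpha>\<^sup>2 * ((q - p)\<^sup>2 / 4)"
    proof -
    have e: "bc 2 (gmap \<alpha> (i + 3) x) - bc 2 (gmap \<alpha> (i + 3) y) = \<alpha> * (p - q) / 2"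
     "bc 3 (gmap \<alpha> (i + 3) x) - bc 3 (gmap \<alpha> (i + 3) y) = \<alpha> * (q - p) / 2"
     by (simp_all add: 1 gmap_456 p_def q_def bc_sum algebra_simps add_divide_distrib diff_divide_distrib)
    show ?thesis unfolding dist_bc e by (simp add: power2_eq_square field_simps)
   qed
   moreover have "p\<^sup>2 + q\<^sup>2 + p * q - (q - p)\<^sup>2 / 4 = 3 / 4 * (p + q)\<^sup>2" by (simp add: power2_eq_square field_simps)
   then have "(q - p)\<^sup>2 / 4 <= p\<^sup>2 + q\<^sup>2 + p * q" using zero_le_power2[of "p + q"] by linarith
   ultimately show ?thesis by blast
  next
   case 2
   have "(dist (gmap \<alpha> (i + 3) x) (gmap \<alpha> (i + 3) y))\<^sup>2 = \<alpha>\<^sup>2 * ((2 * q + p)\<^sup>2 / 4)"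
    proof -
    have e: "bc 2 (gmap \<alpha> (i + 3) x) - bc 2 (gmap \<alpha> (i + 3) y) = \<alpha> * (0) / 2"
     "bc 3 (gmap \<alpha> (i + 3) x) - bc 3 (gmap \<alpha> (i + 3) y) = \<alpha> * (2 * q + p) / 2"
     by (simp_all add: 2 gmap_456 p_def q_def bc_sum algebra_simps add_divide_distrib diff_divide_distrib)
    show ?thesis unfolding dist_bc e by (simp add: power2_eq_square field_simps)
   qed
   moreover have "p\<^sup>2 + q\<^sup>2 + p * q - (2 * q + p)\<^sup>2 / 4 = 3 / 4 * p\<^sup>2" by (simp add: power2_eq_square field_simps)
   then have "(2 * q + p)\<^sup>2 / 4 <= p\<^sup>2 + q\<^sup>2 + p * q" using zero_le_power2[of p] by linarith
   ultimately show ?thesis by blast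
  next
   case 3
   have "(dist (gmap \<alpha> (i + 3) x) (gmap \<alpha> (i + 3) y))\<^sup>2 = \<alpha>\<^sup>2 * ((2 * p + q)\<^sup>2 / 4)"
    proof -
    have e: "bc 2 (gmap \<alpha> (i + 3) x) - bc 2 (gmap \<alpha> (i + 3) y) = \<alpha> * (2 * p + q) / 2"
     "bc 3 (gmap \<alpha> (i + 3) x) - bc 3 (gmap \<alpha> (i + 3) y) = \<alpha> * (0) / 2"
     by (simp_all add: 3 gmap_456 p_def q_def bc_sum algebra_simps add_divide_distrib diff_divide_distrib)
    show ?thesis unfolding dist_bc e by (simp add: power2_eq_square field_simps)
   qed
   moreover have "p\<^sup>2 + q\<^sup>2 + p * q - (2 * p + q)\<^sup>2 / 4 = 3 / 4 * q\<^sup>2" by (simp add: power2_eq_square field_simps)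
   then have "(2 * p + q)\<^sup>2 / 4 <= p\<^sup>2 + q\<^sup>2 + p * q" using zero_le_power2[of q] by linarith
   ultimately show ?thesis by blast
  qed
 qed
 then show "(dist (gmap \<alpha> (i + 3) x) (gmap \<alpha> (i + 3) y))\<^sup>2 <= (\<alpha> * dist x y)\<^sup>2"
  unfolding d by (metis mult_left_mono zero_le_power2)
qed (use a0 in simp)

lemma index_cases: "j \<in> {1..6::nat} ==> j \<in> L3 \<or> (\<exists>i\<in>L3. j = i + 3)"
proof -
 assume "j \<in> {1..6}"
 then have "j = 1 \<or> j = 2 \<or> j = 3 \<or> j = 1 + 3 \<or> j = 2 + 3 \<or> j = 3 + 3" by auto
 then show ?thesis by blast
qed

lemma gmap_lipschitz: "j \<in> {1..6} ==> dist (gmap \<alpha> j x) (gmap \<alpha> j y) <= r * dist x y"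
proof -
 assume "j \<in> {1..6}"
 then consider "j \<in> L3" | i where "i \<in> L3" "j = i + 3" using index_cases by blast
 then show ?thesis
 proof cases
  case 2
  have "\<alpha> * dist x y <= r * dist x y" using r_bounds by (intro mult_right_mono) auto
  then show ?thesis using dist_gmap_joint[OF 2(1), of x y] 2(2) by simp
 qed (simp add: dist_gmap)
qed

lemma gmap_continuous: "j \<in> {1..6} ==> continuous_on UNIV (gmap \<alpha> j)"
proof -
 assume j: "j \<in> {1..6}"
 show ?thesis
  unfolding continuous_on_iff
 proof (intro ballI allI impI)
  fix x :: "real^2" and e :: real assume e: "0 < e"
  show "\<exists>d>0. \<forall>x'\<in>UNIV. dist x' x < d \<longrightarrow> dist (gmap \<alpha> j x') (gmap \<alpha> j x) < e"
  proof (intro exI conjI ballI impI)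
   fix x' assume "dist x' x < e"
   moreover have "dist (gmap \<alpha> j x') (gmap \<alpha> j x) <= 1 * dist x' x"
    using gmap_lipschitz[OF j, of x' x] r_bounds mult_right_mono[of r 1 "dist x' x"] by simp
   ultimately show "dist (gmap \<alpha> j x') (gmap \<alpha> j x) < e" by simp
  qed (rule e)
 qed
qed

lemma gmap_tri: "j \<in> {1..6} ==> x \<in> tri ==> gmap \<alpha> j x \<in> tri"
proof -
 assume j: "j \<in> {1..6}" and x: "x \<in> tri"
 from j consider "j \<in> L3" | i where "i \<in> L3" "j = i + 3" using index_cases by blast
 then show ?thesis
 proof cases
  case 1
  then show ?thesis using tri_bc[OF x] r_bounds by (intro bc_tri) (simp add: bc_gmap del: insert_iff)
 next
  case 2
  note o = o_L3[OF 2(1)]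
  have "\<bar>bc (ob i) x - bc (oa i) x\<bar> <= 1"
   using tri_bc[OF x o(1)] tri_bc[OF x o(2)] tri_bc_le[OF x o(1)] tri_bc_le[OF x o(2)] by simp
  then have "\<bar>\<alpha> * (bc (ob i) x - bc (oa i) x)\<bar> <= 1"
   using a0 a1 by (simp add: abs_mult mult_le_one)
  then have "0 <= 1 - \<alpha> * (bc (ob i) x - bc (oa i) x)" "0 <= 1 + \<alpha> * (bc (ob i) x - bc (oa i) x)" by linarith+
  then have "0 <= bc k (gmap \<alpha> j x)" if k: "k \<in> L3" for k
   using L3_cases[OF 2(1) k] gmap_joint[OF 2(1), of x] unfolding 2(2) by (elim disjE) simp_all
  then show ?thesis by (rule bc_tri)
 qed
qed

text \<open>Edge types: the numbers 1 to 3 stand for the sides of the triangle, each opposite to the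
  vertex of this number, and 4 to 6 stand for the joining edges of the first level.\<close>

definition side :: "nat => (real^2) set"
 where "side \<tau> = (if \<tau> \<in> L3 then closed_segment (gpt (oa \<tau>)) (gpt (ob \<tau>)) else gmap \<alpha> \<tau> ` tri)"

lemma side_tri: "\<tau> \<in> {1..6} ==> side \<tau> \<subseteq> tri"
proof -
 assume t: "\<tau> \<in> {1..6}"
 show ?thesis
 proof (cases "\<tau> \<in> L3")
  case True
  then show ?thesis using tri_segment[OF tri_gpt[OF o_L3(1)[OF True]] tri_gpt[OF o_L3(2)[OF True]]] by (simp add: side_def)
 next
  case False then show ?thesis using gmap_tri[OF t] by (auto simp: side_def)
 qed
qed

lemma side_123: "i \<in> L3 ==> x \<in> side i \<longleftrightarrow> x \<in> tri \<and> bc i x = 0"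
proof
 assume i: "i \<in> L3"
 note o = o_L3[OF i]
 { assume x: "x \<in> side i"
  then obtain u where u: "0 <= u" "u <= 1" "x = (1 - u) *\<^sub>R gpt (oa i) + u *\<^sub>R gpt (ob i)"
   using i by (auto simp: side_def closed_segment_def simp del: insert_iff)
  then show "x \<in> tri \<and> bc i x = 0" using side_tri[of i] x i o
   by (auto simp: bc_affine bc_gpt' simp del: insert_iff) }
 assume x: "x \<in> tri \<and> bc i x = 0"
 have s: "bc (oa i) x + bc (ob i) x = 1" using bc_sum[of x] x i by (auto simp: oa_def ob_def)
 have "x = (1 - bc (ob i) x) *\<^sub>R gpt (oa i) + bc (ob i) x *\<^sub>R gpt (ob i)"
 proof -
  have "bc j ((1 - bc (ob i) x) *\<^sub>R gpt (oa i) + bc (ob i) x *\<^sub>R gpt (ob i)) = bc j x" if j: "j \<in> L3" for j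
   using L3_cases[OF i j] o x s j by (auto simp: bc_affine bc_gpt' simp del: insert_iff)
  then show ?thesis by (intro bc_eqI) auto
 qed
 moreover have "0 <= bc (ob i) x" "bc (ob i) x <= 1" using x tri_bc tri_bc_le o by auto
 ultimately show "x \<in> side i" using i unfolding side_def closed_segment_def by auto
qed

text \<open>The image of the triangle is already the image of one side, because the map sees only a
  coordinate difference; \<open>u\<close> is the parameter of the point on the side with the same
  difference.\<close>

lemma side_456:
 assumes i: "i \<in> L3"
 shows "side (i + 3) = closed_segment (gmap \<alpha> (i + 3) (gpt (oa i))) (gmap \<alpha> (i + 3) (gpt (ob i)))"
proof -
 note o = o_L3[OF i]
 have n: "i + 3 \<notin> L3" using i by auto
 show ?thesis
 proof (intro subset_antisym subsetI)
  fix y assume "y \<in> side (i + 3)"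
  then obtain x where x: "x \<in> tri" "y = gmap \<alpha> (i + 3) x" using n by (auto simp: side_def)
  define u where "u = (1 + bc (ob i) x - bc (oa i) x) / 2"
  have u: "0 <= u" "u <= 1"
   using tri_bc[OF x(1) o(1)] tri_bc[OF x(1) o(2)] tri_bc_le[OF x(1) o(1)] tri_bc_le[OF x(1) o(2)] by (auto simp: u_def)
  define z where "z = (1 - u) *\<^sub>R gpt (oa i) + u *\<^sub>R gpt (ob i)"
  have e: "bc (ob i) z - bc (oa i) z = bc (ob i) x - bc (oa i) x"
   using o by (simp add: z_def bc_affine bc_gpt' u_def del: insert_iff)
  have "bc j (gmap \<alpha> (i + 3) z) = bc j y" if "j \<in> L3" for j
   using L3_cases[OF i that] unfolding x(2) by (elim disjE) (simp_all only: gmap_joint[OF i] e)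
  then have "y = gmap \<alpha> (i + 3) z" by (intro bc_eqI) auto
  also have "\<dots> = (1 - u) *\<^sub>R gmap \<alpha> (i + 3) (gpt (oa i)) + u *\<^sub>R gmap \<alpha> (i + 3) (gpt (ob i))"
   unfolding z_def by (rule gmap_affine) simp
  finally show "y \<in> closed_segment (gmap \<alpha> (i + 3) (gpt (oa i))) (gmap \<alpha> (i + 3) (gpt (ob i)))"
   using u by (auto simp: closed_segment_def)
 next
  fix y assume "y \<in> closed_segment (gmap \<alpha> (i + 3) (gpt (oa i))) (gmap \<alpha> (i + 3) (gpt (ob i)))"
  then obtain u where u: "0 <= u" "u <= 1"
   "y = (1 - u) *\<^sub>R gmap \<alpha> (i + 3) (gpt (oa i)) + u *\<^sub>R gmap \<alpha> (i + 3) (gpt (ob i))" by (auto simp: closed_segment_def)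
  have "y = gmap \<alpha> (i + 3) ((1 - u) *\<^sub>R gpt (oa i) + u *\<^sub>R gpt (ob i))" using u(3) by (simp add: gmap_affine)
  moreover have "(1 - u) *\<^sub>R gpt (oa i) + u *\<^sub>R gpt (ob i) \<in> tri"
   using tri_segment[OF tri_gpt[OF o(1)] tri_gpt[OF o(2)]] u by (auto simp: closed_segment_def)
  ultimately show "y \<in> side (i + 3)" using n unfolding side_def by simp
 qed
qed

text \<open>Since \<open>r + \<alpha> + r = 1\<close>, each side is covered by its images under the
  two triangle maps at its ends and the joining map at its midpoint. This is the covering hypothesis
  of \<open>attractor_exists\<close>.\<close>

lemma sides_invariant: "(\<Union>i\<in>L3. side i) \<subseteq> (\<Union>j\<in>{1..6}. gmap \<alpha> j ` (\<Union>i\<in>L3. side i))"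
proof
 fix x assume "x \<in> (\<Union>i\<in>L3. side i)"
 then obtain i where i: "i \<in> L3" "x \<in> side i" by blast
 note o = o_L3[OF i(1)]
 have x: "x \<in> tri" "bc i x = 0" using side_123 i by auto
 have s: "bc (oa i) x = 1 - bc (ob i) x" using bc_sum[of x] x i by (auto simp: oa_def ob_def)
 have rr: "0 < r" "r < 1 / 2" using r_bounds by auto
 have b: "0 <= bc (oa i) x" "0 <= bc (ob i) x" using tri_bc[OF x(1)] o by auto
 have mk: "x \<in> (\<Union>j\<in>{1..6}. gmap \<alpha> j ` (\<Union>i\<in>L3. side i))"
  if j: "j \<in> {1..6}" and u: "0 <= u" "u <= 1"
   and e: "\<And>k. k \<in> L3 ==> bc k (gmap \<alpha> j ((1 - u) *\<^sub>R gpt (oa i) + u *\<^sub>R gpt (ob i))) = bc k x" for j u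
 proof -
  have "x = gmap \<alpha> j ((1 - u) *\<^sub>R gpt (oa i) + u *\<^sub>R gpt (ob i))" using e by (intro bc_eqI) auto
  moreover have "(1 - u) *\<^sub>R gpt (oa i) + u *\<^sub>R gpt (ob i) \<in> side i"
   using u i(1) by (auto simp: side_def closed_segment_def)
  ultimately show ?thesis using j i(1) by blast
 qed
 have bz: "bc (oa i) ((1 - u) *\<^sub>R gpt (oa i) + u *\<^sub>R gpt (ob i)) = 1 - u" "bc (ob i) ((1 - u) *\<^sub>R gpt (oa i) + u *\<^sub>R gpt (ob i)) = u"
  "bc i ((1 - u) *\<^sub>R gpt (oa i) + u *\<^sub>R gpt (ob i)) = 0" for u
  using o i(1) by (simp_all add: bc_affine bc_gpt' del: insert_iff)
 consider "bc (ob i) x <= r" | "bc (oa i) x <= r" | "r <= bc (ob i) x" "r <= bc (oa i) x" by linarith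
 then show "x \<in> (\<Union>j\<in>{1..6}. gmap \<alpha> j ` (\<Union>i\<in>L3. side i))"
 proof cases
  case 1
  define u where "u = bc (ob i) x / r"
  have u: "r * u = bc (ob i) x" "0 <= u" "u <= 1" using rr b 1 by (auto simp: u_def)
  show ?thesis
  proof (rule mk[of "oa i" u])
   fix k assume k: "k \<in> L3"
   show "bc k (gmap \<alpha> (oa i) ((1 - u) *\<^sub>R gpt (oa i) + u *\<^sub>R gpt (ob i))) = bc k x"
    unfolding bc_gmap[OF o(1) k] using L3_cases[OF i(1) k] o(3-5) u x(2) s by (elim disjE) (simp_all add: bz right_diff_distrib)
  qed (use o u in auto)
 next
  case 2
  define u where "u = 1 - bc (oa i) x / r"
  have u: "r * u = r - bc (oa i) x" "0 <= u" "u <= 1" using rr b 2 by (auto simp: u_def field_simps)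
  show ?thesis
  proof (rule mk[of "ob i" u])
   fix k assume k: "k \<in> L3"
   show "bc k (gmap \<alpha> (ob i) ((1 - u) *\<^sub>R gpt (oa i) + u *\<^sub>R gpt (ob i))) = bc k x"
    unfolding bc_gmap[OF o(2) k] using L3_cases[OF i(1) k] o(3-5) u x(2) s by (elim disjE) (simp_all add: bz right_diff_distrib)
  qed (use o u in auto)
 next
  case 3
  define u where "u = 1 / 2 + (bc (ob i) x - 1 / 2) / \<alpha>"
  have al: "\<bar>bc (ob i) x - 1 / 2\<bar> <= \<alpha> / 2" using 3 s by (auto simp: r_def abs_le_iff field_simps)
  then have "\<bar>(bc (ob i) x - 1 / 2) / \<alpha>\<bar> <= 1 / 2" using a0 by (simp add: field_simps)
  then have u: "0 <= u" "u <= 1" "\<alpha> * (u - (1 - u)) = 2 * bc (ob i) x - 1"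
   using a0 by (auto simp: u_def abs_le_iff field_simps)
  show ?thesis
  proof (rule mk[of "i + 3" u])
   fix k assume k: "k \<in> L3"
   show "bc k (gmap \<alpha> (i + 3) ((1 - u) *\<^sub>R gpt (oa i) + u *\<^sub>R gpt (ob i))) = bc k x"
    using L3_cases[OF i(1) k] by (elim disjE) (simp_all only: gmap_joint[OF i(1)] bz u x s, simp_all)
  qed (use i u in auto)
 qed
qed

abbreviation "K \<equiv> gasket \<alpha>"

lemma gasket_props: "compact K" "K \<noteq> {}" "K = (\<Union>j\<in>{1..6}. gmap \<alpha> j ` K)" "K \<subseteq> tri" "i \<in> L3 ==> side i \<subseteq> K"
proof -
 have "\<exists>K. compact K \<and> K \<noteq> {} \<and> K = (\<Union>j\<in>{1..6}. gmap \<alpha> j ` K) \<and> (\<Union>i\<in>L3. side i) \<subseteq> K \<and> K \<subseteq> tri"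
 proof (rule attractor_exists[of "{1..6}" "gmap \<alpha>" tri "\<Union>i\<in>L3. side i"])
  show "tri \<noteq> {}" using tri_gpt[of 1] by auto
  show "gmap \<alpha> j ` tri \<subseteq> tri" if "j \<in> {1..6}" for j using gmap_tri that by blast
  have "side i \<subseteq> tri" if "i \<in> L3" for i using side_tri[of i] that by force
  then show "(\<Union>i\<in>L3. side i) \<subseteq> tri" by blast
  show "\<exists>K. compact K \<and> K \<noteq> {} \<and> K = (\<Union>j\<in>{1..6}. gmap \<alpha> j ` K) \<and> (\<Union>i\<in>L3. side i) \<subseteq> K \<and> K \<subseteq> tri"
   if "compact K" "K \<noteq> {}" "K = (\<Union>j\<in>{1..6}. gmap \<alpha> j ` K)" "(\<Union>i\<in>L3. side i) \<subseteq> K" "K \<subseteq> tri" for K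
   using that by blast
 qed (use gmap_continuous tri_compact sides_invariant in auto)
 then obtain L where L: "compact L" "L \<noteq> {}" "L = (\<Union>j\<in>{1..6}. gmap \<alpha> j ` L)" "(\<Union>i\<in>L3. side i) \<subseteq> L" "L \<subseteq> tri" by blast
 have "K = L" unfolding gasket_def
 proof (rule the_equality)
  show "compact L \<and> L \<noteq> {} \<and> L = (\<Union>j\<in>{1..6}. gmap \<alpha> j ` L)" using L by blast
  fix M assume M: "compact M \<and> M \<noteq> {} \<and> M = (\<Union>j\<in>{1..6}. gmap \<alpha> j ` M)"
  have "M \<subseteq> L"
   by (rule attractor_subset[of "{1..6}" "gmap \<alpha>" r]) (use gmap_lipschitz r_bounds M L in auto)
  moreover have "L \<subseteq> M"
   by (rule attractor_subset[of "{1..6}" "gmap \<alpha>" r]) (use gmap_lipschitz r_bounds M L in auto)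
  ultimately show "M = L" by blast
 qed
 then show "compact K" "K \<noteq> {}" "K = (\<Union>j\<in>{1..6}. gmap \<alpha> j ` K)" "K \<subseteq> tri" "i \<in> L3 ==> side i \<subseteq> K" using L by auto
qed

end

section \<open>Words and edges\<close>

lemma words_iff: "v \<in> words n \<longleftrightarrow> length v = n \<and> set v \<subseteq> L3"
 by (simp add: words_def)

lemma words_0: "words 0 = {[]}"
 by (auto simp: words_def)

text \<open>Words are split at the end, because the last letter is the outermost map.\<close>

lemma words_Suc: "words (Suc n) = (%(v, a). v @ [a]) ` (words n \<times> L3)"
proof (intro subset_antisym subsetI)
 fix v assume v: "v \<in> words (Suc n)"
 then obtain u a where "v = u @ [a]" by (cases v rule: rev_exhaust) (auto simp: words_iff)
 then show "v \<in> (%(v, a). v @ [a]) ` (words n \<times> L3)" using v by (auto simp: words_iff image_iff)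
qed (auto simp: words_iff)

lemma finite_words: "finite (words n)" and card_words: "card (words n) = 3 ^ n"
proof -
 have *: "words n = {v. set v \<subseteq> L3 \<and> length v = n}" by (auto simp: words_def)
 show "finite (words n)" unfolding * by (rule finite_lists_length_eq) simp
 show "card (words n) = 3 ^ n" unfolding * by (subst card_lists_length_eq) (simp_all add: numeral_3_eq_3)
qed

text \<open>The side of the triangle on which an edge of type \<open>\<tau>\<close> lies.\<close>

definition base :: "nat => nat"
 where "base \<tau> = (if \<tau> <= 3 then \<tau> else \<tau> - 3)"

lemma base_L3: "\<tau> \<in> {1..6} ==> base \<tau> \<in> L3"
 by (auto simp: base_def)

context gasket_loc
begin

abbreviation "fw \<equiv> gmap_word \<alpha>"

lemma fw_Nil [simp]: "fw [] x = x" and fw_snoc [simp]: "fw (v @ [a]) x = gmap \<alpha> a (fw v x)"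
 and fw_append: "fw (v @ t) x = fw t (fw v x)"
 by (simp_all add: gmap_word_def)

lemma fw_affine: "u + v = 1 ==> fw w (u *\<^sub>R x + v *\<^sub>R y) = u *\<^sub>R fw w x + v *\<^sub>R fw w y"
 by (induction w rule: rev_induct) (simp_all add: gmap_affine)

lemma image_segment: "fw w ` closed_segment x y = closed_segment (fw w x) (fw w y)"
 by (force simp: closed_segment_def image_iff fw_affine)

lemma dist_fw: "v \<in> words n ==> dist (fw v x) (fw v y) = r ^ n * dist x y"
proof (induction n arbitrary: v)
 case (Suc n)
 then obtain u a where "v = u @ [a]" "u \<in> words n" "a \<in> L3" unfolding words_Suc by auto
 then show ?case using Suc.IH by (simp add: dist_gmap del: insert_iff)
qed (simp add: words_0)

lemma fw_eq_iff: "v \<in> words n ==> fw v x = fw v y \<longleftrightarrow> x = y"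
 using dist_fw[of v n x y] r_bounds by (metis dist_eq_0_iff mult_eq_0_iff power_eq_0_iff less_irrefl)

lemma gmap_image:
 assumes "\<And>j. j \<in> {1..6} ==> gmap \<alpha> j ` A \<subseteq> A"
 shows "v \<in> words n ==> fw v ` A \<subseteq> A"
proof (induction n arbitrary: v)
 case (Suc n)
 then obtain u a where u: "v = u @ [a]" "u \<in> words n" "a \<in> L3" unfolding words_Suc by auto
 then have "a \<in> {1..6}" by auto
 then show ?case using Suc.IH[OF u(2)] assms[of a] u(1) by auto
qed (simp add: words_0)

lemma fw_tri: "v \<in> words n ==> x \<in> tri ==> fw v x \<in> tri"
 using gmap_image[of tri v n] gmap_tri by blast

lemma fw_K: "v \<in> words n ==> x \<in> K ==> fw v x \<in> K"
 using gmap_image[of K v n] gasket_props(3) by blast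

lemma gmap_tri_bc:
 assumes "a \<in> L3" "b \<in> L3" "x \<in> tri"
 shows "a = b ==> 1 - r <= bc a (gmap \<alpha> b x)" "a \<noteq> b ==> bc a (gmap \<alpha> b x) <= r"
 using tri_bc[OF assms(3,1)] tri_bc_le[OF assms(3,1)] bc_gmap[OF assms(2,1), of x] r_bounds
 by (auto simp: mult_le_cancel_left1)

text \<open>Coordinate \<open>a\<close> is at least \<open>1 - r\<close> on one image and at most
  \<open>r\<close> on the other, a gap of \<open>1 - 2 * r = \<alpha>\<close>; the division by 2
  comes from the Lipschitz constant of the coordinates.\<close>

lemma gmap_sep:
 assumes "a \<in> L3" "b \<in> L3" "a \<noteq> b" "x \<in> tri" "y \<in> tri"
 shows "\<alpha> / 2 <= dist (gmap \<alpha> a x) (gmap \<alpha> b y)"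
 using gmap_tri_bc(1)[OF assms(1,1,4)] gmap_tri_bc(2)[OF assms(1,2,5)] assms(3) r_bounds
  bc_lipschitz[OF assms(1), of "gmap \<alpha> a x" "gmap \<alpha> b y"] by linarith

text \<open>Common letters at the end are outermost maps and scale distances by \<open>r\<close>; at
  the first difference, read from the end, \<open>gmap_sep\<close> applies. In particular the cells
  of one level are pairwise disjoint.\<close>

lemma fw_sep:
 assumes "v \<in> words n" "w \<in> words n" "v \<noteq> w" "x \<in> tri" "y \<in> tri"
 shows "\<alpha> / 2 * r ^ n <= dist (fw v x) (fw w y)"
 using assms
proof (induction n arbitrary: v w)
 case (Suc n)
 then obtain v' a where v: "v = v' @ [a]" "v' \<in> words n" "a \<in> L3" unfolding words_Suc by auto
 from Suc obtain w' b where w: "w = w' @ [b]" "w' \<in> words n" "b \<in> L3" unfolding words_Suc by auto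
 show ?case
 proof (cases "a = b")
  case True
  then have "\<alpha> / 2 * r ^ n <= dist (fw v' x) (fw w' y)" using Suc v w by auto
  then have "r * (\<alpha> / 2 * r ^ n) <= r * dist (fw v' x) (fw w' y)" using r_bounds by (intro mult_left_mono) auto
  then show ?thesis using v w True by (simp add: dist_gmap mult_ac del: insert_iff)
 next
  case False
  have "\<alpha> / 2 * r ^ Suc n <= \<alpha> / 2 * 1" using r_bounds a0 by (intro mult_left_mono power_le_one) auto
  also have "\<dots> <= dist (fw v x) (fw w y)"
   using gmap_sep[OF v(3) w(3) False fw_tri[OF v(2) Suc.prems(4)] fw_tri[OF w(2) Suc.prems(5)]] v w by simp
  finally show ?thesis .
 qed
qed (simp add: words_0)

lemma dist_gpt: "i \<in> L3 ==> j \<in> L3 ==> i \<noteq> j ==> dist (gpt i) (gpt j) = 1"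
proof -
 assume ij: "i \<in> L3" "j \<in> L3" "i \<noteq> j"
 then have "(dist (gpt i) (gpt j))\<^sup>2 = 1" unfolding dist_bc by (auto simp: bc_gpt)
 then show ?thesis by (simp add: power2_eq_1_iff) (metis zero_le_dist not_one_le_zero neg_0_le_iff_le)
qed

section \<open>Edge types and the labelling of all edges\<close>

definition corner :: "nat => nat => real^2"
 where "corner \<tau> a = (if \<tau> \<in> L3 then gpt a else gmap \<alpha> \<tau> (gpt a))"

definition len :: "nat => real"
 where "len \<tau> = (if \<tau> \<in> L3 then 1 else \<alpha>)"

lemma base_456: "\<tau> \<in> {1..6} ==> \<tau> \<notin> L3 ==> \<tau> = base \<tau> + 3"
 by (auto simp: base_def)

lemma base_123: "\<tau> \<in> L3 ==> base \<tau> = \<tau>"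
 by (auto simp: base_def)

lemma side_segment:
 assumes "\<tau> \<in> {1..6}"
 shows "side \<tau> = closed_segment (corner \<tau> (oa (base \<tau>))) (corner \<tau> (ob (base \<tau>)))"
proof (cases "\<tau> \<in> L3")
 case True then show ?thesis unfolding side_def corner_def base_123[OF True] by simp
next
 case False then show ?thesis using side_456[OF base_L3[OF assms]] base_456[OF assms False] unfolding corner_def by simp
qed

lemma dist_corner:
 assumes "\<tau> \<in> {1..6}"
 shows "dist (corner \<tau> (oa (base \<tau>))) (corner \<tau> (ob (base \<tau>))) = len \<tau>"
proof (cases "\<tau> \<in> L3")
 case True then show ?thesis using dist_gpt o_L3 unfolding corner_def len_def base_123[OF True] by simp
next
 case False
 then have t: "\<tau> = 4 \<or> \<tau> = 5 \<or> \<tau> = 6" using assms by auto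
 have "(dist (corner \<tau> (oa (base \<tau>))) (corner \<tau> (ob (base \<tau>))))\<^sup>2 = \<alpha>\<^sup>2"
  using t by (elim disjE) (simp_all add: dist_bc corner_def base_def oa_def ob_def gmap_456 bc_gpt, simp_all add: power2_eq_square field_simps)
 then show ?thesis using a0 False by (simp add: len_def power2_eq_iff_nonneg)
qed

text \<open>Three features that tell the edge types apart: a coordinate vanishing on the edge, the
  coordinates of its midpoint, and whether it reaches a vertex of the triangle.\<close>

lemma side_props:
 assumes t: "\<tau> \<in> {1..6}"
 shows "x \<in> side \<tau> ==> bc (base \<tau>) x = 0" "\<exists>m\<in>side \<tau>. \<forall>k\<in>L3. bc k m = (if k = base \<tau> then 0 else 1 / 2)"
  "(\<exists>x\<in>side \<tau>. bc (oa (base \<tau>)) x = 1) \<longleftrightarrow> \<tau> \<in> L3"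
proof -
 define i where "i = base \<tau>"
 have i: "i \<in> L3" using base_L3[OF t] by (simp add: i_def)
 note o = o_L3[OF i]
 have z: "bc i ((1 / 2) *\<^sub>R gpt (oa i) + (1 / 2) *\<^sub>R gpt (ob i)) = 0" "bc (oa i) ((1 / 2) *\<^sub>R gpt (oa i) + (1 / 2) *\<^sub>R gpt (ob i)) = 1 / 2"
  "bc (ob i) ((1 / 2) *\<^sub>R gpt (oa i) + (1 / 2) *\<^sub>R gpt (ob i)) = 1 / 2"
  using o i by (simp_all add: bc_affine bc_gpt' del: insert_iff)
 have zt: "(1 / 2) *\<^sub>R gpt (oa i) + (1 / 2) *\<^sub>R gpt (ob i) \<in> tri"
  using L3_cases[OF i] z by (intro bc_tri) fastforce
 have "(x \<in> side \<tau> \<longrightarrow> bc i x = 0) \<and> (\<exists>m\<in>side \<tau>. \<forall>k\<in>L3. bc k m = (if k = i then 0 else 1 / 2)) \<and>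
  ((\<exists>x\<in>side \<tau>. bc (oa i) x = 1) \<longleftrightarrow> \<tau> \<in> L3)"
 proof (cases "\<tau> \<in> L3")
  case True
  then have ti: "\<tau> = i" using base_123 by (simp add: i_def)
  have "bc k ((1 / 2) *\<^sub>R gpt (oa i) + (1 / 2) *\<^sub>R gpt (ob i)) = (if k = i then 0 else 1 / 2)" if "k \<in> L3" for k
   using L3_cases[OF i that] z by auto
  moreover have "gpt (oa i) \<in> side i" using i by (simp add: side_def)
  moreover have "bc (oa i) (gpt (oa i)) = 1" using bc_gpt' o by simp
  ultimately show ?thesis using side_123[OF i] z zt True unfolding ti by blast
 next
  case False
  then have ti: "\<tau> = i + 3" using base_456 t by (simp add: i_def)
  have s: "side \<tau> = gmap \<alpha> (i + 3) ` tri" using False by (simp add: side_def ti)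
  have "bc k (gmap \<alpha> (i + 3) ((1 / 2) *\<^sub>R gpt (oa i) + (1 / 2) *\<^sub>R gpt (ob i))) = (if k = i then 0 else 1 / 2)" if "k \<in> L3" for k
   using L3_cases[OF i that] o by (elim disjE) (simp_all add: gmap_joint[OF i] z)
  moreover have "bc (oa i) (gmap \<alpha> (i + 3) x) \<noteq> 1" if x: "x \<in> tri" for x
  proof -
   have "- 1 <= bc (ob i) x - bc (oa i) x" using tri_bc[OF x o(2)] tri_bc_le[OF x o(1)] by simp
   then have "\<alpha> * - 1 <= \<alpha> * (bc (ob i) x - bc (oa i) x)" using a0 by (intro mult_left_mono) auto
   then show ?thesis using a1 unfolding gmap_joint[OF i] by auto
  qed
  ultimately show ?thesis using gmap_joint(1)[OF i] zt False unfolding s by blast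
 qed
 then show "x \<in> side \<tau> ==> bc (base \<tau>) x = 0" "\<exists>m\<in>side \<tau>. \<forall>k\<in>L3. bc k m = (if k = base \<tau> then 0 else 1 / 2)"
  "(\<exists>x\<in>side \<tau>. bc (oa (base \<tau>)) x = 1) \<longleftrightarrow> \<tau> \<in> L3" unfolding i_def by blast+
qed

lemma side_inj:
 assumes t: "\<tau> \<in> {1..6}" "\<tau>' \<in> {1..6}" and e: "side \<tau> = side \<tau>'"
 shows "\<tau> = \<tau>'"
proof -
 obtain m where "m \<in> side \<tau>" "\<forall>k\<in>L3. bc k m = (if k = base \<tau> then 0 else 1 / 2)" using side_props(2)[OF t(1)] by blast
 then have b: "base \<tau> = base \<tau>'" using side_props(1)[OF t(2), of m] base_L3[OF t(2)] e by (auto split: if_splits)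
 have "\<tau> \<in> L3 \<longleftrightarrow> \<tau>' \<in> L3" using side_props(3)[OF t(1)] side_props(3)[OF t(2)] e b by simp
 then show ?thesis using b t base_123 base_456 by metis
qed

text \<open>Different last letters are excluded by the separation of the cells, and equal ones can
  be cancelled. What remains is an edge of the empty word: the coordinates of its midpoint are at
  most \<open>1 / 2\<close>, whereas each point in a cell of the first level has a coordinate at
  least \<open>1 - r > 1 / 2\<close>.\<close>

lemma edge_inj_aux:
 assumes "v \<in> words n" "w \<in> words (n + m)" "\<tau> \<in> {1..6}" "\<tau>' \<in> {1..6}" "fw v ` side \<tau> = fw w ` side \<tau>'"
 shows "v = w \<and> \<tau> = \<tau>'"
 using assms(1,2,5)
proof (induction n arbitrary: v w)
 case 0
 then have v: "v = []" by (simp add: words_0)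
 show ?case
 proof (cases m)
  case 0
  then show ?thesis using "0.prems" v side_inj assms(3,4) by (simp add: words_0)
 next
  case (Suc k)
  then obtain u a where w: "w = u @ [a]" "u \<in> words k" "a \<in> L3" using "0.prems"(2) unfolding words_Suc[of k] by (auto simp: words_Suc)
  obtain x where x: "x \<in> side \<tau>" "\<forall>k\<in>L3. bc k x = (if k = base \<tau> then 0 else 1 / 2)" using side_props(2)[OF assms(3)] by blast
  obtain y where y: "y \<in> side \<tau>'" "x = gmap \<alpha> a (fw u y)" using x(1) "0.prems"(3) v w by auto
  have "fw u y \<in> tri" using y(1) side_tri[OF assms(4)] fw_tri[OF w(2)] by blast
  then have "1 - r <= bc a x" using gmap_tri_bc(1)[OF w(3,3)] y(2) by simp
  then show ?thesis using x(2) w(3) r_bounds by (auto split: if_splits)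
 qed
next
 case (Suc n)
 then obtain v' a where v: "v = v' @ [a]" "v' \<in> words n" "a \<in> L3" unfolding words_Suc by auto
 from Suc.prems(2) obtain w' b where w: "w = w' @ [b]" "w' \<in> words (n + m)" "b \<in> L3" by (auto simp: words_Suc)
 obtain x where x: "x \<in> side \<tau>" using side_props(2)[OF assms(3)] by blast
 then obtain y where y: "y \<in> side \<tau>'" "fw v x = fw w y" using Suc.prems(3) by blast
 have "a = b"
 proof (rule ccontr)
  assume "a \<noteq> b"
  then have "\<alpha> / 2 <= dist (fw v x) (fw w y)"
   using gmap_sep[OF v(3) w(3) _ fw_tri[OF v(2)] fw_tri[OF w(2)], of x y] x y(1) side_tri[OF assms(3)] side_tri[OF assms(4)]
   unfolding v(1) w(1) fw_snoc by blast
  then show False using y a0 by simp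
 qed
 moreover have "inj (gmap \<alpha> a)"
 proof (rule injI)
  fix p q assume "gmap \<alpha> a p = gmap \<alpha> a q"
  then show "p = q" using dist_gmap[OF v(3), of p q] r_bounds by simp
 qed
 moreover have "gmap \<alpha> a ` fw v' ` side \<tau> = gmap \<alpha> b ` fw w' ` side \<tau>'" using Suc.prems(3) v w by (simp add: image_image)
 ultimately have "fw v' ` side \<tau> = fw w' ` side \<tau>'" by (simp add: inj_image_eq_iff)
 then show ?case using Suc.IH[OF v(2) w(2)] v w \<open>a = b\<close> by simp
qed

text \<open>A word and an edge type. By \<open>edge_inj\<close> and \<open>all_edges_eq\<close> each
  edge has exactly one label, so sums over edges turn into sums over words and six types.\<close>

definition labels :: "(nat list \<times> nat) set"
 where "labels = (\<Union>n. words n) \<times> {1..6}"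

lemma edge_inj: "inj_on (%(v, \<tau>). fw v ` side \<tau>) labels"
proof (rule inj_onI, clarify)
 fix v \<tau> w \<tau>' assume a: "(v, \<tau>) \<in> labels" "(w, \<tau>') \<in> labels" "fw v ` side \<tau> = fw w ` side \<tau>'"
 have W: "v \<in> words (length v)" "w \<in> words (length w)" using a by (auto simp: labels_def words_iff)
 have t: "\<tau> \<in> {1..6}" "\<tau>' \<in> {1..6}" using a by (auto simp: labels_def)
 show "v = w \<and> \<tau> = \<tau>'"
 proof (cases "length v <= length w")
  case True
  then show ?thesis using edge_inj_aux[OF W(1), of w "length w - length v"] W t a(3) by simp
 next
  case False
  then show ?thesis using edge_inj_aux[OF W(2), of v "length v - length w"] W t a(3) by force
 qed
qed

lemma base_edge_eq: "i \<in> L3 ==> base_edge \<alpha> i = side (i + 3)"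
 by (auto simp: base_edge_def side_def tri_def)

lemma all_edges_eq: "all_edges \<alpha> = (%(v, \<tau>). fw v ` side \<tau>) ` labels"
proof (intro subset_antisym subsetI)
 fix e assume "e \<in> all_edges \<alpha>"
 then consider n where "e \<in> triangle_edges \<alpha> n" | n where "e \<in> joining_edges \<alpha> n" by (auto simp: all_edges_def)
 then show "e \<in> (%(v, \<tau>). fw v ` side \<tau>) ` labels"
 proof cases
  case 1
  then obtain x y w where xy: "e = closed_segment x y" "w \<in> words n" "x \<noteq> y" "x \<in> fw w ` gpt ` L3" "y \<in> fw w ` gpt ` L3"
   unfolding triangle_edges_def by blast
  from xy(4,5) obtain a b where "a \<in> L3" "b \<in> L3" "x = fw w (gpt a)" "y = fw w (gpt b)" by blast
  then have w: "w \<in> words n" "a \<in> L3" "b \<in> L3" "a \<noteq> b" "e = closed_segment (fw w (gpt a)) (fw w (gpt b))" using xy by auto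
  have "\<exists>\<tau>\<in>L3. closed_segment (gpt a) (gpt b) = side \<tau>"
   using w(2-4) by (auto simp: side_def oa_def ob_def closed_segment_commute)
  then obtain \<tau> where "\<tau> \<in> L3" "e = fw w ` side \<tau>" using w(5) by (metis image_segment)
  then show ?thesis using w(1) by (intro image_eqI[of _ _ "(w, \<tau>)"]) (auto simp: labels_def)
 next
  case 2
  then obtain m w i where "w \<in> words m" "i \<in> L3" "e = fw w ` base_edge \<alpha> i" unfolding joining_edges_def by blast
  then show ?thesis by (intro image_eqI[of _ _ "(w, i + 3)"]) (auto simp: labels_def base_edge_eq)
 qed
next
 fix e assume "e \<in> (%(v, \<tau>). fw v ` side \<tau>) ` labels"
 then obtain n v \<tau> where e: "v \<in> words n" "\<tau> \<in> {1..6}" "e = fw v ` side \<tau>" by (auto simp: labels_def)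
 show "e \<in> all_edges \<alpha>"
 proof (cases "\<tau> \<in> L3")
  case True
  have "gpt (oa \<tau>) \<noteq> gpt (ob \<tau>)" using dist_gpt[of "oa \<tau>" "ob \<tau>"] o_L3[OF True] by auto
  then have "fw v (gpt (oa \<tau>)) \<noteq> fw v (gpt (ob \<tau>))" using fw_eq_iff[OF e(1)] by simp
  moreover have "e = closed_segment (fw v (gpt (oa \<tau>))) (fw v (gpt (ob \<tau>)))"
   using e(3) True by (simp add: side_def image_segment)
  ultimately have "e \<in> triangle_edges \<alpha> n" using e(1) o_L3(1,2)[OF True] unfolding triangle_edges_def by blast
  then show ?thesis by (auto simp: all_edges_def)
 next
  case False
  then have "e = fw v ` base_edge \<alpha> (base \<tau>)" using e base_456[OF e(2) False] base_edge_eq[OF base_L3[OF e(2)]] by simp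
  \<comment> \<open>A word of length \<open>n\<close> contributes joining edges only from level
    \<open>Suc n\<close> on.\<close>
  then have "e \<in> joining_edges \<alpha> (Suc n)" using e base_L3[OF e(2)] unfolding joining_edges_def by blast
  then show ?thesis by (auto simp: all_edges_def)
 qed
qed

lemma edge_K:
 assumes "v \<in> words n" "\<tau> \<in> {1..6}"
 shows "fw v ` side \<tau> \<subseteq> fw v ` K"
proof -
 have "side \<tau> \<subseteq> K"
 proof (cases "\<tau> \<in> L3")
  case False
  \<comment> \<open>A joining edge of the first level lies on a side of the triangle, and the sides
    belong to the gasket.\<close>
  have "side \<tau> \<subseteq> side (base \<tau>)"
   using side_123[OF base_L3[OF assms(2)]] side_props(1)[OF assms(2)] side_tri[OF assms(2)] by blast
  then show ?thesis using gasket_props(5)[OF base_L3[OF assms(2)]] by blast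
 qed (rule gasket_props)
 then show ?thesis by blast
qed

lemma edge_arclength:
 assumes "v \<in> words n" "\<tau> \<in> {1..6}" and R: "arclength_param (fw v ` side \<tau>) l R"
 shows "l = len \<tau> * r ^ n" "continuous_on {0..l} R" "R ` {0..l} \<subseteq> fw v ` side \<tau>"
proof -
 obtain x y where xy: "fw v ` side \<tau> = closed_segment x y" "x \<noteq> y" "l = dist x y" "\<forall>t\<in>{0..l}. R t = x + (t / l) *\<^sub>R (y - x)"
  using R unfolding arclength_param_def by blast
 have "closed_segment x y = closed_segment (fw v (corner \<tau> (oa (base \<tau>)))) (fw v (corner \<tau> (ob (base \<tau>))))"
  unfolding xy(1)[symmetric] side_segment[OF assms(2)] image_segment ..
 \<comment> \<open>A segment determines its endpoints up to their order, and thus its length,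
   whichever direction the parametrization takes.\<close>
 then have "dist x y = dist (fw v (corner \<tau> (oa (base \<tau>)))) (fw v (corner \<tau> (ob (base \<tau>))))"
  unfolding closed_segment_eq by (auto simp: doubleton_eq_iff dist_commute)
 then show "l = len \<tau> * r ^ n" using xy(3) dist_corner[OF assms(2)] dist_fw[OF assms(1)] by simp
 have l: "0 < l" using xy by simp
 have "continuous_on {0..l} (%t. x + (t / l) *\<^sub>R (y - x))" using l by (intro continuous_intros) auto
 then show "continuous_on {0..l} R" by (rule continuous_on_eq) (use xy in auto)
 show "R ` {0..l} \<subseteq> fw v ` side \<tau>"
 proof clarify
  fix t assume t: "t \<in> {0..l}"
  have "R t = (1 - t / l) *\<^sub>R x + (t / l) *\<^sub>R y" using xy(4) t by (simp add: algebra_simps)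
  then show "R t \<in> fw v ` side \<tau>" unfolding xy(1) closed_segment_def using t l by auto
 qed
qed

end

section \<open>The Hausdorff measure of the gasket\<close>

lemma finite_subadditive:
 fixes q :: "'a set => ennreal"
 assumes "q {} = 0" and q: "\<And>A. q (\<Union>i::nat. A i) <= (\<Sum>i. q (A i))" and "finite I"
 shows "q (\<Union>i\<in>I. A i) <= (\<Sum>i\<in>I. q (A i))"
proof -
 define n where "n = card I"
 obtain h where h: "bij_betw h {0..<n} I" unfolding n_def using ex_bij_betw_nat_finite[OF assms(3)] by blast
 define C where "C k = (if k < n then A (h k) else {})" for k
 have "(\<Union>i\<in>I. A i) = (\<Union>k\<in>{0..<n}. A (h k))" unfolding bij_betw_imp_surj_on[OF h, symmetric] by simp
 also have "\<dots> = (\<Union>k. C k)" by (auto simp: C_def split: if_splits)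
 finally have "q (\<Union>i\<in>I. A i) <= (\<Sum>k. q (C k))" using q[of C] by simp
 also have "\<dots> = (\<Sum>k\<in>{0..<n}. q (C k))" by (intro suminf_finite) (auto simp: C_def assms(1))
 also have "\<dots> = (\<Sum>k\<in>{0..<n}. q (A (h k)))" by (intro sum.cong) (auto simp: C_def)
 also have "\<dots> = (\<Sum>i\<in>I. q (A i))" by (rule sum.reindex_bij_betw[OF h])
 finally show ?thesis .
qed

context gasket_loc
begin

text \<open>The similarity dimension of the three triangle maps, that is, the solution
  \<open>s\<close> of \<open>3 * r powr s = 1\<close>.\<close>

definition dm :: real where "dm = ln 3 / - ln r"

lemma ln_r: "ln r < 0" "- ln r < ln 3"
proof -
 show "ln r < 0" using r_bounds by simp
 have "ln (1 / 3) < ln r" using r_bounds by (subst ln_less_cancel_iff) auto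
 then show "- ln r < ln 3" by (simp add: ln_div)
qed

lemma dm_gt_1: "1 < dm"
 unfolding dm_def using ln_r by (simp add: divide_simps)

lemma r_powr: "r powr dm = 1 / 3"
proof -
 have "r powr dm = exp (- ln 3)" using ln_r r_bounds by (simp add: powr_def dm_def)
 then show ?thesis by (simp add: exp_minus inverse_eq_divide)
qed

lemma r_power_powr: "(r ^ n) powr dm = (1 / 3) ^ n"
proof -
 have "(r ^ n) powr dm = (r powr dm) ^ n" using r_bounds by (simp add: powr_realpow[symmetric] powr_powr mult.commute)
 then show ?thesis by (simp add: r_powr)
qed

abbreviation "hm \<equiv> hausdorff_outer dm :: (real^2) set => ennreal"

lemma surj_fw: "v \<in> words n ==> surj (fw v)"
proof (induction n arbitrary: v)
 case (Suc n)
 then obtain u a where v: "v = u @ [a]" "u \<in> words n" "a \<in> L3" unfolding words_Suc by auto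
 show ?case unfolding surj_def
 proof
  fix y
  obtain x where x: "(1 / r) *\<^sub>R (y - gpt a) + gpt a = fw u x" using Suc.IH[OF v(2)] unfolding surj_def by blast
  have "fw v x = y" using r_bounds v(1) by (simp add: gmap_123[OF v(3)] x[symmetric])
  then show "\<exists>x. y = fw v x" by blast
 qed
qed (simp add: words_0)

lemma hd_fw_le: "v \<in> words n ==> hm (fw v ` A) <= ennreal ((1 / 3) ^ n) * hm A"
 unfolding r_power_powr[symmetric]
 by (rule hausdorff_outer_lipschitz) (use dist_fw dm_gt_1 r_bounds in auto)

text \<open>The Lipschitz estimate is applied to the similarity and to its inverse, whose ratio is
  \<open>1 / r ^ n\<close>.\<close>

lemma hd_fw: "v \<in> words n ==> hm (fw v ` A) = ennreal ((1 / 3) ^ n) * hm A"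
proof (rule antisym[OF hd_fw_le])
 assume v: "v \<in> words n"
 define g where "g = inv (fw v)"
 have g: "fw v (g y) = y" for y unfolding g_def by (rule surj_f_inv_f[OF surj_fw[OF v]])
 have "g (fw v x) = x" for x using g[of "fw v x"] fw_eq_iff[OF v] by simp
 then have A: "A = g ` fw v ` A" by (force simp: image_iff)
 have "dist (g x) (g y) <= (1 / r ^ n) * dist x y" for x y
  using dist_fw[OF v, of "g x" "g y"] r_bounds by (simp add: g field_simps)
 then have "hm (g ` fw v ` A) <= ennreal ((1 / r ^ n) powr dm) * hm (fw v ` A)"
  by (rule hausdorff_outer_lipschitz) (use r_bounds dm_gt_1 in auto)
 then have "hm A <= ennreal (3 ^ n) * hm (fw v ` A)"
  using A r_bounds by (simp add: powr_divide r_power_powr power_one_over)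
 then have "ennreal ((1 / 3) ^ n) * hm A <= ennreal ((1 / 3) ^ n) * (ennreal (3 ^ n) * hm (fw v ` A))" by (intro mult_left_mono) auto
 also have "\<dots> = hm (fw v ` A)" by (simp add: mult.assoc[symmetric] ennreal_mult[symmetric] power_mult_distrib[symmetric])
 finally show "ennreal ((1 / 3) ^ n) * hm A <= hm (fw v ` A)" .
qed

lemmas hd_finite_Un = finite_subadditive[of hm, OF hausdorff_outer_empty hausdorff_outer_countable_subadditive]

text \<open>What the cells of level \<open>Suc n\<close> leave out consists of three copies of what
  level \<open>n\<close> leaves out and of points on three segments, which are null sets because
  \<open>dm > 1\<close>.\<close>

lemma hd_rest: "hm (K - (\<Union>v\<in>words n. fw v ` K)) = 0"
proof (induction n)
 case 0 then show ?case by (simp add: words_0 hausdorff_outer_empty)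
next
 case (Suc n)
 let ?Z = "K - (\<Union>v\<in>words n. fw v ` K)"
 have one: "fw [a] = gmap \<alpha> a" for a by (simp add: gmap_word_def fun_eq_iff)
 have a1: "[a] \<in> words 1" if "a \<in> L3" for a using that by (simp add: words_iff)
 have sub: "K - (\<Union>v\<in>words (Suc n). fw v ` K) \<subseteq> (\<Union>a\<in>L3. fw [a] ` ?Z) \<union> (\<Union>i\<in>L3. side (i + 3))"
 proof
  fix x assume x: "x \<in> K - (\<Union>v\<in>words (Suc n). fw v ` K)"
  then have "x \<in> (\<Union>j\<in>{1..6}. gmap \<alpha> j ` K)" by (intro subsetD[OF equalityD1[OF gasket_props(3)]]) simp
  then obtain j y where j: "j \<in> {1..6}" "y \<in> K" "x = gmap \<alpha> j y" by blast
  then consider "j \<in> L3" | i where "i \<in> L3" "j = i + 3" using index_cases by blast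
  then show "x \<in> (\<Union>a\<in>L3. fw [a] ` ?Z) \<union> (\<Union>i\<in>L3. side (i + 3))"
  proof cases
   case 1
   have "y \<notin> fw v ` K" if v: "v \<in> words n" for v
   proof
    assume "y \<in> fw v ` K"
    then have "x \<in> fw (v @ [j]) ` K" using j by auto
    moreover have "v @ [j] \<in> words (Suc n)" using v 1 by (auto simp: words_iff)
    ultimately show False using x by blast
   qed
   then show ?thesis using j 1 unfolding one by blast
  next
   case 2
   then have "side j = gmap \<alpha> j ` tri" by (auto simp: side_def)
   then have "x \<in> side (i + 3)" using j 2 subsetD[OF gasket_props(4) j(2)] by simp
   then show ?thesis using 2(1) by blast
  qed
 qed
 have "hm (side (i + 3)) = 0" if "i \<in> L3" for i
  unfolding side_456[OF that] by (rule hausdorff_outer_segment[OF dm_gt_1])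
 then have s: "hm (\<Union>i\<in>L3. side (i + 3)) = 0" using hd_finite_Un[of L3 "%i. side (i + 3)"] by simp
 have "hm (fw [a] ` ?Z) = 0" if "a \<in> L3" for a using hd_fw[OF a1[OF that], of ?Z] Suc by simp
 then have "hm (\<Union>a\<in>L3. fw [a] ` ?Z) = 0" using hd_finite_Un[of L3 "%a. fw [a] ` ?Z"] by simp
 then have "hm (K - (\<Union>v\<in>words (Suc n). fw v ` K)) <= 0 + 0"
  using order_trans[OF hausdorff_outer_mono[OF sub] hausdorff_outer_Un, of dm] unfolding s by simp
 then show ?case by simp
qed

lemma diameter_fw:
 assumes "v \<in> words n" "A \<subseteq> K"
 shows "bounded (fw v ` A)" "diameter (fw v ` A) <= r ^ n * diameter K"
proof -
 have b: "bounded K" using gasket_props(1) by (rule compact_imp_bounded)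
 have "fw v ` A \<subseteq> K" using fw_K[OF assms(1)] assms(2) by blast
 then show "bounded (fw v ` A)" by (rule bounded_subset[OF b])
 show "diameter (fw v ` A) <= r ^ n * diameter K"
 proof (rule diameter_le)
  show "fw v ` A \<noteq> {} \<or> 0 <= r ^ n * diameter K" using r_bounds diameter_ge_0[OF b] by simp
  fix x y assume "x \<in> fw v ` A" "y \<in> fw v ` A"
  then obtain x' y' where xy: "x' \<in> K" "y' \<in> K" "x = fw v x'" "y = fw v y'" using assms(2) by blast
  have "dist x y = r ^ n * dist x' y'" unfolding xy by (rule dist_fw[OF assms(1)])
  then show "norm (x - y) <= r ^ n * diameter K" unfolding dist_norm[symmetric]
   using diameter_bounded_bound[OF b xy(1,2)] r_bounds by (simp add: mult_left_mono)
 qed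
qed

text \<open>The \<open>3 ^ n\<close> cells of level \<open>n\<close> have diameter at most
  \<open>r ^ n * D\<close>, so they cost at most
  \<open>3 ^ n * (r ^ n * D) powr dm = D powr dm\<close> at every level; the rest of the gasket
  costs nothing.\<close>

lemma hd_K_finite: "hm K < \<infinity>"
proof -
 define D where "D = diameter K"
 have D: "0 <= D" unfolding D_def by (rule diameter_ge_0[OF compact_imp_bounded[OF gasket_props(1)]])
 have "hm K <= ennreal (D powr dm)"
 proof (rule hausdorff_outer_least)
  fix \<delta> :: real assume \<delta>: "0 < \<delta>"
  have "(%n. r ^ n * D) \<longlonglongrightarrow> 0 * D" using r_bounds by (intro tendsto_intros LIMSEQ_realpow_zero) auto
  then have "\<forall>\<^sub>F n in sequentially. r ^ n * D < \<delta>" using \<delta> by (intro order_tendstoD) auto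
  then obtain n where n: "r ^ n * D < \<delta>" using eventually_happens by (auto simp: eventually_sequentially)
  let ?U = "\<Union>v\<in>words n. fw v ` K"
  define C where "C b = (if b then ?U else K - ?U)" for b :: bool
  note fs = finite_subadditive[of "hausdorff_pre dm \<delta>", OF hausdorff_pre_empty hausdorff_pre_countable_subadditive]
  have "hausdorff_pre dm \<delta> K <= hausdorff_pre dm \<delta> (\<Union>b\<in>{True, False}. C b)"
   by (rule hausdorff_pre_mono) (auto simp: C_def)
  also have "\<dots> <= (\<Sum>b\<in>{True, False}. hausdorff_pre dm \<delta> (C b))" using \<delta> by (intro fs) auto
  also have "\<dots> = hausdorff_pre dm \<delta> ?U + hausdorff_pre dm \<delta> (K - ?U)" by (simp add: C_def)
  also have "hausdorff_pre dm \<delta> (K - ?U) = 0"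
   using hausdorff_outer_upper[OF \<delta>, of dm "K - ?U"] hd_rest[of n] by simp
  also have "hausdorff_pre dm \<delta> ?U <= (\<Sum>v\<in>words n. hausdorff_pre dm \<delta> (fw v ` K))"
   using \<delta> by (intro fs finite_words) auto
  also have "\<dots> <= (\<Sum>v\<in>words n. ennreal ((1 / 3) ^ n * D powr dm))"
  proof (rule sum_mono)
   fix v assume v: "v \<in> words n"
   note d = diameter_fw[OF v order_refl, folded D_def]
   have "hausdorff_pre dm \<delta> (fw v ` K) <= ennreal (diameter (fw v ` K) powr dm)"
    using d n \<delta> by (intro hausdorff_pre_single) auto
   also have "\<dots> <= ennreal ((r ^ n * D) powr dm)"
    using d diameter_ge_0[OF d(1)] dm_gt_1 by (intro ennreal_leI powr_mono2) auto
   also have "\<dots> = ennreal ((1 / 3) ^ n * D powr dm)"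
    using D r_bounds by (simp add: powr_mult r_power_powr)
   finally show "hausdorff_pre dm \<delta> (fw v ` K) <= ennreal ((1 / 3) ^ n * D powr dm)" .
  qed
  also have "\<dots> = ennreal (3 ^ n * ((1 / 3) ^ n * D powr dm))"
   by (simp add: card_words ennreal_of_nat_eq_real_of_nat ennreal_mult)
  also have "3 ^ n * ((1 / 3) ^ n * D powr dm) = D powr dm" by (simp add: power_one_over)
  finally show "hausdorff_pre dm \<delta> K <= ennreal (D powr dm)" by simp
 qed
 then have "hm K < top" by (rule le_less_trans) simp
 then show ?thesis by simp
qed

text \<open>Counting replaces a self-similar measure. If \<delta> is below the separation at level
  \<open>n\<close>, the words whose points lie in \<open>V\<close> share their last \<open>n\<close>
  letters, so at most \<open>3 ^ (N - n)\<close> of them exist.\<close>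

lemma word_count:
 assumes \<delta>: "0 < \<delta>" and V: "\<And>y z. y \<in> V ==> z \<in> V ==> dist y z < \<delta>" and x: "x \<in> tri"
 shows "\<exists>N0. \<forall>N\<ge>N0. real (card {v \<in> words N. fw v x \<in> V}) <= 3 ^ N * (\<delta> / (\<alpha> / 2 * r)) powr dm"
proof (cases "\<delta> < \<alpha> / 2")
 case False
 have "real (card {v \<in> words N. fw v x \<in> V}) <= 3 ^ N * (\<delta> / (\<alpha> / 2 * r)) powr dm" for N
 proof -
  have "\<alpha> / 2 * r <= \<alpha> / 2 * 1" using a0 r_bounds by (intro mult_left_mono) auto
  then have "\<alpha> / 2 * r <= \<delta>" using False by linarith
  then have "1 <= \<delta> / (\<alpha> / 2 * r)" using a0 r_bounds by (simp add: field_simps)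
  then have "1 <= (\<delta> / (\<alpha> / 2 * r)) powr dm" using dm_gt_1 by (intro ge_one_powr_ge_zero) auto
  moreover have "card {v \<in> words N. fw v x \<in> V} <= 3 ^ N" unfolding card_words[symmetric] by (rule card_mono[OF finite_words]) auto
  then have "real (card {v \<in> words N. fw v x \<in> V}) <= 3 ^ N" by (metis of_nat_le_iff of_nat_numeral of_nat_power)
  moreover have "3 ^ N * 1 <= 3 ^ N * (\<delta> / (\<alpha> / 2 * r)) powr dm" using calculation(1) by (intro mult_left_mono) auto
  ultimately show ?thesis by linarith
 qed
 then show ?thesis by blast
next
 case True
 have "(%k. \<alpha> / 2 * r ^ k) \<longlonglongrightarrow> \<alpha> / 2 * 0" using r_bounds by (intro tendsto_intros LIMSEQ_realpow_zero) auto
 then have "\<forall>\<^sub>F k in sequentially. \<alpha> / 2 * r ^ k < \<delta>" using \<delta> by (intro order_tendstoD) auto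
 then have ex: "\<exists>k. \<alpha> / 2 * r ^ k <= \<delta>" unfolding eventually_sequentially by (meson less_imp_le order_refl)
 \<comment> \<open>Minimality places \<delta> below the separation for \<open>n = k - 1\<close>,
   while the bound for \<open>k\<close> itself gives
   \<open>r ^ n <= \<delta> / (\<alpha> / 2 * r)\<close>; this is the origin of the
   constant.\<close>
 define k where "k = (LEAST k. \<alpha> / 2 * r ^ k <= \<delta>)"
 have k: "\<alpha> / 2 * r ^ k <= \<delta>" unfolding k_def by (rule LeastI_ex[OF ex])
 have "k \<noteq> 0" using k True by (intro notI) simp
 then obtain n where n: "k = Suc n" using not0_implies_Suc by blast
 have n2: "\<delta> < \<alpha> / 2 * r ^ n" using not_less_Least[of n "%k. \<alpha> / 2 * r ^ k <= \<delta>"] n by (simp add: k_def)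
 have "real (card {v \<in> words N. fw v x \<in> V}) <= 3 ^ N * (\<delta> / (\<alpha> / 2 * r)) powr dm" if N: "n <= N" for N
 proof -
  let ?S = "{v \<in> words N. fw v x \<in> V}"
  have "inj_on (take (N - n)) ?S"
  proof (rule inj_onI)
   fix v w assume v: "v \<in> ?S" and w: "w \<in> ?S" and e: "take (N - n) v = take (N - n) w"
   have d: "drop (N - n) u \<in> words n" "fw u x = fw (drop (N - n) u) (fw (take (N - n) u) x)" "fw (take (N - n) u) x \<in> tri"
    if "u \<in> ?S" for u
   proof -
    show "drop (N - n) u \<in> words n" using that N set_drop_subset[of "N - n" u] by (auto simp: words_iff)
    show "fw u x = fw (drop (N - n) u) (fw (take (N - n) u) x)" by (simp flip: fw_append)
    show "fw (take (N - n) u) x \<in> tri"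
     by (rule fw_tri[of _ "N - n", OF _ x]) (use that set_take_subset[of "N - n" u] in \<open>auto simp: words_iff\<close>)
   qed
   have "dist (fw v x) (fw w x) < \<alpha> / 2 * r ^ n" using V[of "fw v x" "fw w x"] v w n2 by auto
   then have "drop (N - n) v = drop (N - n) w"
    using fw_sep[OF d(1)[OF v] d(1)[OF w] _ d(3)[OF v] d(3)[OF w]] d(2)[OF v] d(2)[OF w] by fastforce
   then show "v = w" using e by (metis append_take_drop_id)
  qed
  moreover have "take (N - n) ` ?S \<subseteq> words (N - n)"
  proof clarify
   fix u assume "u \<in> words N"
   then show "take (N - n) u \<in> words (N - n)" using set_take_subset[of "N - n" u] by (auto simp: words_iff)
  qed
  ultimately have "card ?S <= card (words (N - n))" by (rule card_inj_on_le[OF _ _ finite_words])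
  then have "card ?S <= 3 ^ (N - n)" unfolding card_words .
  then have "real (card ?S) <= 3 ^ (N - n)" by (metis of_nat_le_iff of_nat_numeral of_nat_power)
  also have "\<dots> = 3 ^ N * (1 / 3) ^ n" using N by (simp add: power_diff power_one_over)
  also have "\<dots> = 3 ^ N * (r ^ n) powr dm" by (simp add: r_power_powr)
  also have "\<dots> <= 3 ^ N * (\<delta> / (\<alpha> / 2 * r)) powr dm"
  proof -
   have "r ^ n <= \<delta> / (\<alpha> / 2 * r)" using k n a0 r_bounds by (simp add: field_simps)
   then show ?thesis using r_bounds dm_gt_1 by (intro mult_left_mono powr_mono2) auto
  qed
  finally show ?thesis .
 qed
 then show ?thesis by blast
qed

text \<open>Mass distribution principle: a cover by small sets is counted against the words of a
 long fixed length.\<close>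

lemma hd_K_pos: "0 < hm K"
proof -
 obtain x where xK: "x \<in> K" using gasket_props(2) by blast
 then have x: "x \<in> tri" using gasket_props(4) by blast
 \<comment> \<open>From \<open>word_count\<close> for the sets \<open>V i\<close> below, in which
   any two points are closer than \<open>3 * \<rho> i\<close>.\<close>
 define c where "c = (3 / (\<alpha> / 2 * r)) powr dm"
 have c: "0 < c" using a0 r_bounds by (simp add: c_def)
 have "ennreal (1 / c) <= hausdorff_pre dm 1 K"
 proof (rule hausdorff_pre_ge)
  fix U :: "nat => (real^2) set" assume U: "hcover 1 K U"
  show "ennreal (1 / c) <= hcost dm U"
  proof (rule ennreal_le_epsilon)
   fix e :: real assume e: "0 < e"
   \<comment> \<open>Slightly more than the diameter, also when the diameter is 0, so that the
     neighbourhoods \<open>V i\<close> are open and cover \<open>U i\<close>. The excess in the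
     power \<open>dm\<close> sums to at most \<open>e\<close>.\<close>
   define \<rho> where "\<rho> i = (diameter (U i) powr dm + e * (1 / 2) ^ Suc i) powr (1 / dm)" for i
   have bU: "bounded (U i)" for i using U by (simp add: hcover_def)
   have \<rho>d: "\<rho> i powr dm = diameter (U i) powr dm + e * (1 / 2) ^ Suc i" for i
    using e dm_gt_1 by (simp add: \<rho>_def powr_powr add_nonneg_nonneg)
   have \<rho>: "diameter (U i) < \<rho> i" for i
   proof -
    have "diameter (U i) = (diameter (U i) powr dm) powr (1 / dm)"
     using dm_gt_1 diameter_ge_0[OF bU] by (simp add: powr_powr)
    also have "\<dots> < \<rho> i" unfolding \<rho>_def using e dm_gt_1 by (intro powr_less_mono2) auto
    finally show ?thesis .
   qed
   have \<rho>0: "0 < \<rho> i" for i using \<rho>[of i] diameter_ge_0[OF bU[of i]] by simp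
   define V where "V i = (\<Union>y\<in>U i. ball y (\<rho> i))" for i
   have Vd: "dist y z < 3 * \<rho> i" if yz: "y \<in> V i" "z \<in> V i" for y z i
   proof -
    obtain y' z' where "y' \<in> U i" "dist y' y < \<rho> i" "z' \<in> U i" "dist z' z < \<rho> i" using yz by (auto simp: V_def)
    moreover have "dist y' z' <= diameter (U i)" using calculation by (intro diameter_bounded_bound bU)
    ultimately show ?thesis using \<rho>[of i] dist_triangle[of y z y'] dist_triangle[of y' z z'] by (simp add: dist_commute)
   qed
   have "K \<subseteq> (\<Union>i. V i)" using U \<rho>0 unfolding hcover_def V_def by force
   moreover have "open (V i)" for i by (auto simp: V_def)
   ultimately obtain I where I: "finite I" "K \<subseteq> (\<Union>i\<in>I. V i)"
    by (metis compactE_image[OF gasket_props(1), of UNIV V])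
   have "\<exists>N0. \<forall>N\<ge>N0. real (card {v \<in> words N. fw v x \<in> V i}) <= 3 ^ N * (3 * \<rho> i / (\<alpha> / 2 * r)) powr dm" for i
    by (rule word_count[OF _ _ x]) (use \<rho>0[of i] Vd[of _ i] in auto)
   then have "\<forall>i. \<exists>N0. \<forall>N\<ge>N0. real (card {v \<in> words N. fw v x \<in> V i}) <= 3 ^ N * (3 * \<rho> i / (\<alpha> / 2 * r)) powr dm" by blast
   from choice[OF this] obtain N0 where N0: "\<And>i N. N0 i <= N ==> real (card {v \<in> words N. fw v x \<in> V i}) <= 3 ^ N * (3 * \<rho> i / (\<alpha> / 2 * r)) powr dm"
    by blast
   \<comment> \<open>One word length that is long enough for all the finitely many sets of the
     subcover.\<close>
   define N where "N = (\<Sum>i\<in>I. N0 i)"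
   have N: "N0 i <= N" if "i \<in> I" for i unfolding N_def by (rule member_le_sum[OF that]) (use I in auto)
   have "words N \<subseteq> (\<Union>i\<in>I. {v \<in> words N. fw v x \<in> V i})" using I(2) fw_K[OF _ xK] by blast
   then have "card (words N) <= card (\<Union>i\<in>I. {v \<in> words N. fw v x \<in> V i})" using I(1) by (intro card_mono) (auto simp: finite_words)
   also have "\<dots> <= (\<Sum>i\<in>I. card {v \<in> words N. fw v x \<in> V i})" by (rule card_UN_le[OF I(1)])
   finally have "real (card (words N)) <= real (\<Sum>i\<in>I. card {v \<in> words N. fw v x \<in> V i})" by (rule of_nat_mono)
   also have "\<dots> = (\<Sum>i\<in>I. real (card {v \<in> words N. fw v x \<in> V i}))" by (rule of_nat_sum)
   also have "\<dots> <= (\<Sum>i\<in>I. 3 ^ N * (3 * \<rho> i / (\<alpha> / 2 * r)) powr dm)" by (intro sum_mono N0 N)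
   also have "\<dots> = (\<Sum>i\<in>I. 3 ^ N * (c * \<rho> i powr dm))"
   proof (rule sum.cong[OF refl])
    fix i
    have "(3 * \<rho> i / (\<alpha> / 2 * r)) = 3 / (\<alpha> / 2 * r) * \<rho> i" by simp
    then show "3 ^ N * (3 * \<rho> i / (\<alpha> / 2 * r)) powr dm = 3 ^ N * (c * \<rho> i powr dm)"
     using a0 r_bounds \<rho>0[of i] unfolding c_def by (simp only: powr_mult)
   qed
   also have "\<dots> = 3 ^ N * (c * (\<Sum>i\<in>I. \<rho> i powr dm))" by (simp add: sum_distrib_left)
   finally have "1 <= c * (\<Sum>i\<in>I. \<rho> i powr dm)" by (simp add: card_words)
   then have "1 / c <= (\<Sum>i\<in>I. \<rho> i powr dm)" using c by (simp add: field_simps)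
   also have "\<dots> = (\<Sum>i\<in>I. diameter (U i) powr dm) + (\<Sum>i\<in>I. e * (1 / 2) ^ Suc i)" by (simp add: \<rho>d sum.distrib)
   also have "(\<Sum>i\<in>I. e * (1 / 2) ^ Suc i) <= e"
   proof -
    have s: "(%i. e * (1 / 2) ^ Suc i) sums (e * 1)" by (intro sums_mult power_half_series)
    then show ?thesis using sum_le_suminf[OF sums_summable[OF s] I(1)] e sums_unique[OF s] by simp
   qed
   finally have "ennreal (1 / c) <= ennreal ((\<Sum>i\<in>I. diameter (U i) powr dm) + e)" by (intro ennreal_leI) simp
   also have "\<dots> = (\<Sum>i\<in>I. ennreal (diameter (U i) powr dm)) + ennreal e"
    using e by (simp add: sum_nonneg)
   also have "\<dots> <= hcost dm U + ennreal e"
    unfolding hcost_def by (intro add_right_mono sum_le_suminf I(1)) auto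
   finally show "ennreal (1 / c) <= hcost dm U + ennreal e" .
  qed
 qed
 also have "\<dots> <= hm K" by (rule hausdorff_outer_upper) simp
 finally show ?thesis using c by (auto intro: less_le_trans[of _ "ennreal (1 / c)"])
qed

section \<open>The normalized measure and averages over cells\<close>

definition gm :: "(real^2) measure"
 where "gm = uniform_measure (hausdorff_measure dm) K"

lemma closed_K: "closed K" using gasket_props(1) by (rule compact_imp_closed)

lemma compact_fw: "v \<in> words n ==> compact (fw v ` K)"
proof (rule compact_continuous_image[OF _ gasket_props(1)])
 assume v: "v \<in> words n"
 have "r ^ n * dist x y <= 1 * dist x y" for x y using r_bounds by (intro mult_right_mono power_le_one) auto
 then show "continuous_on K (fw v)" unfolding continuous_on_iff by (metis dist_fw[OF v] le_less_trans mult_1)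
qed

lemma emeasure_gm: "A \<in> sets borel ==> A \<subseteq> K ==> emeasure gm A = hm A / hm K"
 unfolding gm_def using closed_K by (subst emeasure_uniform_measure) (auto simp: emeasure_hausdorff Int_absorb1)

lemma sets_gm [simp, measurable_cong]: "sets gm = sets borel" and space_gm [simp]: "space gm = UNIV"
 by (simp_all add: gm_def)

lemma finite_gm: "finite_measure gm" and measure_gm_UNIV: "measure gm UNIV = 1"
proof -
 have "emeasure gm UNIV = hm K / hm K"
  unfolding gm_def using closed_K by (subst emeasure_uniform_measure) (auto simp: emeasure_hausdorff)
 also have "\<dots> = 1" using hd_K_pos hd_K_finite by (intro ennreal_divide_self) auto
 finally have e: "emeasure gm UNIV = 1" .
 then show "finite_measure gm" by (intro finite_measureI) simp
 show "measure gm UNIV = 1" using e by (simp add: measure_def)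
qed

lemma measure_gm_fw: "v \<in> words n ==> measure gm (fw v ` K) = (1 / 3) ^ n"
proof -
 assume v: "v \<in> words n"
 have "emeasure gm (fw v ` K) = ennreal ((1 / 3) ^ n) * (hm K / hm K)"
  using compact_fw[OF v] fw_K[OF v] by (subst emeasure_gm) (auto simp: hd_fw[OF v] ennreal_times_divide dest: compact_imp_closed)
 also have "hm K / hm K = 1" using hd_K_pos hd_K_finite by (intro ennreal_divide_self) auto
 finally show ?thesis by (simp add: measure_def)
qed

text \<open>The values \<open>a n v\<close> are free within \<open>\<delta> n\<close> of \<phi> on
  the cell, so that samples with the oscillation added and with the oscillation subtracted are both
  covered.\<close>

lemma level_average:
 fixes \<phi> :: "real^2 => real" and a :: "nat => nat list => real"
 assumes \<phi>: "continuous_on K \<phi>" and \<delta>: "\<delta> \<longlonglongrightarrow> 0"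
  and a: "\<And>n v x. v \<in> words n ==> x \<in> fw v ` K ==> \<bar>a n v - \<phi> x\<bar> <= \<delta> n"
 shows "(%n. (1 / 3) ^ n * (\<Sum>v\<in>words n. a n v)) \<longlonglongrightarrow> (LINT x:K|gm. \<phi> x)"
proof -
 interpret finite_measure gm by (rule finite_gm)
 obtain B where B: "\<And>x. x \<in> K ==> \<bar>\<phi> x\<bar> <= B"
  using compact_imp_bounded[OF compact_continuous_image[OF \<phi> gasket_props(1)]] by (auto simp: bounded_iff)
 have m: "(%x. indicator K x *\<^sub>R \<phi> x) \<in> borel_measurable gm"
  using borel_measurable_continuous_on_indicator[OF _ \<phi>] closed_K by (simp add: borel_closed)
 have B0: "0 <= B" using B gasket_props(2) by force
 have i\<phi>: "integrable gm (%x. indicator K x *\<^sub>R \<phi> x)"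
  by (rule integrable_const_bound[of _ B]) (use m B B0 in \<open>auto simp: indicator_def\<close>)
 have "\<bar>(1 / 3) ^ n * (\<Sum>v\<in>words n. a n v) - (LINT x:K|gm. \<phi> x)\<bar> <= \<delta> n" for n
 proof -
  have bv [measurable]: "fw v ` K \<in> sets borel" if "v \<in> words n" for v
   using compact_fw[OF that] by (simp add: borel_compact)
  let ?s = "%x. \<Sum>v\<in>words n. a n v * indicator (fw v ` K) x"
  have ia: "integrable gm (%x. a n v * indicator (fw v ` K) x)" if "v \<in> words n" for v
   using bv[OF that] by (intro integrable_mult_right integrable_real_indicator) (auto simp: emeasure_eq_measure)
  have ia': "integrable gm ?s" using ia by (rule Bochner_Integration.integrable_sum)
  have "(LINT x|gm. ?s x) = (\<Sum>v\<in>words n. a n v * (1 / 3) ^ n)"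
   using ia bv by (subst Bochner_Integration.integral_sum) (auto intro!: sum.cong simp: measure_gm_fw)
  then have e: "(1 / 3) ^ n * (\<Sum>v\<in>words n. a n v) - (LINT x:K|gm. \<phi> x) = (LINT x|gm. ?s x - indicator K x *\<^sub>R \<phi> x)"
   using ia' i\<phi> by (simp add: set_lebesgue_integral_def sum_distrib_left sum_distrib_right mult.commute)
  \<comment> \<open>The cells of one level are disjoint, so exactly one summand of the step function
    is active at \<open>x\<close>.\<close>
  have s: "?s x = a n v" if v: "v \<in> words n" and x: "x \<in> fw v ` K" for v x
  proof -
   have "x \<notin> fw w ` K" if w: "w \<in> words n" "w \<noteq> v" for w
   proof
    assume "x \<in> fw w ` K"
    then obtain y z where yz: "y \<in> K" "z \<in> K" "x = fw v y" "x = fw w z" using x by blast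
    then have "\<alpha> / 2 * r ^ n <= dist (fw v y) (fw w z)" using fw_sep[OF v w(1)] w(2) gasket_props(4) by blast
    moreover have "0 < \<alpha> / 2 * r ^ n" using a0 r_bounds by simp
    ultimately show False using yz by simp
   qed
   then have "?s x = (\<Sum>w\<in>words n. if w = v then a n v else 0)" using x by (intro sum.cong) (auto simp: indicator_def)
   then show ?thesis using v by (simp add: finite_words)
  qed
  define Z where "Z = K - (\<Union>v\<in>words n. fw v ` K)"
  have \<delta>0: "0 <= \<delta> n"
  proof -
   obtain v x where "v \<in> words n" "x \<in> K" using gasket_props(2) card_words[of n] by (metis card.empty ex_in_conv power_not_zero zero_neq_numeral)
   then show ?thesis using a[of v n "fw v x"] by force
  qed
  have "Z \<in> sets borel" unfolding Z_def using closed_K bv finite_words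
   by (intro sets.Diff sets.finite_UN) (auto simp: borel_closed)
  moreover have "emeasure gm Z = 0" using emeasure_gm[OF calculation] hd_rest[of n] by (simp add: Z_def)
  ultimately have ae: "AE x in gm. x \<notin> Z" by (intro AE_not_in) (auto simp: null_sets_def)
  have "AE x in gm. \<bar>?s x - indicator K x *\<^sub>R \<phi> x\<bar> <= \<delta> n"
   using ae
  proof eventually_elim
   case (elim x)
   consider v where "v \<in> words n" "x \<in> fw v ` K" | "x \<notin> K" using elim by (auto simp: Z_def)
   then show ?case
   proof cases
    case 1
    then have "x \<in> K" using fw_K by blast
    then show ?thesis unfolding s[OF 1] using a[OF 1] by simp
   next
    case 2
    then have "x \<notin> fw v ` K" if "v \<in> words n" for v using fw_K[OF that] by blast
    then have "?s x = 0" by (intro sum.neutral) (auto simp: indicator_def)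
    then show ?thesis using 2 \<delta>0 by simp
   qed
  qed
  then have "(LINT x|gm. \<bar>?s x - indicator K x *\<^sub>R \<phi> x\<bar>) <= (LINT x|gm. \<delta> n)"
   using ia' i\<phi> by (intro integral_mono_AE) auto
  then show ?thesis unfolding e by (intro order_trans[OF integral_abs_bound]) (simp add: measure_gm_UNIV)
 qed
 then have "\<forall>\<^sub>F n in sequentially. norm ((1 / 3) ^ n * (\<Sum>v\<in>words n. a n v) - (LINT x:K|gm. \<phi> x)) <= \<delta> n"
  unfolding real_norm_def by (intro always_eventually allI)
 from Lim_null_comparison[OF this \<delta>] show ?thesis by (rule LIM_zero_cancel)
qed

end

section \<open>Logarithmic means\<close>

lemma cesaro:
 fixes u :: "nat => real"
 assumes u: "u \<longlonglongrightarrow> Y"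
 shows "(%M. (\<Sum>m\<le>M. u m) / real (Suc M)) \<longlonglongrightarrow> Y"
proof (rule LIMSEQ_I)
 fix e :: real assume e: "0 < e"
 obtain n0 where n0: "\<And>n. n0 <= n ==> \<bar>u n - Y\<bar> < e / 2"
  using LIMSEQ_D[OF u, of "e / 2"] e by auto
 define C where "C = (\<Sum>m<n0. \<bar>u m - Y\<bar>)"
 obtain n1 where n1: "2 * C / e < real n1" using reals_Archimedean2 by blast
 show "\<exists>no. \<forall>n\<ge>no. norm ((\<Sum>m\<le>n. u m) / real (Suc n) - Y) < e"
 proof (intro exI allI impI)
  fix n assume n: "max n0 n1 <= n"
  have "(\<Sum>m\<le>n. u m) / real (Suc n) - Y = (\<Sum>m\<le>n. u m - Y) / real (Suc n)"
   by (simp add: sum_subtractf diff_divide_distrib)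
  then have "\<bar>(\<Sum>m\<le>n. u m) / real (Suc n) - Y\<bar> <= (\<Sum>m\<le>n. \<bar>u m - Y\<bar>) / real (Suc n)"
   by (simp add: abs_divide divide_right_mono)
  also have "(\<Sum>m\<le>n. \<bar>u m - Y\<bar>) = C + (\<Sum>m=n0..n. \<bar>u m - Y\<bar>)"
   unfolding C_def using n by (subst sum.union_disjoint[symmetric]) (auto intro!: sum.cong)
  also have "(\<Sum>m=n0..n. \<bar>u m - Y\<bar>) <= (\<Sum>m=n0..n. e / 2)" using n0 by (intro sum_mono) (auto intro: less_imp_le)
  also have "\<dots> <= real (Suc n) * (e / 2)" using e by (auto intro!: mult_right_mono)
  also have "(C + real (Suc n) * (e / 2)) / real (Suc n) = C / real (Suc n) + e / 2" by (simp add: field_simps)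
  also have "C / real (Suc n) < e / 2"
  proof -
   have "2 * C < e * real n1" using n1 e by (simp add: field_simps)
   also have "\<dots> <= e * real (Suc n)" using n e by (intro mult_left_mono) auto
   finally show ?thesis by (simp add: field_simps)
  qed
  finally show "norm ((\<Sum>m\<le>n. u m) / real (Suc n) - Y) < e" by (simp add: divide_right_mono)
 qed
qed

text \<open>For \<open>1 <= p <= Suc n\<close>, the largest \<open>m\<close> with
  \<open>p * 3 ^ m <= Suc n\<close>: the level down to which \<open>Suc n\<close> vectors suffice
  when \<open>p * 3 ^ m\<close> of them are spent.\<close>

definition lev :: "nat => nat => nat"
 where "lev p n = nat \<lfloor>log 3 (real (Suc n) / real p)\<rfloor>"

lemma lev_bounds:
 assumes "1 <= p" "p <= Suc n"
 shows "p * 3 ^ lev p n <= Suc n" "real (Suc n) < real p * 3 ^ Suc (lev p n)"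
proof -
 define x where "x = real (Suc n) / real p"
 have x: "1 <= x" using assms by (simp add: x_def field_simps)
 then have "0 <= log 3 x" by simp
 then have l: "real (lev p n) <= log 3 x" "log 3 x < real (lev p n) + 1"
  unfolding lev_def x_def[symmetric] by linarith+
 have "3 ^ lev p n <= x" using l(1) x by (simp add: le_log_iff powr_realpow)
 then have "real p * 3 ^ lev p n <= real (Suc n)" using assms by (simp add: x_def field_simps)
 then have "real (p * 3 ^ lev p n) <= real (Suc n)" by simp
 then show "p * 3 ^ lev p n <= Suc n" by (simp only: of_nat_le_iff)
 have "log 3 x < real (Suc (lev p n))" using l(2) by simp
 then have "x < 3 ^ Suc (lev p n)" using x by (simp add: log_less_iff powr_realpow del: of_nat_Suc power_Suc)
 then show "real (Suc n) < real p * 3 ^ Suc (lev p n)" using assms by (simp add: x_def field_simps)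
qed

lemma lev_asymp:
 assumes p: "1 <= p"
 shows "(%n. real (Suc (lev p n)) / ln (1 + real (Suc n))) \<longlonglongrightarrow> 1 / ln 3"
proof -
 define C where "C = ln (real p) + ln 3 + ln 2"
 have C: "\<bar>ln 3 * real (Suc (lev p n)) - ln (1 + real (Suc n))\<bar> <= C" if n: "p <= Suc n" for n
 proof -
  note b = lev_bounds[OF p n]
  have p0: "0 < real p" "0 <= ln (real p)" using p by auto
  have "ln (real p * 3 ^ lev p n) <= ln (real (Suc n))"
  proof (subst ln_le_cancel_iff)
   show "real p * 3 ^ lev p n <= real (Suc n)" using of_nat_mono[OF b(1), where 'a = real] by simp
  qed (use p0 in auto)
  then have 1: "ln (real p) + ln 3 * real (lev p n) <= ln (real (Suc n))" using p0 by (simp add: ln_mult ln_realpow mult.commute)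
  have "ln (real (Suc n)) < ln (real p * 3 ^ Suc (lev p n))" using b(2) p0 by (subst ln_less_cancel_iff) auto
  then have 2: "ln (real (Suc n)) < ln (real p) + ln 3 * real (Suc (lev p n))" using p0 by (simp add: ln_mult ln_realpow del: power_Suc) (simp add: algebra_simps)
  have "ln (1 + real (Suc n)) <= ln (2 * real (Suc n))" by (subst ln_le_cancel_iff) auto
  then have 3: "ln (1 + real (Suc n)) <= ln 2 + ln (real (Suc n))" by (simp add: ln_mult del: of_nat_Suc)
  have 4: "ln (real (Suc n)) <= ln (1 + real (Suc n))" by (subst ln_le_cancel_iff) auto
  have 5: "ln 3 * real (Suc (lev p n)) = ln 3 * real (lev p n) + ln (3::real)" by (simp add: algebra_simps)
  have "0 < ln (3::real)" "0 < ln (2::real)" by auto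
  then show ?thesis using 1 2 3 4 5 p0 unfolding C_def abs_le_iff by linarith
 qed
 have fl: "filterlim (%n. ln (1 + real (Suc n))) at_top sequentially"
  using ln_at_top_shift by (simp add: add_ac)
 have "(%n. C / ln (1 + real (Suc n))) \<longlonglongrightarrow> 0" by (rule tendsto_divide_0[OF tendsto_const filterlim_at_top_imp_at_infinity[OF fl]])
 moreover have "\<forall>\<^sub>F n in sequentially. norm (ln 3 * real (Suc (lev p n)) / ln (1 + real (Suc n)) - 1) <= C / ln (1 + real (Suc n))"
  using eventually_ge_at_top[of p]
 proof eventually_elim
  case (elim n)
  have l: "0 < ln (1 + real (Suc n))" by simp
  have "norm (ln 3 * real (Suc (lev p n)) / ln (1 + real (Suc n)) - 1)
   = \<bar>ln 3 * real (Suc (lev p n)) - ln (1 + real (Suc n))\<bar> / ln (1 + real (Suc n))"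
   using l by (simp add: abs_divide diff_divide_distrib[symmetric] field_simps del: of_nat_Suc)
  also have "\<dots> <= C / ln (1 + real (Suc n))" using C[of n] elim l by (intro divide_right_mono) auto
  finally show ?case .
 qed
 ultimately have "(%n. ln 3 * real (Suc (lev p n)) / ln (1 + real (Suc n)) - 1) \<longlonglongrightarrow> 0" by (rule Lim_null_comparison[rotated])
 then have "(%n. ln 3 * real (Suc (lev p n)) / ln (1 + real (Suc n))) \<longlonglongrightarrow> 1" by (rule LIM_zero_cancel)
 then have "(%n. ln 3 * real (Suc (lev p n)) / ln (1 + real (Suc n)) * (1 / ln 3)) \<longlonglongrightarrow> 1 * (1 / ln 3)" by (intro tendsto_mult tendsto_const)
 moreover have "ln 3 * real (Suc (lev p n)) / ln (1 + real (Suc n)) * (1 / ln 3) = real (Suc (lev p n)) / ln (1 + real (Suc n))" for n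
  by (simp del: of_nat_Suc)
 ultimately show ?thesis by simp
qed

lemma lev_at_top:
 assumes p: "1 <= p"
 shows "filterlim (lev p) at_top sequentially"
proof -
 have fl: "filterlim (%n. ln (1 + real (Suc n))) at_top sequentially"
  using ln_at_top_shift by (simp add: add_ac)
 have "filterlim (%n. real (Suc (lev p n)) / ln (1 + real (Suc n)) * ln (1 + real (Suc n))) at_top sequentially"
  by (rule filterlim_tendsto_pos_mult_at_top[OF lev_asymp[OF p] _ fl]) simp
 moreover have "real (Suc (lev p n)) / ln (1 + real (Suc n)) * ln (1 + real (Suc n)) = real (Suc (lev p n))" for n
 proof -
  have "ln (1 + real (Suc n)) \<noteq> 0" by (simp add: ln_eq_zero_iff)
  then show ?thesis by (simp del: of_nat_Suc)
 qed
 ultimately have "filterlim (%n. real (Suc (lev p n))) at_top sequentially" by simp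
 then have f: "filterlim (%n. - 1 + real (Suc (lev p n))) at_top sequentially"
  by (intro filterlim_tendsto_add_at_top[OF tendsto_const])
 then show ?thesis by (simp add: filterlim_sequentially_iff_filterlim_real)
qed

lemma log_sum_limit:
 assumes u: "u \<longlonglongrightarrow> Y" and p: "1 <= p"
 shows "(%n. (\<Sum>m\<le>lev p n. u m) / ln (1 + real (Suc n))) \<longlonglongrightarrow> Y / ln 3"
proof -
 have "(%n. (\<Sum>m\<le>lev p n. u m) / real (Suc (lev p n))) \<longlonglongrightarrow> Y"
  using filterlim_compose[OF cesaro[OF u] lev_at_top[OF p]] .
 from tendsto_mult[OF this lev_asymp[OF p]] show ?thesis by (simp del: of_nat_Suc)
qed

text \<open>The limit argument, separated from the operators. Taking \<open>M\<close> as the level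
  reached by \<open>N\<close> vectors, the sums of \<open>U\<close> and \<open>V\<close> have about
  \<open>ln N / ln 3\<close> terms. A constant factor in the count of vectors shifts this level by a
  bounded amount only and disappears in the limit.\<close>

lemma kf_limit:
 fixes kf :: "nat => real" and \<kappa> :: "int => real"
 assumes U: "U \<longlonglongrightarrow> Y" and V: "V \<longlonglongrightarrow> Y" and Y: "0 <= Y"
  and up: "\<And>M N. kf N <= Z * (\<Sum>m\<le>M. U m) + (1 / 3) ^ Suc M * real N * C"
  and low: "\<And>M N A. finite A ==> 9 * card A * 3 ^ M <= N ==> sum \<kappa> A * (\<Sum>m\<le>M. V m) <= kf N"
  and Z: "\<And>e. 0 < e ==> \<exists>A. finite A \<and> A \<noteq> {} \<and> Z - e < sum \<kappa> A" and C: "0 <= C"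
 shows "(%n. kf (Suc n) / ln (1 + real (Suc n))) \<longlonglongrightarrow> Z * Y / ln 3"
proof (rule order_tendstoI)
 let ?f = "%n. kf (Suc n) / ln (1 + real (Suc n))"
 have lp: "0 < ln (1 + real (Suc n))" for n by simp
 have fl: "filterlim (%n. ln (1 + real (Suc n))) at_top sequentially"
  using ln_at_top_shift by (simp add: add_ac)
 fix y
 {
  assume y: "y < Z * Y / ln 3"
  define q where "q = Y / ln 3"
  have l3: "0 <= q" using Y by (simp add: q_def)
  define D where "D = Z * q - y"
  have D: "0 < D" using y by (simp add: D_def q_def)
  \<comment> \<open>Costs at most half of the gap \<open>D\<close>; the summand 1 allows for
    \<open>q = 0\<close>.\<close>
  define e where "e = D / (2 * (q + 1))"
  have e: "0 < e" using D l3 unfolding e_def by (intro divide_pos_pos) auto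
  obtain A where A: "finite A" "A \<noteq> {}" "Z - e < sum \<kappa> A" using Z[OF e] by blast
  have "e * q <= e * (q + 1)" using e by (intro mult_left_mono) auto
  also have "\<dots> = D / 2" unfolding e_def using l3 by (simp add: field_simps)
  finally have "y < (Z - e) * q" using D unfolding D_def by (simp add: left_diff_distrib)
  also have "\<dots> <= sum \<kappa> A * q" using A l3 by (intro mult_right_mono) auto
  finally have yA: "y < sum \<kappa> A * (Y / ln 3)" by (simp add: q_def)
  \<comment> \<open>The factor in the hypothesis \<open>low\<close>: with this \<open>p\<close>,
    level \<open>lev p n\<close> is admissible for \<open>Suc n\<close> vectors.\<close>
  define p where "p = 9 * card A"
  have "0 < card A" using A by (simp add: card_gt_0_iff)
  then have p: "1 <= p" unfolding p_def by linarith
  have "(%n. sum \<kappa> A * ((\<Sum>m\<le>lev p n. V m) / ln (1 + real (Suc n)))) \<longlonglongrightarrow> sum \<kappa> A * (Y / ln 3)"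
   by (intro tendsto_intros log_sum_limit V p)
  from order_tendstoD(1)[OF this yA] eventually_ge_at_top[of p]
  show "\<forall>\<^sub>F n in sequentially. y < ?f n"
  proof eventually_elim
   case (elim n)
   have "9 * card A * 3 ^ lev p n <= Suc n" using lev_bounds(1)[OF p, of n] elim(2) by (simp add: p_def)
   from low[OF A(1) this] have "sum \<kappa> A * (\<Sum>m\<le>lev p n. V m) / ln (1 + real (Suc n)) <= ?f n"
    using lp[of n] by (intro divide_right_mono) auto
   then show ?case using elim(1) by (simp del: of_nat_Suc)
  qed
 }
 assume y: "Z * Y / ln 3 < y"
 have "(%n. C / ln (1 + real (Suc n))) \<longlonglongrightarrow> 0" by (rule tendsto_divide_0[OF tendsto_const filterlim_at_top_imp_at_infinity[OF fl]])
 then have "(%n. Z * ((\<Sum>m\<le>lev 1 n. U m) / ln (1 + real (Suc n))) + C / ln (1 + real (Suc n))) \<longlonglongrightarrow> Z * (Y / ln 3) + 0"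
  by (intro tendsto_intros log_sum_limit U) auto
 then have "\<forall>\<^sub>F n in sequentially. Z * ((\<Sum>m\<le>lev 1 n. U m) / ln (1 + real (Suc n))) + C / ln (1 + real (Suc n)) < y"
  by (rule order_tendstoD) (use y in simp)
 then show "\<forall>\<^sub>F n in sequentially. ?f n < y"
 proof eventually_elim
  case (elim n)
  \<comment> \<open>At this level the remainder in \<open>up\<close> is at most \<open>C\<close>,
    and it vanishes after division by the logarithm.\<close>
  have "real (Suc n) < real 1 * 3 ^ Suc (lev 1 n)" by (rule lev_bounds) auto
  then have "(1 / 3) ^ Suc (lev 1 n) * real (Suc n) <= 1" by (simp add: power_one_over field_simps)
  then have "(1 / 3) ^ Suc (lev 1 n) * real (Suc n) * C <= 1 * C" by (rule mult_right_mono[OF _ C])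
  then have "kf (Suc n) <= Z * (\<Sum>m\<le>lev 1 n. U m) + C" using up[of "Suc n" "lev 1 n"] by linarith
  then have "?f n <= (Z * (\<Sum>m\<le>lev 1 n. U m) + C) / ln (1 + real (Suc n))" using lp[of n] by (intro divide_right_mono) auto
  then show ?case using elim by (simp add: add_divide_distrib del: of_nat_Suc)
 qed
qed

section \<open>Sums over the odd integers\<close>

definition odd_wt :: "real => int => real"
 where "odd_wt p k = (2 / (pi * \<bar>of_int (2 * k + 1)\<bar>)) powr p"

text \<open>The total of \<open>odd_wt p\<close> over the integers: every odd positive number occurs
  twice as \<open>\<bar>2 * k + 1\<bar>\<close>, and the odd terms form the part
  \<open>1 - 2 powr - p\<close> of the zeta series.\<close>

definition odd_sum :: "real => real"
 where "odd_sum p = 2 * (2 / pi) powr p * ((1 - 2 powr - p) * zeta_real p)"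

lemma odd_series:
 assumes p: "1 < p"
 shows "(%n. odd_wt p (int n)) sums (odd_sum p / 2)"
proof -
 define f where "f n = 1 / real (Suc n) powr p" for n
 have "summable (%n. real n powr - p)" using p by (subst summable_real_powr_iff) simp
 then have "summable (%n. real (Suc n) powr - p)" by (subst summable_Suc_iff)
 then have fs: "f sums zeta_real p" unfolding zeta_real_def f_def by (simp add: powr_minus_divide summable_sums)
 \<comment> \<open>The zeta series is grouped in pairs. The second member of a pair has an even base
   and equals \<open>2 powr - p\<close> times a term of the whole series, so subtraction leaves the
   odd terms.\<close>
 have "(%n. sum f {n * 2..<n * 2 + 2}) sums zeta_real p" by (rule sums_group[OF fs]) simp
 moreover have "sum f {n * 2..<n * 2 + 2} = f (2 * n) + f (Suc (2 * n))" for n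
  by (simp add: numeral_2_eq_2 mult.commute)
 ultimately have "(%n. f (2 * n) + f (Suc (2 * n))) sums zeta_real p" by simp
 moreover have "(%n. 2 powr - p * f n) sums (2 powr - p * zeta_real p)" by (rule sums_mult[OF fs])
 moreover have "2 powr - p * f n = f (Suc (2 * n))" for n
 proof -
  have "real (Suc (Suc (2 * n))) = 2 * real (Suc n)" by simp
  then show ?thesis unfolding f_def by (simp only: powr_mult powr_minus_divide) simp
 qed
 ultimately have "(%n. f (2 * n) + f (Suc (2 * n)) - f (Suc (2 * n))) sums (zeta_real p - 2 powr - p * zeta_real p)"
  by (intro sums_diff) auto
 then have "(%n. (2 / pi) powr p * f (2 * n)) sums ((2 / pi) powr p * (zeta_real p - 2 powr - p * zeta_real p))"
  by (intro sums_mult) simp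
 moreover have "(2 / pi) powr p * f (2 * n) = odd_wt p (int n)" for n
 proof -
  have "2 / (pi * \<bar>of_int (2 * int n + 1)\<bar>) = (2 / pi) / real (Suc (2 * n))" by simp
  then show ?thesis unfolding odd_wt_def f_def by (simp only: powr_divide) simp
 qed
 ultimately show ?thesis by (simp add: odd_sum_def left_diff_distrib)
qed

text \<open>Replacing \<open>k\<close> by \<open>- k - 1\<close> changes the sign of
  \<open>2 * k + 1\<close>, which pairs the frequencies of the symmetric range.\<close>

lemma odd_wt_sum: "(\<Sum>k=-int n..<int n. odd_wt p k) = 2 * (\<Sum>i<n. odd_wt p (int i))"
proof (induction n)
 case (Suc n)
 have "{- int (Suc n)..<int (Suc n)} = insert (- int n - 1) (insert (int n) {- int n..<int n})" by auto
 moreover have "odd_wt p (- int n - 1) = odd_wt p (int n)"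
 proof -
  have "\<bar>real_of_int (2 * (- int n - 1) + 1)\<bar> = \<bar>real_of_int (2 * int n + 1)\<bar>" by simp
  then show ?thesis unfolding odd_wt_def by simp
 qed
 ultimately show ?case using Suc by simp
qed simp

lemma odd_wt_nonneg: "0 <= odd_wt p k" by (simp add: odd_wt_def)

lemma odd_wt_finite_sum:
 assumes "1 < p" "finite A"
 shows "sum (odd_wt p) A <= odd_sum p"
proof -
 define n where "n = nat (Max ((%k. \<bar>k\<bar> + 1) ` insert 0 A))"
 have "A \<subseteq> {-int n..<int n}"
 proof
  fix k assume "k \<in> A"
  then have "\<bar>k\<bar> + 1 <= Max ((%k. \<bar>k\<bar> + 1) ` insert 0 A)" using assms(2) by (intro Max_ge) auto
  then show "k \<in> {-int n..<int n}" unfolding n_def by auto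
 qed
 then have "sum (odd_wt p) A <= (\<Sum>k=-int n..<int n. odd_wt p k)" by (intro sum_mono2) (auto simp: odd_wt_nonneg)
 also have "\<dots> <= 2 * (odd_sum p / 2)" unfolding odd_wt_sum
  using sum_le_suminf[of "%i. odd_wt p (int i)" "{..<n}"] odd_series[OF assms(1)]
  by (auto simp: sums_iff odd_wt_nonneg)
 finally show ?thesis by simp
qed

lemma odd_wt_approx:
 assumes "1 < p" "0 < e"
 shows "\<exists>A. finite A \<and> A \<noteq> {} \<and> odd_sum p - e < sum (odd_wt p) A"
proof -
 have "(%n. 2 * (\<Sum>i<n. odd_wt p (int i))) \<longlonglongrightarrow> 2 * (odd_sum p / 2)"
  using odd_series[OF assms(1)] unfolding sums_def by (intro tendsto_intros)
 then have "\<forall>\<^sub>F n in sequentially. odd_sum p - e < 2 * (\<Sum>i<n. odd_wt p (int i))"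
  by (rule order_tendstoD) (use assms in simp)
 then have "\<forall>\<^sub>F n in sequentially. 0 < n \<and> odd_sum p - e < 2 * (\<Sum>i<n. odd_wt p (int i))"
  using eventually_gt_at_top[of 0] by eventually_elim auto
 then obtain n where "0 < n" "odd_sum p - e < (\<Sum>k=-int n..<int n. odd_wt p k)"
  unfolding odd_wt_sum by (auto simp: eventually_sequentially)
 then show ?thesis by (intro exI[of _ "{-int n..<int n}"]) auto
qed

section \<open>The spectral triple of the gasket\<close>

text \<open>The enumeration of the edges, carried over to labels: curve \<open>j\<close> belongs to
  the word \<open>V j\<close> and the edge type \<open>T j\<close>.\<close>

locale gasket_curves = gasket_loc \<alpha> for \<alpha> :: real +
 fixes V :: "nat => nat list" and T :: "nat => nat" and l :: "nat => real" and R :: "nat => real => real^2"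
 assumes lab: "bij_betw (%j. (V j, T j)) UNIV labels"
  and arc: "\<And>j. arclength_param (fw (V j) ` side (T j)) (l j) (R j)"
begin

lemma V_words: "V j \<in> words (length (V j))" and T_16: "T j \<in> {1..6}"
proof -
 have "(V j, T j) \<in> labels" using bij_betw_apply[OF lab] by blast
 then show "V j \<in> words (length (V j))" "T j \<in> {1..6}" by (auto simp: labels_def words_iff)
qed

lemma l_eq: "l j = len (T j) * r ^ length (V j)"
 by (rule edge_arclength(1)[OF V_words T_16 arc])

lemma R_cont: "continuous_on {0..l j} (R j)"
 by (rule edge_arclength(2)[OF V_words T_16 arc])

lemma R_cell: "t \<in> {0..l j} ==> R j t \<in> fw (V j) ` K"
 using edge_arclength(3)[OF V_words T_16 arc] edge_K[OF V_words T_16] by blast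

lemma R_K: "t \<in> {0..l j} ==> R j t \<in> K"
proof -
 assume "t \<in> {0..l j}"
 then obtain y where y: "y \<in> K" "R j t = fw (V j) y" using R_cell by blast
 show "R j t \<in> K" unfolding y(2) by (rule fw_K[OF V_words y(1)])
qed

lemma len_bounds: "0 < len \<tau>" "len \<tau> <= 1"
 using a0 a1 by (auto simp: len_def)

lemma r_pow: "0 < r ^ n" "r ^ n <= 1"
 using r_bounds(2,3) by (auto intro: power_le_one)

sublocale curves_dim l R K dm
proof
 show "0 < l j" for j unfolding l_eq using len_bounds r_pow by simp
 show "l j <= 1" for j unfolding l_eq using len_bounds[of "T j"] r_pow[of "length (V j)"] by (intro mult_le_one) auto
qed (rule dm_gt_1)

lemma l_powr: "l j powr p = len (T j) powr p * (r powr p) ^ length (V j)"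
proof -
 have "(r ^ n) powr p = (r powr p) ^ n" for n
  using r_bounds by (simp add: powr_realpow[symmetric] powr_powr mult.commute)
 then show ?thesis unfolding l_eq using len_bounds r_pow by (simp add: powr_mult)
qed

definition Jl :: "nat => nat set"
 where "Jl m = {j. length (V j) = m}"

lemma Jl_bij: "bij_betw (%j. (V j, T j)) (Jl m) (words m \<times> {1..6})"
proof (rule bij_betw_imageI)
 show "inj_on (%j. (V j, T j)) (Jl m)" using bij_betw_imp_inj_on[OF lab] by (rule inj_on_subset) simp
 show "(%j. (V j, T j)) ` Jl m = words m \<times> {1..6}"
 proof (intro subset_antisym subsetI)
  fix x assume "x \<in> words m \<times> {1..6 :: nat}"
  then obtain v \<tau> where x: "x = (v, \<tau>)" "v \<in> words m" "\<tau> \<in> {1..6}" by auto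
  then have "(v, \<tau>) \<in> labels" by (auto simp: labels_def)
  then have "(v, \<tau>) \<in> range (%j. (V j, T j))" using bij_betw_imp_surj_on[OF lab] by simp
  then obtain j where "(v, \<tau>) = (V j, T j)" by (rule rangeE)
  then show "x \<in> (%j. (V j, T j)) ` Jl m" using x by (intro image_eqI[of _ _ j]) (auto simp: Jl_def words_iff)
 next
  fix x assume "x \<in> (%j. (V j, T j)) ` Jl m"
  then obtain j where "length (V j) = m" "x = (V j, T j)" by (auto simp: Jl_def)
  then show "x \<in> words m \<times> {1..6}" using V_words[of j] T_16[of j] by auto
 qed
qed

lemma finite_Jl: "finite (Jl m)"
 using bij_betw_finite[OF Jl_bij] finite_words by auto

lemma card_Jl: "card (Jl m) = 6 * 3 ^ m"
 using bij_betw_same_card[OF Jl_bij, of m] by (simp add: card_cartesian_product card_words)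

lemma sum_Jl: "(\<Sum>j\<in>Jl m. F (V j) (T j)) = (\<Sum>v\<in>words m. \<Sum>\<tau>\<in>{1..6}. F v \<tau>)"
proof -
 have "(\<Sum>j\<in>Jl m. F (V j) (T j)) = (\<Sum>x\<in>words m \<times> {1..6}. F (fst x) (snd x))"
  using sum.reindex_bij_betw[OF Jl_bij, of "%x. F (fst x) (snd x)" m] by simp
 then show ?thesis by (simp add: sum.cartesian_product case_prod_beta)
qed

lemma sum_len: "(\<Sum>\<tau>\<in>{1..6}. len \<tau> powr p) = 3 + 3 * \<alpha> powr p"
proof -
 have "{1..6::nat} = {1, 2, 3, 4, 5, 6}" by auto
 then show ?thesis by (simp add: len_def)
qed

lemma sum_level: "(\<Sum>j\<in>Jl m. l j powr p * F (V j)) = (3 + 3 * \<alpha> powr p) * ((r powr p) ^ m * (\<Sum>v\<in>words m. F v))"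
proof -
 have "(\<Sum>j\<in>Jl m. l j powr p * F (V j)) = (\<Sum>j\<in>Jl m. len (T j) powr p * ((r powr p) ^ m * F (V j)))"
  by (intro sum.cong) (auto simp: l_powr Jl_def)
 also have "\<dots> = (\<Sum>v\<in>words m. \<Sum>\<tau>\<in>{1..6}. len \<tau> powr p * ((r powr p) ^ m * F v))" by (rule sum_Jl)
 also have "\<dots> = (\<Sum>v\<in>words m. (3 + 3 * \<alpha> powr p) * ((r powr p) ^ m * F v))"
  unfolding sum_len[symmetric] sum_distrib_right ..
 finally show ?thesis by (simp add: sum_distrib_left)
qed

definition Ju :: "nat => nat set"
 where "Ju M = {j. length (V j) <= M}"

lemma Ju_eq: "Ju M = (\<Union>m\<in>{..M}. Jl m)"
 by (auto simp: Ju_def Jl_def)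

lemma sum_Ju: "sum F (Ju M) = (\<Sum>m\<le>M. sum F (Jl m))"
 unfolding Ju_eq by (rule sum.UNION_disjoint) (auto simp: finite_Jl, auto simp: Jl_def)

lemma finite_Ju: "finite (Ju M)"
 unfolding Ju_eq by (simp add: finite_Jl)

text \<open>The exact number is \<open>6 * (1 + 3 + ... + 3 ^ M) = 3 * (3 ^ (M + 1) - 1)\<close>; 9
  is the factor expected by \<open>kf_limit\<close>.\<close>

lemma card_Ju: "card (Ju M) <= 9 * 3 ^ M"
proof -
 have "card (Ju M) <= (\<Sum>m\<le>M. card (Jl m))" unfolding Ju_eq by (rule card_UN_le) simp
 also have "\<dots> <= 9 * 3 ^ M" by (induction M) (simp_all add: card_Jl)
 finally show ?thesis .
qed

lemma off_Ju: "j \<notin> Ju M ==> l j powr dm <= (1 / 3) ^ Suc M"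
proof -
 assume "j \<notin> Ju M"
 then have "Suc M <= length (V j)" by (simp add: Ju_def)
 then have "(1 / 3 :: real) ^ length (V j) <= (1 / 3) ^ Suc M" by (intro power_decreasing) auto
 moreover have "len (T j) powr dm <= 1" using len_bounds[of "T j"] dm_gt_1 by (intro powr_le1) auto
 ultimately have "len (T j) powr dm * (1 / 3) ^ length (V j) <= 1 * (1 / 3) ^ Suc M" by (intro mult_mono) auto
 then show ?thesis by (simp add: l_powr r_powr)
qed

lemma \<kappa>_eq: "\<kappa> k = odd_wt dm k"
 by (simp add: \<kappa>_def odd_wt_def)

lemma okf_cont:
 assumes f: "continuous_on K f" and B: "\<And>x. x \<in> K ==> cmod (f x) <= B"
 shows "okf f B"
 unfolding okf_def
proof (intro allI conjI ballI)
 fix j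
 show "continuous_on {- l j..l j} (%x. f (R j \<bar>x\<bar>))"
 proof (rule continuous_on_compose2[OF f])
  show "continuous_on {- l j..l j} (%x. R j \<bar>x\<bar>)"
   by (rule continuous_on_compose2[OF R_cont]) (auto intro!: continuous_intros)
  show "(%x. R j \<bar>x\<bar>) ` {- l j..l j} \<subseteq> K" using R_K[of _ j] by auto
 qed
 show "cmod (f (R j t)) <= B" if "t \<in> {0..l j}" for t using B R_K[OF that] by simp
qed

lemma cont_bound:
 assumes f: "continuous_on K f"
 obtains B :: real where "0 <= B" "\<And>x. x \<in> K ==> cmod (f x) <= B"
proof -
 obtain B where B: "\<And>x. x \<in> K ==> cmod (f x) <= B"
  using compact_imp_bounded[OF compact_continuous_image[OF f gasket_props(1)]] by (auto simp: bounded_iff)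
 moreover have "0 <= B" using B gasket_props(2) norm_ge_zero order_trans by blast
 ultimately show thesis by (rule that[rotated])
qed

text \<open>Both factors of a weight are at most 1, so a weight above \<open>\<tau>\<close> forces
  both above \<open>\<tau>\<close>. The power of the length then bounds the level of the edge, and
  summability of the odd weights leaves finitely many frequencies.\<close>

lemma compact_G: "compact_op H G"
proof (rule diag_compact[OF ewt_bound(2)])
 fix \<tau> :: real assume \<tau>: "0 < \<tau>"
 have "(%n. (1 / 3 :: real) ^ n) \<longlonglongrightarrow> 0" by (rule LIMSEQ_realpow_zero) auto
 then have "\<forall>\<^sub>F n in sequentially. (1 / 3 :: real) ^ n < \<tau>" using \<tau> by (rule order_tendstoD)
 then obtain M where M: "(1 / 3 :: real) ^ Suc M < \<tau>" unfolding eventually_sequentially by (meson le_Suc_eq order_refl)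
 define A where "A = {k. \<tau> < \<kappa> k}"
 have fA: "finite A"
 proof (rule ccontr)
  assume "infinite A"
  obtain n where n: "odd_sum dm / \<tau> < real n" using reals_Archimedean2 by blast
  obtain C where C: "C \<subseteq> A" "finite C" "card C = n" using infinite_arbitrarily_large[OF \<open>infinite A\<close>] by blast
  have "real n * \<tau> <= sum \<kappa> C" unfolding C(3)[symmetric] using C(1) by (intro sum_bounded_below) (auto simp: A_def)
  also have "\<dots> <= odd_sum dm" unfolding \<kappa>_eq by (rule odd_wt_finite_sum[OF dm_gt_1 C(2)])
  finally show False using n \<tau> by (simp add: field_simps)
 qed
 have "{v \<in> E. \<tau> < \<bar>ewt v\<bar>} \<subseteq> e ` (Ju M \<times> A)"
 proof clarify
  fix j k assume a: "\<tau> < \<bar>ewt (e (j, k))\<bar>"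
  have lk: "0 <= l j powr dm" "l j powr dm <= 1" "0 <= \<kappa> k" "\<kappa> k <= 1"
   using l_pos[of j] l_le[of j] dm_gt_1 \<kappa>_nonneg \<kappa>_le_1 by (auto intro: powr_le1)
  then have t: "\<tau> < l j powr dm * \<kappa> k" using a by (simp add: ewt_e abs_mult)
  have "l j powr dm * \<kappa> k <= l j powr dm * 1" "l j powr dm * \<kappa> k <= 1 * \<kappa> k"
   using lk by (intro mult_left_mono mult_right_mono; simp)+
  then have "(1 / 3) ^ Suc M < l j powr dm" "k \<in> A" using t M by (auto simp: A_def)
  moreover then have "j \<in> Ju M" using off_Ju[of j M] by (meson not_less)
  ultimately show "e (j, k) \<in> e ` (Ju M \<times> A)" by blast
 qed
 then show "finite {v \<in> E. \<tau> < \<bar>ewt v\<bar>}" using fA finite_Ju by (meson finite_SigmaI finite_imageI finite_subset)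
qed auto

definition osc :: "(real^2 => complex) => nat => real"
 where "osc f m = (SUP (v, x, y)\<in>words m \<times> K \<times> K. cmod (f (fw v x) - f (fw v y)))"

text \<open>Uniform continuity of \<open>f\<close> on the compact gasket, as a cell of level
  \<open>m\<close> has diameter at most \<open>r ^ m\<close> times that of the gasket.\<close>

lemma osc:
 assumes f: "continuous_on K f"
 shows "v \<in> words m ==> x \<in> K ==> y \<in> K ==> cmod (f (fw v x) - f (fw v y)) <= osc f m"
  and "osc f \<longlonglongrightarrow> 0" and "0 <= osc f m"
proof -
 obtain B where B: "0 <= B" "\<And>x. x \<in> K ==> cmod (f x) <= B" by (rule cont_bound[OF f]) blast
 let ?F = "%(v, x, y). cmod (f (fw v x) - f (fw v y))"
 have bd: "bdd_above (?F ` (words m \<times> K \<times> K))" for m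
 proof (rule bdd_aboveI[of _ "B + B"], clarify)
  fix v x y assume "v \<in> words m" "x \<in> K" "y \<in> K"
  then show "cmod (f (fw v x) - f (fw v y)) <= B + B"
   using norm_triangle_ineq4[of "f (fw v x)" "f (fw v y)"] B(2)[of "fw v x"] B(2)[of "fw v y"] fw_K[of v m] by fastforce
 qed
 have up: "cmod (f (fw v x) - f (fw v y)) <= osc f m" if "v \<in> words m" "x \<in> K" "y \<in> K" for v x y m
  unfolding osc_def using cSUP_upper[OF _ bd, of "(v, x, y)" m] that by simp
 then show "v \<in> words m ==> x \<in> K ==> y \<in> K ==> cmod (f (fw v x) - f (fw v y)) <= osc f m" by blast
 obtain x0 where x0: "x0 \<in> K" using gasket_props(2) by blast
 have ne: "replicate m 1 \<in> words m" for m by (auto simp: words_iff)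
 have nn: "0 <= osc f m" for m using up[OF ne x0 x0, of m] by simp
 then show "0 <= osc f m" .
 show "osc f \<longlonglongrightarrow> 0"
 proof (rule LIMSEQ_I)
  fix \<eta> :: real assume \<eta>: "0 < \<eta>"
  obtain \<delta> where \<delta>: "0 < \<delta>" "\<And>x y. x \<in> K ==> y \<in> K ==> dist x y < \<delta> ==> dist (f x) (f y) < \<eta> / 2"
   using compact_uniformly_continuous[OF f gasket_props(1)] \<eta> unfolding uniformly_continuous_on_def
   by (meson half_gt_zero dist_commute)
  define D where "D = diameter K"
  have "(%n. r ^ n * D) \<longlonglongrightarrow> 0 * D" using r_bounds by (intro tendsto_intros LIMSEQ_realpow_zero) auto
  then have "\<forall>\<^sub>F n in sequentially. r ^ n * D < \<delta>" using \<delta> by (intro order_tendstoD) auto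
  then obtain n0 where n0: "\<And>n. n0 <= n ==> r ^ n * D < \<delta>" unfolding eventually_sequentially by blast
  have "osc f n <= \<eta> / 2" if n: "n0 <= n" for n
   unfolding osc_def
  proof (rule cSUP_least)
   show "words n \<times> K \<times> K \<noteq> {}" using ne x0 by blast
   fix z assume "z \<in> words n \<times> K \<times> K"
   then obtain v x y where z: "z = (v, x, y)" "v \<in> words n" "x \<in> K" "y \<in> K" by auto
   have "dist (fw v x) (fw v y) <= r ^ n * D"
    unfolding dist_fw[OF z(2)] D_def
    using diameter_bounded_bound[OF compact_imp_bounded[OF gasket_props(1)] z(3,4)] r_pow[of n] by (intro mult_left_mono) auto
   then have "dist (f (fw v x)) (f (fw v y)) < \<eta> / 2" using n0[OF n] \<delta>(2)[OF fw_K[OF z(2,3)] fw_K[OF z(2,4)]] by simp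
   then show "?F z <= \<eta> / 2" using z(1) by (simp add: dist_norm)
  qed
  then have "norm (osc f n - 0) < \<eta>" if "n0 <= n" for n using that nn[of n] \<eta> by fastforce
  then show "\<exists>no. \<forall>n\<ge>no. norm (osc f n - 0) < \<eta>" by blast
 qed
qed

text \<open>On every edge \<open>f\<close> is compared with its value at one point of the
  surrounding cell. The upper and the lower estimate lead to level sums \<open>U\<close> and
  \<open>W\<close> with the same limit, so a genuine limit of the logarithmic means results.\<close>

lemma kf_lim:
 assumes f: "continuous_on K f"
 shows "kf_means H (qform H (Af f)) \<longlonglongrightarrow>
  odd_sum dm * ((3 + 3 * \<alpha> powr dm) * (LINT x:K|gm. (cmod (f x))\<^sup>2)) / ln 3"
proof -
 obtain B where B: "0 <= B" "\<And>x. x \<in> K ==> cmod (f x) <= B" by (rule cont_bound[OF f]) blast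
 have ok: "okf f B" by (rule okf_cont[OF f B(2)])
 obtain x0 where x0: "x0 \<in> K" using gasket_props(2) by blast
 define c where "c v = cmod (f (fw v x0))" for v
 define \<omega> where "\<omega> = osc f"
 have \<omega>: "\<omega> \<longlonglongrightarrow> 0" "0 <= \<omega> m" for m using osc(2,3)[OF f] by (simp_all add: \<omega>_def)
 have oscR: "cmod (f (R j t) - f (fw (V j) x0)) <= \<omega> (length (V j))" if t: "t \<in> {0..l j}" for j t
 proof -
  obtain y where y: "y \<in> K" "R j t = fw (V j) y" using R_cell[OF t] by blast
  show ?thesis unfolding y(2) \<omega>_def by (rule osc(1)[OF f V_words y(1) x0])
 qed
 have cell: "\<bar>cmod (f x) - c v\<bar> <= \<omega> m" "cmod (f x) <= B" "c v <= B" if v: "v \<in> words m" and x: "x \<in> fw v ` K" for v m x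
 proof -
  obtain y where y: "y \<in> K" "x = fw v y" using x by blast
  show "cmod (f x) <= B" "c v <= B" unfolding c_def y(2) using B(2) fw_K[OF v] y(1) x0 by auto
  show "\<bar>cmod (f x) - c v\<bar> <= \<omega> m"
   using norm_triangle_ineq3[of "f x" "f (fw v x0)"] osc(1)[OF f v y(1) x0] unfolding c_def \<omega>_def y(2) by linarith
 qed
 define \<beta> where "\<beta> = 3 + 3 * \<alpha> powr dm"
 define Y where "Y = \<beta> * (LINT x:K|gm. (cmod (f x))\<^sup>2)"
 have \<beta>: "0 <= \<beta>" by (simp add: \<beta>_def)
 have Y: "0 <= Y" unfolding Y_def set_lebesgue_integral_def using \<beta> by (intro mult_nonneg_nonneg integral_nonneg_AE) auto
 have \<phi>: "continuous_on K (%x. (cmod (f x))\<^sup>2)" by (intro continuous_intros f)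
 \<comment> \<open>The error in the squares:
   \<open>\<bar>a^2 - b^2\<bar> = \<bar>a - b\<bar> * (a + b)\<close>, where the difference is at
   most \<open>2 * \<omega> n\<close> and the sum at most \<open>2 * B + \<omega> n\<close>.\<close>
 have \<delta>: "(%n. 2 * \<omega> n * (2 * B + \<omega> n)) \<longlonglongrightarrow> 2 * 0 * (2 * B + 0)" by (intro tendsto_intros \<omega>)
 define U where "U n = \<beta> * ((1 / 3) ^ n * (\<Sum>v\<in>words n. (c v + \<omega> n)\<^sup>2))" for n
 define W where "W n = \<beta> * ((1 / 3) ^ n * (\<Sum>v\<in>words n. (max 0 (c v - \<omega> n))\<^sup>2))" for n
 have sq: "\<bar>a\<^sup>2 - b\<^sup>2\<bar> <= 2 * w * (2 * B + w)" if "\<bar>a - b\<bar> <= 2 * w" "0 <= a" "0 <= b" "a + b <= 2 * B + w" for a b w :: real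
 proof -
  have "\<bar>a\<^sup>2 - b\<^sup>2\<bar> = \<bar>a - b\<bar> * (a + b)" using that by (simp add: power2_eq_square square_diff_square_factored abs_mult mult.commute)
  also have "\<dots> <= 2 * w * (2 * B + w)" using that by (intro mult_mono) auto
  finally show ?thesis .
 qed
 have U: "U \<longlonglongrightarrow> Y" unfolding U_def Y_def
 proof (intro tendsto_mult tendsto_const, rule level_average[OF \<phi>])
  show "(%n. 2 * \<omega> n * (2 * B + \<omega> n)) \<longlonglongrightarrow> 0" using \<delta> by simp
  fix n v x assume vx: "v \<in> words n" "x \<in> fw v ` K"
  show "\<bar>(c v + \<omega> n)\<^sup>2 - (cmod (f x))\<^sup>2\<bar> <= 2 * \<omega> n * (2 * B + \<omega> n)"
   using cell[OF vx] \<omega>(2)[of n] by (intro sq) (auto simp: c_def)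
 qed
 have W: "W \<longlonglongrightarrow> Y" unfolding W_def Y_def
 proof (intro tendsto_mult tendsto_const, rule level_average[OF \<phi>])
  show "(%n. 2 * \<omega> n * (2 * B + \<omega> n)) \<longlonglongrightarrow> 0" using \<delta> by simp
  fix n v x assume vx: "v \<in> words n" "x \<in> fw v ` K"
  have "0 <= c v" by (simp add: c_def)
  then show "\<bar>(max 0 (c v - \<omega> n))\<^sup>2 - (cmod (f x))\<^sup>2\<bar> <= 2 * \<omega> n * (2 * B + \<omega> n)"
   using cell[OF vx] \<omega>(2)[of n] by (intro sq) (auto simp: max_def abs_le_iff)
 qed
 have lv: "(\<Sum>j\<in>Ju M. l j powr dm * F (length (V j)) (V j)) = (\<Sum>m\<le>M. \<beta> * ((1 / 3) ^ m * (\<Sum>v\<in>words m. F m v)))" for F :: "nat => nat list => real" and M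
 proof -
  have "(\<Sum>j\<in>Jl m. l j powr dm * F (length (V j)) (V j)) = (\<Sum>j\<in>Jl m. l j powr dm * F m (V j))" for m
   by (intro sum.cong) (auto simp: Jl_def)
  then show ?thesis unfolding sum_Ju sum_level r_powr \<beta>_def by simp
 qed
 have "(%n. ky_fan H (qform H (Af f)) (Suc n) / ln (1 + real (Suc n))) \<longlonglongrightarrow> odd_sum dm * Y / ln 3"
 proof (rule kf_limit[OF U W Y])
  fix M N
  have "ky_fan H (qform H (Af f)) N <= odd_sum dm * (\<Sum>j\<in>Ju M. l j powr dm * (cmod (f (fw (V j) x0)) + \<omega> (length (V j)))\<^sup>2)
   + (1 / 3) ^ Suc M * real N * B\<^sup>2"
  proof (rule Af_ky_fan_upper[OF ok oscR])
   show "sum \<kappa> A <= odd_sum dm" if "finite A" for A unfolding \<kappa>_eq by (rule odd_wt_finite_sum[OF dm_gt_1 that])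
  qed (auto simp: finite_Ju off_Ju simp del: power_Suc)
  then show "ky_fan H (qform H (Af f)) N <= odd_sum dm * (\<Sum>m\<le>M. U m) + (1 / 3) ^ Suc M * real N * B\<^sup>2"
   unfolding c_def[symmetric] lv[of "%m v. (c v + \<omega> m)\<^sup>2"] U_def .
 next
  fix M N and A :: "int set" assume A: "finite A" "9 * card A * 3 ^ M <= N"
  have "card (Ju M) * card A <= 9 * 3 ^ M * card A" by (rule mult_right_mono[OF card_Ju]) simp
  also have "\<dots> <= N" using A(2) by (simp add: mult_ac)
  finally have "card (Ju M) * card A <= N" .
  then have "sum \<kappa> A * (\<Sum>j\<in>Ju M. l j powr dm * (max 0 (cmod (f (fw (V j) x0)) - \<omega> (length (V j))))\<^sup>2)
   <= ky_fan H (qform H (Af f)) N"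
   by (intro Af_ky_fan_lower[OF ok oscR finite_Ju A(1)]) auto
  then show "sum \<kappa> A * (\<Sum>m\<le>M. W m) <= ky_fan H (qform H (Af f)) N"
   unfolding c_def[symmetric] lv[of "%m v. (max 0 (c v - \<omega> m))\<^sup>2"] W_def .
 next
  fix \<eta> :: real assume "0 < \<eta>"
  then show "\<exists>A. finite A \<and> A \<noteq> {} \<and> odd_sum dm - \<eta> < sum \<kappa> A" using odd_wt_approx[OF dm_gt_1] unfolding \<kappa>_eq by blast
 qed simp
 then show ?thesis unfolding kf_means_def Y_def \<beta>_def .
qed

end

text \<open>Collects coefficients for the polarization in \<open>rep_G_decomp\<close>, where each of
  the four operators is a combination of the same four vectors.\<close>

lemma combination_of_four:
 fixes x y z w :: "'a::complex_vector"
 shows "(a1 *\<^sub>C x + b1 *\<^sub>C y + c1 *\<^sub>C z + d1 *\<^sub>C w) - (a2 *\<^sub>C x + b2 *\<^sub>C y + c2 *\<^sub>C z + d2 *\<^sub>C w)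
   + \<i> *\<^sub>C ((a3 *\<^sub>C x + b3 *\<^sub>C y + c3 *\<^sub>C z + d3 *\<^sub>C w) - (a4 *\<^sub>C x + b4 *\<^sub>C y + c4 *\<^sub>C z + d4 *\<^sub>C w))
  = (a1 - a2 + \<i> * (a3 - a4)) *\<^sub>C x + (b1 - b2 + \<i> * (b3 - b4)) *\<^sub>C y
   + (c1 - c2 + \<i> * (c3 - c4)) *\<^sub>C z + (d1 - d2 + \<i> * (d3 - d4)) *\<^sub>C w"
 by (simp add: scaleC_add_left scaleC_add_right scaleC_scaleC right_diff_distrib cvec.scale_left_diff_distrib
   cvec.scale_right_diff_distrib algebra_simps)

section \<open>The spectral dimension\<close>

context gasket_curves
begin

lemma abs_tev_powr: "\<bar>tev (j, k)\<bar> powr - p = l j powr p * odd_wt p k"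
proof -
 have "2 * k + 1 \<noteq> 0" by presburger
 then have "0 < \<bar>of_int (2 * k + 1) :: real\<bar>" by (simp del: of_int_add of_int_mult)
 then have "inverse \<bar>tev (j, k)\<bar> = l j * (2 / (pi * \<bar>of_int (2 * k + 1)\<bar>))"
  unfolding abs_tev by (simp add: field_simps del: of_int_add of_int_mult)
 moreover have "\<bar>tev (j, k)\<bar> powr - p = inverse \<bar>tev (j, k)\<bar> powr p" by (simp add: powr_minus inverse_powr)
 ultimately show ?thesis unfolding odd_wt_def by (simp only: powr_mult)
qed

text \<open>Since \<open>\<bar>tev (j, k)\<bar> >= 1\<close>, the numbers \<open>1 + t^2\<close> and
  \<open>t^2\<close> differ by at most the factor 2, so the trace may be compared with powers of the
  eigenvalues.\<close>

lemma dirac_wt: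
 assumes p: "0 < p"
 shows "(1 + (tev (j, k))\<^sup>2) powr (- p / 2) <= l j powr p * odd_wt p k"
  "2 powr (- p / 2) * (l j powr p * odd_wt p k) <= (1 + (tev (j, k))\<^sup>2) powr (- p / 2)"
  "(1 + (tev (j, k))\<^sup>2) powr (- p / 2) <= 1"
proof -
 have t: "1 <= \<bar>tev (j, k)\<bar>" by (rule abs_tev_ge)
 then have t2: "1 <= (tev (j, k))\<^sup>2" using power_mono[OF t, of 2] by simp
 have e: "((tev (j, k))\<^sup>2) powr (- p / 2) = l j powr p * odd_wt p k"
 proof -
  have "(tev (j, k))\<^sup>2 = \<bar>tev (j, k)\<bar> powr 2" using t by simp
  then have "((tev (j, k))\<^sup>2) powr (- p / 2) = \<bar>tev (j, k)\<bar> powr - p" by (simp only: powr_powr) simp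
  then show ?thesis by (simp add: abs_tev_powr)
 qed
 show "(1 + (tev (j, k))\<^sup>2) powr (- p / 2) <= l j powr p * odd_wt p k"
  unfolding e[symmetric] using p t2 by (intro powr_mono2') auto
 have "2 powr (- p / 2) * (l j powr p * odd_wt p k) = (2 * (tev (j, k))\<^sup>2) powr (- p / 2)" unfolding e[symmetric] by (simp add: powr_mult)
 also have "\<dots> <= (1 + (tev (j, k))\<^sup>2) powr (- p / 2)" using p t2 by (intro powr_mono2') auto
 finally show "2 powr (- p / 2) * (l j powr p * odd_wt p k) <= (1 + (tev (j, k))\<^sup>2) powr (- p / 2)" .
 have "(1 + (tev (j, k))\<^sup>2) powr (- p / 2) <= 1 powr (- p / 2)" using p by (intro powr_mono2') auto
 then show "(1 + (tev (j, k))\<^sup>2) powr (- p / 2) <= 1" by simp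
qed

lemma sum_l_Ju: "(\<Sum>j\<in>Ju M. l j powr p) = (3 + 3 * \<alpha> powr p) * (\<Sum>m\<le>M. (3 * r powr p) ^ m)"
 using sum_level[of p "%_. 1"] by (simp add: sum_Ju card_words sum_distrib_left power_mult_distrib mult.commute)

text \<open>Decided by the geometric series with ratio \<open>3 * r powr p\<close>, which converges
  exactly for \<open>p > dm\<close>. In that case \<open>p > 1\<close>, and the sum over the
  frequencies is finite too.\<close>

lemma trace_finite_iff:
 assumes p: "0 < p"
 shows "trace_op H (fun_calc H (st_dirac S) (%t. (1 + t\<^sup>2) powr (- p / 2))) < \<infinity> \<longleftrightarrow> dm < p"
proof -
 define gw where "gw v = (1 + (tev (ix v))\<^sup>2) powr (- p / 2)" for v
 have gw0: "0 <= gw v" for v by (simp add: gw_def)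
 have gw1: "gw v <= 1" for v unfolding gw_def using dirac_wt(3)[OF p] by (cases "ix v") simp
 have ab: "\<bar>gw v\<bar> <= 1" for v using gw0[of v] gw1[of v] by simp
 have fc: "fun_calc H (st_dirac S) (%t. (1 + t\<^sup>2) powr (- p / 2)) = diag_op H E gw"
  unfolding gw_def by (rule fun_calc_S[where C = 1]) (use dirac_wt(3)[OF p] in auto)
 have q: "r powr p = exp (p * ln r)" for p using r_bounds by (simp add: powr_def)
 show ?thesis unfolding fc
 proof
  assume lt: "dm < p"
  then have p1: "1 < p" using dm_gt_1 by simp
  have "p * ln r < dm * ln r" using lt ln_r by (intro mult_strict_right_mono_neg) auto
  then have "r powr p < 1 / 3" unfolding r_powr[symmetric] q by simp
  then have q1: "0 <= 3 * r powr p" "3 * r powr p < 1" by auto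
  define W where "W = (3 + 3 * \<alpha> powr p) * (1 / (1 - 3 * r powr p))"
  have W: "(\<Sum>j\<in>J. l j powr p) <= W" if J: "finite J" for J
  proof -
   have "J \<subseteq> Ju (Max (insert 0 ((%j. length (V j)) ` J)))" using J by (auto simp: Ju_def)
   then have "(\<Sum>j\<in>J. l j powr p) <= (\<Sum>j\<in>Ju (Max (insert 0 ((%j. length (V j)) ` J))). l j powr p)"
    by (intro sum_mono2 finite_Ju) auto
   also have "\<dots> <= W" unfolding sum_l_Ju W_def
   proof (rule mult_left_mono)
    fix M show "(\<Sum>m\<le>M. (3 * r powr p) ^ m) <= 1 / (1 - 3 * r powr p)"
     using sum_le_suminf[OF summable_geometric, of "3 * r powr p" "{..M}"] suminf_geometric[of "3 * r powr p"] q1 by simp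
   qed simp
   finally show ?thesis .
  qed
  show "trace_op H (diag_op H E gw) < \<infinity>"
  proof (rule trace_diag_finite[where C = 1 and S = "W * odd_sum p"])
   fix F assume F: "finite F" "F \<subseteq> E"
   define B where "B = ix ` F"
   have FB: "F = e ` B" using F(2) unfolding B_def by (force simp: image_iff)
   have fB: "finite B" using F by (simp add: B_def)
   have "(\<Sum>v\<in>F. gw v) = (\<Sum>jk\<in>B. gw (e jk))" unfolding FB
    using inj_on_subset[OF inj_e subset_UNIV, of B] by (simp add: sum.reindex)
   also have "\<dots> <= (\<Sum>jk\<in>B. l (fst jk) powr p * odd_wt p (snd jk))"
    using dirac_wt(1)[OF p] by (intro sum_mono) (auto simp: gw_def)
   also have "\<dots> <= (\<Sum>jk\<in>fst ` B \<times> snd ` B. l (fst jk) powr p * odd_wt p (snd jk))"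
    using fB by (intro sum_mono2) (auto simp: odd_wt_nonneg intro: rev_image_eqI)
   also have "\<dots> = (\<Sum>j\<in>fst ` B. l j powr p) * (\<Sum>k\<in>snd ` B. odd_wt p k)"
    by (simp add: sum_product sum.cartesian_product case_prod_beta)
   also have "\<dots> <= W * odd_sum p"
    using fB W odd_wt_finite_sum[OF p1] W[of "{}"] by (intro mult_mono) (auto intro: sum_nonneg odd_wt_nonneg)
   finally show "(\<Sum>v\<in>F. gw v) <= W * odd_sum p" .
  qed (use ab gw0 in auto)
 next
  assume fin: "trace_op H (diag_op H E gw) < \<infinity>"
  obtain B where B: "\<And>F. finite F ==> F \<subseteq> E ==> (\<Sum>v\<in>F. gw v) <= B"
   by (rule trace_diag_finite_imp[where C = 1 and ew = gw]) (use ab gw0 fin in auto)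
  show "dm < p"
  proof (rule ccontr)
   assume "\<not> dm < p"
   then have "dm * ln r <= p * ln r" using ln_r by (intro mult_right_mono_neg) auto
   then have "1 / 3 <= r powr p" unfolding r_powr[symmetric] q by simp
   then have q1: "1 <= 3 * r powr p" by simp
   \<comment> \<open>The frequency 0 alone suffices for divergence: every level contributes at least
     a fixed amount.\<close>
   define c where "c = 2 powr (- p / 2) * odd_wt p 0"
   have c: "0 < c" by (simp add: c_def odd_wt_def)
   have "c * real (Suc M) <= B" for M
   proof -
    let ?F = "(%j. e (j, 0)) ` Ju M"
    have inj: "inj_on (%j. e (j, 0)) (Ju M)" using inj_e by (auto simp: inj_on_def inj_def)
    have "(\<Sum>m\<le>M. 1) <= (\<Sum>m\<le>M. (3 * r powr p) ^ m)" using q1 by (intro sum_mono one_le_power)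
    then have "real (Suc M) <= (\<Sum>m\<le>M. (3 * r powr p) ^ m)" by (simp del: power_mult_distrib)
    also have "\<dots> = 1 * (\<Sum>m\<le>M. (3 * r powr p) ^ m)" by simp
    also have "\<dots> <= (\<Sum>j\<in>Ju M. l j powr p)" unfolding sum_l_Ju
     by (intro mult_right_mono sum_nonneg) (auto simp: add_increasing2)
    finally have "c * real (Suc M) <= c * (\<Sum>j\<in>Ju M. l j powr p)" using c by (intro mult_left_mono) auto
    also have "\<dots> = (\<Sum>j\<in>Ju M. 2 powr (- p / 2) * (l j powr p * odd_wt p 0))" by (simp add: c_def sum_distrib_left sum_distrib_right mult_ac)
    also have "\<dots> <= (\<Sum>j\<in>Ju M. gw (e (j, 0)))" using dirac_wt(2)[OF p] by (intro sum_mono) (simp add: gw_def)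
    also have "\<dots> = (\<Sum>v\<in>?F. gw v)" by (simp add: sum.reindex[OF inj])
    also have "\<dots> <= B" using finite_Ju by (intro B) auto
    finally show ?thesis .
   qed
   moreover obtain M where "B / c < real M" using reals_Archimedean2 by blast
   then have "B < c * real (Suc M)" using c by (simp add: field_simps)
   ultimately show False by (meson not_less)
  qed
 qed
qed

lemma spectral_dim_S: "spectral_dim S = dm"
proof -
 have "{p. 0 < p \<and> trace_op H (fun_calc H (st_dirac S) (%t. (1 + t\<^sup>2) powr (- p / 2))) < \<infinity>} = {dm<..}"
  using trace_finite_iff dm_gt_1 by force
 then show ?thesis unfolding spectral_dim_def st_space_S by simp
qed

section \<open>Polarization and the trace formula\<close>

definition C :: real
 where "C = odd_sum dm * (3 + 3 * \<alpha> powr dm) / ln 3"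

lemma Af_dixmier:
 assumes f: "continuous_on K f" and w: "extended_limit w"
 shows "Af f \<in> dixmier_ideal H" "positive_op H (Af f)"
  "dixmier_trace_pos H w (Af f) = of_real (C * (LINT x:K|gm. (cmod (f x))\<^sup>2))"
proof -
 obtain B where B: "0 <= B" "\<And>x. x \<in> K ==> cmod (f x) <= B" by (rule cont_bound[OF f]) blast
 have ok: "okf f B" by (rule okf_cont[OF f B(2)])
 show pos: "positive_op H (Af f)" by (rule Af_positive[OF ok])
 have cp: "compact_op H (Af f)" unfolding Af_def
  by (rule compact_sandwich[OF rep_bounded_ops[OF ok] rep_bounded_ops[OF okf_cnj[OF ok]] compact_G])
 note lm = log_means_eq[OF pos cp]
 have lim: "log_means H (Af f) \<longlonglongrightarrow> C * (LINT x:K|gm. (cmod (f x))\<^sup>2)"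
  using kf_lim[OF f] unfolding lm by (simp add: C_def mult.assoc)
 show "Af f \<in> dixmier_ideal H"
  using cp convergent_imp_bounded[OF lim] by (simp add: dixmier_ideal_def bounded_imp_bdd_above)
 show "dixmier_trace_pos H w (Af f) = of_real (C * (LINT x:K|gm. (cmod (f x))\<^sup>2))"
  unfolding dixmier_trace_pos_def by (rule extended_limit_lim[OF w tendsto_of_real[OF lim]])
qed

text \<open>The function \<open>(c + f) / 2\<close> of the polarization identity. For
  \<open>c\<close> equal to 1 and -1 the squared moduli differ by \<open>Re (f x)\<close>, for
  \<open>\<i>\<close> and \<open>- \<i>\<close> they differ by \<open>Im (f x)\<close>.\<close>

definition sh :: "complex => (real^2 => complex) => real^2 => complex"
 where "sh c f x = c / 2 + 1 / 2 * f x"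

lemma sh_cont: "continuous_on K f ==> continuous_on K (sh c f)"
 unfolding sh_def by (intro continuous_intros)

lemma rep_sh:
 assumes f: "continuous_on K f" and u: "u \<in> carr H"
 shows "st_rep S (sh c f) u = (c / 2) *\<^sub>C u + (1 / 2) *\<^sub>C st_rep S f u"
proof -
 obtain B where B: "\<And>x. x \<in> K ==> cmod (f x) <= B" using cont_bound[OF f] by metis
 obtain D where D: "\<And>x. x \<in> K ==> cmod (sh c f x) <= D" using cont_bound[OF sh_cont[OF f]] by metis
 have "st_rep S (sh c f) u = st_rep S (%_. c / 2) u + (1 / 2) *\<^sub>C st_rep S f u"
  by (rule rep_lin[OF okf_cont[of "%_. c / 2" "cmod (c / 2)"] okf_cont[OF f B] okf_cont[OF sh_cont[OF f] D] u]) (auto simp: sh_def)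
 then show ?thesis by (simp only: rep_const[OF u])
qed

lemma Af_sh:
 assumes f: "continuous_on K f" and h: "h \<in> carr H"
 shows "Af (sh c f) h = (c * cnj c / 4) *\<^sub>C G h + (c / 4) *\<^sub>C G (st_rep S (%x. cnj (f x)) h)
  + (cnj c / 4) *\<^sub>C st_rep S f (G h) + (1 / 4) *\<^sub>C st_rep S f (G (st_rep S (%x. cnj (f x)) h))"
proof -
 have fc: "continuous_on K (%x. cnj (f x))" by (intro continuous_intros f)
 obtain B where B: "\<And>x. x \<in> K ==> cmod (f x) <= B" using cont_bound[OF f] by metis
 have ok: "okf f B" by (rule okf_cont[OF f B])
 define p q where "p = st_rep S f" and "q = st_rep S (%x. cnj (f x))"
 have pb: "p \<in> bounded_ops H" and qb: "q \<in> bounded_ops H" unfolding p_def q_def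
  by (rule rep_bounded_ops[OF ok], rule rep_bounded_ops[OF okf_cnj[OF ok]])
 have Gb: "G \<in> bounded_ops H" using compact_G by (simp add: compact_op_def)
 have lin: "A (a *\<^sub>C u + b *\<^sub>C v) = a *\<^sub>C A u + b *\<^sub>C A v" "A u \<in> carr H"
  if "A \<in> bounded_ops H" "u \<in> carr H" "v \<in> carr H" for A a b u v
  using that by (auto simp: bounded_ops_def)
 have sc: "(%x. cnj (sh c f x)) = sh (cnj c) (%x. cnj (f x))" by (simp add: sh_def fun_eq_iff)
 have qh: "q h \<in> carr H" by (rule lin(2)[OF qb h h])
 have gh: "G h \<in> carr H" "G (q h) \<in> carr H" using lin(2)[OF Gb] h qh by auto
 have "Af (sh c f) h = st_rep S (sh c f) (G ((cnj c / 2) *\<^sub>C h + (1 / 2) *\<^sub>C q h))"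
  unfolding Af_def comp_def sc rep_sh[OF fc h] q_def ..
 also have "\<dots> = st_rep S (sh c f) ((cnj c / 2) *\<^sub>C G h + (1 / 2) *\<^sub>C G (q h))" unfolding lin(1)[OF Gb h qh] ..
 also have "\<dots> = (c / 2) *\<^sub>C ((cnj c / 2) *\<^sub>C G h + (1 / 2) *\<^sub>C G (q h)) + (1 / 2) *\<^sub>C ((cnj c / 2) *\<^sub>C p (G h) + (1 / 2) *\<^sub>C p (G (q h)))"
  using rep_sh[OF f, of "(cnj c / 2) *\<^sub>C G h + (1 / 2) *\<^sub>C G (q h)" c] lin(1)[OF pb gh, of "cnj c / 2" "1 / 2"] gh
  by (simp add: p_def)
 finally show ?thesis unfolding p_def[symmetric] q_def[symmetric] by (simp add: scaleC_add_right scaleC_scaleC add_ac)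
qed

text \<open>Polarization with the constant function 1 in one argument: summing the expansion
  \<open>Af_sh\<close> over the fourth roots of unity \<open>c\<close> with weight \<open>c\<close>
  cancels every term except the one with coefficient \<open>cnj c / 4\<close>.\<close>

lemma rep_G_decomp:
 assumes f: "continuous_on K f"
 shows "st_rep S f \<circ> G = Af (sh 1 f) - Af (sh (- 1) f) + \<i> *\<^sub>C (Af (sh \<i> f) - Af (sh (- \<i>) f))"
proof
 fix h
 obtain B where B: "\<And>x. x \<in> K ==> cmod (f x) <= B" using cont_bound[OF f] by metis
 have pb: "st_rep S f \<in> bounded_ops H" by (rule rep_bounded_ops[OF okf_cont[OF f B]])
 have Gb: "G \<in> bounded_ops H" using compact_G by (simp add: compact_op_def)
 show "(st_rep S f \<circ> G) h = (Af (sh 1 f) - Af (sh (- 1) f) + \<i> *\<^sub>C (Af (sh \<i> f) - Af (sh (- \<i>) f))) h"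
 proof (cases "h \<in> carr H")
  case True
  show ?thesis
   unfolding fun_diff_def plus_fun_def scaleC_fun_def Af_sh[OF f True] combination_of_four
   by (simp add: scaleC_one)
 next
  case False
  have "Af (sh c f) h = 0" for c
  proof -
   have "Af (sh c f) \<in> bounded_ops H"
    using Af_positive[OF okf_cont[OF sh_cont[OF f]]] cont_bound[OF sh_cont[OF f, of c]] unfolding positive_op_def by metis
   then show ?thesis using False by (simp add: bounded_ops_def)
  qed
  moreover have "G h = 0" using Gb False by (simp add: bounded_ops_def)
  ultimately show ?thesis by (simp add: fun_diff_def plus_fun_def scaleC_fun_def zero_fun_def op_zero[OF pb, unfolded zero_fun_def])
 qed
qed

lemma set_integrable_cont:
 fixes \<psi> :: "real^2 => 'b::{banach, second_countable_topology}"
 assumes \<psi>: "continuous_on K \<psi>"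
 shows "set_integrable gm K \<psi>"
proof -
 interpret finite_measure gm by (rule finite_gm)
 obtain B where B: "\<And>x. x \<in> K ==> norm (\<psi> x) <= B"
  using compact_imp_bounded[OF compact_continuous_image[OF \<psi> gasket_props(1)]] by (auto simp: bounded_iff)
 have "0 <= B" using B gasket_props(2) norm_ge_zero order_trans by blast
 moreover have "(%x. indicator K x *\<^sub>R \<psi> x) \<in> borel_measurable gm"
  using borel_measurable_continuous_on_indicator[OF _ \<psi>] closed_K by (simp add: borel_closed)
 ultimately show ?thesis unfolding set_integrable_def
  by (intro integrable_const_bound[of _ B]) (auto simp: indicator_def B)
qed

text \<open>The operators in \<open>rep_G_decomp\<close> are positive and in the ideal, so the
  linear extension may be evaluated on them; the same polarization for scalar functions reassembles
  the real and imaginary parts of \<open>f\<close>.\<close>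

lemma trace_formula:
 assumes f: "continuous_on K f" and w: "extended_limit w"
 shows "dixmier_trace H w (st_rep S f \<circ> G) = of_real C * (LINT x:K|gm. f x)"
proof -
 let ?I = "%c. LINT x:K|gm. (cmod (sh c f x))\<^sup>2"
 have int: "set_integrable gm K (%x. (cmod (sh c f x))\<^sup>2)" for c
  by (intro set_integrable_cont continuous_intros sh_cont f)
 have ints: "set_integrable gm K f" by (rule set_integrable_cont[OF f])
 have "dixmier_trace H w (st_rep S f \<circ> G) = dixmier_trace_pos H w (Af (sh 1 f)) - dixmier_trace_pos H w (Af (sh (- 1) f))
   + \<i> * (dixmier_trace_pos H w (Af (sh \<i> f)) - dixmier_trace_pos H w (Af (sh (- \<i>) f)))"
  by (rule dixmier_trace_eq[OF w _ rep_G_decomp[OF f]]) (use Af_dixmier(1,2)[OF sh_cont[OF f] w] in auto)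
 also have "\<dots> = of_real C * (of_real (?I 1 - ?I (- 1)) + \<i> * of_real (?I \<i> - ?I (- \<i>)))"
  unfolding Af_dixmier(3)[OF sh_cont[OF f] w] by (simp add: algebra_simps)
 also have "?I 1 - ?I (- 1) = (LINT x:K|gm. Re (f x))"
 proof -
  have "(cmod (sh 1 f x))\<^sup>2 - (cmod (sh (- 1) f x))\<^sup>2 = Re (f x)" for x
   unfolding cmod_power2 sh_def by (simp add: power2_eq_square field_simps)
  then show ?thesis unfolding set_integral_diff(2)[OF int int, symmetric] by simp
 qed
 also have "?I \<i> - ?I (- \<i>) = (LINT x:K|gm. Im (f x))"
 proof -
  have "(cmod (sh \<i> f x))\<^sup>2 - (cmod (sh (- \<i>) f x))\<^sup>2 = Im (f x)" for x
   unfolding cmod_power2 sh_def by (simp add: power2_eq_square field_simps)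
  then show ?thesis unfolding set_integral_diff(2)[OF int int, symmetric] by simp
 qed
 also have "of_real (LINT x:K|gm. Re (f x)) + \<i> * of_real (LINT x:K|gm. Im (f x)) = (LINT x:K|gm. f x)"
 proof -
  note I = ints[unfolded set_integrable_def]
  have "(LINT x:K|gm. Re (f x)) = Re (LINT x:K|gm. f x)" "(LINT x:K|gm. Im (f x)) = Im (LINT x:K|gm. f x)"
   unfolding set_lebesgue_integral_def integral_Re[OF I, symmetric] integral_Im[OF I, symmetric] by simp_all
  then show ?thesis by (simp add: complex_eq_iff)
 qed
 finally show ?thesis .
qed

lemma dm_eq: "dm = ln 3 / (ln 2 - ln (1 - \<alpha>))"
 unfolding dm_def r_def using a1 by (simp add: ln_div)

text \<open>Because \<open>1 - \<alpha> = 2 * r\<close> and \<open>r powr dm = 1 / 3\<close>, the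
  term \<open>3 * (1 - \<alpha>) powr dm\<close> equals \<open>2 powr dm\<close>. The bracket in the
  denominator then factors, and \<open>dm * (ln 2 - ln (1 - \<alpha>))\<close> is
  \<open>ln 3\<close>.\<close>

lemma C_eq: "C = (2 powr (dm + 1) * (2 powr dm - 1) * zeta_real dm * (3 + 3 * \<alpha> powr dm)) /
 (dm * pi powr dm * (2 powr dm * ln 2 - 3 * (1 - \<alpha>) powr dm * ln (1 - \<alpha>)))"
proof -
 define t where "t = (2::real) powr dm"
 have t: "0 < t" by (simp add: t_def)
 have L: "0 < ln 2 - ln (1 - \<alpha>)" using a0 a1 ln_r unfolding r_def by (simp add: ln_div)
 have "1 - \<alpha> = 2 * r" by (simp add: r_def)
 then have "3 * (1 - \<alpha>) powr dm = t" by (simp only: powr_mult r_powr t_def)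
 then have "dm * pi powr dm * (2 powr dm * ln 2 - 3 * (1 - \<alpha>) powr dm * ln (1 - \<alpha>)) = dm * (ln 2 - ln (1 - \<alpha>)) * (pi powr dm * t)"
  by (simp add: t_def algebra_simps)
 also have "dm * (ln 2 - ln (1 - \<alpha>)) = ln 3" using L by (simp add: dm_eq)
 finally have D: "dm * pi powr dm * (2 powr dm * ln 2 - 3 * (1 - \<alpha>) powr dm * ln (1 - \<alpha>)) = ln 3 * (pi powr dm * t)" .
 have o: "odd_sum dm = 2 * (t / pi powr dm) * ((1 - 1 / t) * zeta_real dm)"
  by (simp add: odd_sum_def powr_divide powr_minus_divide t_def)
 have e: "2 powr (dm + 1) = 2 * t" by (simp add: powr_add t_def)
 have "0 < pi powr dm" "0 < ln (3::real)" by auto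
 then show ?thesis unfolding D unfolding C_def o e t_def[symmetric] using t by (simp add: field_simps)
qed

end

theorem theorem5p11:
  fixes \<alpha> :: real
    and \<epsilon> :: "nat \<Rightarrow> (real^2) set"
    and l :: "nat \<Rightarrow> real"
    and R :: "nat \<Rightarrow> real \<Rightarrow> real^2"
    and w :: "(nat \<Rightarrow> complex) \<Rightarrow> complex"
  assumes "0 < \<alpha>" and "\<alpha> < 1 / 3"
    and "bij_betw \<epsilon> UNIV (all_edges \<alpha>)"
    and "\<And>j. arclength_param (\<epsilon> j) (l j) (R j)"
    and "extended_limit w"
  shows "let S = gasket_triple \<alpha> l R;
      \<dd> = spectral_dim S;
      c = (2 powr (\<dd> + 1) * (2 powr \<dd> - 1) * zeta_real \<dd> * (3 + 3 * \<alpha> powr \<dd>)) /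
          (\<dd> * pi powr \<dd> * (2 powr \<dd> * ln 2 - 3 * (1 - \<alpha>) powr \<dd> * ln (1 - \<alpha>)))
    in \<dd> = ln 3 / (ln 2 - ln (1 - \<alpha>)) \<and>
       (\<forall>f \<in> cont_algebra (gasket \<alpha>).
          dixmier_trace (st_space S) w
            (st_rep S f \<circ> fun_calc (st_space S) (st_dirac S) (\<lambda>t. \<bar>t\<bar> powr (- \<dd>)))
          = of_real c *
            (LINT x:gasket \<alpha>|uniform_measure (hausdorff_measure \<dd>) (gasket \<alpha>). f x))"
proof -
 interpret gasket_loc \<alpha> by unfold_locales fact+
 \<comment> \<open>The inverse labelling turns the arbitrary enumeration of the edges into an
   enumeration of labels, by which \<open>gasket_curves\<close> indexes its curves.\<close>
 define J where "J = inv_into labels (\<lambda>(v, \<tau>). gmap_word \<alpha> v ` side \<tau>)"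
 have bij: "bij_betw (\<lambda>(v, \<tau>). gmap_word \<alpha> v ` side \<tau>) labels (all_edges \<alpha>)"
  unfolding bij_betw_def all_edges_eq using edge_inj by simp
 have J: "bij_betw (J \<circ> \<epsilon>) UNIV labels"
  unfolding J_def by (rule bij_betw_trans[OF assms(3) bij_betw_inv_into[OF bij]])
 interpret gasket_curves \<alpha> "\<lambda>j. fst (J (\<epsilon> j))" "\<lambda>j. snd (J (\<epsilon> j))" l R
 proof
  show "bij_betw (\<lambda>j. (fst (J (\<epsilon> j)), snd (J (\<epsilon> j)))) UNIV labels" using J by (simp add: comp_def)
  fix j
  have "\<epsilon> j \<in> all_edges \<alpha>" using assms(3) by (auto simp: bij_betw_def)
  then have "(\<lambda>(v, \<tau>). gmap_word \<alpha> v ` side \<tau>) (J (\<epsilon> j)) = \<epsilon> j"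
   unfolding J_def by (intro bij_betw_inv_into_right[OF bij])
  then show "arclength_param (gmap_word \<alpha> (fst (J (\<epsilon> j))) ` side (snd (J (\<epsilon> j)))) (l j) (R j)"
   using assms(4)[of j] by (simp add: case_prod_beta)
 qed
 show ?thesis
  unfolding gasket_triple_def Let_def spectral_dim_S st_space_S fun_calc_G C_eq[symmetric] gm_def[symmetric]
  using dm_eq trace_formula[OF _ assms(5)] by (auto simp: cont_algebra_def)
qed

end
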